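(* Let $n\ge5$ and let $L$ be a perfect Lie algebra over $\mathbb F$. Then $L$ is $(\Theta_n,\mathfrak g)$-graded with $\mathfrak g\cong sl_n$ (and satisfies the conditions $( * )$ of the context if $n=5,6$) if and only if there exist an associative algebra $\mathfrak a$ with involution $\eta$, identity element $1^+\neq0$ and two orthogonal idempotents $e_1$ and $e_2$ such that $1^+=e_1+e_2$ and $e_2=\eta(e_1)$, and a unital associative right $\mathfrak a$-module $\mathcal B$ with a hermitian form $\chi$ with values in $\mathfrak a$, such that $L$ is centrally isogenous to the $(\Theta_n,\mathfrak g)$-graded unitary Lie algebra $\mathfrak u$ of the hermitian form $\xi=w\perp-\chi$ on the right $\mathfrak a$-module $\mathfrak a^n\oplus\mathcal B$.
   Context: $\mathbb F$ is a field of characteristic $0$; algebras are $\mathbb F$-algebras and involutions are $\mathbb F$-linear antiautomorphisms squaring to the identity. $(\Theta_n,\mathfrak g)$-graded: let $\varepsilon_1,\dots,\varepsilon_n$ be the weights of the natural $sl_n$-module and $\Theta_n=\{0,\pm\varepsilon_i\pm\varepsilon_j,\pm\varepsilon_i,\pm2\varepsilon_i\mid 1\le i\ne j\le n\}$. A Lie algebra $L$ is $(\Theta_n,\mathfrak g)$-graded if $\mathfrak g\subseteq L$ is a subalgebra identified with $sl_n$, with Cartan subalgebra $\mathfrak h$ of diagonal matrices, $L=\bigoplus_{\alpha\in\Theta_n}L_\alpha$ where $L_\alpha=\{x\mid[h,x]=\alpha(h)x\ \forall h\in\mathfrak h\}$, and $L_0=\sum_{\alpha,-\alpha\in\Theta_n\setminus\{0\}}[L_\alpha,L_{-\alpha}]$.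 Conditions $( * )$: let $V$ be the natural $sl_n$-module, $\Lambda=\wedge^2V$, and $V',\Lambda'$ their duals; for a simple $\mathfrak g$-module $M$ let $L_{(M)}$ be the $M$-isotypic component of the $\mathfrak g$-module $L$. For $n=6$: $[L_{(\Lambda)},L_{(\Lambda)}]=[L_{(\Lambda')},L_{(\Lambda')}]=0$. For $n=5$: $[L_{(\Lambda)},L_{(\Lambda)}+L_{(V)}]=[L_{(\Lambda')},L_{(\Lambda')}+L_{(V')}]=0$. A hermitian form on a right $\mathfrak a$-module $\mathcal B$ is a bilinear map $\chi:\mathcal B\times\mathcal B\to\mathfrak a$ with $\chi(xa,y)=\eta(a)\chi(x,y)$, $\chi(x,ya)=\chi(x,y)a$, $\chi(y,x)=\eta(\chi(x,y))$. The Lie algebra $\mathfrak u$: regard $\mathfrak a^n$ (column vectors) as a right $\mathfrak a$-module, put $w(\alpha_1,\alpha_2)=\eta(\alpha_1)^t\alpha_2$ and $\xi(\alpha_1\oplus\beta_1,\alpha_2\oplus\beta_2)=w(\alpha_1,\alpha_2)-\chi(\beta_1,\beta_2)\in\mathfrak a$ for $\alpha_i\in\mathfrak a^n$, $\beta_i\in\mathcal B$. Let $\mathfrak U=\{T\in\mathrm{End}_{\mathfrak a}(\mathfrak a^n\oplus\mathcal B)\mid\xi(Tu,v)+\xi(u,Tv)=0\ \forall u,v\in\mathfrak a^n\oplus\mathcal B\}$, a Lie algebra under the commutator. It contains a copy of $sl_n$: $x\in sl_n$ acts on $\mathfrak a^n$ as left multiplication by $\frac12(x+x^t)\otimes(e_1-e_2)+\frac12(x-x^t)\otimes1^+\in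 M_n(\mathbb F)\otimes\mathfrak a=M_n(\mathfrak a)$ and as $0$ on $\mathcal B$. The $(\Theta_n,\mathfrak g)$-graded unitary Lie algebra $\mathfrak u$ of $\xi=w\perp-\chi$ is the ideal of $\mathfrak U$ generated by this copy of $sl_n$. Two perfect Lie algebras are centrally isogenous if they have isomorphic universal covering algebras (universal central extensions). *)

theory Defs
  imports "HOL-Analysis.Determinants" "HOL-Library.Function_Algebras"
begin

section \<open>Vector spaces, bilinear maps and Lie algebras on carrier sets\<close>

text \<open>
  A vector space is a subspace of a type of class \<open>ab_group_add\<close> that carries a scalar
  multiplication over the field \<open>'f\<close>. Carriers are needed because algebras are quantified
  existentially below. Homomorphisms are functions that are considered on the carrier only.
\<close>

record ('f, 'v) vs =
  carrier :: "'v set"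
  scale :: "'f \<Rightarrow> 'v \<Rightarrow> 'v"

record ('f, 'l) lie = "('f, 'l) vs" +
  bracket :: "'l \<Rightarrow> 'l \<Rightarrow> 'l"

definition vspace :: "('f::field, 'v::ab_group_add, 'm) vs_scheme \<Rightarrow> bool" where
  "vspace V \<longleftrightarrow> vector_space (scale V) \<and> module.subspace (scale V) (carrier V)"

definition vspan :: "('f::field, 'v::ab_group_add, 'm) vs_scheme \<Rightarrow> 'v set \<Rightarrow> 'v set" where
  "vspan V S = module.span (scale V) S"

definition vlinear ::
  "('f::field, 'v::ab_group_add, 'm) vs_scheme \<Rightarrow> ('f, 'w::ab_group_add, 'k) vs_scheme \<Rightarrow> ('v \<Rightarrow> 'w) \<Rightarrow> bool"
where
  "vlinear V W f \<longleftrightarrow>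
     (\<forall>x\<in>carrier V. f x \<in> carrier W) \<and>
     (\<forall>x\<in>carrier V. \<forall>y\<in>carrier V. f (x + y) = f x + f y) \<and>
     (\<forall>c. \<forall>x\<in>carrier V. f (scale V c x) = scale W c (f x))"

definition vbilinear ::
  "('f::field, 'u::ab_group_add, 'm) vs_scheme \<Rightarrow> ('f, 'v::ab_group_add, 'k) vs_scheme \<Rightarrow>
   ('f, 'w::ab_group_add, 'j) vs_scheme \<Rightarrow> ('u \<Rightarrow> 'v \<Rightarrow> 'w) \<Rightarrow> bool"
where
  "vbilinear U V W b \<longleftrightarrow>
     (\<forall>x\<in>carrier U. vlinear V W (b x)) \<and> (\<forall>y\<in>carrier V. vlinear U W (\<lambda>x. b x y))"

definition lie_algebra :: "('f::field, 'l::ab_group_add) lie \<Rightarrow> bool" where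
  "lie_algebra L \<longleftrightarrow> vspace L \<and> vbilinear L L L (bracket L) \<and>
     (\<forall>x\<in>carrier L. bracket L x x = 0) \<and>
     (\<forall>x\<in>carrier L. \<forall>y\<in>carrier L. \<forall>z\<in>carrier L.
        bracket L x (bracket L y z) + bracket L y (bracket L z x) + bracket L z (bracket L x y) = 0)"

definition bracket_span :: "('f::field, 'l::ab_group_add) lie \<Rightarrow> 'l set \<Rightarrow> 'l set \<Rightarrow> 'l set" where
  "bracket_span L X Y = vspan L {bracket L x y | x y. x \<in> X \<and> y \<in> Y}"

definition perfect :: "('f::field, 'l::ab_group_add) lie \<Rightarrow> bool" where
  "perfect L \<longleftrightarrow> bracket_span L (carrier L) (carrier L) = carrier L"

definition lie_hom ::
  "('f::field, 'l::ab_group_add) lie \<Rightarrow> ('f, 'm::ab_group_add) lie \<Rightarrow> ('l \<Rightarrow> 'm) \<Rightarrow> bool"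
where
  "lie_hom L M f \<longleftrightarrow> vlinear L M f \<and>
     (\<forall>x\<in>carrier L. \<forall>y\<in>carrier L. f (bracket L x y) = bracket M (f x) (f y))"

definition lie_isomorphic ::
  "('f::field, 'l::ab_group_add) lie \<Rightarrow> ('f, 'm::ab_group_add) lie \<Rightarrow> bool"
where
  "lie_isomorphic L M \<longleftrightarrow> (\<exists>f. lie_hom L M f \<and> bij_betw f (carrier L) (carrier M))"

definition lie_ideal :: "('f::field, 'l::ab_group_add) lie \<Rightarrow> 'l set \<Rightarrow> bool" where
  "lie_ideal L I \<longleftrightarrow> I \<subseteq> carrier L \<and> module.subspace (scale L) I \<and>
     (\<forall>x\<in>carrier L. \<forall>y\<in>I. bracket L x y \<in> I)"


section \<open>Universal central extensions\<close>

definition central_extension ::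
  "('f::field, 'e::ab_group_add) lie \<Rightarrow> ('f, 'l::ab_group_add) lie \<Rightarrow> ('e \<Rightarrow> 'l) \<Rightarrow> bool"
where
  "central_extension E L p \<longleftrightarrow> lie_algebra E \<and> lie_algebra L \<and> lie_hom E L p \<and>
     p ` carrier E = carrier L \<and>
     (\<forall>z\<in>carrier E. p z = 0 \<longrightarrow> (\<forall>x\<in>carrier E. bracket E z x = 0))"

definition unique_lift ::
  "('f::field, 'e::ab_group_add) lie \<Rightarrow> ('e \<Rightarrow> 'l) \<Rightarrow> ('f, 'm::ab_group_add) lie \<Rightarrow> ('m \<Rightarrow> 'l) \<Rightarrow> bool"
where
  "unique_lift E p M q \<longleftrightarrow>
     (\<exists>f. lie_hom E M f \<and> (\<forall>x\<in>carrier E. q (f x) = p x) \<and>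
        (\<forall>g. lie_hom E M g \<and> (\<forall>x\<in>carrier E. q (g x) = p x) \<longrightarrow> (\<forall>x\<in>carrier E. g x = f x)))"

text \<open>
  HOL cannot quantify over all types inside a definition. The extensions of \<open>L\<close> in the
  following definition therefore live in one type, which is large enough: a perfect central
  extension of \<open>L\<close> is a quotient of the space with basis \<open>L \<times> L\<close>. The lemma
  \<open>universal_central_extension_any_type\<close> shows that the universal property then holds for
  central extensions of \<open>L\<close> in every type.
\<close>

definition universal_central_extension ::
  "('f::field, 'l \<times> 'l \<Rightarrow> 'f) lie \<Rightarrow> ('f, 'l::ab_group_add) lie \<Rightarrow> (('l \<times> 'l \<Rightarrow> 'f) \<Rightarrow> 'l) \<Rightarrow> bool"
where
  "universal_central_extension E L p \<longleftrightarrow> central_extension E L p \<and>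
     (\<forall>(M :: ('f, 'l \<times> 'l \<Rightarrow> 'f) lie) q. central_extension M L q \<longrightarrow> unique_lift E p M q)"

definition centrally_isogenous ::
  "('f::field, 'l::ab_group_add) lie \<Rightarrow> ('f, 'm::ab_group_add) lie \<Rightarrow> bool"
where
  "centrally_isogenous L M \<longleftrightarrow> perfect L \<and> perfect M \<and>
     (\<exists>E p E' p'. universal_central_extension E L p \<and> universal_central_extension E' M p' \<and>
        lie_isomorphic E E')"


lemma lie_algebraD:
  assumes "lie_algebra L"
  shows "vector_space (scale L)" "module.subspace (scale L) (carrier L)"
    "\<And>x y. x \<in> carrier L \<Longrightarrow> y \<in> carrier L \<Longrightarrow> bracket L x y \<in> carrier L"
    "\<And>x y z. x \<in> carrier L \<Longrightarrow> y \<in> carrier L \<Longrightarrow> z \<in> carrier L \<Longrightarrow>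
       bracket L x (y + z) = bracket L x y + bracket L x z"
    "\<And>x y z. x \<in> carrier L \<Longrightarrow> y \<in> carrier L \<Longrightarrow> z \<in> carrier L \<Longrightarrow>
       bracket L (x + y) z = bracket L x z + bracket L y z"
    "\<And>x. x \<in> carrier L \<Longrightarrow> bracket L x x = 0"
  using assms by (auto simp: lie_algebra_def vspace_def vbilinear_def vlinear_def)

lemma lie_homD:
  assumes "lie_hom L M f"
  shows "\<And>x. x \<in> carrier L \<Longrightarrow> f x \<in> carrier M"
    "\<And>x y. x \<in> carrier L \<Longrightarrow> y \<in> carrier L \<Longrightarrow> f (x + y) = f x + f y"
    "\<And>c x. x \<in> carrier L \<Longrightarrow> f (scale L c x) = scale M c (f x)"
    "\<And>x y. x \<in> carrier L \<Longrightarrow> y \<in> carrier L \<Longrightarrow> f (bracket L x y) = bracket M (f x) (f y)"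
  using assms by (auto simp: lie_hom_def vlinear_def)

lemma lie_algebra_subalgebra:
  assumes "lie_algebra L" "K \<subseteq> carrier L" "module.subspace (scale L) K"
    and "\<And>x y. x \<in> K \<Longrightarrow> y \<in> K \<Longrightarrow> bracket L x y \<in> K"
  shows "lie_algebra (L\<lparr>carrier := K\<rparr>)"
  using assms unfolding lie_algebra_def vspace_def vbilinear_def vlinear_def
  by (simp add: subset_iff)

lemma lie_hom_image_zero:
  assumes "lie_algebra L" "lie_hom L M f"
  shows "f 0 = 0"
proof -
  interpret vector_space "scale L" using lie_algebraD[OF assms(1)] by simp
  have "0 \<in> carrier L" using subspace_0 lie_algebraD[OF assms(1)] by simp
  then have "f (0 + 0) = f 0 + f 0" using lie_homD(2)[OF assms(2)] by blast
  then show ?thesis by simp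
qed

lemma lie_hom_diff:
  assumes "lie_algebra L" "lie_hom L M f" "x \<in> carrier L" "y \<in> carrier L"
  shows "x - y \<in> carrier L" "f (x - y) = f x - f y"
proof -
  interpret vector_space "scale L" using lie_algebraD[OF assms(1)] by simp
  show *: "x - y \<in> carrier L" using subspace_diff lie_algebraD[OF assms(1)] assms by simp
  have "f ((x - y) + y) = f (x - y) + f y"
    using assms(2) * assms(4) by (metis lie_hom_def vlinear_def)
  then show "f (x - y) = f x - f y" by simp
qed

text \<open>The bracket of a central extension depends only on the images in the quotient.\<close>

lemma central_extension_bracket_eq:
  assumes ext: "central_extension M L q"
    and "x \<in> carrier M" "y \<in> carrier M" "x' \<in> carrier M" "y' \<in> carrier M"
    and "q x = q x'" "q y = q y'"
  shows "bracket M x y = bracket M x' y'"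
proof -
  have M: "lie_algebra M" and hom: "lie_hom M L q"
    and cen: "\<And>z v. z \<in> carrier M \<Longrightarrow> q z = 0 \<Longrightarrow> v \<in> carrier M \<Longrightarrow> bracket M z v = 0"
    using ext by (auto simp: central_extension_def)
  note D = lie_algebraD[OF M]
  have left: "bracket M a c = bracket M b c"
    if "a \<in> carrier M" "b \<in> carrier M" "c \<in> carrier M" "q a = q b" for a b c
  proof -
    have d: "a - b \<in> carrier M" "q (a - b) = 0"
      using lie_hom_diff[OF M hom that(1,2)] that(4) by auto
    have "bracket M ((a - b) + b) c = bracket M (a - b) c + bracket M b c"
      using D(5) d(1) that by blast
    then show ?thesis using cen[OF d that(3)] by simp
  qed
  have skew: "bracket M a c = - bracket M c a" if "a \<in> carrier M" "c \<in> carrier M" for a c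
  proof -
    interpret vector_space "scale M" using D(1) .
    have "a + c \<in> carrier M" using subspace_add[OF D(2)] that by blast
    then have "0 = bracket M (a + c) (a + c)" using D(6) by simp
    also have "\<dots> = bracket M a (a + c) + bracket M c (a + c)"
      using D(5) that \<open>a + c \<in> carrier M\<close> by blast
    also have "\<dots> = (bracket M a a + bracket M a c) + (bracket M c a + bracket M c c)"
      using D(4) that by presburger
    also have "\<dots> = bracket M a c + bracket M c a"
      using D(6) that by simp
    finally show ?thesis by (metis eq_neg_iff_add_eq_0)
  qed
  have "bracket M x y = bracket M x' y" using left assms by blast
  also have "\<dots> = - bracket M y x'" using skew assms by blast
  also have "\<dots> = - bracket M y' x'" using left assms by metis
  also have "\<dots> = bracket M x' y'" using skew assms by metis
  finally show ?thesis .
qed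

lemma vspan_subset_induct:
  assumes "vector_space (scale V)" "module.subspace (scale V) P" "S \<subseteq> P"
  shows "vspan V S \<subseteq> P"
proof -
  interpret vector_space "scale V" by fact
  show ?thesis unfolding vspan_def using span_minimal assms by blast
qed

lemma lie_hom_image_subspace:
  assumes L: "lie_algebra L" and M: "lie_algebra M" and f: "lie_hom L M f"
    and "K \<subseteq> carrier L" and K: "module.subspace (scale L) K"
  shows "module.subspace (scale M) (f ` K)"
proof -
  interpret L: vector_space "scale L" using lie_algebraD[OF L] by simp
  interpret M: vector_space "scale M" using lie_algebraD[OF M] by simp
  show ?thesis
    unfolding M.subspace_def
  proof (intro conjI ballI allI)
    show "0 \<in> f ` K"
      using L.subspace_0[OF K] lie_hom_image_zero[OF L f] by force
  next
    fix u v assume "u \<in> f ` K" "v \<in> f ` K"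
    then obtain x y where "x \<in> K" "y \<in> K" "u = f x" "v = f y" by auto
    moreover from this have "f (x + y) = u + v"
      using lie_homD(2)[OF f] assms(4) by blast
    ultimately show "u + v \<in> f ` K" using L.subspace_add[OF K] by (metis imageI)
  next
    fix c u assume "u \<in> f ` K"
    then obtain x where "x \<in> K" "u = f x" by auto
    moreover from this have "f (scale L c x) = scale M c u"
      using lie_homD(3)[OF f] assms(4) by blast
    ultimately show "scale M c u \<in> f ` K" using L.subspace_scale[OF K] by (metis imageI)
  qed
qed

text \<open>A subspace containing all brackets is again a central extension of a perfect quotient.\<close>

lemma central_extension_restrict:
  assumes ext: "central_extension M L q" and perf: "perfect L"
    and K: "K \<subseteq> carrier M" "module.subspace (scale M) K"
    and br: "\<And>x y. x \<in> carrier M \<Longrightarrow> y \<in> carrier M \<Longrightarrow> bracket M x y \<in> K"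
  shows "central_extension (M\<lparr>carrier := K\<rparr>) L q"
proof -
  have M: "lie_algebra M" and L: "lie_algebra L" and hom: "lie_hom M L q"
    and sur: "q ` carrier M = carrier L"
    using ext by (auto simp: central_extension_def)
  have "lie_algebra (M\<lparr>carrier := K\<rparr>)"
    using lie_algebra_subalgebra[OF M K] br K by blast
  moreover have "lie_hom (M\<lparr>carrier := K\<rparr>) L q"
    using lie_homD[OF hom] K unfolding lie_hom_def vlinear_def by (simp add: subset_iff)
  moreover have "q ` K = carrier L"
  proof
    show "q ` K \<subseteq> carrier L" using K sur by blast
    have "{bracket L x y |x y. x \<in> carrier L \<and> y \<in> carrier L} \<subseteq> q ` K"
    proof clarify
      fix x y assume "x \<in> carrier L" "y \<in> carrier L"
      then obtain x' y' where *: "x' \<in> carrier M" "y' \<in> carrier M" "x = q x'" "y = q y'"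
        using sur by (metis imageE)
      then have "bracket L x y = q (bracket M x' y')"
        using hom by (auto simp: lie_hom_def)
      then show "bracket L x y \<in> q ` K" using br * by blast
    qed
    then have "bracket_span L (carrier L) (carrier L) \<subseteq> q ` K"
      unfolding bracket_span_def
      using vspan_subset_induct lie_hom_image_subspace[OF M L hom K] lie_algebraD(1)[OF L] by blast
    then show "carrier L \<subseteq> q ` K" using perf by (simp add: perfect_def)
  qed
  ultimately show ?thesis
    using ext K(1) unfolding central_extension_def by (auto simp: subset_iff)
qed

lemma universal_central_extension_perfect:
  assumes univ: "universal_central_extension E L p" and perf: "perfect L"
  shows "perfect E"
proof -
  have ext: "central_extension E L p"
    and lift: "\<And>(M :: ('a, 'b \<times> 'b \<Rightarrow> 'a) lie) q. central_extension M L q \<Longrightarrow> unique_lift E p M q"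
    using univ by (auto simp: universal_central_extension_def)
  have E: "lie_algebra E" using ext by (simp add: central_extension_def)
  interpret vector_space "scale E" using lie_algebraD[OF E] by simp
  define D where "D = bracket_span E (carrier E) (carrier E)"
  have sub: "D \<subseteq> carrier E"
    unfolding D_def bracket_span_def
    using lie_algebraD[OF E] by (intro vspan_subset_induct) auto
  have D: "central_extension (E\<lparr>carrier := D\<rparr>) L p"
    using central_extension_restrict[OF ext perf sub]
    by (auto simp: D_def bracket_span_def vspan_def intro: span_base)
  obtain f where f: "lie_hom E (E\<lparr>carrier := D\<rparr>) f" "\<forall>x\<in>carrier E. p (f x) = p x"
    using lift[OF D] by (auto simp: unique_lift_def)
  then have "lie_hom E E f" using sub by (auto simp: lie_hom_def vlinear_def)
  moreover have "lie_hom E E (\<lambda>x. x)" by (simp add: lie_hom_def vlinear_def)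
  ultimately have "\<forall>x\<in>carrier E. f x = x"
    using lift[OF ext] f(2) by (simp add: unique_lift_def) metis
  then have "carrier E \<subseteq> D" using f(1) by (auto simp: lie_hom_def vlinear_def)
  then show ?thesis using sub by (simp add: perfect_def D_def)
qed

lemma universal_central_extension_any_type:
  fixes M :: "('f::field, 'm::ab_group_add) lie" and L :: "('f, 'l::ab_group_add) lie"
  assumes univ: "universal_central_extension E L p" and perf: "perfect L"
    and ext: "central_extension M L q"
  shows "unique_lift E p M q"
proof -
  have E: "lie_algebra E" and p: "lie_hom E L p"
    using univ by (auto simp: universal_central_extension_def central_extension_def)
  have perfE: "perfect E" by (rule universal_central_extension_perfect[OF univ perf])
  have M: "lie_algebra M" and L: "lie_algebra L" and hom: "lie_hom M L q"
    and sur: "q ` carrier M = carrier L"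
    using ext by (auto simp: central_extension_def)
  note D = lie_algebraD[OF M]
  interpret E: vector_space "scale E" using lie_algebraD[OF E] by simp
  interpret M: vector_space "scale M" using D(1) .
  define s where "s = inv_into (carrier M) q"
  have s: "s x \<in> carrier M" "q (s x) = x" if "x \<in> carrier L" for x
    using that sur by (auto simp: s_def inv_into_into f_inv_into_f)
  define h where "h = (\<lambda>(x, y). if x \<in> carrier L \<and> y \<in> carrier L then bracket M (s x) (s y) else 0)"
  define K where "K = M.span (range h)"
  have rh: "range h \<subseteq> carrier M"
    using s D(3) M.subspace_0[OF D(2)] by (auto simp: h_def)
  have KM: "K \<subseteq> carrier M" unfolding K_def using M.span_minimal[OF rh D(2)] .
  have Ksub: "M.subspace K" by (simp add: K_def)
  have Kbr: "bracket M x y \<in> K" if "x \<in> carrier M" "y \<in> carrier M" for x y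
  proof -
    have qx: "q x \<in> carrier L" "q y \<in> carrier L" using that sur by auto
    have "bracket M x y = bracket M (s (q x)) (s (q y))"
      using central_extension_bracket_eq[OF ext that] s qx by simp
    also have "\<dots> = h (q x, q y)" using qx by (simp add: h_def)
    finally show ?thesis unfolding K_def by (simp add: M.span_base)
  qed
  have extK: "central_extension (M\<lparr>carrier := K\<rparr>) L q"
    by (rule central_extension_restrict[OF ext perf KM Ksub Kbr])
  have LK: "lie_algebra (M\<lparr>carrier := K\<rparr>)" using extK by (simp add: central_extension_def)
  \<comment> \<open>Coordinates with respect to a basis chosen among the brackets embed \<open>K\<close> into the type of
      functions on pairs.\<close>
  obtain B where B: "B \<subseteq> range h" "M.independent B" "range h \<subseteq> M.span B"
    using M.maximal_independent_subset by blast
  have spB: "M.span B = K"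
    unfolding K_def using B by (metis M.span_eq M.span_superset order_trans)
  define i where "i = inv h"
  have hi: "h (i b) = b" if "b \<in> B" for b
    using that B(1) by (auto simp: i_def f_inv_into_f)
  define e where "e = (\<lambda>m z. if z \<in> i ` B then M.representation B m (h z) else 0)"
  have e_add: "e (x + y) = e x + e y" if "x \<in> K" "y \<in> K" for x y
    using that spB B(2) by (auto simp: e_def fun_eq_iff M.representation_add)
  have e_scale: "e (scale M c x) = (\<lambda>z. c * e x z)" if "x \<in> K" for x c
    using that spB B(2) by (auto simp: e_def fun_eq_iff M.representation_scale)
  have e_inj: "inj_on e K"
  proof (rule inj_onI)
    fix x y assume xy: "x \<in> K" "y \<in> K" "e x = e y"
    have "M.representation B x b = M.representation B y b" if "b \<in> B" for b
      using fun_cong[OF xy(3), of "i b"] that hi by (simp add: e_def)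
    moreover have "M.representation B v b = 0" if "b \<notin> B" for v b
      using that M.representation_ne_zero by blast
    ultimately have rep: "M.representation B x b = M.representation B y b" for b
      by (cases "b \<in> B") simp_all
    have "x = (\<Sum>b | M.representation B x b \<noteq> 0. scale M (M.representation B x b) b)"
      by (rule M.sum_nonzero_representation_eq[symmetric, OF B(2)]) (simp add: spB xy)
    also have "\<dots> = (\<Sum>b | M.representation B y b \<noteq> 0. scale M (M.representation B y b) b)"
      by (simp only: rep)
    also have "\<dots> = y"
      by (rule M.sum_nonzero_representation_eq[OF B(2)]) (simp add: spB xy)
    finally show "x = y" .
  qed
  define d where "d = inv_into K e"
  have de: "d (e x) = x" if "x \<in> K" for x using that e_inj by (simp add: d_def)
  define N :: "('f, 'l \<times> 'l \<Rightarrow> 'f) lie"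
    where "N = \<lparr>carrier = e ` K, scale = (\<lambda>c u z. c * u z), bracket = (\<lambda>u v. e (bracket M (d u) (d v)))\<rparr>"
  have e0: "e 0 = 0" using e_add[of 0 0] M.subspace_0[OF Ksub] by simp
  have dK: "d u \<in> K" and ed: "e (d u) = u" if "u \<in> carrier N" for u
    using that de by (auto simp: N_def)
  have eN: "e x \<in> carrier N" if "x \<in> K" for x using that by (simp add: N_def)
  have scN: "scale N c (e x) = e (scale M c x)" if "x \<in> K" for c x
    using e_scale[OF that] by (simp add: N_def)
  have Nadd: "u + v \<in> carrier N" "d (u + v) = d u + d v" if "u \<in> carrier N" "v \<in> carrier N" for u v
  proof -
    have "u + v = e (d u + d v)" using e_add dK ed that by metis
    then show "u + v \<in> carrier N" "d (u + v) = d u + d v"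
      using M.subspace_add[OF Ksub] dK that eN de by metis+
  qed
  have Nscale: "scale N c u \<in> carrier N" "d (scale N c u) = scale M c (d u)" if "u \<in> carrier N" for c u
  proof -
    have "scale N c u = e (scale M c (d u))" using scN dK ed that by metis
    then show "scale N c u \<in> carrier N" "d (scale N c u) = scale M c (d u)"
      using M.subspace_scale[OF Ksub] dK that eN de by metis+
  qed
  have Nbr: "bracket N u v \<in> carrier N" "d (bracket N u v) = bracket M (d u) (d v)"
    if "u \<in> carrier N" "v \<in> carrier N" for u v
  proof -
    have "bracket N u v = e (bracket M (d u) (d v))" by (simp add: N_def)
    then show "bracket N u v \<in> carrier N" "d (bracket N u v) = bracket M (d u) (d v)"
      using Kbr KM dK that eN de by (metis subsetD)+
  qed
  have N0: "0 \<in> carrier N" "d 0 = 0" using e0 M.subspace_0[OF Ksub] eN de by metis+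
  have dM: "d u \<in> carrier M" if "u \<in> carrier N" for u using dK KM that by blast
  have Neq: "u = v" if "u \<in> carrier N" "v \<in> carrier N" "d u = d v" for u v
    using ed that by metis
  have vsN: "vector_space (scale N)"
    by unfold_locales (auto simp: N_def fun_eq_iff algebra_simps)
  interpret N: vector_space "scale N" by (rule vsN)
  have subN: "N.subspace (carrier N)"
    unfolding N.subspace_def using N0 Nadd Nscale by blast
  have Mscale: "bracket M x (scale M c y) = scale M c (bracket M x y)"
    "bracket M (scale M c x) y = scale M c (bracket M x y)"
    if "x \<in> carrier M" "y \<in> carrier M" for c x y
    using M that by (auto simp: lie_algebra_def vbilinear_def vlinear_def)
  have bilN: "vbilinear N N N (bracket N)"
    unfolding vbilinear_def vlinear_def
    by (intro conjI ballI allI Nbr; (rule Neq)?)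
      (simp_all add: Nadd Nscale Nbr dM D(4,5) Mscale)
  have altN: "bracket N u u = 0" if "u \<in> carrier N" for u
    by (rule Neq) (simp_all add: that Nbr N0 dM D(6))
  have jacN: "bracket N u (bracket N v w) + bracket N v (bracket N w u) + bracket N w (bracket N u v) = 0"
    if "u \<in> carrier N" "v \<in> carrier N" "w \<in> carrier N" for u v w
    using M by (intro Neq) (simp_all add: that Nadd Nbr N0 dM lie_algebra_def)
  have LN: "lie_algebra N"
    unfolding lie_algebra_def vspace_def using vsN subN bilN altN jacN by blast
  have dhom: "lie_hom N M d"
    unfolding lie_hom_def vlinear_def by (simp add: Nadd Nscale Nbr dM)
  have "(\<lambda>u. q (d u)) ` carrier N = q ` K"
    using de by (simp add: N_def image_image)
  also have "\<dots> = carrier L" using extK by (simp add: central_extension_def)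
  finally have surN: "(\<lambda>u. q (d u)) ` carrier N = carrier L" .
  have "lie_hom N L (\<lambda>u. q (d u))"
    unfolding lie_hom_def vlinear_def
    using dM by (simp add: lie_homD[OF dhom] lie_homD[OF hom])
  moreover have "bracket N z x = 0" if "z \<in> carrier N" "q (d z) = 0" "x \<in> carrier N" for z x
    using ext that by (intro Neq) (simp_all add: Nbr N0 dM central_extension_def)
  ultimately have extN: "central_extension N L (\<lambda>u. q (d u))"
    unfolding central_extension_def using LN L surN by simp
  have "unique_lift E p N (\<lambda>u. q (d u))"
    using univ extN unfolding universal_central_extension_def by blast
  then obtain g where g: "lie_hom E N g" "\<And>x. x \<in> carrier E \<Longrightarrow> q (d (g x)) = p x"
    unfolding unique_lift_def by blast
  define f where "f = (\<lambda>x. d (g x))"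
  have f: "lie_hom E M f" "\<And>x. x \<in> carrier E \<Longrightarrow> q (f x) = p x"
    unfolding lie_hom_def vlinear_def f_def
    using g(2) by (simp_all add: lie_homD[OF g(1)] lie_homD[OF dhom])
  have "g' x = f x"
    if g': "lie_hom E M g'" "\<And>x. x \<in> carrier E \<Longrightarrow> q (g' x) = p x" and x: "x \<in> carrier E" for g' x
  proof -
    let ?P = "{x \<in> carrier E. g' x = f x}"
    have "E.subspace ?P"
      unfolding E.subspace_def using lie_algebraD(2)[OF E]
      by (simp add: E.subspace_def lie_homD[OF f(1)] lie_homD[OF g'(1)]
          lie_hom_image_zero[OF E f(1)] lie_hom_image_zero[OF E g'(1)])
    moreover have "{bracket E x y |x y. x \<in> carrier E \<and> y \<in> carrier E} \<subseteq> ?P"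
    proof clarify
      fix x y assume xy: "x \<in> carrier E" "y \<in> carrier E"
      have c: "f z \<in> carrier M" "g' z \<in> carrier M" if "z \<in> carrier E" for z
        using that f g' by (auto simp: lie_hom_def vlinear_def)
      have "g' (bracket E x y) = bracket M (g' x) (g' y)"
        using g' xy by (auto simp: lie_hom_def)
      also have "\<dots> = bracket M (f x) (f y)"
        by (rule central_extension_bracket_eq[OF ext]) (use xy c f g' in auto)
      also have "\<dots> = f (bracket E x y)"
        using f xy by (auto simp: lie_hom_def)
      finally show "bracket E x y \<in> carrier E \<and> g' (bracket E x y) = f (bracket E x y)"
        using lie_algebraD(3)[OF E] xy by blast
    qed
    ultimately have "bracket_span E (carrier E) (carrier E) \<subseteq> ?P"
      unfolding bracket_span_def using vspan_subset_induct E.vector_space_axioms by blast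
    then show ?thesis using perfE x by (auto simp: perfect_def)
  qed
  then show ?thesis unfolding unique_lift_def using f by blast
qed


section \<open>Graded Lie algebras\<close>

definition sl :: "('f::field, 'f^'n^'n) lie" where
  "sl = \<lparr>carrier = {x. trace x = 0}, scale = (\<lambda>c x. \<chi> i j. c * x $ i $ j),
         bracket = (\<lambda>x y. x ** y - y ** x)\<rparr>"

definition cartan :: "('f::field^'n^'n) set" where
  "cartan = {h \<in> carrier sl. \<forall>i j. i \<noteq> j \<longrightarrow> h $ i $ j = 0}"

text \<open>Linear functionals on the Cartan subalgebra are extended by \<open>0\<close> to all matrices.\<close>

definition eps :: "'n \<Rightarrow> 'f::field^'n^'n \<Rightarrow> 'f" where
  "eps i = (\<lambda>h. if h \<in> cartan then h $ i $ i else 0)"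

definition Theta :: "('f::field^'n^'n \<Rightarrow> 'f) set" where
  "Theta = {0}
     \<union> (\<Union>i. \<Union>j\<in>-{i}. {eps i + eps j, eps i - eps j, - eps i + eps j, - eps i - eps j})
     \<union> (\<Union>i. {eps i, - eps i, eps i + eps i, - (eps i + eps i)})"

definition weight_space ::
  "('f::field^'n^'n \<Rightarrow> 'l) \<Rightarrow> ('f, 'l::ab_group_add) lie \<Rightarrow> ('f^'n^'n \<Rightarrow> 'f) \<Rightarrow> 'l set"
where
  "weight_space \<iota> L \<alpha> = {x \<in> carrier L. \<forall>h\<in>cartan. bracket L (\<iota> h) x = scale L (\<alpha> h) x}"

text \<open>The map \<open>\<iota>\<close> identifies \<open>sl\<close> with the subalgebra \<open>\<gg>\<close> of \<open>L\<close>.\<close>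

definition Theta_graded :: "('f::field^'n^'n \<Rightarrow> 'l) \<Rightarrow> ('f, 'l::ab_group_add) lie \<Rightarrow> bool" where
  "Theta_graded \<iota> L \<longleftrightarrow> lie_algebra L \<and>
     lie_hom sl L \<iota> \<and> inj_on \<iota> (carrier sl) \<and>
     (\<forall>x\<in>carrier L. \<exists>!f. (\<forall>\<alpha>\<in>Theta. f \<alpha> \<in> weight_space \<iota> L \<alpha>) \<and> (\<forall>\<alpha>. \<alpha> \<notin> Theta \<longrightarrow> f \<alpha> = 0) \<and>
        x = (\<Sum>\<alpha>\<in>Theta. f \<alpha>)) \<and>
     weight_space \<iota> L 0 =
       vspan L (\<Union>\<alpha>\<in>{\<alpha>. \<alpha> \<in> Theta - {0} \<and> - \<alpha> \<in> Theta - {0}}.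
          bracket_span L (weight_space \<iota> L \<alpha>) (weight_space \<iota> L (- \<alpha>)))"


section \<open>Isotypic components\<close>

record ('f, 'n, 'v) sl_module = "('f, 'v) vs" +
  act :: "'f^'n^'n \<Rightarrow> 'v \<Rightarrow> 'v"

definition natural_module :: "('f::field, 'n::finite, 'f^'n) sl_module" where
  "natural_module = \<lparr>carrier = UNIV, scale = (*s), act = (*v)\<rparr>"

text \<open>
  In characteristic \<open>0\<close> the exterior square of the natural module is the module of
  skew-symmetric matrices, with \<open>v \<and> w\<close> corresponding to \<open>v w\<^sup>t - w v\<^sup>t\<close>.
\<close>

definition exterior_square :: "('f::field, 'n::finite, 'f^'n^'n) sl_module" where
  "exterior_square = \<lparr>carrier = {m. transpose m = - m}, scale = (\<lambda>c m. \<chi> i j. c * m $ i $ j),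
     act = (\<lambda>x m. x ** m + m ** transpose x)\<rparr>"

definition dual_module ::
  "('f::field, 'n::finite, 'v::ab_group_add) sl_module \<Rightarrow> ('f, 'n, 'v \<Rightarrow> 'f) sl_module"
where
  "dual_module M =
     \<lparr>carrier = {f. vlinear M \<lparr>carrier = UNIV, scale = (*)\<rparr> f \<and> (\<forall>v. v \<notin> carrier M \<longrightarrow> f v = 0)},
      scale = (\<lambda>c f v. c * f v),
      act = (\<lambda>x f v. if v \<in> carrier M then - f (act M x v) else 0)\<rparr>"

definition isotypic_component ::
  "('f::field^'n^'n \<Rightarrow> 'l) \<Rightarrow> ('f, 'l::ab_group_add) lie \<Rightarrow> ('f, 'n::finite, 'v::ab_group_add) sl_module \<Rightarrow> 'l set"
where
  "isotypic_component \<iota> L M = vspan L (\<Union>{N. N \<subseteq> carrier L \<and> module.subspace (scale L) N \<and>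
     (\<forall>x\<in>carrier sl. \<forall>v\<in>N. bracket L (\<iota> x) v \<in> N) \<and>
     (\<exists>f. bij_betw f (carrier M) N \<and> vlinear M L f \<and>
        (\<forall>x\<in>carrier sl. \<forall>v\<in>carrier M. f (act M x v) = bracket L (\<iota> x) (f v)))})"

definition star_conditions :: "('f::field^'n^'n \<Rightarrow> 'l) \<Rightarrow> ('f, 'l::ab_group_add) lie \<Rightarrow> bool" where
  "star_conditions \<iota> L \<longleftrightarrow>
    (let V = isotypic_component \<iota> L natural_module;
         V' = isotypic_component \<iota> L (dual_module natural_module);
         \<Lambda> = isotypic_component \<iota> L exterior_square;
         \<Lambda>' = isotypic_component \<iota> L (dual_module exterior_square)
     in (CARD('n) = 6 \<longrightarrow> bracket_span L \<Lambda> \<Lambda> = {0} \<and> bracket_span L \<Lambda>' \<Lambda>' = {0}) \<and>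
        (CARD('n) = 5 \<longrightarrow>
           bracket_span L \<Lambda> {x + y | x y. x \<in> \<Lambda> \<and> y \<in> V} = {0} \<and>
           bracket_span L \<Lambda>' {x + y | x y. x \<in> \<Lambda>' \<and> y \<in> V'} = {0}))"


section \<open>Unitary Lie algebras\<close>

record ('f, 'a) inv_algebra = "('f, 'a) vs" +
  mult :: "'a \<Rightarrow> 'a \<Rightarrow> 'a"
  unit :: 'a
  invol :: "'a \<Rightarrow> 'a"

record ('f, 'a, 'b) herm_module = "('f, 'b) vs" +
  ract :: "'b \<Rightarrow> 'a \<Rightarrow> 'b"
  herm :: "'b \<Rightarrow> 'b \<Rightarrow> 'a"

definition involutive_algebra :: "('f::field, 'a::ab_group_add) inv_algebra \<Rightarrow> bool" where
  "involutive_algebra A \<longleftrightarrow> vspace A \<and> vbilinear A A A (mult A) \<and>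
     (\<forall>a\<in>carrier A. \<forall>b\<in>carrier A. \<forall>c\<in>carrier A. mult A (mult A a b) c = mult A a (mult A b c)) \<and>
     unit A \<in> carrier A \<and>
     (\<forall>a\<in>carrier A. mult A (unit A) a = a \<and> mult A a (unit A) = a) \<and>
     vlinear A A (invol A) \<and>
     (\<forall>a\<in>carrier A. \<forall>b\<in>carrier A. invol A (mult A a b) = mult A (invol A b) (invol A a)) \<and>
     (\<forall>a\<in>carrier A. invol A (invol A a) = a)"

definition unital_right_module ::
  "('f::field, 'a::ab_group_add) inv_algebra \<Rightarrow> ('f, 'a, 'b::ab_group_add) herm_module \<Rightarrow> bool"
where
  "unital_right_module A B \<longleftrightarrow> vspace B \<and> vbilinear B A B (ract B) \<and>
     (\<forall>x\<in>carrier B. \<forall>a\<in>carrier A. \<forall>b\<in>carrier A. ract B x (mult A a b) = ract B (ract B x a) b) \<and>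
     (\<forall>x\<in>carrier B. ract B x (unit A) = x)"

definition hermitian_form ::
  "('f::field, 'a::ab_group_add) inv_algebra \<Rightarrow> ('f, 'a, 'b::ab_group_add) herm_module \<Rightarrow> bool"
where
  "hermitian_form A B \<longleftrightarrow> vbilinear B B A (herm B) \<and>
     (\<forall>x\<in>carrier B. \<forall>y\<in>carrier B. \<forall>a\<in>carrier A.
        herm B (ract B x a) y = mult A (invol A a) (herm B x y) \<and>
        herm B x (ract B y a) = mult A (herm B x y) a) \<and>
     (\<forall>x\<in>carrier B. \<forall>y\<in>carrier B. herm B y x = invol A (herm B x y))"

definition coordinate_data ::
  "('f::field, 'a::ab_group_add) inv_algebra \<Rightarrow> 'a \<Rightarrow> 'a \<Rightarrow> ('f, 'a, 'b::ab_group_add) herm_module \<Rightarrow> bool"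
where
  "coordinate_data A e1 e2 B \<longleftrightarrow> involutive_algebra A \<and> unit A \<noteq> 0 \<and>
     e1 \<in> carrier A \<and> e2 \<in> carrier A \<and> mult A e1 e1 = e1 \<and> mult A e2 e2 = e2 \<and>
     mult A e1 e2 = 0 \<and> mult A e2 e1 = 0 \<and> unit A = e1 + e2 \<and> e2 = invol A e1 \<and>
     unital_right_module A B \<and> hermitian_form A B"

definition sum_module ::
  "('f::field, 'a::ab_group_add) inv_algebra \<Rightarrow> ('f, 'a, 'b::ab_group_add) herm_module \<Rightarrow>
   ('f, 'a, ('a^'n) \<times> 'b) herm_module"
where
  "sum_module A B =
     \<lparr>carrier = {v. \<forall>i. v $ i \<in> carrier A} \<times> carrier B,
      scale = (\<lambda>c (v, x). (\<chi> i. scale A c (v $ i), scale B c x)),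
      ract = (\<lambda>(v, x) a. (\<chi> i. mult A (v $ i) a, ract B x a)),
      herm = (\<lambda>(v, x) (w, y). (\<Sum>i\<in>UNIV. mult A (invol A (v $ i)) (w $ i)) - herm B x y)\<rparr>"

text \<open>Endomorphisms are extended by \<open>0\<close> outside the module.\<close>

definition skew_endomorphisms ::
  "('f::field, 'a::ab_group_add) inv_algebra \<Rightarrow> ('f, 'a, 'w::ab_group_add) herm_module \<Rightarrow> ('f, 'w \<Rightarrow> 'w) lie"
where
  "skew_endomorphisms A W =
     \<lparr>carrier = {T. vlinear W W T \<and> (\<forall>v. v \<notin> carrier W \<longrightarrow> T v = 0) \<and>
        (\<forall>v\<in>carrier W. \<forall>a\<in>carrier A. T (ract W v a) = ract W (T v) a) \<and>
        (\<forall>u\<in>carrier W. \<forall>v\<in>carrier W. herm W (T u) v + herm W u (T v) = 0)},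
      scale = (\<lambda>c T v. scale W c (T v)),
      bracket = (\<lambda>S T v. S (T v) - T (S v))\<rparr>"

definition sl_matrix ::
  "('f::field, 'a::ab_group_add) inv_algebra \<Rightarrow> 'a \<Rightarrow> 'a \<Rightarrow> 'f^'n^'n \<Rightarrow> 'a^'n^'n"
where
  "sl_matrix A e1 e2 x = (\<chi> i j. scale A ((x $ i $ j + x $ j $ i) / 2) (e1 - e2)
                              + scale A ((x $ i $ j - x $ j $ i) / 2) (unit A))"

definition sl_action ::
  "('f::field, 'a::ab_group_add) inv_algebra \<Rightarrow> 'a \<Rightarrow> 'a \<Rightarrow> ('f, 'a, 'b::ab_group_add) herm_module \<Rightarrow>
   'f^'n^'n \<Rightarrow> ('a^'n) \<times> 'b \<Rightarrow> ('a^'n) \<times> 'b"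
where
  "sl_action A e1 e2 B x u = (if u \<in> carrier (sum_module A B)
     then (\<chi> i. \<Sum>j\<in>UNIV. mult A (sl_matrix A e1 e2 x $ i $ j) (fst u $ j), 0) else 0)"

definition unitary_lie ::
  "('f::field, 'a::ab_group_add) inv_algebra \<Rightarrow> 'a \<Rightarrow> 'a \<Rightarrow> ('f, 'a, 'b::ab_group_add) herm_module \<Rightarrow>
   ('f, ('a^'n) \<times> 'b \<Rightarrow> ('a^'n) \<times> 'b) lie"
where
  "unitary_lie A e1 e2 B =
     (let U = skew_endomorphisms A (sum_module A B)
      in U\<lparr>carrier := lie_ideal U hull (sl_action A e1 e2 B ` carrier sl)\<rparr>)"

end

theory Submission
  imports Defs
begin

text \<open>
  Record a weight of \<open>sl\<^sub>n\<close> as an integral vector, so that \<open>\<Theta>\<^sub>n\<close> consists of the vectors of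
  \<open>\<ell>\<^sup>1\<close>-norm at most two. In a \<open>\<Theta>\<^sub>n\<close>-graded Lie algebra, weight spaces whose weights add up to a vector
  of norm above two commute, except for coincidences of weights with \<open>n = 5, 6\<close>; the conditions
  \<open>(*)\<close> say exactly that they always commute. Reducing weights modulo two then yields components
  \<open>M\<^sub>i\<^sub>j\<close>, \<open>M\<^sub>i\<close> and \<open>M\<^sub>0\<close> that multiply like in a unitary Lie algebra. The elements
  \<open>E\<^sub>i\<^sub>j - E\<^sub>j\<^sub>i\<close> identify all \<open>M\<^sub>i\<^sub>j\<close> with one space \<open>\<aa>\<close> and all \<open>M\<^sub>i\<close> with one space \<open>\<B>\<close>, on
  which the bracket induces the product, the module structure and the form \<open>\<chi>\<close>; the associative law
  is the Jacobi identity for four indices. Now \<open>L\<close> and \<open>\<uu>\<close> are both generated by copies of \<open>\<aa>\<close> and \<open>\<B>\<close>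
  with the same relations, and the diagonal copies generate in \<open>L \<times> \<uu>\<close> a central extension of both.
  Conversely the grading of \<open>\<uu>\<close> lifts to a perfect central extension, since the bracket there depends
  only on the images in \<open>\<uu>\<close>, and descends from there to \<open>L\<close>.
\<close>

text \<open>Weights are functionals on traceless diagonal matrices, so integral vectors that differ
  by a constant vector give the same weight. \<open>5 \<le> CARD('n)\<close> separates vectors of
  norm at most two from each other and nonzero vectors of norm at most four from zero; but a sum of
  two weights can still coincide with a third one when n is 5 or 6. Reduction modulo two is natural
  because the four Peirce parts of a coefficient at (i, j) of a unitary matrix have the four weights
  \<open>\<plusminus>\<epsilon>\<^sub>i\<plusminus>\<epsilon>\<^sub>j\<close>, which agree only
  modulo two. The unit \<open>e1 + e2\<close> at (i, j) is
  \<open>E\<^sub>i\<^sub>j - E\<^sub>j\<^sub>i\<close>, and \<open>e1\<close> itself is the family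
  of root vectors \<open>E\<^sub>i\<^sub>j\<close>. The relations among the diagonal brackets of
  \<open>L\<close> and of the unitary Lie algebra may differ. They never have to be compared: in the
  product, an element with one zero component sends each paired generator to a paired generator with
  one zero component, and such a generator is zero. Along a central extension, vectors of small
  nonzero weight lift uniquely; only the zero weight space has to be recovered from
  perfectness.\<close>

lemma lie_algebra_bracketD:
  assumes "lie_algebra L"
  shows "\<And>c x y. x \<in> carrier L \<Longrightarrow> y \<in> carrier L \<Longrightarrow> bracket L (scale L c x) y = scale L c (bracket L x y)"
    "\<And>c x y. x \<in> carrier L \<Longrightarrow> y \<in> carrier L \<Longrightarrow> bracket L x (scale L c y) = scale L c (bracket L x y)"
    "\<And>x y z. x \<in> carrier L \<Longrightarrow> y \<in> carrier L \<Longrightarrow> z \<in> carrier L \<Longrightarrow>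
       bracket L x (bracket L y z) + bracket L y (bracket L z x) + bracket L z (bracket L x y) = 0"
  using assms by (auto simp: lie_algebra_def vbilinear_def vlinear_def)

section \<open>Projections onto subspaces and brackets defined on the whole type\<close>

text \<open>A basis of \<open>K\<close> extends to a basis of the whole space, which gives a linear
  retraction onto \<open>K\<close>. It serves to extend operations from a carrier to its type and to
  realize a quotient inside the same type.\<close>

lemma exists_projection:
  assumes "vector_space sc" "module.subspace sc K"
  shows "\<exists>g. Vector_Spaces.linear sc sc g \<and> (\<forall>x. g x \<in> K) \<and> (\<forall>x\<in>K. g x = x)"
proof -
  interpret vector_space sc by fact
  interpret vp: vector_space_pair sc sc ..
  have "\<exists>g. range g \<subseteq> K \<and> Vector_Spaces.linear sc sc g \<and> (\<forall>v\<in>K. g (id v) = v)"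
    by (rule vp.linear_exists_left_inverse_on) (use assms linear_ident in \<open>auto simp: id_def\<close>)
  then show ?thesis by auto
qed

text \<open>The Jacobi identity has the form of a derivation rule, the form in which later
  computations move an operator past a bracket.\<close>

locale total_lie_algebra = vector_space sc for sc :: "'f::field_char_0 \<Rightarrow> 'l::ab_group_add \<Rightarrow> 'l" +
  fixes br :: "'l \<Rightarrow> 'l \<Rightarrow> 'l"
  assumes br_add_left: "br (x + y) z = br x z + br y z"
    and br_add_right: "br x (y + z) = br x y + br x z"
    and br_scale_left: "br (sc c x) y = sc c (br x y)"
    and br_scale_right: "br x (sc c y) = sc c (br x y)"
    and br_self [simp]: "br x x = 0"
    and br_jacobi: "br x (br y z) = br (br x y) z + br y (br x z)"
begin

lemma br_skew: "br x y = - br y x"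
proof -
  have "br (x + y) (x + y) = br y x + br x y" unfolding br_add_left br_add_right by simp
  then have "br x y + br y x = 0" by (metis br_self add.commute)
  then show ?thesis by (rule eq_neg_iff_add_eq_0[THEN iffD2])
qed

lemma br_zero_left [simp]: "br 0 x = 0" using br_add_left[of 0 0 x] by simp
lemma br_zero_right [simp]: "br x 0 = 0" using br_add_right[of x 0 0] by simp
lemma br_minus_left [simp]: "br (- x) y = - br x y"
  using br_add_left[of x "- x" y] by (simp add: minus_unique)
lemma br_minus_right [simp]: "br x (- y) = - br x y"
  using br_add_right[of x y "- y"] by (simp add: minus_unique)
lemma br_diff_left: "br (x - y) z = br x z - br y z"
  using br_add_left[of x "- y" z] by simp
lemma br_diff_right: "br x (y - z) = br x y - br x z"
  using br_add_right[of x y "- z"] by simp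

lemma br_jacobi_left: "br (br x y) z = br x (br y z) - br y (br x z)"
  using br_jacobi[of x y z] by (simp add: algebra_simps)

lemma br_sum_right: "br x (sum f I) = (\<Sum>i\<in>I. br x (f i))"
  by (induction I rule: infinite_finite_induct) (auto simp: br_add_right)

lemma subspace_br_left: "subspace S \<Longrightarrow> subspace {x. br x y \<in> S}"
  by (auto simp: subspace_def br_add_left br_scale_left)
lemma subspace_br_right: "subspace S \<Longrightarrow> subspace {y. br x y \<in> S}"
  by (auto simp: subspace_def br_add_right br_scale_right)

text \<open>By bilinearity the elements that one fixed argument brackets into \<open>S\<close> form
  a subspace, so the two arguments can be extended to spans one after the other.\<close>

lemma span_br_subset:
  assumes "subspace S" "\<And>x y. x \<in> X \<Longrightarrow> y \<in> Y \<Longrightarrow> br x y \<in> S" "x \<in> span X" "y \<in> span Y"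
  shows "br x y \<in> S"
proof -
  have "span Y \<subseteq> {y. br x y \<in> S}" if "x \<in> X" for x
    by (rule span_minimal) (use assms that in \<open>auto intro: subspace_br_right\<close>)
  then have "span X \<subseteq> {x. br x y \<in> S}"
    by (intro span_minimal) (use assms in \<open>auto intro: subspace_br_left\<close>)
  then show ?thesis using assms by auto
qed

end

text \<open>Extending the bracket by a projection onto the carrier removes all carrier side
  conditions from computations with the Jacobi identity.\<close>

lemma total_bracket_exists:
  fixes L :: "('f::field_char_0, 'l::ab_group_add) lie"
  assumes "lie_algebra L"
  shows "\<exists>br. total_lie_algebra (scale L) br \<and> (\<forall>x\<in>carrier L. \<forall>y\<in>carrier L. br x y = bracket L x y) \<and>
    (\<forall>x y. br x y \<in> carrier L)"
proof -
  note D = lie_algebraD[OF assms] lie_algebra_bracketD[OF assms]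
  interpret vector_space "scale L" using D(1) .
  obtain g where g: "Vector_Spaces.linear (scale L) (scale L) g" "\<And>x. g x \<in> carrier L"
    "\<And>x. x \<in> carrier L \<Longrightarrow> g x = x"
    using exists_projection[OF D(1,2)] by blast
  interpret g: Vector_Spaces.linear "scale L" "scale L" g by fact
  define br where "br x y = bracket L (g x) (g y)" for x y
  have skew: "bracket L x y = - bracket L y x" if "x \<in> carrier L" "y \<in> carrier L" for x y
  proof -
    have "x + y \<in> carrier L" using D(2) that by (simp add: subspace_add)
    then have "bracket L (x + y) (x + y) = 0" by (rule D(6))
    then have "bracket L x y + bracket L y x = 0"
      using that D(5)[of x y "x + y"] D(4)[of _ x y] D(6) \<open>x + y \<in> carrier L\<close> by simp
    then show ?thesis by (rule eq_neg_iff_add_eq_0[THEN iffD2])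
  qed
  have "total_lie_algebra (scale L) br"
  proof unfold_locales
    fix x y z
    have "br x (br y z) + br y (br z x) + br z (br x y) = 0"
      unfolding br_def by (simp add: g D)
    moreover have "br y (br z x) = - br y (br x z)"
    proof -
      have "g y \<in> carrier L" "bracket L (g x) (g z) \<in> carrier L" by (simp_all add: g D)
      then have "bracket L (g y) (- bracket L (g x) (g z)) = - bracket L (g y) (bracket L (g x) (g z))"
        using D(8)[of "g y" "bracket L (g x) (g z)" "-1"] by simp
      moreover have "g (- bracket L (g x) (g z)) = - bracket L (g x) (g z)"
        by (intro g(3) subspace_neg[OF D(2)] D g)
      ultimately show ?thesis unfolding br_def by (simp add: g D skew[of "g z" "g x"])
    qed
    moreover have "br z (br x y) = - br (br x y) z"
      unfolding br_def using skew[of "g z" "bracket L (g x) (g y)"] by (simp add: g D)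
    ultimately show "br x (br y z) = br (br x y) z + br y (br x z)"
      by (simp add: algebra_simps)
  qed (simp_all add: br_def g.add g.scale D g)
  then show ?thesis using g by (intro exI[of _ br]) (simp add: br_def D)
qed


section \<open>Existence of universal central extensions\<close>

text \<open>The extension is the space of symbols \<open>d (x, y)\<close> modulo bilinearity,
  alternation and the Jacobi identity, with \<open>P\<close> sending a symbol to the bracket in
  \<open>L\<close>. Every central extension receives a map from it: the bracket there depends only
  on the images in \<open>L\<close>, so it satisfies the same relations. Perfectness makes
  \<open>P\<close> map onto \<open>L\<close>, and uniqueness of lifts follows.\<close>

lemma universal_central_extension_exists:
  fixes L :: "('f::field_char_0, 'l::ab_group_add) lie"
  assumes L: "lie_algebra L" and perf: "perfect L"
  shows "\<exists>E p. universal_central_extension E L p"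
proof -
  note D = lie_algebraD[OF L] lie_algebra_bracketD[OF L]
  interpret L: vector_space "scale L" using D(1) .
  define s where "s = (\<lambda>(c::'f) (f :: 'l \<times> 'l \<Rightarrow> 'f) z. c * f z)"
  interpret V: vector_space s
    by unfold_locales (auto simp: s_def fun_eq_iff algebra_simps)
  \<comment> \<open>The functions \<open>d z\<close> are independent but do not span the function
    type. The symbols that matter form the subspace \<open>F\<close> below; linear maps prescribed
    on the \<open>d z\<close> are extended to the whole type by \<open>construct\<close>.\<close>
  define d where "d z = (\<lambda>w. if w = z then 1 else 0 :: 'f)" for z :: "'l \<times> 'l"
  have d_inj: "inj d" by (auto simp: inj_on_def d_def fun_eq_iff split: if_splits)
  have ind: "V.independent (range d)"
    unfolding V.independent_explicit_module
  proof (intro allI impI)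
    fix t u v assume t: "finite t" "t \<subseteq> range d" "(\<Sum>v\<in>t. s (u v) v) = 0" "v \<in> t"
    then obtain z where z: "v = d z" by auto
    have "(\<Sum>v\<in>t. s (u v) v) z = (\<Sum>v\<in>t. u v * v z)"
      by (induction t rule: infinite_finite_induct) (auto simp: s_def)
    also have "\<dots> = (\<Sum>w\<in>t. if w = v then u v else 0)"
    proof (rule sum.cong[OF refl])
      fix w assume "w \<in> t"
      then obtain y where y: "w = d y" using t by auto
      have "w = v \<longleftrightarrow> y = z" using y z inj_eq[OF d_inj] by simp
      moreover have "w z = (if y = z then 1 else 0)" by (simp add: y d_def eq_commute)
      ultimately show "u w * w z = (if w = v then u v else 0)" by auto
    qed
    also have "\<dots> = u v" using t by simp
    finally show "u v = 0" using t by simp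
  qed
  define C where "C = carrier L"
  have C: "\<And>x y. x \<in> C \<Longrightarrow> y \<in> C \<Longrightarrow> x + y \<in> C" "\<And>c x. x \<in> C \<Longrightarrow> scale L c x \<in> C"
    "\<And>x y. x \<in> C \<Longrightarrow> y \<in> C \<Longrightarrow> bracket L x y \<in> C"
    using D(2,3) by (auto simp: C_def L.subspace_add L.subspace_scale)
  define Rel where "Rel = {d (x + y, z) - (d (x, z) + d (y, z)) | x y z. x \<in> C \<and> y \<in> C \<and> z \<in> C}
    \<union> {d (z, x + y) - (d (z, x) + d (z, y)) | x y z. x \<in> C \<and> y \<in> C \<and> z \<in> C}
    \<union> {d (scale L c x, y) - s c (d (x, y)) | c x y. x \<in> C \<and> y \<in> C}
    \<union> {d (x, scale L c y) - s c (d (x, y)) | c x y. x \<in> C \<and> y \<in> C}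
    \<union> {d (x, x) | x. x \<in> C}
    \<union> {d (x, bracket L y z) + d (y, bracket L z x) + d (z, bracket L x y) | x y z. x \<in> C \<and> y \<in> C \<and> z \<in> C}"
  define K where "K = V.span Rel"
  have Rel0: "v \<in> K" if "v \<in> Rel" for v using that by (simp add: K_def V.span_base)
  have Ksub: "V.subspace K" by (simp add: K_def)
  obtain g where g: "Vector_Spaces.linear s s g" "\<And>x. g x \<in> K" "\<And>x. x \<in> K \<Longrightarrow> g x = x"
    using exists_projection[OF V.vector_space_axioms Ksub] by blast
  \<comment> \<open>The quotient by \<open>K\<close> stays in the same type: it is the image of the
    projection \<open>pi\<close>, whose kernel is \<open>K\<close>.\<close>
  define pi where "pi f = f - g f" for f
  interpret g: Vector_Spaces.linear s s g by fact
  have pi_lin: "Vector_Spaces.linear s s pi"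
    by unfold_locales (simp_all add: pi_def g.add g.scale V.scale_right_diff_distrib)
  interpret pi: Vector_Spaces.linear s s pi by (rule pi_lin)
  have piK: "pi f = 0" if "f \<in> K" for f using that g by (simp add: pi_def)
  define F where "F = V.span {d (x, y) | x y. x \<in> C \<and> y \<in> C}"
  have Fsub: "V.subspace F" by (simp add: F_def)
  define t where "t x y = pi (d (x, y))" for x y
  have tF: "t x y \<in> pi ` F" if "x \<in> C" "y \<in> C" for x y
    using that unfolding t_def F_def by (intro imageI V.span_base) auto
  have pieq: "pi u = pi v" if "u - v \<in> Rel" for u v
    using piK[OF Rel0[OF that]] by (simp add: pi.diff)
  have t_add: "t (x + y) z = t x z + t y z" "t z (x + y) = t z x + t z y"
    if "x \<in> C" "y \<in> C" "z \<in> C" for x y z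
    unfolding t_def pi.add[symmetric] using that
    by (intro pieq; unfold Rel_def; blast)+
  have t_scale: "t (scale L c x) y = s c (t x y)" "t x (scale L c y) = s c (t x y)"
    if "x \<in> C" "y \<in> C" for x y c
    unfolding t_def pi.scale[symmetric] using that
    by (intro pieq; unfold Rel_def; blast)+
  have t_self: "t x x = 0" if "x \<in> C" for x
    unfolding t_def using that by (intro piK Rel0; unfold Rel_def; blast)
  have t_jac: "t x (bracket L y z) + t y (bracket L z x) + t z (bracket L x y) = 0"
    if "x \<in> C" "y \<in> C" "z \<in> C" for x y z
    unfolding t_def pi.add[symmetric] using that
    by (intro piK Rel0; unfold Rel_def; blast)
  define m0 where "m0 = (\<lambda>(x, y). bracket L x y)"
  interpret VL: vector_space_pair s "scale L" ..
  define P where "P = VL.construct (range d) (\<lambda>v. m0 (inv d v))"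
  have P_lin: "Vector_Spaces.linear s (scale L) P" unfolding P_def by (rule VL.linear_construct[OF ind])
  interpret P: Vector_Spaces.linear s "scale L" P by (rule P_lin)
  have Pd: "P (d (x, y)) = bracket L x y" for x y
    unfolding P_def by (subst VL.construct_basis[OF ind]) (auto simp: m0_def inv_f_f[OF d_inj])
  have Rel_PK: "P v = 0" if "v \<in> Rel" for v
    using that unfolding Rel_def
    by (auto simp: P.diff P.add P.scale Pd C_def D)
  have PK: "P v = 0" if "v \<in> K" for v
  proof -
    have "K \<subseteq> {v. P v = 0}" unfolding K_def
      by (rule V.span_minimal) (auto simp: Rel_PK P.subspace_kernel)
    then show ?thesis using that by auto
  qed
  have Ppi: "P (pi v) = P v" for v
    by (simp add: pi_def P.diff PK g)
  have PF: "P v \<in> C" if "v \<in> F" for v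
  proof -
    have "F \<subseteq> P -` C" unfolding F_def
      by (rule V.span_minimal) (use D(2) in \<open>auto simp: Pd C C_def[symmetric] intro!: P.subspace_vimage\<close>)
    then show ?thesis using that by auto
  qed
  \<comment> \<open>In a central extension a bracket depends only on the images in \<open>L\<close>;
    this dictates the bracket of two classes as the symbol of their images under
    \<open>P\<close>.\<close>
  define E where "E = \<lparr>carrier = pi ` F, scale = s, bracket = (\<lambda>a b. t (P a) (P b))\<rparr>"
  have EP: "P v \<in> C" if "v \<in> carrier E" for v using that PF Ppi by (auto simp: E_def)
  have Esub: "V.subspace (pi ` F)" by (rule pi.subspace_image[OF Fsub])
  have Pt: "P (t x y) = bracket L x y" for x y by (simp add: t_def Ppi Pd)
  have LE: "lie_algebra E"
    unfolding lie_algebra_def vspace_def vbilinear_def vlinear_def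
    using Esub V.vector_space_axioms EP
    by (auto simp: E_def P.add P.scale t_add t_scale t_self tF Pt t_jac)
  have homE: "lie_hom E L P"
    unfolding lie_hom_def vlinear_def using EP
    by (auto simp: E_def P.add P.scale Pt C_def)
  have sur: "P ` carrier E = carrier L"
  proof
    show "P ` carrier E \<subseteq> carrier L" using EP by (auto simp: C_def)
    have "carrier L = L.span {bracket L x y |x y. x \<in> carrier L \<and> y \<in> carrier L}"
      using perf by (simp add: perfect_def bracket_span_def vspan_def)
    also have "\<dots> \<subseteq> P ` pi ` F"
    proof (rule L.span_minimal)
      show "{bracket L x y |x y. x \<in> carrier L \<and> y \<in> carrier L} \<subseteq> P ` pi ` F"
      proof clarify
        fix x y assume "x \<in> carrier L" "y \<in> carrier L"
        then show "bracket L x y \<in> P ` pi ` F" using tF[of x y] Pt[of x y] by (metis C_def imageI)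
      qed
    qed (intro P.subspace_image Esub)
    finally show "carrier L \<subseteq> P ` carrier E" by (simp add: E_def)
  qed
  have t0: "t 0 x = 0" if "x \<in> C" for x
  proof -
    have "0 \<in> C" using D(2) by (simp add: C_def L.subspace_0)
    then show ?thesis using t_add(1)[of 0 0 x] that by simp
  qed
  have extE: "central_extension E L P"
    unfolding central_extension_def using LE L homE sur EP by (auto simp: E_def t0)
  have "unique_lift E P M q" if ext: "central_extension M L q" for M :: "('f, 'l \<times> 'l \<Rightarrow> 'f) lie" and q
  proof -
    have M: "lie_algebra M" and hom: "lie_hom M L q" and surM: "q ` carrier M = carrier L"
      using ext by (auto simp: central_extension_def)
    note DM = lie_algebraD[OF M] lie_algebra_bracketD[OF M]
    interpret M: vector_space "scale M" using DM(1) .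
    interpret VM: vector_space_pair s "scale M" ..
    define sec where "sec = inv_into (carrier M) q"
    have sec: "sec x \<in> carrier M" "q (sec x) = x" if "x \<in> C" for x
      using that surM by (auto simp: sec_def inv_into_into f_inv_into_f C_def)
    \<comment> \<open>\<open>m\<close> is the bracket of \<open>M\<close> read as a function on
      \<open>L\<close>. It does not depend on the section, so the sum of two lifts may replace the
      chosen lift of a sum, and likewise for multiples and brackets. Hence \<open>m\<close>
      satisfies every relation in \<open>Rel\<close>.\<close>
    define m where "m x y = bracket M (sec x) (sec y)" for x y
    have m: "m x y = bracket M a b" if "a \<in> carrier M" "b \<in> carrier M" "q a = x" "q b = y" for a b x y
      unfolding m_def by (rule central_extension_bracket_eq[OF ext])
        (use that surM sec in \<open>auto simp: C_def\<close>)
    have mC: "m x y \<in> carrier M" if "x \<in> C" "y \<in> C" for x y using that by (simp add: m_def sec DM)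
    have qm: "q (m x y) = bracket L x y" if "x \<in> C" "y \<in> C" for x y
      using that by (simp add: m_def sec lie_homD[OF hom])
    define f where "f = VM.construct (range d) (\<lambda>v. case_prod m (inv d v))"
    have f_lin: "Vector_Spaces.linear s (scale M) f" unfolding f_def by (rule VM.linear_construct[OF ind])
    interpret f: Vector_Spaces.linear s "scale M" f by (rule f_lin)
    have fd: "f (d (x, y)) = m x y" for x y
      unfolding f_def by (subst VM.construct_basis[OF ind]) (auto simp: inv_f_f[OF d_inj])
    have Ms: "\<And>x y. x \<in> carrier M \<Longrightarrow> y \<in> carrier M \<Longrightarrow> x + y \<in> carrier M"
      "\<And>c x. x \<in> carrier M \<Longrightarrow> scale M c x \<in> carrier M"
      using DM(2) by (auto simp: M.subspace_add M.subspace_scale)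
    have Rel_fK: "f v = 0" if "v \<in> Rel" for v
    proof -
      have a1: "m (x + y) z = m x z + m y z" "m z (x + y) = m z x + m z y"
        if "x \<in> C" "y \<in> C" "z \<in> C" for x y z
      proof -
        have "m (x + y) z = bracket M (sec x + sec y) (sec z)"
          by (rule m) (use that in \<open>simp_all add: Ms sec lie_homD[OF hom]\<close>)
        then show "m (x + y) z = m x z + m y z" using that by (simp add: m_def DM sec)
        have "m z (x + y) = bracket M (sec z) (sec x + sec y)"
          by (rule m) (use that in \<open>simp_all add: Ms sec lie_homD[OF hom]\<close>)
        then show "m z (x + y) = m z x + m z y" using that by (simp add: m_def DM sec)
      qed
      have a2: "m (scale L c x) y = scale M c (m x y)" "m x (scale L c y) = scale M c (m x y)"
        if "x \<in> C" "y \<in> C" for x y c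
      proof -
        have "m (scale L c x) y = bracket M (scale M c (sec x)) (sec y)"
          by (rule m) (use that in \<open>simp_all add: Ms sec lie_homD[OF hom]\<close>)
        then show "m (scale L c x) y = scale M c (m x y)" using that by (simp add: m_def DM sec)
        have "m x (scale L c y) = bracket M (sec x) (scale M c (sec y))"
          by (rule m) (use that in \<open>simp_all add: Ms sec lie_homD[OF hom]\<close>)
        then show "m x (scale L c y) = scale M c (m x y)" using that by (simp add: m_def DM sec)
      qed
      have a3: "m x (bracket L y z) = bracket M (sec x) (bracket M (sec y) (sec z))"
        if "x \<in> C" "y \<in> C" "z \<in> C" for x y z
        by (rule m) (use that in \<open>simp_all add: sec DM lie_homD[OF hom]\<close>)
      have a4: "m x x = 0" if "x \<in> C" for x using that by (simp add: m_def sec DM)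
      show ?thesis using that unfolding Rel_def
        by (auto simp: f.diff f.add f.scale fd a1 a2 a3 a4 DM sec)
    qed
    have fK: "f v = 0" if "v \<in> K" for v
    proof -
      have "K \<subseteq> {v. f v = 0}" unfolding K_def
        by (rule V.span_minimal) (auto simp: Rel_fK f.subspace_kernel)
      then show ?thesis using that by auto
    qed
    have fpi: "f (pi v) = f v" for v by (simp add: pi_def f.diff fK g)
    have fF: "f v \<in> carrier M \<and> q (f v) = P v" if "v \<in> F" for v
    proof -
      have "V.subspace {v. f v \<in> carrier M \<and> q (f v) = P v}"
        unfolding V.subspace_def using DM(2) lie_hom_image_zero[OF M hom]
        by (auto simp: f.zero P.zero f.add P.add f.scale P.scale Ms M.subspace_0 lie_homD[OF hom])
      then have "F \<subseteq> {v. f v \<in> carrier M \<and> q (f v) = P v}"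
        unfolding F_def by (rule V.span_minimal[rotated]) (auto simp: fd Pd qm mC)
      then show ?thesis using that by auto
    qed
    have fE: "f v \<in> carrier M" "q (f v) = P v" if "v \<in> carrier E" for v
      using that fF fpi Ppi by (auto simp: E_def)
    have f_hom: "lie_hom E M f"
      unfolding lie_hom_def vlinear_def
    proof (intro conjI ballI allI)
      fix x y assume xy: "x \<in> carrier E" "y \<in> carrier E"
      have "f (bracket E x y) = m (P x) (P y)" by (simp add: E_def t_def fpi fd)
      also have "\<dots> = bracket M (f x) (f y)" by (rule m) (use fE xy in auto)
      finally show "f (bracket E x y) = bracket M (f x) (f y)" .
    qed (use fE in \<open>auto simp: E_def f.add f.scale\<close>)
    have uniq: "g' x = f x"
      if g': "lie_hom E M g'" "\<And>x. x \<in> carrier E \<Longrightarrow> q (g' x) = P x" and x: "x \<in> carrier E" for g' x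
    proof -
      have piFE: "pi y \<in> carrier E" if "y \<in> F" for y using that by (simp add: E_def)
      have scE: "scale E = s" by (simp add: E_def)
      note gg = lie_homD[OF g'(1)]
      have "V.subspace {v \<in> F. g' (pi v) = f (pi v)}"
        unfolding V.subspace_def
        using lie_hom_image_zero[OF LE g'(1)] Fsub gg piFE
        by (auto simp: pi.zero f.zero pi.add f.add pi.scale f.scale V.subspace_add V.subspace_scale
            V.subspace_0 scE)
      \<comment> \<open>Surjectivity of \<open>P\<close> turns the symbol of \<open>(a, b)\<close>
        into a bracket of \<open>E\<close>. On brackets two lifts agree, because brackets of
        \<open>M\<close> depend only on images in \<open>L\<close>.\<close>
      moreover have "d (a, b) \<in> {v \<in> F. g' (pi v) = f (pi v)}" if ab: "a \<in> C" "b \<in> C" for a b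
      proof -
        have "a \<in> P ` carrier E" "b \<in> P ` carrier E" using ab by (simp_all only: sur C_def)
        then obtain a' b' where *: "a' \<in> carrier E" "b' \<in> carrier E" "P a' = a" "P b' = b"
          by (elim imageE) simp
        have "pi (d (a, b)) = bracket E a' b'" using * by (simp add: E_def t_def)
        moreover have "g' (bracket E a' b') = f (bracket E a' b')"
          using gg(4)[OF *(1,2)] lie_homD(4)[OF f_hom *(1,2)]
            central_extension_bracket_eq[OF ext, of "g' a'" "g' b'" "f a'" "f b'"] * fE g' gg(1)
          by simp
        ultimately show ?thesis using ab by (auto simp: F_def intro: V.span_base)
      qed
      ultimately have "F \<subseteq> {v \<in> F. g' (pi v) = f (pi v)}"
        unfolding F_def by (intro V.span_minimal) (auto simp: F_def)
      then show ?thesis using x by (auto simp: E_def)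
    qed
    show ?thesis unfolding unique_lift_def using f_hom fE uniq by blast
  qed
  then show ?thesis using extE unfolding universal_central_extension_def by blast
qed

section \<open>Central isogeny\<close>

lemma lie_algebra_zero:
  assumes "lie_algebra L"
  shows "0 \<in> carrier L" "\<And>x. x \<in> carrier L \<Longrightarrow> bracket L x 0 = 0"
    "\<And>x. x \<in> carrier L \<Longrightarrow> bracket L 0 x = 0"
proof -
  note D = lie_algebraD[OF assms]
  interpret vector_space "scale L" using D(1) .
  show 0: "0 \<in> carrier L" using D(2) by (rule subspace_0)
  show "bracket L x 0 = 0" "bracket L 0 x = 0" if "x \<in> carrier L" for x
    using D(4)[OF that 0 0] D(5)[OF 0 0 that] by simp_all
qed

lemma perfect_induct:
  assumes E: "lie_algebra E" "perfect E" and S: "module.subspace (scale E) S"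
    and br: "\<And>x y. x \<in> carrier E \<Longrightarrow> y \<in> carrier E \<Longrightarrow> bracket E x y \<in> S"
    and x: "x \<in> carrier E"
  shows "x \<in> S"
proof -
  have "bracket_span E (carrier E) (carrier E) \<subseteq> S"
    unfolding bracket_span_def using E S br by (intro vspan_subset_induct lie_algebraD(1)) auto
  then show ?thesis using E(2) x by (auto simp: perfect_def)
qed

text \<open>Two homomorphisms with the same images in \<open>L\<close> differ by central elements,
  so they agree on brackets, and brackets span the perfect algebra \<open>E\<close>.\<close>

lemma central_extension_hom_unique:
  assumes E: "lie_algebra E" "perfect E" and M: "central_extension M L q"
    and f: "lie_hom E M f" and g: "lie_hom E M g"
    and eq: "\<And>x. x \<in> carrier E \<Longrightarrow> q (f x) = q (g x)" and x: "x \<in> carrier E"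
  shows "f x = g x"
proof -
  interpret E: vector_space "scale E" using lie_algebraD[OF E(1)] by simp
  note fD = lie_homD[OF f] and gD = lie_homD[OF g]
  have "x \<in> {x \<in> carrier E. f x = g x}"
  proof (rule perfect_induct[OF E _ _ x])
    show "E.subspace {x \<in> carrier E. f x = g x}"
      unfolding E.subspace_def using lie_algebraD(2)[OF E(1)]
      by (simp add: E.subspace_def fD gD lie_hom_image_zero[OF E(1) f] lie_hom_image_zero[OF E(1) g])
    fix x y assume xy: "x \<in> carrier E" "y \<in> carrier E"
    have "bracket M (f x) (f y) = bracket M (g x) (g y)"
      by (rule central_extension_bracket_eq[OF M]) (use xy fD gD eq in auto)
    then show "bracket E x y \<in> {x \<in> carrier E. f x = g x}"
      using xy lie_algebraD(3)[OF E(1)] by (simp add: fD gD)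
  qed
  then show ?thesis by simp
qed

lemma lie_hom_comp: "lie_hom E M f \<Longrightarrow> lie_hom M N g \<Longrightarrow> lie_hom E N (\<lambda>x. g (f x))"
  by (simp add: lie_hom_def vlinear_def)

lemma central_extension_perfect:
  assumes "central_extension P L f" "perfect P"
  shows "perfect L"
proof -
  have P: "lie_algebra P" and L: "lie_algebra L" and f: "lie_hom P L f" and s: "f ` carrier P = carrier L"
    using assms by (auto simp: central_extension_def)
  interpret L: vector_space "scale L" using lie_algebraD[OF L] by simp
  interpret P: vector_space "scale P" using lie_algebraD[OF P] by simp
  let ?B = "bracket_span L (carrier L) (carrier L)"
  have "carrier L \<subseteq> ?B"
  proof (rule subsetI)
    fix y assume "y \<in> carrier L"
    then obtain x where x: "x \<in> carrier P" "y = f x" using s by auto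
    have "x \<in> {x \<in> carrier P. f x \<in> ?B}"
    proof (rule perfect_induct[OF P assms(2) _ _ x(1)])
      show "P.subspace {x \<in> carrier P. f x \<in> ?B}"
        unfolding P.subspace_def bracket_span_def vspan_def
        using lie_algebraD(2)[OF P] lie_hom_image_zero[OF P f]
        by (auto simp: P.subspace_def lie_homD[OF f] L.span_zero intro: L.span_add L.span_scale)
      fix x y assume "x \<in> carrier P" "y \<in> carrier P"
      then show "bracket P x y \<in> {x \<in> carrier P. f x \<in> ?B}"
        using lie_algebraD(3)[OF P] lie_homD[OF f]
        unfolding bracket_span_def vspan_def by (auto intro!: L.span_base) blast
    qed
    then show "y \<in> ?B" using x by simp
  qed
  moreover have "?B \<subseteq> carrier L"
    unfolding bracket_span_def using lie_algebraD[OF L] by (intro vspan_subset_induct) auto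
  ultimately show ?thesis by (simp add: perfect_def)
qed

text \<open>If the composite kills \<open>z\<close>, then \<open>p\<close> kills every bracket
  \<open>[z, a]\<close>, so these are central. The Jacobi identity then gives
  \<open>[z, [a, b]] = 0\<close>, and the elements \<open>[a, b]\<close> span the perfect algebra
  \<open>M\<close>.\<close>

lemma central_extension_comp:
  assumes MP: "central_extension M P p" and PL: "central_extension P L q" and perf: "perfect M"
  shows "central_extension M L (\<lambda>x. q (p x))"
proof -
  have M: "lie_algebra M" and P: "lie_algebra P" and L: "lie_algebra L" and p: "lie_hom M P p"
    and q: "lie_hom P L q"
    and sp: "p ` carrier M = carrier P" and sq: "q ` carrier P = carrier L"
    and cp: "\<And>z x. z \<in> carrier M \<Longrightarrow> p z = 0 \<Longrightarrow> x \<in> carrier M \<Longrightarrow> bracket M z x = 0"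
    and cq: "\<And>z x. z \<in> carrier P \<Longrightarrow> q z = 0 \<Longrightarrow> x \<in> carrier P \<Longrightarrow> bracket P z x = 0"
    using MP PL by (auto simp: central_extension_def)
  note MD = lie_algebraD[OF M] lie_algebra_bracketD[OF M] and pD = lie_homD[OF p]
  interpret M: vector_space "scale M" using MD(1) .
  have "bracket M z x = 0" if z: "z \<in> carrier M" "q (p z) = 0" and x: "x \<in> carrier M" for z x
  proof -
    have zc: "bracket M (bracket M z a) b = 0" "bracket M b (bracket M z a) = 0"
      if "a \<in> carrier M" "b \<in> carrier M" for a b
    proof -
      have 0: "p (bracket M z a) = 0" using that z pD cq[of "p z" "p a"] by simp
      then show "bracket M (bracket M z a) b = 0" using cp that z MD by blast
      have "bracket M b (bracket M z a) = bracket M b 0"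
        by (rule central_extension_bracket_eq[OF MP])
          (use that z MD 0 lie_hom_image_zero[OF M p] in \<open>auto simp: M.subspace_0\<close>)
      then show "bracket M b (bracket M z a) = 0"
        using MD(4)[of b 0 0] that MD(2) by (simp add: M.subspace_0)
    qed
    have "x \<in> {x \<in> carrier M. bracket M z x = 0}"
    proof (rule perfect_induct[OF M perf _ _ x])
      show "M.subspace {x \<in> carrier M. bracket M z x = 0}"
        unfolding M.subspace_def using MD(2) MD(4)[of z 0 0] z(1)
        by (auto simp: MD M.subspace_def)
      fix a b assume ab: "a \<in> carrier M" "b \<in> carrier M"
      have "bracket M z (bracket M a b) = 0"
      proof -
        have "bracket M a (bracket M b z) = 0"
        proof -
          have "bracket M b z \<in> carrier M" using ab z MD by simp
          moreover have "p (bracket M b z) = 0"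
          proof -
            have "bracket P (p b) (p z) = bracket P (p b) 0"
              by (rule central_extension_bracket_eq[OF PL])
                (use ab z pD lie_hom_image_zero[OF P q] lie_algebra_zero[OF P] in auto)
            also have "\<dots> = 0" using ab pD by (simp add: lie_algebra_zero[OF P])
            finally show ?thesis using ab z pD by simp
          qed
          ultimately have "bracket M a (bracket M b z) = bracket M a 0"
            by (intro central_extension_bracket_eq[OF MP])
              (use ab MD lie_hom_image_zero[OF M p] in \<open>auto simp: M.subspace_0\<close>)
          then show ?thesis using MD(4)[of a 0 0] ab MD(2) by (simp add: M.subspace_0)
        qed
        moreover have "bracket M b (bracket M z a) = 0" using zc ab by simp
        ultimately show ?thesis using MD(9)[of z a b] ab z by simp
      qed
      then show "bracket M a b \<in> {x \<in> carrier M. bracket M z x = 0}" using ab MD by simp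
    qed
    then show ?thesis by simp
  qed
  then show ?thesis
    unfolding central_extension_def using M L lie_hom_comp[OF p q] sp sq
    by (auto simp: image_image[of q p, symmetric])
qed

text \<open>The lift of \<open>p\<close> through \<open>f\<close> is onto because a bracket of
  \<open>P\<close> depends only on images in \<open>L\<close>, and these can be lifted to
  \<open>E\<close>. Its kernel lies in the kernel of \<open>p\<close>, which is central.\<close>

lemma universal_central_extension_lift:
  assumes E: "universal_central_extension E L p" and PL: "central_extension P L f" and perf: "perfect P"
  obtains h where "central_extension E P h" "\<And>x. x \<in> carrier E \<Longrightarrow> f (h x) = p x"
proof -
  have pL: "perfect L" by (rule central_extension_perfect[OF PL perf])
  have ext: "central_extension E L p" using E by (simp add: universal_central_extension_def)
  obtain h where h: "lie_hom E P h" "\<And>x. x \<in> carrier E \<Longrightarrow> f (h x) = p x"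
    using universal_central_extension_any_type[OF E pL PL] by (auto simp: unique_lift_def)
  have LE: "lie_algebra E" and P: "lie_algebra P" and sp: "p ` carrier E = carrier L"
    and sf: "f ` carrier P = carrier L"
    and c: "\<And>z x. z \<in> carrier E \<Longrightarrow> p z = 0 \<Longrightarrow> x \<in> carrier E \<Longrightarrow> bracket E z x = 0"
    and f: "lie_hom P L f"
    using ext PL by (auto simp: central_extension_def)
  have hD: "h x \<in> carrier P" if "x \<in> carrier E" for x using lie_homD(1)[OF h(1)] that .
  have "carrier P \<subseteq> h ` carrier E"
  proof
    fix x assume "x \<in> carrier P"
    then show "x \<in> h ` carrier E"
    proof (rule perfect_induct[OF P perf, rotated 2])
      show "module.subspace (scale P) (h ` carrier E)"
        using lie_hom_image_subspace[OF LE P h(1)] lie_algebraD[OF LE] by blast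
      fix x y assume xy: "x \<in> carrier P" "y \<in> carrier P"
      have "f x \<in> p ` carrier E" "f y \<in> p ` carrier E" using xy sp sf by auto
      then obtain a b where ab: "a \<in> carrier E" "b \<in> carrier E" "f x = p a" "f y = p b" by auto
      have "bracket P x y = bracket P (h a) (h b)"
        by (rule central_extension_bracket_eq[OF PL]) (use xy ab h(2) hD in auto)
      also have "\<dots> = h (bracket E a b)" using ab by (simp add: lie_homD[OF h(1)])
      finally show "bracket P x y \<in> h ` carrier E" using ab lie_algebraD(3)[OF LE] by simp
    qed
  qed
  moreover have "bracket E z x = 0" if "z \<in> carrier E" "h z = 0" "x \<in> carrier E" for z x
  proof (rule c)
    have "f 0 = 0" by (rule lie_hom_image_zero[OF P f])
    then show "p z = 0" using h(2)[of z] that by simp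
  qed (use that in auto)
  ultimately have "central_extension E P h"
    unfolding central_extension_def using LE P h(1) hD by blast
  then show ?thesis using h(2) that by blast
qed

text \<open>Both universal central extensions are universal over \<open>P\<close>.\<close>

lemma centrally_isogenous_via:
  fixes P :: "('f::field_char_0, 'p::ab_group_add) lie" and L :: "('f, 'l::ab_group_add) lie"
    and M :: "('f, 'm::ab_group_add) lie"
  assumes perf: "perfect P" and PL: "central_extension P L f" and PM: "central_extension P M g"
  shows "centrally_isogenous L M"
proof -
  have pL: "perfect L" and pM: "perfect M" using perf PL PM central_extension_perfect by blast+
  have P: "lie_algebra P" and L: "lie_algebra L" and M: "lie_algebra M" using PL PM by (auto simp: central_extension_def)
  obtain E p where E: "universal_central_extension E L p"
    using universal_central_extension_exists[OF L pL] by blast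
  obtain E' p' where E': "universal_central_extension E' M p'"
    using universal_central_extension_exists[OF M pM] by blast
  obtain h where h: "central_extension E P h" "\<And>x. x \<in> carrier E \<Longrightarrow> f (h x) = p x"
    using universal_central_extension_lift[OF E PL perf] by blast
  obtain h' where h': "central_extension E' P h'" "\<And>x. x \<in> carrier E' \<Longrightarrow> g (h' x) = p' x"
    using universal_central_extension_lift[OF E' PM perf] by blast
  have pE: "perfect E" "perfect E'" using universal_central_extension_perfect E E' pL pM by blast+
  have LE: "lie_algebra E" "lie_algebra E'" and hh: "lie_hom E P h" "lie_hom E' P h'"
    using h h' by (auto simp: central_extension_def)
  note e1 = central_extension_comp[OF h'(1) PL pE(2)] and e2 = central_extension_comp[OF h(1) PM pE(1)]
  obtain a where a: "lie_hom E E' a" "\<And>x. x \<in> carrier E \<Longrightarrow> f (h' (a x)) = p x"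
    using universal_central_extension_any_type[OF E pL e1] by (auto simp: unique_lift_def)
  obtain b where b: "lie_hom E' E b" "\<And>x. x \<in> carrier E' \<Longrightarrow> g (h (b x)) = p' x"
    using universal_central_extension_any_type[OF E' pM e2] by (auto simp: unique_lift_def)
  have ha: "h' (a x) = h x" if "x \<in> carrier E" for x
    by (rule central_extension_hom_unique[OF LE(1) pE(1) PL lie_hom_comp[OF a(1) hh(2)] hh(1) _ that])
      (simp add: a h)
  have hb: "h (b x) = h' x" if "x \<in> carrier E'" for x
    by (rule central_extension_hom_unique[OF LE(2) pE(2) PM lie_hom_comp[OF b(1) hh(1)] hh(2) _ that])
      (simp add: b h')
  have idh: "lie_hom E E (\<lambda>x. x)" "lie_hom E' E' (\<lambda>x. x)" by (simp_all add: lie_hom_def vlinear_def)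
  note aD = lie_homD(1)[OF a(1)] and bD = lie_homD(1)[OF b(1)]
  have ba: "b (a x) = x" if "x \<in> carrier E" for x
    by (rule central_extension_hom_unique[OF LE(1) pE(1) h(1) lie_hom_comp[OF a(1) b(1)] idh(1) _ that])
      (simp add: ha hb aD)
  have ab: "a (b x) = x" if "x \<in> carrier E'" for x
    by (rule central_extension_hom_unique[OF LE(2) pE(2) h'(1) lie_hom_comp[OF b(1) a(1)] idh(2) _ that])
      (simp add: ha hb bD)
  have "bij_betw a (carrier E) (carrier E')"
    by (rule bij_betw_byWitness[of _ b]) (use aD bD ba ab in auto)
  then have "lie_isomorphic E E'" using a(1) by (auto simp: lie_isomorphic_def)
  then show ?thesis using E E' pL pM by (auto simp: centrally_isogenous_def)
qed

text \<open>An isomorphism is a central extension with zero kernel, so one of the two universal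
  central extensions can be made to cover both algebras.\<close>

lemma centrally_isogenous_common_extension:
  fixes L :: "('f::field, 'l::ab_group_add) lie" and M :: "('f, 'm::ab_group_add) lie"
  assumes "centrally_isogenous L M"
  obtains E :: "('f, 'l \<times> 'l \<Rightarrow> 'f) lie" and p q where "perfect E" "central_extension E L p" "central_extension E M q"
proof -
  obtain E p E' p' f where *: "perfect L" "perfect M" "universal_central_extension E L p"
    "universal_central_extension E' M p'" "lie_hom E E' f" "bij_betw f (carrier E) (carrier E')"
    using assms by (auto simp: centrally_isogenous_def lie_isomorphic_def)
  have E: "perfect E" "central_extension E L p" "central_extension E' M p'"
    using * universal_central_extension_perfect by (auto simp: universal_central_extension_def)
  have L: "lie_algebra E" "lie_algebra E'" using E by (auto simp: central_extension_def)
  have inj: "inj_on f (carrier E)" and sf: "f ` carrier E = carrier E'" using *(6) by (auto simp: bij_betw_def)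
  have "central_extension E E' f"
    unfolding central_extension_def
  proof (intro conjI ballI impI)
    fix z x assume z: "z \<in> carrier E" "f z = 0" and x: "x \<in> carrier E"
    have 0: "0 \<in> carrier E" by (rule lie_algebra_zero[OF L(1)])
    then have "z = 0" using inj z lie_hom_image_zero[OF L(1) *(5)] by (auto simp: inj_on_def)
    then show "bracket E z x = 0" using lie_algebraD(5)[OF L(1) 0 0 x] by simp
  qed (use L * sf in auto)
  from that[OF E(1,2) central_extension_comp[OF this E(3) E(1)]] show ?thesis .
qed

section \<open>Integral weights\<close>

definition sgl :: "int \<Rightarrow> 'n \<Rightarrow> 'n \<Rightarrow> int" where
  "sgl s i = (\<lambda>j. if j = i then s else 0)"

definition nrm :: "('n::finite \<Rightarrow> int) \<Rightarrow> int" where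
  "nrm w = (\<Sum>i\<in>UNIV. \<bar>w i\<bar>)"

text \<open>Constant vectors give the zero functional because matrices in \<open>cartan\<close> have
  trace zero, so \<open>wt\<close> forgets constant shifts. The value 0 outside
  \<open>cartan\<close> follows the convention of \<open>eps\<close>.\<close>

definition wt :: "('n::finite \<Rightarrow> int) \<Rightarrow> 'f::field^'n^'n \<Rightarrow> 'f" where
  "wt w = (\<lambda>h. if h \<in> cartan then \<Sum>i\<in>UNIV. of_int (w i) * h $ i $ i else 0)"

lemma sgl_apply [simp]: "sgl s i i = s" "j \<noteq> i \<Longrightarrow> sgl s i j = 0"
  by (auto simp: sgl_def)

lemma sgl_add: "sgl s i + sgl t i = sgl (s + t) i" by (auto simp: sgl_def fun_eq_iff)
lemma sgl_minus: "- sgl s i = sgl (- s) i" by (auto simp: sgl_def fun_eq_iff)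
lemma sgl_zero [simp]: "sgl 0 i = 0" by (auto simp: sgl_def fun_eq_iff)

lemma wt_add: "wt (v + w) = wt v + wt w"
  by (auto simp: wt_def fun_eq_iff algebra_simps sum.distrib)
lemma wt_minus: "wt (- w) = - wt w"
  by (auto simp: wt_def fun_eq_iff sum_negf)
lemma wt_zero [simp]: "wt 0 = 0" by (auto simp: wt_def fun_eq_iff)
lemma wt_outside: "h \<notin> cartan \<Longrightarrow> wt w h = 0" by (simp add: wt_def)

lemma wt_sgl: "wt (sgl s i) h = (if h \<in> cartan then of_int s * h $ i $ i else 0)"
proof -
  have "(\<Sum>j\<in>UNIV. of_int (sgl s i j) * h $ j $ j) = (\<Sum>j\<in>UNIV. if j = i then of_int s * h $ i $ i else 0)"
    by (rule sum.cong) (auto simp: sgl_def)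
  then show ?thesis by (simp add: wt_def)
qed

lemma eps_wt: "eps i = wt (sgl 1 i)" "- eps i = wt (sgl (-1) i)"
  by (auto simp: eps_def wt_sgl fun_eq_iff)

lemma nrm_zero [simp]: "nrm 0 = 0" by (simp add: nrm_def)
lemma nrm_nonneg [simp]: "0 \<le> nrm w" by (simp add: nrm_def sum_nonneg)
lemma nrm_minus [simp]: "nrm (- w) = nrm w" by (simp add: nrm_def)
lemma nrm_add: "nrm (v + w) \<le> nrm v + nrm w"
  unfolding nrm_def sum.distrib[symmetric] by (rule sum_mono) (simp add: abs_triangle_ineq)
lemma nrm_sgl [simp]: "nrm (sgl s i) = \<bar>s\<bar>"
proof -
  have "(\<Sum>j\<in>UNIV. \<bar>sgl s i j\<bar>) = (\<Sum>j\<in>UNIV. if j = i then \<bar>s\<bar> else 0)"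
    by (rule sum.cong) (auto simp: sgl_def)
  then show ?thesis by (simp add: nrm_def)
qed
lemma nrm_eq_0 [simp]: "nrm w = 0 \<longleftrightarrow> w = 0"
  by (auto simp: nrm_def sum_nonneg_eq_0_iff fun_eq_iff)

lemma nrm_add_sgl: "nrm (w + sgl s i) = nrm w - \<bar>w i\<bar> + \<bar>w i + s\<bar>"
proof -
  have "nrm (w + sgl s i) - nrm w = (\<Sum>j\<in>UNIV. if j = i then \<bar>w i + s\<bar> - \<bar>w i\<bar> else 0)"
    unfolding nrm_def sum_subtractf[symmetric] by (rule sum.cong) (auto simp: sgl_def)
  then show ?thesis by simp
qed

lemma nrm_sgl2 [simp]: "i \<noteq> j \<Longrightarrow> nrm (sgl s i + sgl t j) = \<bar>s\<bar> + \<bar>t\<bar>"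
  by (simp add: nrm_add_sgl)

lemma nrm_split:
  assumes "w \<noteq> 0"
  obtains s i v where "w = v + sgl s i" "s = 1 \<or> s = -1" "nrm v = nrm w - 1"
proof -
  obtain i where i: "w i \<noteq> 0" using assms by (auto simp: fun_eq_iff)
  have "nrm (w + sgl (- sgn (w i)) i) = nrm w - 1"
    using i by (auto simp: nrm_add_sgl sgn_if)
  moreover have "w = (w + sgl (- sgn (w i)) i) + sgl (sgn (w i)) i"
    by (simp add: add.assoc sgl_add)
  ultimately show ?thesis using i by (intro that[of "w + sgl (- sgn (w i)) i" "sgn (w i)" i]) (auto simp: sgn_if)
qed

text \<open>Unit steps are split off one at a time. The third case allows \<open>i = j\<close>,
  which covers twice a unit vector; \<open>nrm w = 2\<close> excludes cancellation there.\<close>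

lemma nrm_le_2_cases:
  assumes "nrm w \<le> 2"
  obtains "w = 0" | s i where "w = sgl s i" "s = 1 \<or> s = -1"
  | s i t j where "w = sgl s i + sgl t j" "s = 1 \<or> s = -1" "t = 1 \<or> t = -1" "nrm w = 2"
proof (cases "w = 0")
  case False
  then obtain s i v where 1: "w = v + sgl s i" "s = 1 \<or> s = -1" "nrm v = nrm w - 1" using nrm_split by blast
  show ?thesis
  proof (cases "v = 0")
    case True then show ?thesis using 1 that by simp
  next
    case False
    then obtain t j u where 2: "v = u + sgl t j" "t = 1 \<or> t = -1" "nrm u = nrm v - 1" using nrm_split by blast
    then have "nrm u \<le> 0" using 1 assms by simp
    then have "nrm u = 0" using nrm_nonneg[of u] by linarith
    then have "u = 0" "nrm w = 2" using 2 1 by auto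
    then show ?thesis using 1 2 that(3)[of t j s i] by simp
  qed
qed (use that in simp)

lemma finite_nrm_le_2: "finite {w :: 'n::finite \<Rightarrow> int. nrm w \<le> 2}"
proof (rule finite_subset)
  show "{w :: 'n \<Rightarrow> int. nrm w \<le> 2} \<subseteq> {0} \<union> (\<lambda>(s, i). sgl s i) ` ({1, -1} \<times> UNIV) \<union>
     (\<lambda>(s, i, t, j). sgl s i + sgl t j) ` ({1, -1} \<times> UNIV \<times> {1, -1} \<times> UNIV)"
  proof
    fix w :: "'n \<Rightarrow> int" assume "w \<in> {w. nrm w \<le> 2}"
    then have "nrm w \<le> 2" by simp
    then show "w \<in> {0} \<union> (\<lambda>(s, i). sgl s i) ` ({1, -1} \<times> UNIV) \<union>
     (\<lambda>(s, i, t, j). sgl s i + sgl t j) ` ({1, -1} \<times> UNIV \<times> {1, -1} \<times> UNIV)"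
      by (cases rule: nrm_le_2_cases) (auto simp: image_iff)
  qed
qed simp

text \<open>The integers \<open>\<bar>a + b\<bar>\<close> and
  \<open>\<bar>a\<bar> + \<bar>b\<bar>\<close> have the same parity. Hence a cancellation in a sum
  costs at least two, which two vectors of norm at most two cannot afford if their sum is to have
  norm above two.\<close>

lemma nrm_add_parity: "even (nrm (v + w) + nrm v + nrm w)"
proof -
  have "nrm (v + w) + nrm v + nrm w = (\<Sum>i\<in>UNIV. \<bar>v i + w i\<bar> + \<bar>v i\<bar> + \<bar>w i\<bar>)"
    by (simp add: nrm_def sum.distrib)
  also have "even \<dots>" by (rule dvd_sum) presburger
  finally show ?thesis .
qed

definition cartan_elt :: "'n::finite \<Rightarrow> 'n \<Rightarrow> 'f::field^'n^'n" where
  "cartan_elt i j = (\<chi> a b. if a = b then (if a = i then 1 else if a = j then -1 else 0) else 0)"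

lemma cartan_elt_in: "i \<noteq> j \<Longrightarrow> (cartan_elt i j :: 'b::field^'n::finite^'n) \<in> cartan"
proof -
  assume ij: "i \<noteq> j"
  have "(\<Sum>a\<in>UNIV. if a = i then 1 else if a = j then -1 else 0 :: 'b) =
    (\<Sum>a\<in>UNIV. (if a = i then 1 else 0) + (if a = j then -1 else 0))"
    using ij by (intro sum.cong) auto
  also have "\<dots> = 0" by (simp add: sum.distrib)
  finally show ?thesis by (simp add: cartan_def sl_def trace_def cartan_elt_def)
qed

lemma wt_cartan_elt:
  assumes "i \<noteq> j"
  shows "wt w (cartan_elt i j :: 'b::field^'n::finite^'n) = of_int (w i) - of_int (w j)"
proof -
  have "(\<Sum>a\<in>UNIV. of_int (w a) * (if a = i then 1 else if a = j then -1 else 0 :: 'b)) =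
    (\<Sum>a\<in>UNIV. (if a = i then of_int (w i) else 0) + (if a = j then - of_int (w j) else 0))"
    using assms by (intro sum.cong) auto
  also have "\<dots> = of_int (w i) - of_int (w j)" by (simp add: sum.distrib)
  finally show ?thesis by (simp add: wt_def cartan_elt_in[OF assms]) (simp add: cartan_elt_def)
qed

text \<open>The diagonal matrices with entries 1 and -1 at two places detect the differences of
  coordinates, and characteristic zero recovers these as integers.\<close>

lemma wt_eq_const:
  assumes "wt v = (wt w :: 'f::field_char_0^'n::finite^'n \<Rightarrow> 'f)"
  obtains c where "v = w + (\<lambda>_. c)"
proof -
  have "v i - w i = v j - w j" for i j
  proof (cases "i = j")
    case False
    have "wt v (cartan_elt i j :: 'f^'n^'n) = wt w (cartan_elt i j)" using assms by simp
    then have "of_int (v i - v j) = (of_int (w i - w j) :: 'f)" using False by (simp add: wt_cartan_elt)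
    then show ?thesis by (simp only: of_int_eq_iff)
  qed simp
  note * = this
  define c where "c = v undefined - w undefined"
  have "v i = w i + c" for i using *[of i undefined] unfolding c_def by linarith
  then have "v = w + (\<lambda>_. c)" by (intro ext) (simp only: plus_fun_apply)
  then show ?thesis by (rule that)
qed

lemma nrm_const: "nrm (\<lambda>_ :: 'n::finite. c) = int (CARD('n)) * \<bar>c\<bar>"
  by (simp add: nrm_def)

text \<open>The constant shift between \<open>v\<close> and \<open>w\<close> has norm n times its
  absolute value, which is at least n unless the shift is zero.\<close>

lemma wt_inj:
  assumes "wt v = (wt w :: 'f::field_char_0^'n::finite^'n \<Rightarrow> 'f)" "nrm v + nrm w < int CARD('n)"
  shows "v = w"
proof -
  obtain c where c: "v = w + (\<lambda>_. c)" using wt_eq_const[OF assms(1)] .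
  have "int CARD('n) * \<bar>c\<bar> = nrm (v + - w)" unfolding c by (simp add: nrm_const[symmetric])
  also have "\<dots> < int CARD('n)" using nrm_add[of v "- w"] assms(2) by simp
  finally have "c = 0" by (cases "c = 0") (auto simp: mult_less_cancel_left2)
  then show ?thesis using c by (simp add: fun_eq_iff)
qed

lemma Theta_wt:
  assumes "2 \<le> CARD('n)"
  shows "(Theta :: ('f::field^'n::finite^'n \<Rightarrow> 'f) set) = wt ` {w. nrm w \<le> 2}"
proof
  show "(Theta :: ('f^'n^'n \<Rightarrow> 'f) set) \<subseteq> wt ` {w. nrm w \<le> 2}"
  proof
    fix \<alpha> :: "'f^'n^'n \<Rightarrow> 'f" assume "\<alpha> \<in> Theta"
    have wtI: "wt (sgl s i + sgl t j) \<in> wt ` {w. nrm w \<le> 2}" if "\<bar>s\<bar> + \<bar>t\<bar> \<le> 2" for s t and i j :: 'n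
      using nrm_add[of "sgl s i" "sgl t j"] that by auto
    have e: "eps i + eps j = wt (sgl 1 i + sgl 1 j)" "eps i - eps j = wt (sgl 1 i + sgl (-1) j)"
      "- eps i + eps j = wt (sgl (-1) i + sgl 1 j)" "- eps i - eps j = wt (sgl (-1) i + sgl (-1) j)"
      "- (eps i + eps j) = wt (sgl (-1) i + sgl (-1) j)"
      "eps i = wt (sgl 1 i + sgl 0 i)" "- eps i = wt (sgl (-1) i + sgl 0 i)"
      for i j :: 'n
      by (simp_all add: wt_add flip: eps_wt)
    have W: "eps i + eps j \<in> wt ` {w. nrm w \<le> 2}" "eps i - eps j \<in> wt ` {w. nrm w \<le> 2}"
      "- eps i + eps j \<in> wt ` {w. nrm w \<le> 2}" "- eps i - eps j \<in> wt ` {w. nrm w \<le> 2}"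
      for i j :: 'n
      unfolding e(1-4) by (rule wtI; simp)+
    have W5: "- (eps i + eps j) \<in> wt ` {w. nrm w \<le> 2}" for i j :: 'n
      unfolding e(5) by (rule wtI; simp)
    have W': "eps i \<in> wt ` {w. nrm w \<le> 2}" "- eps i \<in> wt ` {w. nrm w \<le> 2}" for i :: 'n
      by (subst e, rule wtI, simp)+
    have W0: "0 \<in> wt ` {w :: 'n \<Rightarrow> int. nrm w \<le> 2}" by (rule image_eqI[of _ _ 0]) auto
    have "Theta \<subseteq> wt ` {w :: 'n \<Rightarrow> int. nrm w \<le> 2}"
      unfolding Theta_def by (intro Un_least UN_least insert_subsetI W W5 W' W0 empty_subsetI)
    with \<open>\<alpha> \<in> Theta\<close> show "\<alpha> \<in> wt ` {w. nrm w \<le> 2}" by (rule subsetD[rotated])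
  qed
  show "wt ` {w. nrm w \<le> 2} \<subseteq> (Theta :: ('f^'n^'n \<Rightarrow> 'f) set)"
  proof clarify
    fix w :: "'n \<Rightarrow> int" assume "nrm w \<le> 2"
    then show "wt w \<in> (Theta :: ('f^'n^'n \<Rightarrow> 'f) set)"
    proof (cases rule: nrm_le_2_cases)
      case 1 then show ?thesis by (simp add: Theta_def)
    next
      case (2 s i) then show ?thesis by (auto simp: Theta_def simp flip: eps_wt)
    next
      case (3 s i t j)
      show ?thesis
      proof (cases "i = j")
        case True
        have "wt w = (0 :: 'f^'n^'n \<Rightarrow> 'f) \<or> wt w = (eps i + eps i :: 'f^'n^'n \<Rightarrow> 'f) \<or>
            wt w = (- (eps i + eps i) :: 'f^'n^'n \<Rightarrow> 'f)"
          using 3(2,3)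
        proof (elim disjE)
          assume "s = -1" "t = -1"
          then show ?thesis
            by (simp only: 3(1) True minus_add_distrib eps_wt(2) wt_add simp_thms)
        qed (simp_all add: 3(1) True wt_add eps_wt(1) sgl_add flip: wt_add)
        then show ?thesis unfolding Theta_def by blast
      next
        case False
        then have "wt w \<in> (\<Union>j\<in>-{i}. {eps i + eps j, eps i - eps j, - eps i + eps j, - eps i - eps j} :: ('f^'n^'n \<Rightarrow> 'f) set)"
          using 3 by (intro UN_I[of j]) (auto simp: wt_add eps_wt(1) wt_minus[symmetric] sgl_minus diff_conv_add_uminus simp del: add_uminus_conv_diff)
        then show ?thesis unfolding Theta_def by blast
      qed
    qed
  qed
qed

section \<open>Lie algebras containing \<open>sl\<close>\<close>

definition unit_matrix :: "'n \<Rightarrow> 'n \<Rightarrow> 'f::field^'n^'n" where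
  "unit_matrix i j = (\<chi> a b. if a = i \<and> b = j then 1 else 0)"

lemma unit_matrix_in_sl: "i \<noteq> j \<Longrightarrow> unit_matrix i j \<in> carrier sl"
  by (auto simp: sl_def unit_matrix_def trace_def intro!: sum.neutral)

lemma mult_unit_matrix: "(x ** unit_matrix i j) $ a $ b = (if b = j then x $ a $ i else 0)"
proof -
  have "(x ** unit_matrix i j) $ a $ b = (\<Sum>k\<in>UNIV. if k = i then (if b = j then x $ a $ i else 0) else 0)"
    unfolding matrix_matrix_mult_def unit_matrix_def vec_lambda_beta by (rule sum.cong) auto
  then show ?thesis by simp
qed

lemma unit_matrix_mult: "(unit_matrix i j ** x) $ a $ b = (if a = i then x $ j $ b else 0)"
proof -
  have "(unit_matrix i j ** x) $ a $ b = (\<Sum>k\<in>UNIV. if k = j then (if a = i then x $ j $ b else 0) else 0)"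
    unfolding matrix_matrix_mult_def unit_matrix_def vec_lambda_beta by (rule sum.cong) auto
  then show ?thesis by simp
qed

lemma unit_matrix_bracket:
  "bracket sl (unit_matrix i j) (unit_matrix k l) =
     (if j = k then unit_matrix i l else 0) - (if l = i then unit_matrix k j else 0)"
  by (auto simp: sl_def vec_eq_iff mult_unit_matrix) (auto simp: unit_matrix_def)

lemma unit_matrix_bracket_cartan:
  assumes "i \<noteq> j"
  shows "bracket sl (unit_matrix i j) (unit_matrix j i) = cartan_elt i j"
  using assms unfolding unit_matrix_bracket by (auto simp: vec_eq_iff unit_matrix_def cartan_elt_def)

lemma cartan_subset_sl: "cartan \<subseteq> carrier sl"
  by (auto simp: cartan_def)

lemma cartan_bracket_unit_matrix:
  assumes "h \<in> cartan"
  shows "bracket sl h (unit_matrix i j) = scale sl (h $ i $ i - h $ j $ j) (unit_matrix i j)"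
  using assms by (auto simp: sl_def vec_eq_iff mult_unit_matrix unit_matrix_mult cartan_def)
    (auto simp: unit_matrix_def)

lemma wt_root: "h \<in> cartan \<Longrightarrow> wt (sgl 1 i + sgl (-1) j) h = h $ i $ i - h $ j $ j"
  by (simp add: wt_add wt_sgl)

text \<open>Commuting with all matrix units off the diagonal forces a scalar matrix, and a scalar
  matrix of trace zero vanishes in characteristic zero. This will keep \<open>sl\<close> embedded in
  a central quotient.\<close>

lemma sl_center:
  fixes x :: "'f::field_char_0^'n::finite^'n"
  assumes x: "x \<in> carrier sl" and c: "\<And>a. a \<in> carrier sl \<Longrightarrow> bracket sl x a = 0"
  shows "x = 0"
proof -
  have eq: "x ** unit_matrix i j = unit_matrix i j ** x" if "i \<noteq> j" for i j
    using c[OF unit_matrix_in_sl[OF that]] by (simp add: sl_def)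
  have *: "(if b = j then x $ a $ i else 0) = (if a = i then x $ j $ b else 0)" if "i \<noteq> j" for i j a b
    using eq[OF that] by (metis mult_unit_matrix unit_matrix_mult)
  have diag: "x $ i $ i = x $ j $ j" for i j using *[of i j j i] by (cases "i = j") auto
  have off: "x $ a $ i = 0" if "a \<noteq> i" for a i using *[of i a a a] that by auto
  have "(\<Sum>i\<in>UNIV. x $ i $ i) = (\<Sum>i\<in>(UNIV::'n set). x $ undefined $ undefined)"
    by (rule sum.cong) (auto intro: diag)
  then have "of_nat CARD('n) * x $ undefined $ undefined = 0"
    using x by (simp add: sl_def trace_def)
  then have "x $ undefined $ undefined = 0" by simp
  then have "x $ a $ i = 0" for a i using diag[of a undefined] off[of a i] by (cases "a = i") auto
  then show ?thesis by (simp add: vec_eq_iff)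
qed


definition wsp :: "('f::field^'n^'n \<Rightarrow> 'l) \<Rightarrow> ('f, 'l::ab_group_add) lie \<Rightarrow> ('n::finite \<Rightarrow> int) \<Rightarrow> 'l set" where
  "wsp \<iota> L w = weight_space \<iota> L (wt w)"

text \<open>This form of the star conditions is uniform in n and speaks of weight spaces only, so it
  can be moved along central extensions.\<close>

definition norm_graded :: "('f::field^'n::finite^'n \<Rightarrow> 'l) \<Rightarrow> ('f, 'l::ab_group_add) lie \<Rightarrow> bool" where
  "norm_graded \<iota> L \<longleftrightarrow> (\<forall>v w x y. nrm v \<le> 2 \<and> nrm w \<le> 2 \<and> 2 < nrm (v + w) \<and> x \<in> wsp \<iota> L v \<and> y \<in> wsp \<iota> L w \<longrightarrow>
     bracket L x y = 0)"

locale sl_lie =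
  fixes L :: "('f::field_char_0, 'l::ab_group_add) lie" and br :: "'l \<Rightarrow> 'l \<Rightarrow> 'l"
    and \<iota> :: "'f^'n::finite^'n \<Rightarrow> 'l"
  assumes lieL: "lie_algebra L" and total: "total_lie_algebra (scale L) br"
    and br_eq: "\<And>x y. x \<in> carrier L \<Longrightarrow> y \<in> carrier L \<Longrightarrow> br x y = bracket L x y"
    and br_closed: "\<And>x y. br x y \<in> carrier L"
    and hom: "lie_hom sl L \<iota>"
begin

sublocale total_lie_algebra "scale L" br by (rule total)

abbreviation "Sp w \<equiv> wsp \<iota> L w"
definition "E i j = \<iota> (unit_matrix i j)"
abbreviation "W2 \<equiv> {w :: 'n \<Rightarrow> int. nrm w \<le> 2}"

lemma carrier_sub: "subspace (carrier L)" by (rule lie_algebraD(2)[OF lieL])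

lemma mem_weight: "x \<in> weight_space \<iota> L \<alpha> \<longleftrightarrow>
    x \<in> carrier L \<and> (\<forall>h\<in>cartan. br (\<iota> h) x = scale L (\<alpha> h) x)"
  using lie_homD(1)[OF hom] cartan_subset_sl by (auto simp: weight_space_def br_eq subset_iff)

lemma mem_Sp: "x \<in> Sp w \<longleftrightarrow> x \<in> carrier L \<and> (\<forall>h\<in>cartan. br (\<iota> h) x = scale L (wt w h) x)"
  by (simp add: wsp_def mem_weight)

lemma Sp_carrier: "x \<in> Sp w \<Longrightarrow> x \<in> carrier L" by (simp add: mem_Sp)

lemma weight_sub: "subspace (weight_space \<iota> L \<alpha>)"
  using carrier_sub unfolding subspace_def
  by (auto simp: mem_weight br_add_right br_scale_right scale_right_distrib scale_left_commute)

lemma Sp_sub: "subspace (Sp w)" unfolding wsp_def by (rule weight_sub)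

lemma weight_br:
  "x \<in> weight_space \<iota> L \<alpha> \<Longrightarrow> y \<in> weight_space \<iota> L \<beta> \<Longrightarrow> br x y \<in> weight_space \<iota> L (\<alpha> + \<beta>)"
  by (auto simp: mem_weight br_closed br_jacobi[of "\<iota> _" x y] br_scale_left br_scale_right scale_left_distrib)

lemma Sp_br: "x \<in> Sp v \<Longrightarrow> y \<in> Sp w \<Longrightarrow> br x y \<in> Sp (v + w)"
  unfolding wsp_def wt_add by (rule weight_br)

lemma E_Sp: "i \<noteq> j \<Longrightarrow> E i j \<in> Sp (sgl 1 i + sgl (-1) j)"
proof -
  assume ij: "i \<noteq> j"
  have E: "E i j \<in> carrier L" using lie_homD(1)[OF hom unit_matrix_in_sl[OF ij]] by (simp add: E_def)
  show ?thesis unfolding mem_Sp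
  proof (intro conjI ballI)
    fix h :: "'f^'n^'n" assume h: "h \<in> cartan"
    then have hs: "h \<in> carrier sl" using cartan_subset_sl by auto
    have "br (\<iota> h) (E i j) = bracket L (\<iota> h) (\<iota> (unit_matrix i j))"
      unfolding E_def by (intro br_eq lie_homD(1)[OF hom] hs unit_matrix_in_sl ij)
    also have "\<dots> = \<iota> (bracket sl h (unit_matrix i j))"
      by (intro lie_homD(4)[OF hom, symmetric] hs unit_matrix_in_sl ij)
    also have "\<dots> = scale L (wt (sgl 1 i + sgl (-1) j) h) (E i j)"
      unfolding cartan_bracket_unit_matrix[OF h] wt_root[OF h] E_def
      by (intro lie_homD(3)[OF hom] unit_matrix_in_sl ij)
    finally show "br (\<iota> h) (E i j) = scale L (wt (sgl 1 i + sgl (-1) j) h) (E i j)" .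
  qed (rule E)
qed

lemma iota_zero: "\<iota> 0 = 0"
proof -
  have "0 \<in> carrier (sl :: ('f, 'f^'n^'n) lie)" by (simp add: sl_def trace_def)
  then show ?thesis using lie_homD(2)[OF hom, of 0 0] by simp
qed

lemma iota_bracket: "x \<in> carrier sl \<Longrightarrow> y \<in> carrier sl \<Longrightarrow> \<iota> (bracket sl x y) = br (\<iota> x) (\<iota> y)"
  by (simp add: lie_homD[OF hom] br_eq)

lemma E_br:
  assumes "i \<noteq> j" "k \<noteq> l"
  shows "j = k \<Longrightarrow> i \<noteq> l \<Longrightarrow> br (E i j) (E k l) = E i l" "j \<noteq> k \<Longrightarrow> i \<noteq> l \<Longrightarrow> br (E i j) (E k l) = 0"
  using assms by (simp_all add: E_def iota_bracket[symmetric] unit_matrix_in_sl unit_matrix_bracket iota_zero)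

lemma H_act:
  assumes "i \<noteq> j" "x \<in> Sp w"
  shows "br (br (E i j) (E j i)) x = scale L (of_int (w i - w j)) x"
  using assms
  by (simp add: E_def iota_bracket[symmetric] unit_matrix_in_sl unit_matrix_bracket_cartan mem_Sp
      cartan_elt_in wt_cartan_elt)

text \<open>Eigenvectors for different weights are independent: some \<open>h\<close> separates
  \<open>\<alpha>\<close> from \<open>\<beta>\<close>, and applying \<open>h\<close> to the relation
  and subtracting \<open>\<beta> h\<close> times it removes the term of \<open>\<beta>\<close>. Such
  an \<open>h\<close> lies in \<open>cartan\<close> because all functionals involved vanish
  elsewhere.\<close>

lemma weight_indep:
  assumes "finite A" "\<And>\<alpha>. \<alpha> \<in> A \<Longrightarrow> x \<alpha> \<in> weight_space \<iota> L \<alpha>" "\<And>\<alpha> h. \<alpha> \<in> A \<Longrightarrow> h \<notin> cartan \<Longrightarrow> \<alpha> h = 0"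
    "(\<Sum>\<alpha>\<in>A. x \<alpha>) = 0" "\<alpha> \<in> A"
  shows "x \<alpha> = 0"
  using assms
proof (induction A arbitrary: x \<alpha> rule: finite_induct)
  case (insert \<beta> A)
  have *: "x \<alpha> = 0" if \<alpha>: "\<alpha> \<in> A" for \<alpha>
  proof -
    have "\<alpha> \<noteq> \<beta>" using insert.hyps \<alpha> by auto
    then obtain h where h: "\<alpha> h \<noteq> \<beta> h" by (auto simp: fun_eq_iff)
    then have hc: "h \<in> cartan" using insert.prems(2) \<alpha> by (metis insertCI)
    define y where "y \<gamma> = scale L (\<gamma> h - \<beta> h) (x \<gamma>)" for \<gamma>
    have y: "y \<gamma> = br (\<iota> h) (x \<gamma>) - scale L (\<beta> h) (x \<gamma>)" if "\<gamma> \<in> insert \<beta> A" for \<gamma>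
      using insert.prems(1)[OF that] hc by (simp add: mem_weight y_def scale_left_diff_distrib)
    have "(\<Sum>\<gamma>\<in>insert \<beta> A. y \<gamma>) = br (\<iota> h) (\<Sum>\<gamma>\<in>insert \<beta> A. x \<gamma>) - scale L (\<beta> h) (\<Sum>\<gamma>\<in>insert \<beta> A. x \<gamma>)"
      by (simp only: sum.cong[OF refl y] sum_subtractf br_sum_right scale_sum_right)
    then have "(\<Sum>\<gamma>\<in>insert \<beta> A. y \<gamma>) = 0" using insert.prems(3) by simp
    then have "(\<Sum>\<gamma>\<in>A. y \<gamma>) = 0" using insert.hyps by (simp add: y_def)
    moreover have "y \<gamma> \<in> weight_space \<iota> L \<gamma>" if "\<gamma> \<in> A" for \<gamma>
      unfolding y_def using insert.prems(1) that by (intro subspace_scale[OF weight_sub]) auto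
    ultimately have "y \<alpha> = 0" using insert.IH[of y \<alpha>] insert.prems(2) \<alpha> by auto
    then show ?thesis using h by (simp add: y_def)
  qed
  have "(\<Sum>\<gamma>\<in>A. x \<gamma>) = 0" using * by simp
  then have "x \<beta> = 0" using insert by simp
  then show ?case using * insert.prems(4) by auto
qed simp

lemma span_weight_decomposition:
  assumes "x \<in> span (\<Union>w\<in>W2. N w)"
  shows "\<exists>f. (\<forall>w\<in>W2. f w \<in> span (N w)) \<and> x = (\<Sum>w\<in>W2. f w)"
  using assms
proof (induction rule: span_induct_alt)
  case base
  show ?case by (intro exI[of _ "\<lambda>_. 0"]) (simp add: span_zero)
next
  case (step c x y)
  then obtain v f where v: "v \<in> W2" "x \<in> N v" and f: "\<forall>w\<in>W2. f w \<in> span (N w)" "y = (\<Sum>w\<in>W2. f w)" by blast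
  have "(\<Sum>w\<in>W2. f w + (if w = v then scale L c x else 0)) = scale L c x + y"
    using v by (simp add: sum.distrib finite_nrm_le_2 f add.commute)
  then show ?case using v f
    by (intro exI[of _ "\<lambda>w. f w + (if w = v then scale L c x else 0)"]) (auto intro: span_add span_scale span_base)
qed

end

locale sl_lie5 = sl_lie +
  constrains L :: "('f::field_char_0, 'l::ab_group_add) lie" and \<iota> :: "'f^'n::finite^'n \<Rightarrow> 'l"
  assumes card5: "5 \<le> CARD('n)"
begin

lemma wt_inj2: "v \<in> W2 \<Longrightarrow> w \<in> W2 \<Longrightarrow> wt v = (wt w :: 'f^'n^'n \<Rightarrow> 'f) \<Longrightarrow> v = w"
  using wt_inj[of v w] card5 by auto

lemma wt_inj_on: "inj_on (wt :: _ \<Rightarrow> 'f^'n^'n \<Rightarrow> 'f) W2"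
  by (rule inj_onI) (rule wt_inj2)

lemma Sp_indep:
  assumes f: "\<And>w. w \<in> W2 \<Longrightarrow> f w \<in> Sp w" and s: "(\<Sum>w\<in>W2. f w) = 0" and w: "w \<in> W2"
  shows "f w = 0"
proof -
  let ?wt = "wt :: _ \<Rightarrow> 'f^'n^'n \<Rightarrow> 'f"
  \<comment> \<open>Independence is available for families indexed by functionals. On
    \<open>W2\<close> the map \<open>wt\<close> is injective, so the family \<open>f\<close> can be
    reindexed.\<close>
  define x where "x \<alpha> = f (the_inv_into W2 ?wt \<alpha>)" for \<alpha>
  have xw: "x (wt v) = f v" if "v \<in> W2" for v
    unfolding x_def using the_inv_into_f_f[OF wt_inj_on that] by simp
  have "(\<Sum>\<alpha>\<in>?wt ` W2. x \<alpha>) = (\<Sum>w\<in>W2. x (wt w))" by (rule sum.reindex_cong[OF wt_inj_on]) auto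
  also have "\<dots> = 0" using s xw by simp
  finally have "x (wt w) = 0"
    by (intro weight_indep[of "?wt ` W2" x]) (use finite_nrm_le_2 f w in \<open>auto simp: xw wt_outside wsp_def\<close>)
  then show ?thesis using xw w by simp
qed

text \<open>Weight components are unique, so a vector of weight \<open>v\<close> equals its own
  component of weight \<open>v\<close> in any homogeneous expansion.\<close>

lemma Sp_span:
  assumes "\<And>w. N w \<subseteq> Sp w" "x \<in> span (\<Union>w\<in>W2. N w)" "x \<in> Sp v" "v \<in> W2"
  shows "x \<in> span (N v)"
proof -
  obtain f where f: "\<And>w. w \<in> W2 \<Longrightarrow> f w \<in> span (N w)" "x = (\<Sum>w\<in>W2. f w)"
    using span_weight_decomposition[OF assms(2)] by blast
  have "span (N w) \<subseteq> Sp w" for w by (rule span_minimal[OF assms(1) Sp_sub])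
  then have fS: "f w \<in> Sp w" if "w \<in> W2" for w using f that by blast
  have "(\<Sum>w\<in>W2. f w - (if w = v then x else 0)) = 0"
    using assms(4) f(2) by (simp add: sum_subtractf finite_nrm_le_2)
  then have "f v - (if v = v then x else 0) = 0"
    by (rule Sp_indep[rotated]) (use assms fS in \<open>auto intro: subspace_diff[OF Sp_sub]\<close>)
  then show ?thesis using f(1)[OF assms(4)] by simp
qed

definition "Gen w = (if w = 0 then \<Union>v\<in>W2 - {0}. {br x y | x y. x \<in> Sp v \<and> y \<in> Sp (- v)} else Sp w)"

lemma Gen_Sp: "Gen w \<subseteq> Sp w"
proof (cases "w = 0")
  case True
  have "br x y \<in> Sp 0" if "x \<in> Sp v" "y \<in> Sp (- v)" for x y v
    using Sp_br[OF that] by simp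
  then show ?thesis using True by (auto simp: Gen_def)
qed (simp add: Gen_def)

definition "generated \<longleftrightarrow> carrier L \<subseteq> span (\<Union>w\<in>W2. Gen w)"

lemma uminus_Theta: "\<alpha> \<in> Theta \<Longrightarrow> - \<alpha> \<in> (Theta :: ('f^'n^'n \<Rightarrow> 'f) set)"
  using card5 by (auto simp: Theta_wt wt_minus[symmetric])

text \<open>Uniqueness of decompositions is automatic by independence of weight spaces. What remains
  of the definition is existence of decompositions and the condition on the zero weight space, and
  together these say that the sets \<open>Gen w\<close> span.\<close>

lemma Theta_graded_iff:
  assumes inj: "inj_on \<iota> (carrier sl)"
  shows "Theta_graded \<iota> L \<longleftrightarrow> generated"
proof -
  let ?wt = "wt :: _ \<Rightarrow> 'f^'n^'n \<Rightarrow> 'f"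
  have T: "Theta = ?wt ` W2" using card5 by (intro Theta_wt) simp
  define Z where "Z = span (\<Union>\<alpha>\<in>{\<alpha> :: 'f^'n^'n \<Rightarrow> 'f. \<alpha> \<in> Theta - {0} \<and> - \<alpha> \<in> Theta - {0}}.
          bracket_span L (weight_space \<iota> L \<alpha>) (weight_space \<iota> L (- \<alpha>)))"
  have wt0: "?wt w = 0 \<longleftrightarrow> w = 0" if "w \<in> W2" for w
    using wt_inj2[of w 0] that by auto
  have bs: "bracket_span L (weight_space \<iota> L (wt w)) (weight_space \<iota> L (- wt w)) =
     span {br x y | x y. x \<in> Sp w \<and> y \<in> Sp (- w)}" for w
  proof -
    have "{bracket L x y |x y. x \<in> Sp w \<and> y \<in> Sp (- w)} = {br x y | x y. x \<in> Sp w \<and> y \<in> Sp (- w)}"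
      using br_eq Sp_carrier by (metis (no_types, lifting))
    then show ?thesis unfolding bracket_span_def vspan_def by (simp add: wt_minus[symmetric] wsp_def)
  qed
  have Zeq: "Z = span (Gen 0)"
  proof
    have 1: "bracket_span L (weight_space \<iota> L \<alpha>) (weight_space \<iota> L (- \<alpha>)) \<subseteq> span (Gen 0)"
      if \<alpha>: "\<alpha> \<in> Theta - {0}" for \<alpha> :: "'f^'n^'n \<Rightarrow> 'f"
    proof -
      have "\<alpha> \<in> ?wt ` W2" "\<alpha> \<noteq> 0" using \<alpha> by (simp_all add: T)
      then obtain w where w: "\<alpha> = wt w" "w \<in> W2" by auto
      moreover have "w \<noteq> 0" using \<open>\<alpha> \<noteq> 0\<close> w by auto
      ultimately show ?thesis unfolding w bs by (intro span_mono) (auto simp: Gen_def)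
    qed
    show "Z \<subseteq> span (Gen 0)" unfolding Z_def using 1 by (intro span_minimal) auto
    have "br x y \<in> Z" if "x \<in> Sp w" "y \<in> Sp (- w)" "w \<in> W2" "w \<noteq> 0" for x y w
    proof -
      have "br x y \<in> bracket_span L (weight_space \<iota> L (wt w)) (weight_space \<iota> L (- wt w))"
        unfolding bs using that by (intro span_base) auto
      moreover have "?wt w \<in> Theta - {0}" "- ?wt w \<in> Theta - {0}"
        using that T wt0[of w] uminus_Theta[of "wt w"] by auto
      ultimately show ?thesis unfolding Z_def by (intro span_base) blast
    qed
    then show "span (Gen 0) \<subseteq> Z" unfolding Z_def by (intro span_minimal) (auto simp: Gen_def)
  qed
  have ZSp: "Z \<subseteq> Sp 0" unfolding Zeq by (rule span_minimal[OF Gen_Sp Sp_sub])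
  show ?thesis
  proof
    assume TG: "Theta_graded \<iota> L"
    then have Z0: "weight_space \<iota> L 0 = Z" by (simp add: Theta_graded_def Z_def vspan_def)
    show generated unfolding generated_def
    proof
      fix x assume "x \<in> carrier L"
      then have "\<exists>!f. (\<forall>\<alpha>\<in>Theta. f \<alpha> \<in> weight_space \<iota> L \<alpha>) \<and> (\<forall>\<alpha>. \<alpha> \<notin> Theta \<longrightarrow> f \<alpha> = 0) \<and>
        x = (\<Sum>\<alpha>\<in>Theta. f \<alpha>)"
        using TG by (simp add: Theta_graded_def)
      then obtain f where f: "\<And>\<alpha>. \<alpha> \<in> Theta \<Longrightarrow> f \<alpha> \<in> weight_space \<iota> L \<alpha>" "x = (\<Sum>\<alpha>\<in>Theta. f \<alpha>)"
        by blast
      have "f (wt w) \<in> span (\<Union>w\<in>W2. Gen w)" if w: "w \<in> W2" for w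
      proof (cases "w = 0")
        case True
        have "(0 :: 'f^'n^'n \<Rightarrow> 'f) \<in> Theta" unfolding T by (rule image_eqI[of _ _ 0]) auto
        then have "f (wt w) \<in> span (Gen 0)" using f(1)[of 0] Z0 Zeq True by auto
        moreover have "Gen 0 \<subseteq> (\<Union>w\<in>W2. Gen w)" using w True by blast
        ultimately show ?thesis using span_mono by blast
      next
        case False
        then have "f (wt w) \<in> Gen w" using f(1)[of "wt w"] T w by (auto simp: Gen_def wsp_def)
        then show ?thesis using w by (intro span_base) auto
      qed
      then show "x \<in> span (\<Union>w\<in>W2. Gen w)" unfolding f T by (intro span_sum) auto
    qed
  next
    assume G: generated
    have dec: "\<exists>!f. (\<forall>\<alpha>\<in>Theta. f \<alpha> \<in> weight_space \<iota> L \<alpha>) \<and> (\<forall>\<alpha>. \<alpha> \<notin> Theta \<longrightarrow> f \<alpha> = 0) \<and> x = (\<Sum>\<alpha>\<in>Theta. f \<alpha>)"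
      if x: "x \<in> carrier L" for x
    proof -
      obtain f where f: "\<And>w. w \<in> W2 \<Longrightarrow> f w \<in> span (Gen w)" "x = (\<Sum>w\<in>W2. f w)"
        using span_weight_decomposition[of x Gen] G x unfolding generated_def by blast
      have fS: "f w \<in> weight_space \<iota> L (wt w)" if "w \<in> W2" for w
        using f(1)[OF that] span_minimal[OF Gen_Sp Sp_sub, of w] by (auto simp: wsp_def)
      define g where "g \<alpha> = (if \<alpha> \<in> Theta then f (the_inv_into W2 ?wt \<alpha>) else 0)" for \<alpha>
      have gw: "g (wt w) = f w" if "w \<in> W2" for w
      proof -
        have "?wt w \<in> Theta" unfolding T using that by blast
        then show ?thesis unfolding g_def using the_inv_into_f_f[OF wt_inj_on that] by simp
      qed
      have "(\<Sum>\<alpha>\<in>Theta. g \<alpha>) = (\<Sum>w\<in>W2. g (wt w))" unfolding T by (rule sum.reindex_cong[OF wt_inj_on]) auto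
      also have "\<dots> = x" using f(2) gw by simp
      finally have g: "(\<forall>\<alpha>\<in>Theta. g \<alpha> \<in> weight_space \<iota> L \<alpha>) \<and> (\<forall>\<alpha>. \<alpha> \<notin> Theta \<longrightarrow> g \<alpha> = 0) \<and> x = (\<Sum>\<alpha>\<in>Theta. g \<alpha>)"
        using fS gw unfolding T by (auto simp: g_def T)
      show ?thesis
      proof (rule ex1I[of _ g])
        fix g' assume g': "(\<forall>\<alpha>\<in>Theta. g' \<alpha> \<in> weight_space \<iota> L \<alpha>) \<and> (\<forall>\<alpha>. \<alpha> \<notin> Theta \<longrightarrow> g' \<alpha> = 0) \<and> x = (\<Sum>\<alpha>\<in>Theta. g' \<alpha>)"
        have "g' \<alpha> - g \<alpha> = 0" if "\<alpha> \<in> Theta" for \<alpha>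
        proof (rule weight_indep[of Theta])
          show "finite (Theta :: ('f^'n^'n \<Rightarrow> 'f) set)" unfolding T by (intro finite_imageI finite_nrm_le_2)
          show "(\<Sum>\<alpha>\<in>Theta. g' \<alpha> - g \<alpha>) = 0" using g g' by (simp add: sum_subtractf)
        qed (use g g' that in \<open>auto simp: T wt_outside intro!: subspace_diff[OF weight_sub]\<close>)
        then show "g' = g" using g g' by (metis (no_types) eq_iff_diff_eq_0 ext)
      qed (rule g)
    qed
    have "weight_space \<iota> L 0 = Z"
    proof
      show "Z \<subseteq> weight_space \<iota> L 0" using ZSp by (simp add: wsp_def)
      show "weight_space \<iota> L 0 \<subseteq> Z"
      proof
        fix x assume x: "x \<in> weight_space \<iota> L 0"
        have "x \<in> span (Gen 0)"
          by (rule Sp_span[where N = Gen]) (use x Gen_Sp G mem_weight in \<open>auto simp: wsp_def generated_def\<close>)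
        then show "x \<in> Z" by (simp add: Zeq)
      qed
    qed
    then show "Theta_graded \<iota> L"
      unfolding Theta_graded_def using lieL hom inj dec by (auto simp: Z_def vspan_def)
  qed
qed

end

section \<open>Induction over traceless matrices\<close>

lemma sl_induct [consumes 1, case_names add scale unit cartan]:
  fixes x :: "'f::field_char_0^'n::finite^'n"
  assumes x: "x \<in> carrier sl"
    and add: "\<And>x y. x \<in> carrier sl \<Longrightarrow> y \<in> carrier sl \<Longrightarrow> P x \<Longrightarrow> P y \<Longrightarrow> P (x + y)"
    and scale: "\<And>c x. x \<in> carrier sl \<Longrightarrow> P x \<Longrightarrow> P (scale sl c x)"
    and unit: "\<And>i j. i \<noteq> j \<Longrightarrow> P (unit_matrix i j)"
    and cartan: "\<And>h. h \<in> cartan \<Longrightarrow> P h"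
  shows "P x"
proof -
  have sl_add: "u + v \<in> carrier sl" if "u \<in> carrier sl" "v \<in> carrier sl" for u v :: "'f^'n^'n"
    using that by (simp add: sl_def trace_def sum.distrib)
  have sl_scale: "scale sl c u \<in> carrier sl" if "u \<in> carrier sl" for c and u :: "'f^'n^'n"
    using that by (simp add: sl_def trace_def flip: sum_distrib_left)
  have c0: "(0 :: 'f^'n^'n) \<in> cartan" by (simp add: cartan_def sl_def trace_def)
  have sum: "sum g A \<in> carrier sl \<and> P (sum g A)" if "\<And>a. a \<in> A \<Longrightarrow> g a \<in> carrier sl \<and> P (g a)"
    for g :: "'n \<times> 'n \<Rightarrow> _" and A
  proof -
    have "finite A" by simp
    then show ?thesis using that
    proof (induction A rule: finite_induct)
      case empty show ?case using subsetD[OF cartan_subset_sl c0] cartan[OF c0] by simp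
    next
      case (insert a A)
      then have "g a \<in> carrier sl" "P (g a)" "sum g A \<in> carrier sl" "P (sum g A)" by auto
      then show ?case unfolding sum.insert[OF insert.hyps] by (intro conjI sl_add add)
    qed
  qed
  define d :: "'f^'n^'n" where "d = (\<chi> i j. if i = j then x $ i $ j else 0)"
  have d: "d \<in> cartan" using x by (simp add: cartan_def sl_def trace_def d_def)
  define g where "g = (\<lambda>(i, j). scale sl (x $ i $ j) (unit_matrix i j))"
  define A where "A = {z :: 'n \<times> 'n. fst z \<noteq> snd z}"
  have "x = sum g A + d"
  proof (intro iffD2[OF vec_eq_iff] allI)
    fix a b
    have "sum g A $ a $ b = (\<Sum>z\<in>A. g z $ a $ b)" by simp
    also have "\<dots> = (\<Sum>z\<in>A. if z = (a, b) then x $ a $ b else 0)"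
      by (rule sum.cong) (auto simp: g_def sl_def unit_matrix_def split: if_splits)
    also have "\<dots> = (if (a, b) \<in> A then x $ a $ b else 0)" by simp
    finally show "x $ a $ b = (sum g A + d) $ a $ b" by (auto simp: d_def A_def)
  qed
  moreover have "sum g A \<in> carrier sl \<and> P (sum g A)"
    by (rule sum) (auto simp: g_def A_def intro!: sl_scale scale unit unit_matrix_in_sl)
  ultimately show ?thesis using add d cartan cartan_subset_sl by auto
qed

lemma sl_closed:
  "x \<in> carrier sl \<Longrightarrow> y \<in> carrier sl \<Longrightarrow> x + y \<in> carrier (sl :: ('f::field, 'f^'n::finite^'n) lie)"
  "x \<in> carrier sl \<Longrightarrow> scale sl c x \<in> carrier (sl :: ('f::field, 'f^'n::finite^'n) lie)"
  by (simp_all add: sl_def trace_def sum.distrib flip: sum_distrib_left)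

lemma sl_zero: "0 \<in> carrier (sl :: ('f::field, 'f^'n::finite^'n) lie)"
  by (simp add: sl_def trace_def)

lemma lie_hom_span:
  assumes E: "lie_algebra E" and L: "lie_algebra L" and p: "lie_hom E L p" and S: "S \<subseteq> carrier E"
    and x: "x \<in> module.span (scale E) S"
  shows "x \<in> carrier E \<and> p x \<in> module.span (scale L) (p ` S)"
proof -
  interpret E: vector_space "scale E" using lie_algebraD[OF E] by simp
  interpret L: vector_space "scale L" using lie_algebraD[OF L] by simp
  note D = lie_algebraD(2)[OF E] and pD = lie_homD[OF p]
  show ?thesis using x
  proof (induction rule: E.span_induct_alt)
    case base show ?case using lie_algebra_zero[OF E] lie_hom_image_zero[OF E p] by (simp add: L.span_zero)
  next
    case (step c x y)
    then have x: "x \<in> carrier E" using S by auto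
    have "scale E c x \<in> carrier E" using E.subspace_scale[OF D x] .
    then show ?case using step x E.subspace_add[OF D]
      by (auto simp: pD intro!: L.span_add L.span_scale intro: L.span_base)
  qed
qed

lemma sl_bracket_bilinear:
  fixes x y z :: "'f::field^'n::finite^'n"
  shows "bracket sl (x + y) z = bracket sl x z + bracket sl y z"
    "bracket sl x (y + z) = bracket sl x y + bracket sl x z"
    "bracket sl (scale sl c x) y = scale sl c (bracket sl x y)"
    "bracket sl x (scale sl c y) = scale sl c (bracket sl x y)"
    "bracket sl y x = scale sl (-1) (bracket sl x y)"
  by (simp_all add: sl_def vec_eq_iff matrix_matrix_mult_def algebra_simps sum.distrib sum_distrib_left)

lemma sl_bracket_closed: "bracket sl x y \<in> carrier (sl :: ('f::field, 'f^'n::finite^'n) lie)"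
  by (simp add: sl_def trace_sub trace_mul_sym[of x y])

lemma sl_lie_exists:
  fixes L :: "('f::field_char_0, 'l::ab_group_add) lie"
  assumes "lie_algebra L" "lie_hom sl L \<iota>"
  obtains br where "sl_lie L br \<iota>"
  using total_bracket_exists[OF assms(1)] assms by (auto simp: sl_lie_def)

context sl_lie5
begin

text \<open>A constant vector other than zero has norm at least n, which exceeds four. The bound
  four covers sums of two weights of norm at most two.\<close>

lemma wt_nonzero:
  assumes "w \<noteq> 0" "nrm w \<le> 4"
  obtains h :: "'f^'n^'n" where "h \<in> cartan" "wt w h \<noteq> 0"
proof -
  have "wt w \<noteq> (wt 0 :: 'f^'n^'n \<Rightarrow> 'f)" using wt_inj[of w 0] assms card5 by fastforce
  then show ?thesis using that by (auto simp: fun_eq_iff) (metis wt_outside)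
qed

end

section \<open>Transfer of gradings along central extensions\<close>

text \<open>A homomorphism respects weights, and a homogeneous vector of \<open>L\<close> lifts to
  the same weight because the images of the weight spaces of \<open>E\<close> span \<open>L\<close>.
  The map stays injective on the copy of \<open>sl\<close>, since an element of its kernel there
  would be central in \<open>sl\<close>.\<close>

lemma Theta_graded_image:
  fixes E :: "('f::field_char_0, 'e::ab_group_add) lie" and \<iota> :: "'f^'n::finite^'n \<Rightarrow> 'e"
  assumes ext: "central_extension E L p" and n: "5 \<le> CARD('n)"
    and TG: "Theta_graded \<iota> E" and NG: "norm_graded \<iota> E"
  shows "Theta_graded (\<lambda>x. p (\<iota> x)) L \<and> norm_graded (\<lambda>x. p (\<iota> x)) L"
proof -
  have LE: "lie_algebra E" and LL: "lie_algebra L" and p: "lie_hom E L p" and sur: "p ` carrier E = carrier L"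
    and cen: "\<And>z x. z \<in> carrier E \<Longrightarrow> p z = 0 \<Longrightarrow> x \<in> carrier E \<Longrightarrow> bracket E z x = 0"
    using ext by (auto simp: central_extension_def)
  have hE: "lie_hom sl E \<iota>" and injE: "inj_on \<iota> (carrier sl)" using TG by (auto simp: Theta_graded_def)
  have hL: "lie_hom sl L (\<lambda>x. p (\<iota> x))" by (rule lie_hom_comp[OF hE p])
  obtain bE where "sl_lie E bE \<iota>" using sl_lie_exists[OF LE hE] .
  then interpret E: sl_lie5 E bE \<iota> using n by (simp add: sl_lie5_def sl_lie5_axioms_def)
  obtain bL where "sl_lie L bL (\<lambda>x. p (\<iota> x))" using sl_lie_exists[OF LL hL] .
  then interpret L: sl_lie5 L bL "\<lambda>x. p (\<iota> x)" using n by (simp add: sl_lie5_def sl_lie5_axioms_def)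
  note pD = lie_homD[OF p]
  have pbr: "p (bE x y) = bL (p x) (p y)" if "x \<in> carrier E" "y \<in> carrier E" for x y
    using that by (simp add: E.br_eq L.br_eq pD)
  have ic: "\<iota> x \<in> carrier E" if "x \<in> carrier sl" for x using lie_homD(1)[OF hE that] .
  have pSp: "p x \<in> L.Sp w" if "x \<in> E.Sp w" for x w
    using that cartan_subset_sl by (auto simp: E.mem_Sp L.mem_Sp pD pbr[symmetric] ic subset_iff)
  have pGen: "p x \<in> L.Gen w" if "x \<in> E.Gen w" for x w
  proof (cases "w = 0")
    case True
    have "x \<in> (\<Union>v\<in>E.W2 - {0}. {bE x y |x y. x \<in> E.Sp v \<and> y \<in> E.Sp (- v)})"
      using that True by (simp only: E.Gen_def if_True simp_thms)
    then obtain v a b where "v \<in> E.W2 - {0}" "x = bE a b" "a \<in> E.Sp v" "b \<in> E.Sp (- v)"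
      by blast
    then have "v \<in> E.W2 - {0}" "p x = bL (p a) (p b)" "p a \<in> L.Sp v" "p b \<in> L.Sp (- v)"
      using pSp pbr E.Sp_carrier by auto
    then have "p x \<in> (\<Union>v\<in>L.W2 - {0}. {bL x y |x y. x \<in> L.Sp v \<and> y \<in> L.Sp (- v)})"
      by blast
    then show ?thesis using True by (simp only: L.Gen_def if_True simp_thms)
  qed (use that pSp in \<open>auto simp: E.Gen_def L.Gen_def\<close>)
  have GE: "E.generated" using TG E.Theta_graded_iff[OF injE] by simp
  have GenC: "(\<Union>w\<in>E.W2. E.Gen w) \<subseteq> carrier E" using E.Gen_Sp E.Sp_carrier by blast
  have GL: "L.generated"
    unfolding L.generated_def
  proof
    fix y assume "y \<in> carrier L"
    then obtain x where x: "x \<in> carrier E" "y = p x" using sur by auto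
    have "p x \<in> L.span (p ` (\<Union>w\<in>E.W2. E.Gen w))"
      using lie_hom_span[OF LE LL p GenC] GE x by (auto simp: E.generated_def)
    moreover have "p ` (\<Union>w\<in>E.W2. E.Gen w) \<subseteq> (\<Union>w\<in>L.W2. L.Gen w)" using pGen by blast
    ultimately show "y \<in> L.span (\<Union>w\<in>L.W2. L.Gen w)" using L.span_mono x by blast
  qed
  have inj: "inj_on (\<lambda>x. p (\<iota> x)) (carrier sl)"
  proof (rule inj_onI)
    fix x y :: "'f^'n^'n" assume xy: "x \<in> carrier sl" "y \<in> carrier sl" "p (\<iota> x) = p (\<iota> y)"
    define z where "z = x + scale sl (-1) y"
    have z: "z \<in> carrier sl" unfolding z_def by (intro sl_closed xy)
    have "\<iota> z = \<iota> x - \<iota> y"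
      unfolding z_def using xy by (simp add: lie_homD[OF hE] sl_closed)
    then have pz: "p (\<iota> z) = 0" using xy lie_hom_diff(2)[OF LE p] ic by simp
    have "bracket sl z a = 0" if a: "a \<in> carrier sl" for a
    proof -
      have "\<iota> (bracket sl z a) = 0" using cen[OF ic[OF z] pz ic[OF a]] z a by (simp add: lie_homD[OF hE])
      then show ?thesis
        using inj_onD[OF injE, of "bracket sl z a" 0] sl_bracket_closed[of z a] E.iota_zero sl_zero by simp
    qed
    then have "z = 0" by (rule sl_center[OF z])
    then show "x = y" by (simp add: z_def sl_def vec_eq_iff)
  qed
  have Sp_lift: "\<exists>x'\<in>E.Sp w. x = p x'" if x: "x \<in> L.Sp w" and w: "w \<in> L.W2" for x w
  proof -
    have "x \<in> L.span (p ` E.Sp w)"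
    proof (rule L.Sp_span[where N = "\<lambda>w. p ` E.Sp w", OF _ _ x w])
      show "p ` E.Sp w \<subseteq> L.Sp w" for w using pSp by blast
      obtain x' where x': "x' \<in> carrier E" "x = p x'" using sur L.Sp_carrier[OF x] by auto
      have "p x' \<in> L.span (p ` (\<Union>w\<in>E.W2. E.Gen w))"
        using lie_hom_span[OF LE LL p GenC] GE x' by (auto simp: E.generated_def)
      moreover have "p ` (\<Union>w\<in>E.W2. E.Gen w) \<subseteq> (\<Union>w\<in>L.W2. p ` E.Sp w)" using E.Gen_Sp by blast
      ultimately show "x \<in> L.span (\<Union>w\<in>L.W2. p ` E.Sp w)" using L.span_mono x' by blast
    qed
    moreover have "L.subspace (p ` E.Sp w)"
      by (rule lie_hom_image_subspace[OF LE LL p _ E.Sp_sub]) (use E.Sp_carrier in blast)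
    ultimately show ?thesis by (auto simp: L.span_eq_iff[THEN iffD2])
  qed
  have "norm_graded (\<lambda>x. p (\<iota> x)) L"
    unfolding norm_graded_def
  proof (intro allI impI, elim conjE)
    fix v w :: "'n \<Rightarrow> int" and x y
    assume *: "nrm v \<le> 2" "nrm w \<le> 2" "2 < nrm (v + w)" "x \<in> L.Sp v" "y \<in> L.Sp w"
    obtain x' y' where xy: "x' \<in> E.Sp v" "x = p x'" "y' \<in> E.Sp w" "y = p y'" using Sp_lift * by blast
    have "bracket E x' y' = 0" using NG * xy unfolding norm_graded_def by blast
    then show "bracket L x y = 0" unfolding xy
      using pD(4)[OF E.Sp_carrier E.Sp_carrier, OF xy(1,3)] lie_hom_image_zero[OF LE p] by simp
  qed
  then show ?thesis using L.Theta_graded_iff[OF inj] GL by simp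
qed

lemma sl_sum_closed:
  fixes P :: "'f::field^'n::finite^'n \<Rightarrow> bool"
  assumes "\<And>x y. x \<in> carrier sl \<Longrightarrow> y \<in> carrier sl \<Longrightarrow> P x \<Longrightarrow> P y \<Longrightarrow> P (x + y)" "P 0"
    "finite A" "\<And>a. a \<in> A \<Longrightarrow> g a \<in> carrier sl \<and> P (g a)"
  shows "sum g A \<in> carrier sl \<and> P (sum g A)"
  using assms(3,4)
proof (induction A rule: finite_induct)
  case empty show ?case using assms(2) sl_zero by simp
next
  case (insert a A)
  then have "g a \<in> carrier sl" "P (g a)" "sum g A \<in> carrier sl" "P (sum g A)" by auto
  then show ?case unfolding sum.insert[OF insert.hyps] by (intro conjI sl_closed assms(1))
qed

text \<open>Trace zero fixes the entry at the reference index \<open>k\<close> as minus the sum of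
  the others.\<close>

lemma cartan_decomposition:
  fixes h :: "'f::field^'n::finite^'n"
  assumes "h \<in> cartan"
  shows "h = (\<Sum>i\<in>UNIV - {k}. scale sl (h $ i $ i) (cartan_elt i k))"
proof (intro iffD2[OF vec_eq_iff] allI)
  fix a b
  have tr: "h $ k $ k = - (\<Sum>i\<in>UNIV - {k}. h $ i $ i)"
    using assms sum.remove[of UNIV k "\<lambda>i. h $ i $ i"] by (simp add: cartan_def sl_def trace_def eq_neg_iff_add_eq_0)
  have "(\<Sum>i\<in>UNIV - {k}. scale sl (h $ i $ i) (cartan_elt i k)) $ a $ b =
      (\<Sum>i\<in>UNIV - {k}. scale sl (h $ i $ i) (cartan_elt i k) $ a $ b)" by simp
  also have "\<dots> = (\<Sum>i\<in>UNIV - {k}. if a = b then (if a = k then - (h $ i $ i) else if i = a then h $ a $ a else 0) else 0)"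
    by (rule sum.cong) (auto simp: sl_def cartan_elt_def)
  also have "\<dots> = h $ a $ b"
    using assms tr by (cases "a = b"; cases "a = k") (simp_all add: cartan_def sum_negf)
  finally show "h $ a $ b = (\<Sum>i\<in>UNIV - {k}. scale sl (h $ i $ i) (cartan_elt i k)) $ a $ b" ..
qed

lemma sl_induct_basis [consumes 2, case_names add scale unit cartan]:
  fixes x :: "'f::field_char_0^'n::finite^'n"
  assumes x: "x \<in> carrier sl" and n: "2 \<le> CARD('n)"
    and add: "\<And>x y. x \<in> carrier sl \<Longrightarrow> y \<in> carrier sl \<Longrightarrow> P x \<Longrightarrow> P y \<Longrightarrow> P (x + y)"
    and scale: "\<And>c x. x \<in> carrier sl \<Longrightarrow> P x \<Longrightarrow> P (scale sl c x)"
    and unit: "\<And>i j. i \<noteq> j \<Longrightarrow> P (unit_matrix i j)"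
    and cartan: "\<And>i j. i \<noteq> j \<Longrightarrow> P (cartan_elt i j)"
  shows "P x"
proof -
  have ce: "cartan_elt i j \<in> carrier sl" if "i \<noteq> j" for i j :: 'n
    using cartan_elt_in[OF that] cartan_subset_sl by auto
  show ?thesis
  using x
  proof (induction rule: sl_induct)
    case (cartan h)
    have "(UNIV :: 'n set) \<noteq> {undefined}"
    proof
      assume "(UNIV :: 'n set) = {undefined}"
      then have "CARD('n) = card {undefined :: 'n}" by (rule arg_cong)
      then show False using n by simp
    qed
    then obtain i j :: 'n where ij: "i \<noteq> j" by blast
    have "P (scale sl 0 (cartan_elt i j))" by (intro scale ce assms(6) ij)
    moreover have "scale sl 0 (cartan_elt i j) = (0 :: 'f^'n^'n)" by (simp add: sl_def vec_eq_iff)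
    ultimately have "P 0" by simp
    then have "(\<Sum>i\<in>UNIV - {undefined}. scale sl (h $ i $ i) (cartan_elt i undefined)) \<in> carrier sl \<and>
       P (\<Sum>i\<in>UNIV - {undefined}. scale sl (h $ i $ i) (cartan_elt i undefined))"
      by (intro sl_sum_closed add) (auto intro!: sl_closed scale assms(6) ce)
    then show ?case using cartan_decomposition[OF cartan, of undefined] by simp
  qed (use add scale unit in auto)
qed

lemma cartan_commute: "g \<in> cartan \<Longrightarrow> h \<in> cartan \<Longrightarrow> bracket sl g h = 0"
  for g h :: "'f::field^'n::finite^'n"
proof -
  assume gh: "g \<in> cartan" "h \<in> cartan"
  have "(g ** h) $ a $ b = (if a = b then g $ a $ a * h $ a $ a else 0)" if "g \<in> cartan" "h \<in> cartan"
    for a b and g h :: "'f^'n^'n"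
  proof -
    have "(g ** h) $ a $ b = (\<Sum>k\<in>UNIV. if k = a then (if a = b then g $ a $ a * h $ a $ a else 0) else 0)"
      unfolding matrix_matrix_mult_def vec_lambda_beta using that
      by (intro sum.cong) (auto simp: cartan_def)
    then show ?thesis by simp
  qed
  from this[OF gh] this[OF gh(2,1)] show ?thesis by (simp add: sl_def vec_eq_iff mult.commute)
qed

text \<open>The kernel is central, so all lifts of \<open>\<iota> h\<close> act on \<open>E\<close>
  in the same way, and weight spaces \<open>Ew\<close> of \<open>E\<close> make sense before a copy
  of \<open>sl\<close> is available in \<open>E\<close>. On nonzero weights of norm at most four,
  \<open>p\<close> is a bijection between weight spaces. Hence the root vectors lift together with
  their relations, and with them all of \<open>sl\<close>; perfectness of \<open>E\<close> yields
  the rest.\<close>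

theorem Theta_graded_lift:
  fixes E :: "('f::field_char_0, 'e::ab_group_add) lie" and \<iota> :: "'f^'n::finite^'n \<Rightarrow> 'l::ab_group_add"
  assumes ext: "central_extension E L p" and perf: "perfect E" and n: "5 \<le> CARD('n)"
    and TG: "Theta_graded \<iota> L" and NG: "norm_graded \<iota> L"
  shows "\<exists>\<iota>' :: 'f^'n^'n \<Rightarrow> 'e. Theta_graded \<iota>' E \<and> norm_graded \<iota>' E"
proof -
  have LE: "lie_algebra E" and LL: "lie_algebra L" and p: "lie_hom E L p" and sur: "p ` carrier E = carrier L"
    and cen: "\<And>z x. z \<in> carrier E \<Longrightarrow> p z = 0 \<Longrightarrow> x \<in> carrier E \<Longrightarrow> bracket E z x = 0"
    using ext by (auto simp: central_extension_def)
  have hL: "lie_hom sl L \<iota>" and injL: "inj_on \<iota> (carrier sl)" using TG by (auto simp: Theta_graded_def)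
  obtain bL where "sl_lie L bL \<iota>" using sl_lie_exists[OF LL hL] .
  then interpret L: sl_lie5 L bL \<iota> using n by (simp add: sl_lie5_def sl_lie5_axioms_def)
  obtain b where bt: "total_lie_algebra (scale E) b" and b_eq: "\<And>x y. x \<in> carrier E \<Longrightarrow> y \<in> carrier E \<Longrightarrow> b x y = bracket E x y"
    and b_closed: "\<And>x y. b x y \<in> carrier E"
    using total_bracket_exists[OF LE] by blast
  interpret T: total_lie_algebra "scale E" b by (rule bt)
  note pD = lie_homD[OF p] and Esub = lie_algebraD(2)[OF LE]
  have pb: "p (b x y) = bL (p x) (p y)" if "x \<in> carrier E" "y \<in> carrier E" for x y
    using that by (simp add: b_eq L.br_eq pD)
  have cenb: "b z x = 0" "b x z = 0" if "z \<in> carrier E" "p z = 0" "x \<in> carrier E" for x z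
    using cen[OF that] that b_eq T.br_skew[of x z] by auto
  have Eadd: "x + y \<in> carrier E" "x - y \<in> carrier E" if "x \<in> carrier E" "y \<in> carrier E" for x y
    using that Esub by (auto intro: T.subspace_add T.subspace_diff)
  have Escale: "scale E c x \<in> carrier E" if "x \<in> carrier E" for c x
    using that Esub by (auto intro: T.subspace_scale)
  have pdiff: "p (x - y) = p x - p y" if "x \<in> carrier E" "y \<in> carrier E" for x y
    by (rule lie_hom_diff(2)[OF LE p that])
  have p0: "p 0 = 0" by (rule lie_hom_image_zero[OF LE p])
  define lf where "lf y = inv_into (carrier E) p y" for y
  have lf: "lf y \<in> carrier E" "p (lf y) = y" if "y \<in> carrier L" for y
    using that sur by (auto simp: lf_def inv_into_into f_inv_into_f)
  have iL: "\<iota> x \<in> carrier L" if "x \<in> carrier sl" for x using lie_homD(1)[OF hL that] .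
  have cs: "h \<in> carrier sl" if "h \<in> cartan" for h :: "'f^'n^'n" using that cartan_subset_sl by auto
  define Ew where "Ew w = {z \<in> carrier E. \<forall>h\<in>cartan. \<forall>t\<in>carrier E. p t = \<iota> h \<longrightarrow> b t z = scale E (wt w h) z}"
    for w :: "'n \<Rightarrow> int"
  have EwD: "b t z = scale E (wt w h) z" if "z \<in> Ew w" "h \<in> cartan" "t \<in> carrier E" "p t = \<iota> h" for z w h t
    using that by (simp add: Ew_def)
  have EwC: "z \<in> carrier E" if "z \<in> Ew w" for z w using that by (simp add: Ew_def)
  have Ew_sub: "T.subspace (Ew w)" for w
    using Esub unfolding T.subspace_def
    by (auto simp: Ew_def T.br_add_right T.br_scale_right T.scale_right_distrib T.scale_left_commute)
  have Ew_br: "b x y \<in> Ew (v + w)" if "x \<in> Ew v" "y \<in> Ew w" for x y v w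
    using that by (auto simp: Ew_def b_closed T.br_jacobi[of _ x y] T.br_scale_left T.br_scale_right
        T.scale_left_distrib wt_add)
  have Ew_p: "p z \<in> L.Sp w" if "z \<in> Ew w" for z w
    unfolding L.mem_Sp
  proof (intro conjI ballI)
    show "p z \<in> carrier L" using EwC[OF that] pD by simp
    fix h :: "'f^'n^'n" assume h: "h \<in> cartan"
    note l = lf[OF iL[OF cs[OF h]]]
    have "bL (\<iota> h) (p z) = p (b (lf (\<iota> h)) z)" using l EwC[OF that] by (simp add: pb)
    also have "\<dots> = scale L (wt w h) (p z)" using EwD[OF that h l] EwC[OF that] by (simp add: pD)
    finally show "bL (\<iota> h) (p z) = scale L (wt w h) (p z)" .
  qed
  have Ew_zero: "z = 0" if z: "z \<in> Ew w" "p z = 0" and w: "w \<noteq> 0" "nrm w \<le> 4" for z w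
  proof -
    obtain h :: "'f^'n^'n" where h: "h \<in> cartan" "wt w h \<noteq> 0" using L.wt_nonzero[OF w] .
    note l = lf[OF iL[OF cs[OF h(1)]]]
    have "scale E (wt w h) z = 0" using EwD[OF z(1) h(1) l] cenb(2)[OF EwC[OF z(1)] z(2) l(1)] by simp
    then show "z = 0" using h by simp
  qed
  have Ew_eq: "z = z'" if "z \<in> Ew w" "z' \<in> Ew w" "p z = p z'" "w \<noteq> 0" "nrm w \<le> 4" for z z' w
    using Ew_zero[of "z - z'" w] that T.subspace_diff[OF Ew_sub] pdiff EwC by simp
  have Ew_lift: "\<exists>z\<in>Ew w. p z = x" if x: "x \<in> L.Sp w" and w: "w \<noteq> 0" "nrm w \<le> 4" for x w
  proof -
    obtain h0 :: "'f^'n^'n" where h0: "h0 \<in> cartan" "wt w h0 \<noteq> 0" using L.wt_nonzero[OF w] .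
    note l = lf[OF iL[OF cs[OF h0(1)]]] and lx = lf[OF L.Sp_carrier[OF x]]
    define c where "c = wt w h0"
    \<comment> \<open>An arbitrary lift of \<open>x\<close> is determined up to central elements.
      The bracket with a lift of \<open>h0\<close> removes this ambiguity and multiplies by the
      eigenvalue \<open>c\<close>, which is nonzero and is divided out.\<close>
    define z where "z = scale E (1 / c) (b (lf (\<iota> h0)) (lf x))"
    have zC: "z \<in> carrier E" unfolding z_def by (intro Escale b_closed)
    have "p z = x" using x h0 l lx by (simp add: z_def pD b_closed pb L.mem_Sp c_def)
    moreover have "b t z = scale E (wt w h) z" if h: "h \<in> cartan" and t: "t \<in> carrier E" "p t = \<iota> h" for h t
    proof -
      have "p (b t (lf (\<iota> h0))) = 0"
        using t l cartan_commute[OF h h0(1)] L.iota_bracket[OF cs[OF h] cs[OF h0(1)]] L.iota_zero by (simp add: pb)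
      then have 1: "b (b t (lf (\<iota> h0))) (lf x) = 0" using cenb(1) b_closed lx by simp
      define k where "k = b t (lf x) - scale E (wt w h) (lf x)"
      have k: "k \<in> carrier E" unfolding k_def by (intro Eadd Escale b_closed lx)
      have "p k = 0" using x h t lx by (simp add: k_def pdiff b_closed Escale pb pD L.mem_Sp)
      then have "b (lf (\<iota> h0)) k = 0" using cenb(2) k l by simp
      then have 2: "b (lf (\<iota> h0)) (b t (lf x)) = scale E (wt w h) (b (lf (\<iota> h0)) (lf x))"
        by (simp add: k_def T.br_diff_right T.br_scale_right)
      show ?thesis unfolding z_def T.br_scale_right T.br_jacobi[of t "lf (\<iota> h0)"] 1 2
        by (simp add: T.scale_left_commute)
    qed
    ultimately show ?thesis using zC by (auto simp: Ew_def intro!: bexI[of _ z])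
  qed
  have root: "sgl 1 i + sgl (-1) j \<noteq> 0" "nrm (sgl 1 i + sgl (-1) j) \<le> 4" if "i \<noteq> j" for i j :: 'n
    using nrm_sgl2[OF that, of 1 "-1"] nrm_zero by (auto simp del: nrm_sgl2)
  define e where "e i j = (SOME z. z \<in> Ew (sgl 1 i + sgl (-1) j) \<and> p z = L.E i j)" for i j
  have e: "e i j \<in> Ew (sgl 1 i + sgl (-1) j)" "p (e i j) = L.E i j" if "i \<noteq> j" for i j
  proof -
    have "\<exists>z. z \<in> Ew (sgl 1 i + sgl (-1) j) \<and> p z = L.E i j"
      using Ew_lift[OF L.E_Sp[OF that] root[OF that]] by blast
    from someI_ex[OF this] show "e i j \<in> Ew (sgl 1 i + sgl (-1) j)" "p (e i j) = L.E i j"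
      by (simp_all add: e_def)
  qed
  have eC: "e i j \<in> carrier E" if "i \<noteq> j" for i j using EwC[OF e(1)[OF that]] .
  have ee: "b (e i j) (e j k) = e i k" if "i \<noteq> j" "j \<noteq> k" "i \<noteq> k" for i j k
  proof (rule Ew_eq[where w = "sgl 1 i + sgl (-1) k"])
    have eq: "sgl 1 i + sgl (-1) j + (sgl 1 j + sgl (-1) k) = sgl 1 i + sgl (-1) k"
      by (auto simp: sgl_def fun_eq_iff)
    show "b (e i j) (e j k) \<in> Ew (sgl 1 i + sgl (-1) k)"
      using Ew_br[OF e(1)[OF that(1)] e(1)[OF that(2)]] unfolding eq .
    show "p (b (e i j) (e j k)) = p (e i k)"
      using that by (simp add: pb eC e L.E_br)
  qed (use that e root in auto)
  have ee0: "b (e i j) (e k l) = 0" if "i \<noteq> j" "k \<noteq> l" "j \<noteq> k" "i \<noteq> l" for i j k l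
  proof (rule Ew_zero[OF Ew_br[OF e(1)[OF that(1)] e(1)[OF that(2)]]])
    show "p (b (e i j) (e k l)) = 0" using that by (simp add: pb eC e L.E_br)
    have "(sgl 1 i + sgl (-1) j + (sgl 1 k + sgl (-1) l)) i > 0"
      using that by (auto simp: sgl_def)
    then show "sgl 1 i + sgl (-1) j + (sgl 1 k + sgl (-1) l) \<noteq> 0" by (metis less_irrefl zero_fun_apply)
    show "nrm (sgl 1 i + sgl (-1) j + (sgl 1 k + sgl (-1) l)) \<le> 4"
      using nrm_add[of "sgl 1 i + sgl (-1) j" "sgl 1 k + sgl (-1) l"] that by simp
  qed
  \<comment> \<open>Diagonal matrices are lifted as brackets of root vectors. Additivity in the
    indices is the Jacobi identity for a triangle \<open>i\<close>, \<open>j\<close>,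
    \<open>k\<close>.\<close>
  define H where "H i j = b (e i j) (e j i)" for i j
  have H_skew: "H j i = - H i j" for i j unfolding H_def by (rule T.br_skew)
  have H_add: "H i k = H i j + H j k" if "i \<noteq> j" "j \<noteq> k" "i \<noteq> k" for i j k
  proof -
    have "H i k = b (b (e i j) (e j k)) (e k i)" using that by (simp add: H_def ee)
    also have "\<dots> = b (e i j) (b (e j k) (e k i)) - b (e j k) (b (e i j) (e k i))" by (rule T.br_jacobi_left)
    also have "b (e i j) (e k i) = - e k j" using T.br_skew[of "e i j" "e k i"] that by (simp add: ee)
    also have "b (e j k) (e k i) = e j i" using that by (simp add: ee)
    finally show ?thesis by (simp add: H_def)
  qed
  have H_Ew: "H i j \<in> Ew 0" if "i \<noteq> j" for i j
  proof -
    have "sgl 1 i + sgl (-1) j + (sgl 1 j + sgl (-1) i) = 0" by (auto simp: sgl_def fun_eq_iff)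
    then show ?thesis
      using Ew_br[OF e(1)[OF that] e(1)[OF that[symmetric]]] by (simp add: H_def)
  qed
  define o' :: 'n where "o' = undefined"
  \<comment> \<open>\<open>hh i\<close> lifts the diagonal matrix with 1 at \<open>i\<close> and -1
    at the reference index \<open>o'\<close>, so a traceless diagonal matrix lifts to the
    combination of the \<open>hh i\<close> with its diagonal entries.\<close>
  define hh where "hh i = (if i = o' then 0 else H i o')" for i
  have hh: "hh i - hh j = H i j" if "i \<noteq> j" for i j
    using H_add[of i j o'] H_skew[of j o'] that by (auto simp: hh_def)
  have hhC: "hh i \<in> carrier E" for i using T.subspace_0[OF Esub] b_closed by (simp add: hh_def H_def)
  define \<iota>' where "\<iota>' x = (\<Sum>i\<in>UNIV. (\<Sum>j\<in>UNIV - {i}. scale E (x $ i $ j) (e i j)) + scale E (x $ i $ i) (hh i))"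
    for x :: "'f^'n^'n"
  have i_add: "\<iota>' (x + y) = \<iota>' x + \<iota>' y" for x y
    by (simp add: \<iota>'_def T.scale_left_distrib sum.distrib)
  have i_scale: "\<iota>' (scale sl c x) = scale E c (\<iota>' x)" for c x
    by (simp add: \<iota>'_def sl_def T.scale_sum_right T.scale_right_distrib)
  have i_C: "\<iota>' x \<in> carrier E" for x
    unfolding \<iota>'_def by (intro T.subspace_sum[OF Esub] Eadd Escale eC hhC) auto
  have i_unit: "\<iota>' (unit_matrix i j) = e i j" if "i \<noteq> j" for i j
  proof -
    have "(\<Sum>l\<in>UNIV - {k}. scale E (unit_matrix i j $ k $ l) (e k l)) + scale E (unit_matrix i j $ k $ k) (hh k) =
      (if k = i then e i j else 0)" for k
    proof -
      have "(\<Sum>l\<in>UNIV - {k}. scale E (unit_matrix i j $ k $ l) (e k l)) = (\<Sum>l\<in>UNIV - {k}. if l = j then (if k = i then e i j else 0) else 0)"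
        by (rule sum.cong) (auto simp: unit_matrix_def)
      then show ?thesis using that by (auto simp: unit_matrix_def)
    qed
    then show ?thesis by (simp add: \<iota>'_def)
  qed
  have i_cartan: "\<iota>' (cartan_elt i j) = H i j" if "i \<noteq> j" for i j
  proof -
    have "(\<Sum>l\<in>UNIV - {k}. scale E (cartan_elt i j $ k $ l) (e k l)) + scale E (cartan_elt i j $ k $ k) (hh k) =
      (if k = i then hh i else 0) + (if k = j then - hh j else 0)" for k
    proof -
      have "(\<Sum>l\<in>UNIV - {k}. scale E (cartan_elt i j $ k $ l) (e k l)) = 0"
        by (rule sum.neutral) (auto simp: cartan_elt_def)
      then show ?thesis using that by (auto simp: cartan_elt_def)
    qed
    then show ?thesis using hh[OF that] by (simp add: \<iota>'_def sum.distrib)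
  qed
  have ce: "cartan_elt i j \<in> carrier sl" if "i \<noteq> j" for i j :: 'n
    using cartan_elt_in[OF that] cartan_subset_sl by auto
  have n2: "2 \<le> CARD('n)" using n by simp
  have i_p: "p (\<iota>' x) = \<iota> x" if "x \<in> carrier sl" for x
    using that n2
  proof (induction rule: sl_induct_basis)
    case (unit i j) then show ?case by (simp add: i_unit e L.E_def)
  next
    case (cartan i j)
    then have "p (\<iota>' (cartan_elt i j)) = bL (L.E i j) (L.E j i)" by (simp add: i_cartan H_def pb eC e)
    also have "\<dots> = \<iota> (bracket sl (unit_matrix i j) (unit_matrix j i))"
      using cartan by (simp add: L.E_def L.iota_bracket unit_matrix_in_sl)
    finally show ?case using cartan by (simp add: unit_matrix_bracket_cartan)
  qed (simp_all add: i_add i_scale pD i_C lie_homD[OF hL])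
  have i_act: "b (\<iota>' h) z = scale E (wt w h) z" if "h \<in> cartan" "z \<in> Ew w" for h z w
    using EwD[OF that(2,1) i_C] i_p cs that by simp
  have i_br: "\<iota>' (bracket sl x y) = b (\<iota>' x) (\<iota>' y)" if "x \<in> carrier sl" "y \<in> carrier sl" for x y
    using that(1) n2 that(2)
  proof (induction arbitrary: y rule: sl_induct_basis)
    case (add x x')
    then show ?case by (simp add: sl_bracket_bilinear(1-4) i_add T.br_add_left)
  next
    case (scale c x)
    then show ?case by (simp add: sl_bracket_bilinear(1-4) i_scale T.br_scale_left)
  next
    case (unit i j)
    from unit(2) n2 show ?case
    proof (induction rule: sl_induct_basis)
      case (add x x')
      then show ?case by (simp add: sl_bracket_bilinear(1-4) i_add T.br_add_right)
    next
      case (scale c x)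
      then show ?case by (simp add: sl_bracket_bilinear(1-4) i_scale T.br_scale_right)
    next
      case u: (unit k l)
      have 0: "\<iota>' 0 = 0" by (simp add: \<iota>'_def)
      consider "j \<noteq> k" "i \<noteq> l" | "j = k" "i \<noteq> l" | "j \<noteq> k" "i = l" | "j = k" "i = l" by blast
      then show ?case
      proof cases
        case 1 then show ?thesis using unit(1) u by (simp add: unit_matrix_bracket i_unit ee0 0)
      next
        case 2 then show ?thesis using unit(1) u by (simp add: unit_matrix_bracket i_unit ee)
      next
        case 3
        have "\<iota>' (- unit_matrix k j) = - \<iota>' (unit_matrix k j)" by (simp add: \<iota>'_def sum_negf sum_subtractf sum.distrib)
        then show ?thesis using unit(1) u 3 T.br_skew[of "e i j" "e k l"] by (simp add: unit_matrix_bracket i_unit ee)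
      next
        case 4 then show ?thesis using unit(1) by (simp add: unit_matrix_bracket_cartan i_cartan H_def i_unit)
      qed
    next
      case (cartan k l)
      have "\<iota>' (bracket sl (unit_matrix i j) (cartan_elt k l)) =
          scale E (-1) (\<iota>' (bracket sl (cartan_elt k l) (unit_matrix i j)))"
        by (subst sl_bracket_bilinear(5)) (rule i_scale)
      also have "\<dots> = - scale E (wt (sgl 1 i + sgl (-1) j) (cartan_elt k l)) (e i j)"
        using unit(1) by (simp add: cartan_bracket_unit_matrix cartan_elt_in[OF cartan] i_scale i_unit wt_root
            flip: T.scale_minus_left)
      also have "\<dots> = - b (\<iota>' (cartan_elt k l)) (e i j)"
        using i_act[OF cartan_elt_in[OF cartan] e(1)[OF unit(1)]] by simp
      also have "\<dots> = b (e i j) (\<iota>' (cartan_elt k l))" by (subst T.br_skew) simp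
      finally show ?case using unit(1) by (simp add: i_unit)
    qed
  next
    case c: (cartan i j)
    from c(2) n2 show ?case
    proof (induction rule: sl_induct_basis)
      case (add x x')
      then show ?case by (simp add: sl_bracket_bilinear(1-4) i_add T.br_add_right)
    next
      case (scale c x)
      then show ?case by (simp add: sl_bracket_bilinear(1-4) i_scale T.br_scale_right)
    next
      case (unit k l)
      then show ?case
        using i_act[OF cartan_elt_in[OF c(1)] e(1)[OF unit]]
        by (simp add: cartan_bracket_unit_matrix cartan_elt_in[OF c(1)] i_scale i_unit wt_root)
    next
      case (cartan k l)
      have "b (\<iota>' (cartan_elt i j)) (H k l) = 0"
        using i_act[OF cartan_elt_in[OF c(1)] H_Ew[OF cartan]] by simp
      moreover have "\<iota>' 0 = 0" by (simp add: \<iota>'_def)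
      moreover have "bracket sl (cartan_elt i j) (cartan_elt k l) = (0 :: 'f^'n^'n)"
        by (intro cartan_commute cartan_elt_in c(1) cartan)
      ultimately show ?case using cartan by (simp add: i_cartan)
    qed
  qed
  have hE: "lie_hom sl E \<iota>'"
    unfolding lie_hom_def vlinear_def by (simp add: i_C i_add i_scale i_br b_eq)
  have "sl_lie E b \<iota>'" using LE bt b_eq b_closed hE by (simp add: sl_lie_def)
  then interpret E: sl_lie5 E b \<iota>' using n by (simp add: sl_lie5_def sl_lie5_axioms_def)
  have injE: "inj_on \<iota>' (carrier sl)" using injL i_p by (metis inj_onI inj_onD)
  have Sp_Ew: "E.Sp w = Ew w" for w
  proof
    show "Ew w \<subseteq> E.Sp w" using i_act EwC by (auto simp: E.mem_Sp)
    show "E.Sp w \<subseteq> Ew w"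
    proof
      fix z assume z: "z \<in> E.Sp w"
      have "b t z = scale E (wt w h) z" if h: "h \<in> cartan" and t: "t \<in> carrier E" "p t = \<iota> h" for h t
      proof -
        have "p (t - \<iota>' h) = 0" using t i_C i_p[OF cs[OF h]] by (simp add: pdiff)
        then have "b (t - \<iota>' h) z = 0" using cenb(1) Eadd t i_C E.Sp_carrier[OF z] by simp
        then show ?thesis using z h by (simp add: T.br_diff_left E.mem_Sp)
      qed
      then show "z \<in> Ew w" using E.Sp_carrier[OF z] by (simp add: Ew_def)
    qed
  qed
  \<comment> \<open>The weight \<open>v + w\<close> is nonzero of norm at most four and the bracket
    vanishes in \<open>L\<close>, so injectivity of \<open>p\<close> on weight spaces
    applies.\<close>
  have big: "b x y = 0" if "x \<in> E.Sp v" "y \<in> E.Sp w" "nrm v \<le> 2" "nrm w \<le> 2" "2 < nrm (v + w)" for x y v w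
  proof (rule Ew_zero)
    show "b x y \<in> Ew (v + w)" using that Ew_br by (simp add: Sp_Ew)
    have "p x \<in> L.Sp v" "p y \<in> L.Sp w" using that Ew_p by (auto simp: Sp_Ew)
    then have "bracket L (p x) (p y) = 0" using NG that unfolding norm_graded_def by blast
    then show "p (b x y) = 0" using E.Sp_carrier that by (simp add: b_eq pD)
    show "v + w \<noteq> 0" using that by (metis nrm_zero not_numeral_less_zero)
    show "nrm (v + w) \<le> 4" using nrm_add[of v w] that by simp
  qed
  have NE: "norm_graded \<iota>' E"
    unfolding norm_graded_def using big E.Sp_carrier b_eq by metis
  \<comment> \<open>\<open>N\<close> turns out to be a subalgebra that maps onto \<open>L\<close>.
    Since brackets of \<open>E\<close> depend only on images in \<open>L\<close>, all of them lie in
    \<open>N\<close>, and by perfectness they span \<open>E\<close>.\<close>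
  define N where "N = T.span (\<Union>w\<in>E.W2. E.Gen w)"
  have Nsub: "T.subspace N" by (simp add: N_def)
  have NC: "N \<subseteq> carrier E" unfolding N_def by (rule T.span_minimal[OF _ Esub]) (use E.Gen_Sp E.Sp_carrier in blast)
  have GenN: "x \<in> N" if "x \<in> E.Gen w" "w \<in> E.W2" for x w using that unfolding N_def by (auto intro: T.span_base)
  have Gen0: "b x y \<in> E.Gen 0" if "x \<in> E.Sp v" "y \<in> E.Sp (- v)" "v \<in> E.W2" "v \<noteq> 0" for x y v
    using that unfolding E.Gen_def by auto
  have pN: "carrier L \<subseteq> p ` N"
  proof -
    have "L.Gen w \<subseteq> p ` N" if w: "w \<in> L.W2" for w
    proof (cases "w = 0")
      case False
      then have "x \<in> p ` N" if "x \<in> L.Sp w" for x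
        using Ew_lift[OF that] GenN[of _ w] w by (auto simp: E.Gen_def Sp_Ew[symmetric])
      then show ?thesis using False by (auto simp: L.Gen_def)
    next
      case True
      have "bL x y \<in> p ` N" if v: "v \<in> L.W2" "v \<noteq> 0" and xy: "x \<in> L.Sp v" "y \<in> L.Sp (- v)" for x y v
      proof -
        obtain x' where x': "x' \<in> Ew v" "p x' = x" using Ew_lift[OF xy(1)] v by auto
        obtain y' where y': "y' \<in> Ew (- v)" "p y' = y" using Ew_lift[OF xy(2)] v by auto
        have "p (b x' y') = bL x y" using x' y' EwC pb by metis
        moreover have "b x' y' \<in> N" using Gen0 GenN[of _ 0] x' y' v by (auto simp: Sp_Ew)
        ultimately show ?thesis by (metis imageI)
      qed
      then show ?thesis using True by (auto simp: L.Gen_def)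
    qed
    then have "(\<Union>w\<in>L.W2. L.Gen w) \<subseteq> p ` N" by blast
    then have "L.span (\<Union>w\<in>L.W2. L.Gen w) \<subseteq> p ` N"
      by (rule L.span_minimal) (rule lie_hom_image_subspace[OF LE LL p NC Nsub])
    moreover have "L.generated" using L.Theta_graded_iff[OF injL] TG by simp
    ultimately show ?thesis by (auto simp: L.generated_def)
  qed
  have Nbr: "b x y \<in> N" if "x \<in> N" "y \<in> N" for x y
  proof (rule T.span_br_subset[OF Nsub _ that[unfolded N_def]])
    fix x y assume "x \<in> (\<Union>w\<in>E.W2. E.Gen w)" "y \<in> (\<Union>w\<in>E.W2. E.Gen w)"
    then obtain v w where x: "x \<in> E.Gen v" "v \<in> E.W2" and y: "y \<in> E.Gen w" "w \<in> E.W2" by blast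
    have xS: "x \<in> E.Sp v" and yS: "y \<in> E.Sp w" using x y E.Gen_Sp by blast+
    consider "v + w = 0" "v \<noteq> 0" | "v + w \<noteq> 0" "nrm (v + w) \<le> 2" | "2 < nrm (v + w)" | "v = 0" "w = 0"
      by fastforce
    then show "b x y \<in> N"
    proof cases
      case 1
      then have "w = - v" by (simp add: eq_neg_iff_add_eq_0 add.commute)
      then show ?thesis using Gen0[of x v y] GenN[of _ 0] xS yS x 1 by simp
    next
      case 2
      then show ?thesis using E.Sp_br[OF xS yS] GenN[of _ "v + w"] by (simp add: E.Gen_def)
    next
      case 3
      then show ?thesis using big[OF xS yS] x y T.subspace_0[OF Nsub] by simp
    next
      \<comment> \<open>An element of \<open>Gen 0\<close> is a bracket of two vectors of opposite
        weight; \<open>x\<close> has weight zero, acts as a derivation and preserves both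
        weights.\<close>
      case 4
      then obtain u c d where u: "u \<in> E.W2" "u \<noteq> 0" "c \<in> E.Sp u" "d \<in> E.Sp (- u)" "y = b c d"
        using y by (auto simp: E.Gen_def)
      have "b x c \<in> E.Sp u" "b x d \<in> E.Sp (- u)"
        using E.Sp_br[OF xS u(3)] E.Sp_br[OF xS u(4)] 4 by simp_all
      then have "b (b x c) d \<in> E.Gen 0" "b c (b x d) \<in> E.Gen 0" using Gen0 u by auto
      then show ?thesis
        unfolding u(5) T.br_jacobi[of x c d] using GenN[of _ 0] by (intro T.subspace_add[OF Nsub]) auto
    qed
  qed
  have "carrier E \<subseteq> N"
  proof
    fix x assume "x \<in> carrier E"
    then show "x \<in> N"
    proof (rule perfect_induct[OF LE perf Nsub, rotated])
      fix x y assume xy: "x \<in> carrier E" "y \<in> carrier E"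
      then have "p x \<in> p ` N" "p y \<in> p ` N" using pN pD by auto
      then obtain x' y' where *: "x' \<in> N" "y' \<in> N" "p x = p x'" "p y = p y'" by auto
      have "bracket E x y = bracket E x' y'"
        by (rule central_extension_bracket_eq[OF ext]) (use xy * NC in auto)
      also have "\<dots> = b x' y'" using * NC by (intro b_eq[symmetric]) auto
      finally show "bracket E x y \<in> N" using Nbr * by simp
    qed
  qed
  then have "E.generated" by (simp add: E.generated_def N_def)
  then show ?thesis using E.Theta_graded_iff[OF injE] NE by blast
qed

section \<open>Coherent families\<close>

text \<open>Transition maps with the cocycle rule are trivialized by transport from the single index
  \<open>i0\<close>.\<close>

lemma coherent_line:
  assumes map: "\<And>i k x. \<lbrakk>i \<in> I; k \<in> I; i \<noteq> k; x \<in> X i\<rbrakk> \<Longrightarrow> tr k i x \<in> X k"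
    and comp: "\<And>i k m x. \<lbrakk>i \<in> I; k \<in> I; m \<in> I; i \<noteq> k; k \<noteq> m; i \<noteq> m; x \<in> X i\<rbrakk> \<Longrightarrow> tr m k (tr k i x) = tr m i x"
    and inv: "\<And>i k x. \<lbrakk>i \<in> I; k \<in> I; i \<noteq> k; x \<in> X i\<rbrakk> \<Longrightarrow> tr i k (tr k i x) = x"
    and x: "i0 \<in> I" "x \<in> X i0"
  obtains y where "y i0 = x" "\<And>i. i \<in> I \<Longrightarrow> y i \<in> X i"
    "\<And>i k. \<lbrakk>i \<in> I; k \<in> I; i \<noteq> k\<rbrakk> \<Longrightarrow> tr k i (y i) = y k"
proof (rule that[of "\<lambda>i. if i = i0 then x else tr i i0 x"])
  let ?y = "\<lambda>i. if i = i0 then x else tr i i0 x"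
  show "?y i0 = x" by simp
  show "?y i \<in> X i" if "i \<in> I" for i using that map x by auto
  show "tr k i (?y i) = ?y k" if "i \<in> I" "k \<in> I" "i \<noteq> k" for i k
    using that x by (auto simp: inv intro: comp)
qed

text \<open>A column, in which the row index varies, is determined by one of its entries, and the
  right moves act on whole columns because they commute with left moves. So the grid is a coherent
  line whose points are columns. As diagonal entries are missing, columns are compared in a row that
  avoids up to three indices; four indices provide one.\<close>

lemma coherent_grid:
  fixes X :: "'n::finite \<Rightarrow> 'n \<Rightarrow> 'v set"
  assumes card: "4 \<le> CARD('n)"
    and lmap: "\<And>i j k x. \<lbrakk>distinct [i, j, k]; x \<in> X i j\<rbrakk> \<Longrightarrow> lft k i x \<in> X k j"
    and lcomp: "\<And>i j k m x. \<lbrakk>distinct [i, j, k, m]; x \<in> X i j\<rbrakk> \<Longrightarrow> lft m k (lft k i x) = lft m i x"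
    and linv: "\<And>i j k x. \<lbrakk>distinct [i, j, k]; x \<in> X i j\<rbrakk> \<Longrightarrow> lft i k (lft k i x) = x"
    and rmap: "\<And>i j k x. \<lbrakk>distinct [i, j, k]; x \<in> X i j\<rbrakk> \<Longrightarrow> rgt k j x \<in> X i k"
    and rcomp: "\<And>i j k m x. \<lbrakk>distinct [i, j, k, m]; x \<in> X i j\<rbrakk> \<Longrightarrow> rgt m k (rgt k j x) = rgt m j x"
    and rinv: "\<And>i j k x. \<lbrakk>distinct [i, j, k]; x \<in> X i j\<rbrakk> \<Longrightarrow> rgt j k (rgt k j x) = x"
    and comm: "\<And>i j k l x. \<lbrakk>distinct [i, j, k, l]; x \<in> X i j\<rbrakk> \<Longrightarrow> rgt l j (lft k i x) = lft k i (rgt l j x)"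
    and x: "i0 \<noteq> j0" "x \<in> X i0 j0"
  obtains y where "y i0 j0 = x" "\<And>i j. i \<noteq> j \<Longrightarrow> y i j \<in> X i j"
    "\<And>i j k. distinct [i, j, k] \<Longrightarrow> lft k i (y i j) = y k j"
    "\<And>i j k. distinct [i, j, k] \<Longrightarrow> rgt k j (y i j) = y i k"
proof -
  have ex: "\<exists>m. m \<notin> A" if "card A \<le> 3" for A :: "'n set"
  proof (rule ccontr)
    assume "\<nexists>m. m \<notin> A"
    then have "A = UNIV" by blast
    then show False using card that by simp
  qed
  \<comment> \<open>The missing diagonal entry of column \<open>j\<close> is filled with the dummy
    \<open>x\<close>, so that two columns with one common entry off the diagonal are equal as
    functions.\<close>
  define Col where "Col j = {c. c j = x \<and> (\<forall>i. i \<noteq> j \<longrightarrow> c i \<in> X i j) \<and>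
    (\<forall>i k. distinct [i, j, k] \<longrightarrow> lft k i (c i) = c k)}" for j
  have Col_eq: "c = d" if "c \<in> Col j" "d \<in> Col j" "i \<noteq> j" "c i = d i" for c d i j
  proof
    fix k show "c k = d k"
      using that unfolding Col_def by (cases "k = i"; cases "k = j") (auto, metis)
  qed
  have Col_ex: "\<exists>c\<in>Col j. c i = z" if z: "z \<in> X i j" "i \<noteq> j" for z i j
  proof -
    obtain c where c: "c i = z" "\<And>i. i \<in> - {j} \<Longrightarrow> c i \<in> X i j"
      "\<And>i k. \<lbrakk>i \<in> - {j}; k \<in> - {j}; i \<noteq> k\<rbrakk> \<Longrightarrow> lft k i (c i) = c k"
      by (rule coherent_line[of "- {j}" "\<lambda>i. X i j" lft i z]) (use z lmap[of _ j] lcomp[of _ j] linv[of _ j] in auto)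
    then have "c(j := x) \<in> Col j" "(c(j := x)) i = z" using z by (auto simp: Col_def)
    then show ?thesis by blast
  qed
  have ColL: "lft k i (c i) = c k" if "c \<in> Col j" "i \<noteq> j" "k \<noteq> j" "i \<noteq> k" for c i j k
    using that by (auto simp: Col_def)
  \<comment> \<open>The old column has no meaningful entry at \<open>j\<close>, so this entry of the
    new column is not prescribed; the left moves inside column \<open>l\<close> force it.\<close>
  define R where "R l j c = (SOME d. d \<in> Col l \<and> (\<forall>i. i \<noteq> j \<and> i \<noteq> l \<longrightarrow> d i = rgt l j (c i)))" for l j c
  have R: "R l j c \<in> Col l \<and> (\<forall>i. i \<noteq> j \<and> i \<noteq> l \<longrightarrow> R l j c i = rgt l j (c i))" if c: "c \<in> Col j" and l: "j \<noteq> l" for l j c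
  proof -
    obtain m where m: "m \<notin> {j, l}" using ex[of "{j, l}"] l by auto
    then have "c m \<in> X m j" using c by (auto simp: Col_def)
    then have "rgt l j (c m) \<in> X m l" using rmap[of m j l] m l by auto
    then obtain d where d: "d \<in> Col l" "d m = rgt l j (c m)" using Col_ex[of _ m l] m by auto
    have "d i = rgt l j (c i)" if i: "i \<noteq> j" "i \<noteq> l" for i
    proof (cases "i = m")
      case False
      have "d i = lft i m (d m)" using ColL[OF d(1), of m i] m i False by auto
      also have "\<dots> = rgt l j (lft i m (c m))" using comm[of m j i l] \<open>c m \<in> X m j\<close> m i l False d by auto
      also have "lft i m (c m) = c i" using ColL[OF c, of m i] m i False by auto
      finally show ?thesis .
    qed (use d in simp)
    with d(1) have "\<exists>d. d \<in> Col l \<and> (\<forall>i. i \<noteq> j \<and> i \<noteq> l \<longrightarrow> d i = rgt l j (c i))" by blast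
    from someI_ex[OF this] show ?thesis unfolding R_def .
  qed
  have ColX: "c i \<in> X i j" if "c \<in> Col j" "i \<noteq> j" for c i j using that by (simp add: Col_def)
  obtain c0 where c0: "c0 \<in> Col j0" "c0 i0 = x" using Col_ex[OF x(2,1)] by blast
  obtain z where z: "z j0 = c0" "\<And>j. j \<in> UNIV \<Longrightarrow> z j \<in> Col j"
    "\<And>j l. \<lbrakk>j \<in> UNIV; l \<in> UNIV; j \<noteq> l\<rbrakk> \<Longrightarrow> R l j (z j) = z l"
  proof (rule coherent_line[of UNIV Col R j0 c0])
    show "R m k (R k i c) = R m i c" if "i \<noteq> k" "k \<noteq> m" "i \<noteq> m" "c \<in> Col i" for i k m c
    proof -
      obtain a where a: "a \<notin> {i, k, m}" using ex[of "{i, k, m}"] card_length[of "[i, k, m]"] by auto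
      have 1: "R k i c \<in> Col k" "R k i c a = rgt k i (c a)" using R[of c i k] that a by auto
      have 2: "R m k (R k i c) \<in> Col m" "R m k (R k i c) a = rgt m k (R k i c a)" using R[OF 1(1), of m] that a by auto
      have 3: "R m i c \<in> Col m" "R m i c a = rgt m i (c a)" using R[of c i m] that a by auto
      have "rgt m k (rgt k i (c a)) = rgt m i (c a)" using rcomp[of a i k m] ColX[of c i a] that a by auto
      then show ?thesis using Col_eq[OF 2(1) 3(1), of a] a 1 2 3 by simp
    qed
    show "R i k (R k i c) = c" if "i \<noteq> k" "c \<in> Col i" for i k c
    proof -
      obtain a where a: "a \<notin> {i, k}" using ex[of "{i, k}"] card_length[of "[i, k]"] by auto
      have 1: "R k i c \<in> Col k" "R k i c a = rgt k i (c a)" using R[of c i k] that a by auto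
      have 2: "R i k (R k i c) \<in> Col i" "R i k (R k i c) a = rgt i k (R k i c a)" using R[OF 1(1), of i] that a by auto
      have "rgt i k (rgt k i (c a)) = c a" using rinv[of a i k] ColX[of c i a] that a by auto
      then show ?thesis using Col_eq[OF 2(1) that(2), of a] a 1 2 by simp
    qed
  qed (use c0 R in auto)
  show ?thesis
  proof (rule that[of "\<lambda>i j. z j i"])
    show "z j i \<in> X i j" if "i \<noteq> j" for i j using ColX[OF z(2) that] by simp
    show "lft k i (z j i) = z j k" if "distinct [i, j, k]" for i j k using ColL[OF z(2)[of j], of i k] that by auto
    show "rgt k j (z j i) = z k i" if "distinct [i, j, k]" for i j k
      using R[OF z(2), of j k] z(3)[of j k] that by auto
  qed (use z c0 in auto)
qed

section \<open>Sums of weights\<close>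

lemma nrm_ge: "(\<Sum>a\<in>A. \<bar>w a\<bar>) \<le> nrm w"
  unfolding nrm_def by (rule sum_mono2) auto

lemma nrm_indicator:
  assumes c: "\<bar>c\<bar> = 1" and u: "\<And>i. u i = 0 \<or> u i = c"
  shows "nrm u = 1 \<Longrightarrow> \<exists>i. u = sgl c i" "nrm u = 2 \<Longrightarrow> \<exists>i j. i \<noteq> j \<and> u = sgl c i + sgl c j"
proof -
  assume n: "nrm u = 1"
  then have "nrm u \<le> 2" by simp
  then show "\<exists>i. u = sgl c i"
  proof (cases rule: nrm_le_2_cases)
    case (2 s i)
    then have "s = c" using u[of i] by auto
    then show ?thesis using 2 by auto
  qed (use n in auto)
next
  assume n: "nrm u = 2"
  then have "nrm u \<le> 2" by simp
  then show "\<exists>i j. i \<noteq> j \<and> u = sgl c i + sgl c j"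
  proof (cases rule: nrm_le_2_cases)
    case (3 s i t j)
    have ij: "i \<noteq> j"
    proof
      assume "i = j"
      then have "u = sgl (s + t) i" using 3 by (simp add: sgl_add)
      then have "\<bar>u i\<bar> = 2" using n by simp
      then show False using u[of i] c by auto
    qed
    then have "u i = s" "u j = t" using 3 by (auto simp: sgl_def)
    then have "s = c" "t = c" using u[of i] u[of j] 3 by auto
    then show ?thesis using 3 ij by blast
  qed (use n in auto)
qed

text \<open>The sum of two weights in \<open>\<Theta>\<^sub>n\<close> that has norm at least three is congruent to a
  weight in \<open>\<Theta>\<^sub>n\<close> only in the cases that the conditions \<open>(*)\<close> address.\<close>

lemma weight_sum_cases:
  fixes u v t :: "'n::finite \<Rightarrow> int"
  assumes n: "5 \<le> CARD('n)" and u: "nrm u \<le> 2" and v: "nrm v \<le> 2" and uv: "2 < nrm (u + v)"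
    and t: "nrm t \<le> 2" "u + v = t + (\<lambda>_. c)"
  obtains (LL) s i j k l where "CARD('n) = 5 \<or> CARD('n) = 6" "s = 1 \<or> s = -1" "distinct [i, j, k, l]"
      "u = sgl s i + sgl s j" "v = sgl s k + sgl s l"
  | (LV) s i j k where "CARD('n) = 5" "s = 1 \<or> s = -1" "distinct [i, j, k]"
      "u = sgl s i + sgl s j" "v = sgl s k"
  | (VL) s i j k where "CARD('n) = 5" "s = 1 \<or> s = -1" "distinct [i, j, k]"
      "v = sgl s i + sgl s j" "u = sgl s k"
proof -
  define z where "z = u + v"
  have tz: "t i = z i - c" for i using fun_cong[OF t(2), of i] by (simp add: z_def)
  have c0: "c \<noteq> 0"
  proof
    assume "c = 0"
    then have "u + v = t" using t(2) by (simp add: fun_eq_iff)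
    then show False using uv t by simp
  qed
  have z4: "nrm z \<le> 4" using nrm_add[of u v] u v by (simp add: z_def)
  \<comment> \<open>The total is at most 4 + 2, while each summand is at least
    \<open>\<bar>c\<bar>\<close>. With at least five summands this forces
    \<open>\<bar>c\<bar> = 1\<close>, and an entry of \<open>z\<close> other than 0 and
    \<open>c\<close> would contribute at least three and exceed the total.\<close>
  have S: "(\<Sum>i\<in>UNIV. \<bar>z i\<bar> + \<bar>z i - c\<bar>) = nrm z + nrm t" by (simp add: nrm_def sum.distrib tz)
  have "(\<Sum>i\<in>(UNIV::'n set). \<bar>c\<bar>) \<le> (\<Sum>i\<in>UNIV. \<bar>z i\<bar> + \<bar>z i - c\<bar>)" by (rule sum_mono) linarith
  then have le6: "int CARD('n) * \<bar>c\<bar> \<le> 6" using S z4 t by simp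
  have c1: "\<bar>c\<bar> = 1"
  proof (rule ccontr)
    assume "\<bar>c\<bar> \<noteq> 1"
    then have "2 \<le> \<bar>c\<bar>" using c0 by linarith
    then have "5 * 2 \<le> int CARD('n) * \<bar>c\<bar>" using n by (intro mult_mono) auto
    then show False using le6 by simp
  qed
  have z01: "z i = 0 \<or> z i = c" for i
  proof (rule ccontr)
    assume "\<not> (z i = 0 \<or> z i = c)"
    then have 3: "3 \<le> \<bar>z i\<bar> + \<bar>z i - c\<bar>" using c1 by linarith
    have "(\<Sum>j\<in>UNIV - {i}. 1) \<le> (\<Sum>j\<in>UNIV - {i}. \<bar>z j\<bar> + \<bar>z j - c\<bar>)" by (rule sum_mono) (use c1 in linarith)
    then have "int CARD('n) - 1 \<le> (\<Sum>j\<in>UNIV - {i}. \<bar>z j\<bar> + \<bar>z j - c\<bar>)" using n by (simp add: of_nat_diff)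
    then have "int CARD('n) - 1 + 3 \<le> (\<Sum>i\<in>UNIV. \<bar>z i\<bar> + \<bar>z i - c\<bar>)" using 3 by (subst sum.remove[of _ i]) auto
    then show False using S z4 t n by linarith
  qed
  have "(\<Sum>i\<in>UNIV. \<bar>z i\<bar> + \<bar>z i - c\<bar>) = (\<Sum>i\<in>(UNIV::'n set). 1)"
  proof (rule sum.cong[OF refl])
    show "\<bar>z i\<bar> + \<bar>z i - c\<bar> = 1" for i using z01[of i] c1 by auto
  qed
  then have N: "int CARD('n) = nrm z + nrm t" using S by simp
  \<comment> \<open>By parity any cancellation would lower the norm of the sum to at most two. Hence
    the norms add up, to three or four.\<close>
  have uvz: "nrm u + nrm v = nrm z \<and> (nrm z = 4 \<or> nrm z = 3)"
    using nrm_add_parity[of u v] nrm_add[of u v] uv u v z4 unfolding z_def by presburger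
  have "(\<Sum>i\<in>UNIV. \<bar>u i\<bar> + \<bar>v i\<bar> - \<bar>u i + v i\<bar>) = 0"
    using uvz by (simp add: nrm_def sum.distrib sum_subtractf z_def)
  then have nc: "\<bar>u i\<bar> + \<bar>v i\<bar> = \<bar>u i + v i\<bar>" for i
    using sum_nonneg_eq_0_iff[of UNIV "\<lambda>i. \<bar>u i\<bar> + \<bar>v i\<bar> - \<bar>u i + v i\<bar>"] by (simp add: abs_triangle_ineq)
  have uvi: "(u i = 0 \<or> u i = c) \<and> (v i = 0 \<or> v i = c) \<and> (u i = 0 \<or> v i = 0)" for i
    using nc[of i] z01[of i] c1 by (simp add: z_def) presburger
  then have ui: "u i = 0 \<or> u i = c" and vi: "v i = 0 \<or> v i = c" and uv0: "u i = 0 \<or> v i = 0" for i by auto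
  note U = nrm_indicator[of c u, OF c1 ui] and V = nrm_indicator[of c v, OF c1 vi]
  have c': "c = 1 \<or> c = -1" using c1 by linarith
  consider "nrm u = 2" "nrm v = 2" | "nrm u = 2" "nrm v = 1" | "nrm u = 1" "nrm v = 2" using uvz u v by linarith
  then show ?thesis
  proof cases
    case 1
    obtain i j k l where *: "i \<noteq> j" "u = sgl c i + sgl c j" "k \<noteq> l" "v = sgl c k + sgl c l" using U(2) V(2) 1 by blast
    have "distinct [i, j, k, l]"
      using uv0[of i] uv0[of j] uv0[of k] uv0[of l] * c0 by (auto simp: sgl_def split: if_splits)
    moreover have "CARD('n) = 5 \<or> CARD('n) = 6" using N n t uvz 1 by linarith
    ultimately show ?thesis using LL c' * by blast
  next
    case 2
    obtain i j k where *: "i \<noteq> j" "u = sgl c i + sgl c j" "v = sgl c k" using U(2) V(1) 2 by blast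
    have "distinct [i, j, k]"
      using uv0[of i] uv0[of j] uv0[of k] * c0 by (auto simp: sgl_def split: if_splits)
    moreover have "CARD('n) = 5" using N n t uvz 2 by linarith
    ultimately show ?thesis using LV c' * by blast
  next
    case 3
    obtain i j k where *: "i \<noteq> j" "v = sgl c i + sgl c j" "u = sgl c k" using U(1) V(2) 3 by blast
    have "distinct [i, j, k]"
      using uv0[of i] uv0[of j] uv0[of k] * c0 by (auto simp: sgl_def split: if_splits)
    moreover have "CARD('n) = 5" using N n t uvz 3 by linarith
    ultimately show ?thesis using VL c' * by blast
  qed
qed

section \<open>Brackets that vanish in every graded Lie algebra\<close>

locale Theta_lie = sl_lie5 L br \<iota>
  for L :: "('f::field_char_0, 'l::ab_group_add) lie" and br and \<iota> :: "'f^'n::finite^'n \<Rightarrow> 'l" +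
  assumes gen: generated
begin

text \<open>A weight that is not congruent to a vector of norm at most two differs from all weights
  of the decomposition, so independence leaves only the zero vector.\<close>

lemma Sp_trivial:
  assumes x: "x \<in> Sp w" and w: "\<And>t c. nrm t \<le> 2 \<Longrightarrow> w \<noteq> t + (\<lambda>_. c)"
  shows "x = 0"
proof -
  let ?wt = "wt :: _ \<Rightarrow> 'f^'n^'n \<Rightarrow> 'f"
  have wn: "?wt w \<notin> ?wt ` W2"
  proof
    assume "?wt w \<in> ?wt ` W2"
    then obtain t where "?wt w = ?wt t" "nrm t \<le> 2" by auto
    then show False using w wt_eq_const[of w t] by metis
  qed
  obtain f where f: "\<And>w. w \<in> W2 \<Longrightarrow> f w \<in> span (Gen w)" "x = (\<Sum>w\<in>W2. f w)"
    using span_weight_decomposition[of x Gen] gen Sp_carrier[OF x] unfolding generated_def by blast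
  have fS: "f w \<in> weight_space \<iota> L (?wt w)" if "w \<in> W2" for w
    using f(1)[OF that] span_minimal[OF Gen_Sp Sp_sub, of w] by (auto simp: wsp_def)
  \<comment> \<open>The homogeneous components of \<open>x\<close> together with \<open>- x\<close>
    at its own additional weight form a vanishing combination.\<close>
  define g where "g \<alpha> = (if \<alpha> = ?wt w then - x else f (the_inv_into W2 ?wt \<alpha>))" for \<alpha>
  have g: "g (?wt w) = - x" by (simp add: g_def)
  have gw: "g (wt t) = f t" if "t \<in> W2" for t
  proof -
    have "wt t \<noteq> ?wt w" using wn that by (metis imageI)
    then show ?thesis using the_inv_into_f_f[OF wt_inj_on that] by (simp add: g_def)
  qed
  have "(\<Sum>\<alpha>\<in>?wt ` W2. g \<alpha>) = (\<Sum>w\<in>W2. g (wt w))" by (rule sum.reindex_cong[OF wt_inj_on]) auto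
  also have "\<dots> = x" using f(2) gw by simp
  finally have "(\<Sum>\<alpha>\<in>insert (?wt w) (?wt ` W2). g \<alpha>) = 0"
    using wn g by (simp add: finite_imageI finite_nrm_le_2)
  then have "g (?wt w) = 0"
    by (rule weight_indep[rotated 3])
      (use x fS gw g in \<open>auto simp: finite_nrm_le_2 wt_outside wsp_def intro!: subspace_neg[OF weight_sub]\<close>)
  then show ?thesis by (simp add: g)
qed

text \<open>In the exceptional coincidences of \<open>weight_sum_cases\<close> all entries of
  \<open>u + v\<close> are at most one in absolute value and \<open>u\<close> has entries of one
  sign only. Either alternative of \<open>ex\<close> rules them out, so the weight of the bracket
  does not occur.\<close>

lemma br_zero:
  assumes x: "x \<in> Sp u" "y \<in> Sp v" and n: "nrm u \<le> 2" "nrm v \<le> 2" "2 < nrm (u + v)"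
    and ex: "(\<exists>a. 2 \<le> \<bar>u a + v a\<bar>) \<or> (\<exists>a b. 0 < u a \<and> u b < 0)"
  shows "br x y = 0"
proof (rule Sp_trivial[OF Sp_br[OF x]])
  fix t :: "'n \<Rightarrow> int" and c assume t: "nrm t \<le> 2"
  show "u + v \<noteq> t + (\<lambda>_. c)"
  proof
    assume eq: "u + v = t + (\<lambda>_. c)"
    show False
      by (rule weight_sum_cases[OF card5 n t eq]) (use ex in \<open>auto simp: sgl_def split: if_splits\<close>)
  qed
qed

text \<open>A root has entries of both signs, so it takes part in no exceptional coincidence. The
  action of the root vectors is therefore under control before the star conditions are used.\<close>

lemma root_br_zero:
  assumes "a \<noteq> b" "x \<in> Sp w" "nrm w \<le> 2" "2 < nrm (sgl 1 a + sgl (-1) b + w)"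
  shows "br (E a b) x = 0"
proof (rule br_zero[OF E_Sp[OF assms(1)] assms(2) _ assms(3,4)])
  show "nrm (sgl 1 a + sgl (-1) b) \<le> 2" using assms(1) by simp
  have "0 < (sgl 1 a + sgl (-1) b) a" "(sgl 1 a + sgl (-1) b) b < 0" using assms(1) by (auto simp: sgl_def)
  then show "(\<exists>c. 2 \<le> \<bar>(sgl 1 a + sgl (-1) b) c + w c\<bar>) \<or>
      (\<exists>c d. 0 < (sgl 1 a + sgl (-1) b) c \<and> (sgl 1 a + sgl (-1) b) d < 0)" by blast
qed

end

section \<open>Isotypic components\<close>

text \<open>The element \<open>e\<^sub>i \<and> e\<^sub>j\<close> in the matrix model of the
  exterior square.\<close>

definition skew_unit :: "'n \<Rightarrow> 'n \<Rightarrow> 'f::field^'n^'n" where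
  "skew_unit i j = unit_matrix i j - unit_matrix j i"

definition weight_vectors ::
  "('f::field, 'n::finite, 'v::ab_group_add) sl_module \<Rightarrow> ('n \<Rightarrow> int) \<Rightarrow> 'v set" where
  "weight_vectors M w = {u \<in> carrier M. \<forall>h\<in>cartan. act M h u = scale M (wt w h) u}"

context sl_lie
begin

text \<open>Module homomorphisms preserve weights, so the weights of \<open>M\<close> bound those of
  its isotypic component.\<close>

lemma isotypic_subset_span:
  fixes M :: "('f, 'n, 'v::ab_group_add) sl_module"
  assumes M: "vector_space (scale M)" and Msub: "module.subspace (scale M) (carrier M)"
    and sp: "carrier M \<subseteq> module.span (scale M) (\<Union>w\<in>S. weight_vectors M w)"
  shows "isotypic_component \<iota> L M \<subseteq> span (\<Union>w\<in>S. Sp w)"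
proof -
  interpret M: vector_space "scale M" by (rule M)
  have M0: "0 \<in> carrier M" using Msub by (rule M.subspace_0)
  have "N \<subseteq> span (\<Union>w\<in>S. Sp w)"
    if N: "N \<subseteq> carrier L" "subspace N"
      and f: "bij_betw f (carrier M) N" "vlinear M L f"
        "\<forall>x\<in>carrier sl. \<forall>v\<in>carrier M. f (act M x v) = bracket L (\<iota> x) (f v)" for N f
  proof
    fix x assume "x \<in> N"
    then obtain u where u: "u \<in> carrier M" "x = f u" using f(1) by (auto simp: bij_betw_def)
    have wv: "f v \<in> Sp w" if v: "v \<in> weight_vectors M w" for v w
    proof -
      have vM: "v \<in> carrier M" and fv: "f v \<in> carrier L" using v f(2) by (auto simp: weight_vectors_def vlinear_def)
      have "br (\<iota> h) (f v) = scale L (wt w h) (f v)" if h: "h \<in> cartan" for h :: "'f^'n^'n"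
      proof -
        have hs: "h \<in> carrier sl" using h cartan_subset_sl by auto
        have "br (\<iota> h) (f v) = f (act M h v)" using f(3) hs vM fv lie_homD(1)[OF hom hs] by (simp add: br_eq)
        also have "act M h v = scale M (wt w h) v" using v h by (simp add: weight_vectors_def)
        also have "f \<dots> = scale L (wt w h) (f v)" using f(2) vM by (simp add: vlinear_def)
        finally show ?thesis .
      qed
      then show ?thesis using fv by (simp add: mem_Sp)
    qed
    have "u \<in> M.span (\<Union>w\<in>S. weight_vectors M w)" using u sp by auto
    then have "u \<in> carrier M \<and> f u \<in> span (\<Union>w\<in>S. Sp w)"
    proof (induction rule: M.span_induct_alt)
      case base
      have "f (0 + 0) = f 0 + f 0" using f(2) M0 unfolding vlinear_def by blast
      then show ?case using M0 by (simp add: span_zero)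
    next
      case (step c x y)
      then obtain w where w: "w \<in> S" "x \<in> weight_vectors M w" by blast
      have x: "x \<in> carrier M" "f x \<in> (\<Union>w\<in>S. Sp w)" using w wv by (auto simp: weight_vectors_def)
      have "f (scale M c x + y) = scale L c (f x) + f y" "scale M c x + y \<in> carrier M"
        using f(2) x(1) step Msub M.subspace_scale M.subspace_add unfolding vlinear_def by auto
      then show ?case using step x(2) by (auto intro: span_add span_scale span_base)
    qed
    then show "x \<in> span (\<Union>w\<in>S. Sp w)" using u by simp
  qed
  then have "\<Union>{N. N \<subseteq> carrier L \<and> subspace N \<and> (\<forall>x\<in>carrier sl. \<forall>v\<in>N. bracket L (\<iota> x) v \<in> N) \<and>
     (\<exists>f. bij_betw f (carrier M) N \<and> vlinear M L f \<and>
        (\<forall>x\<in>carrier sl. \<forall>v\<in>carrier M. f (act M x v) = bracket L (\<iota> x) (f v)))} \<subseteq> span (\<Union>w\<in>S. Sp w)"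
    by blast
  then show ?thesis unfolding isotypic_component_def vspan_def by (rule span_minimal) simp
qed

lemma isotypic_memI:
  fixes M :: "('f, 'n, 'v::ab_group_add) sl_module"
  assumes f: "vlinear M L f" and inj: "inj_on f (carrier M)"
    and act: "\<And>x v. x \<in> carrier sl \<Longrightarrow> v \<in> carrier M \<Longrightarrow> act M x v \<in> carrier M \<and> f (act M x v) = br (\<iota> x) (f v)"
    and M: "0 \<in> carrier M" "\<And>u v. u \<in> carrier M \<Longrightarrow> v \<in> carrier M \<Longrightarrow> u + v \<in> carrier M"
      "\<And>c u. u \<in> carrier M \<Longrightarrow> scale M c u \<in> carrier M"
    and v: "v \<in> carrier M"
  shows "f v \<in> isotypic_component \<iota> L M"
proof -
  note fl = f[unfolded vlinear_def]
  have f0: "f 0 = 0" using fl M(1) by (metis add.right_neutral add_left_cancel)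
  let ?N = "f ` carrier M"
  have sub: "subspace ?N"
    unfolding subspace_def
  proof (intro conjI ballI allI)
    show "0 \<in> ?N" using f0 M(1) by (metis imageI)
    show "x + y \<in> ?N" if "x \<in> ?N" "y \<in> ?N" for x y
      using that fl M(2) by (auto simp: image_iff) metis
    show "scale L c x \<in> ?N" if "x \<in> ?N" for x c
      using that fl M(3) by (auto simp: image_iff) metis
  qed
  have NC: "?N \<subseteq> carrier L" using fl by auto
  have act': "f (act M x v) = bracket L (\<iota> x) (f v)" "bracket L (\<iota> x) (f v) \<in> ?N"
    if "x \<in> carrier sl" "v \<in> carrier M" for x v
    using act[OF that] NC that lie_homD(1)[OF hom] by (auto simp: br_eq[symmetric] image_subset_iff intro: rev_image_eqI)
  have "?N \<in> {N. N \<subseteq> carrier L \<and> subspace N \<and> (\<forall>x\<in>carrier sl. \<forall>v\<in>N. bracket L (\<iota> x) v \<in> N) \<and>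
     (\<exists>f. bij_betw f (carrier M) N \<and> vlinear M L f \<and>
        (\<forall>x\<in>carrier sl. \<forall>v\<in>carrier M. f (act M x v) = bracket L (\<iota> x) (f v)))}"
    using NC sub act' f inj by (auto simp: bij_betw_def)
  then show ?thesis unfolding isotypic_component_def vspan_def using v by (intro span_base) blast
qed

end

section \<open>Weight vectors of the natural module, the exterior square and their duals\<close>

lemma matrix_vector_axis: "(a *v axis i 1) $ j = (a :: 'f::field^'n::finite^'n) $ j $ i"
proof -
  have "(a *v axis i 1) $ j = (\<Sum>k\<in>UNIV. if k = i then a $ j $ i else 0)"
    unfolding matrix_vector_mult_def axis_def vec_lambda_beta by (rule sum.cong) auto
  then show ?thesis by simp
qed

lemma natural_module_span:
  "carrier (natural_module :: ('f::field, 'n::finite, _) sl_module) \<subseteq>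
     module.span (scale natural_module) (\<Union>w\<in>range (sgl 1). weight_vectors natural_module w)"
proof
  fix v :: "'f^'n"
  have hv: "h *v axis i 1 = h $ i $ i *s axis i 1" if "h \<in> cartan" for h :: "'f^'n^'n" and i
  proof (intro iffD2[OF vec_eq_iff] allI)
    fix j
    show "(h *v axis i 1) $ j = (h $ i $ i *s axis i 1) $ j"
      unfolding matrix_vector_axis using that by (auto simp: axis_def cartan_def)
  qed
  have "(axis i 1 :: 'f^'n) \<in> weight_vectors natural_module (sgl 1 i)" for i :: 'n
    by (auto simp: weight_vectors_def natural_module_def wt_sgl hv)
  then have "(\<Sum>i\<in>UNIV. v $ i *s axis i 1) \<in> vec.span (\<Union>w\<in>range (sgl 1). weight_vectors natural_module w)"
    by (intro vec.span_sum vec.span_scale vec.span_base) blast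
  then show "v \<in> module.span (scale natural_module) (\<Union>w\<in>range (sgl 1). weight_vectors natural_module w)"
    by (simp add: basis_expansion natural_module_def)
qed

lemma sum_fun_apply: "sum g A x = (\<Sum>i\<in>A. g i x)"
  by (induction A rule: infinite_finite_induct) auto

lemma vlinear_sum:
  assumes f: "vlinear M N f" and "\<And>i. i \<in> A \<Longrightarrow> g i \<in> carrier M" and "finite A"
    and M: "0 \<in> carrier M" "\<And>u v. u \<in> carrier M \<Longrightarrow> v \<in> carrier M \<Longrightarrow> u + v \<in> carrier M"
  shows "f (sum g A) = (\<Sum>i\<in>A. f (g i)) \<and> sum g A \<in> carrier M"
  using assms(3,2)
proof (induction A rule: finite_induct)
  case empty
  have "f (0 + 0) = f 0 + f 0" using f M(1) unfolding vlinear_def by blast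
  then show ?case using M(1) by simp
next
  case (insert a A)
  then show ?case using f M unfolding vlinear_def by simp
qed

lemma fun_scale_vector_space: "vector_space (\<lambda>c (f :: 'v \<Rightarrow> 'f::field) v. c * f v)"
  by unfold_locales (auto simp: fun_eq_iff algebra_simps)

lemma dual_module_vector_space: "vector_space (scale (dual_module M))"
  by (simp add: dual_module_def fun_scale_vector_space)

lemma dual_module_subspace: "module.subspace (scale (dual_module M)) (carrier (dual_module M))"
proof -
  interpret S: vector_space "scale (dual_module M)" by (rule dual_module_vector_space)
  show ?thesis unfolding S.subspace_def
    by (auto simp: dual_module_def vlinear_def algebra_simps)
qed

lemma dual_natural_expansion:
  assumes "f \<in> carrier (dual_module (natural_module :: ('f::field, 'n::finite, 'f^'n) sl_module))"
  shows "f v = (\<Sum>i\<in>UNIV. f (axis i 1) * v $ i)"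
proof -
  have f: "vlinear natural_module \<lparr>carrier = UNIV, scale = (*)\<rparr> f" using assms by (simp add: dual_module_def)
  have "f (\<Sum>i\<in>UNIV. v $ i *s axis i 1) = (\<Sum>i\<in>UNIV. f (v $ i *s axis i 1))"
    by (rule vlinear_sum[OF f, THEN conjunct1]) (auto simp: natural_module_def)
  also have "\<dots> = (\<Sum>i\<in>UNIV. f (axis i 1) * v $ i)"
    using f by (simp add: vlinear_def natural_module_def mult.commute)
  finally show ?thesis by (simp add: basis_expansion)
qed

lemma dual_natural_span:
  "carrier (dual_module (natural_module :: ('f::field, 'n::finite, _) sl_module)) \<subseteq>
     module.span (scale (dual_module natural_module))
       (\<Union>w\<in>range (sgl (-1)). weight_vectors (dual_module natural_module) w)"
proof
  interpret S: vector_space "\<lambda>c (f :: 'f^'n \<Rightarrow> 'f) v. c * f v" by (rule fun_scale_vector_space)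
  fix f :: "'f^'n \<Rightarrow> 'f" assume f: "f \<in> carrier (dual_module natural_module)"
  have hv: "(h *v v) $ i = h $ i $ i * v $ i" if "h \<in> cartan" for h :: "'f^'n^'n" and i v
  proof -
    have "(h *v v) $ i = (\<Sum>j\<in>UNIV. if j = i then h $ i $ i * v $ i else 0)"
      unfolding matrix_vector_mult_def vec_lambda_beta using that by (intro sum.cong) (auto simp: cartan_def)
    then show ?thesis by simp
  qed
  have "(\<lambda>v. v $ i :: 'f) \<in> weight_vectors (dual_module natural_module) (sgl (-1) i)" for i :: 'n
    by (auto simp: weight_vectors_def dual_module_def natural_module_def wt_sgl vlinear_def fun_eq_iff hv)
  then have "(\<Sum>i\<in>UNIV. (\<lambda>v. f (axis i 1) * v $ i)) \<in>
      S.span (\<Union>w\<in>range (sgl (-1)). weight_vectors (dual_module natural_module) w)"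
    by (intro S.span_sum S.span_scale[where x = "\<lambda>v. v $ _"] S.span_base) blast
  moreover have "(\<Sum>i\<in>UNIV. (\<lambda>v. f (axis i 1) * v $ i)) = f"
    unfolding fun_eq_iff sum_fun_apply by (intro allI dual_natural_expansion[OF f, symmetric])
  ultimately show "f \<in> module.span (scale (dual_module natural_module))
       (\<Union>w\<in>range (sgl (-1)). weight_vectors (dual_module natural_module) w)"
    by (simp add: dual_module_def)
qed

lemma exterior_square_iff:
  "m \<in> carrier (exterior_square :: ('f::field, 'n::finite, 'f^'n^'n) sl_module) \<longleftrightarrow> (\<forall>i j. m $ i $ j = - m $ j $ i)"
  by (auto simp: exterior_square_def transpose_def vec_eq_iff)

text \<open>The sum runs over ordered pairs, so each basis element
  \<open>e\<^sub>i \<and> e\<^sub>j\<close> is met twice; this accounts for the factor 1/2.\<close>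

lemma skew_expansion:
  fixes m :: "'f::field_char_0^'n::finite^'n"
  assumes "transpose m = - m"
  shows "m = (\<Sum>z\<in>UNIV. (\<chi> a b. (m $ fst z $ snd z / 2) * skew_unit (fst z) (snd z) $ a $ b))"
proof (intro iffD2[OF vec_eq_iff] allI)
  fix a b
  have sk: "m $ b $ a = - m $ a $ b"
  proof -
    have "transpose m $ a $ b = (- m) $ a $ b" using assms by simp
    then show ?thesis by (simp add: transpose_def)
  qed
  have "(\<Sum>z\<in>UNIV. (m $ fst z $ snd z / 2) * skew_unit (fst z) (snd z) $ a $ b) =
    (\<Sum>z\<in>UNIV. (if z = (a, b) then m $ a $ b / 2 else 0) + (if z = (b, a) then - (m $ b $ a / 2) else 0))"
  proof (rule sum.cong[OF refl])
    fix z :: "'n \<times> 'n"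
    obtain i j where z: "z = (i, j)" by (cases z)
    have su: "skew_unit i j $ a $ b = (if a = i \<and> b = j then 1 else 0) - (if a = j \<and> b = i then 1 else 0 :: 'f)"
      by (simp only: skew_unit_def vector_minus_component unit_matrix_def vec_lambda_beta)
    show "(m $ fst z $ snd z / 2) * skew_unit (fst z) (snd z) $ a $ b =
      (if z = (a, b) then m $ a $ b / 2 else 0) + (if z = (b, a) then - (m $ b $ a / 2) else 0)"
      unfolding z fst_conv snd_conv su prod.inject
    proof -
      have h1: "x * (if P then 1 else 0) = (if P then x else 0)" for P and x :: 'f by simp
      have h3: "(if a = i \<and> b = j then m $ i $ j / 2 else 0) = (if i = a \<and> j = b then m $ a $ b / 2 else 0)"
        by (rule if_cong) auto
      have h4: "(if a = j \<and> b = i then m $ i $ j / 2 else 0) = (if i = b \<and> j = a then m $ b $ a / 2 else 0)"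
        by (rule if_cong) auto
      have h5: "(if P then - x else 0) = - (if P then x else 0)" for P and x :: 'f by simp
      show "m $ i $ j / 2 * ((if a = i \<and> b = j then 1 else 0) - (if a = j \<and> b = i then 1 else 0)) =
        (if i = a \<and> j = b then m $ a $ b / 2 else 0) + (if i = b \<and> j = a then - (m $ b $ a / 2) else 0)"
        unfolding h5 add_uminus_conv_diff right_diff_distrib h1 h3 h4 ..
    qed
  qed
  also have "\<dots> = m $ a $ b / 2 - m $ b $ a / 2" by (simp add: sum.distrib)
  also have "\<dots> = m $ a $ b" unfolding sk by simp
  finally show "m $ a $ b = (\<Sum>z\<in>UNIV. (\<chi> a b. (m $ fst z $ snd z / 2) * skew_unit (fst z) (snd z) $ a $ b)) $ a $ b"
    by simp
qed

lemma skew_unit_skew: "transpose (skew_unit i j) = - skew_unit i j"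
  unfolding vec_eq_iff transpose_def skew_unit_def unit_matrix_def vector_minus_component vector_uminus_component
    vec_lambda_beta minus_diff_eq
  by (simp only: conj_commute simp_thms)

lemma skew_unit_self: "skew_unit i i = 0" by (simp add: skew_unit_def)

lemma cartan_act_skew:
  fixes m :: "'f::field^'n::finite^'n"
  assumes "h \<in> cartan"
  shows "(h ** m + m ** transpose h) $ a $ b = (h $ a $ a + h $ b $ b) * m $ a $ b"
proof -
  have "(h ** m) $ a $ b = (\<Sum>k\<in>UNIV. if k = a then h $ a $ a * m $ a $ b else 0)"
    unfolding matrix_matrix_mult_def vec_lambda_beta using assms by (intro sum.cong) (auto simp: cartan_def)
  moreover have "(m ** transpose h) $ a $ b = (\<Sum>k\<in>UNIV. if k = b then h $ b $ b * m $ a $ b else 0)"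
    unfolding matrix_matrix_mult_def transpose_def vec_lambda_beta using assms by (intro sum.cong) (auto simp: cartan_def)
  ultimately show ?thesis by (simp add: algebra_simps)
qed

abbreviation "pair_weights s \<equiv> {sgl s i + sgl s j | i j. i \<noteq> j}"

lemma mat_scale_vector_space: "vector_space (\<lambda>c (m :: 'f::field^'n::finite^'n). \<chi> i j. c * m $ i $ j)"
  by unfold_locales (auto simp: vec_eq_iff algebra_simps)

lemma exterior_square_vector_space: "vector_space (scale exterior_square)"
  by (simp add: exterior_square_def mat_scale_vector_space)

lemma exterior_square_subspace:
  "module.subspace (scale exterior_square) (carrier (exterior_square :: ('f::field, 'n::finite, 'f^'n^'n) sl_module))"
proof -
  interpret S: vector_space "scale (exterior_square :: ('f, 'n, 'f^'n^'n) sl_module)"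
    by (rule exterior_square_vector_space)
  have "transpose (x + y) = transpose x + transpose y" "transpose (\<chi> i j. c * x $ i $ j) = (\<chi> i j. c * transpose x $ i $ j)"
    "(\<chi> i j. c * (- x) $ i $ j) = - (\<chi> i j. c * x $ i $ j)"
    for x y :: "'f^'n^'n" and c by (simp_all add: transpose_def vec_eq_iff)
  then show ?thesis unfolding S.subspace_def by (simp add: exterior_square_def) (simp add: transpose_def vec_eq_iff)
qed

lemma exterior_square_closed:
  fixes u v :: "'f::field^'n::finite^'n"
  assumes "u \<in> carrier exterior_square"
  shows "v \<in> carrier exterior_square \<Longrightarrow> u + v \<in> carrier exterior_square"
    "(\<chi> a b. c * u $ a $ b) \<in> carrier exterior_square" "(0 :: 'f^'n^'n) \<in> carrier exterior_square"
proof -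
  interpret S: vector_space "scale (exterior_square :: ('f, 'n, 'f^'n^'n) sl_module)"
    by (rule exterior_square_vector_space)
  show "u + v \<in> carrier exterior_square" if "v \<in> carrier exterior_square"
    using S.subspace_add[OF exterior_square_subspace assms that] .
  show "(\<chi> a b. c * u $ a $ b) \<in> carrier exterior_square"
    using S.subspace_scale[OF exterior_square_subspace assms, of c] by (simp add: exterior_square_def)
  show "(0 :: 'f^'n^'n) \<in> carrier exterior_square" by (rule S.subspace_0[OF exterior_square_subspace])
qed

lemma exterior_square_span:
  "carrier (exterior_square :: ('f::field_char_0, 'n::finite, _) sl_module) \<subseteq>
     module.span (scale exterior_square) (\<Union>w\<in>pair_weights 1. weight_vectors exterior_square w)"
proof
  interpret S: vector_space "\<lambda>c (m :: 'f^'n^'n). \<chi> i j. c * m $ i $ j" by (rule mat_scale_vector_space)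
  fix m :: "'f^'n^'n" assume "m \<in> carrier exterior_square"
  then have m: "transpose m = - m" by (simp add: exterior_square_def)
  have *: "(skew_unit i j :: 'f^'n^'n) \<in> S.span (\<Union>w\<in>pair_weights 1. weight_vectors exterior_square w)" for i j :: 'n
  proof (cases "i = j")
    case False
    have "h ** skew_unit i j + skew_unit i j ** transpose h = (\<chi> a b. wt (sgl 1 i + sgl 1 j) h * skew_unit i j $ a $ b)"
      if "h \<in> cartan" for h :: "'f^'n^'n"
      unfolding vec_eq_iff using that
    proof (intro allI)
      fix a b
      have "(h $ a $ a + h $ b $ b) * skew_unit i j $ a $ b = (h $ i $ i + h $ j $ j) * skew_unit i j $ a $ b"
        by (cases "a = i \<and> b = j \<or> a = j \<and> b = i")
          (auto simp: skew_unit_def unit_matrix_def simp del: if_split_asm split del: if_split)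
      then show "(h ** skew_unit i j + skew_unit i j ** transpose h) $ a $ b =
          (\<chi> a b. wt (sgl 1 i + sgl 1 j) h * skew_unit i j $ a $ b) $ a $ b"
        unfolding cartan_act_skew[OF that] vec_lambda_beta using that by (simp only: wt_add plus_fun_apply wt_sgl) simp
    qed
    then have "(skew_unit i j :: 'f^'n^'n) \<in> weight_vectors exterior_square (sgl 1 i + sgl 1 j)"
      by (auto simp: weight_vectors_def exterior_square_def skew_unit_skew)
    then show ?thesis using False by (intro S.span_base) blast
  qed (simp add: skew_unit_self S.span_zero)
  have sc: "scale exterior_square = (\<lambda>c (m :: 'f^'n^'n). \<chi> i j. c * m $ i $ j)" by (simp add: exterior_square_def)
  show "m \<in> module.span (scale exterior_square) (\<Union>w\<in>pair_weights 1. weight_vectors exterior_square w)"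
    unfolding sc by (subst skew_expansion[OF m]) (intro S.span_sum S.span_scale *)
qed

lemma dual_skew_expansion:
  assumes f: "f \<in> carrier (dual_module (exterior_square :: ('f::field_char_0, 'n::finite, _) sl_module))"
    and m: "m \<in> carrier exterior_square"
  shows "f m = (\<Sum>z\<in>UNIV. f (skew_unit (fst z) (snd z)) / 2 * m $ fst z $ snd z)"
proof -
  have f': "vlinear exterior_square \<lparr>carrier = UNIV, scale = (*)\<rparr> f" using f by (simp add: dual_module_def)
  have mt: "transpose m = - m" using m by (simp add: exterior_square_def)
  have sk: "skew_unit i j \<in> carrier exterior_square" for i j :: 'n by (simp add: exterior_square_def skew_unit_skew)
  have fs: "f (\<chi> a b. c * u $ a $ b) = c * f u" if "u \<in> carrier exterior_square" for c u
  proof -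
    have "f (scale exterior_square c u) = c * f u" using f' that unfolding vlinear_def by simp
    then show ?thesis by (simp add: exterior_square_def)
  qed
  have "f m = f (\<Sum>z\<in>UNIV. (\<chi> a b. (m $ fst z $ snd z / 2) * skew_unit (fst z) (snd z) $ a $ b))"
    using skew_expansion[OF mt] by simp
  also have "\<dots> = (\<Sum>z\<in>UNIV. f (\<chi> a b. (m $ fst z $ snd z / 2) * skew_unit (fst z) (snd z) $ a $ b))"
  proof (rule vlinear_sum[OF f', THEN conjunct1])
    show "(\<chi> a b. (m $ fst z $ snd z / 2) * skew_unit (fst z) (snd z) $ a $ b) \<in> carrier exterior_square" for z
      by (rule exterior_square_closed(2)[OF sk])
    show "(0 :: 'f^'n^'n) \<in> carrier exterior_square" by (rule exterior_square_closed(3)[OF m])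
    show "u + v \<in> carrier exterior_square" if "u \<in> carrier exterior_square" "v \<in> carrier exterior_square"
      for u v :: "'f^'n^'n" using exterior_square_closed(1)[OF that] .
  qed simp
  also have "\<dots> = (\<Sum>z\<in>UNIV. f (skew_unit (fst z) (snd z)) / 2 * m $ fst z $ snd z)"
    unfolding fs[OF sk] by (simp add: mult.commute)
  finally show ?thesis .
qed

lemma dual_exterior_span:
  "carrier (dual_module (exterior_square :: ('f::field_char_0, 'n::finite, _) sl_module)) \<subseteq>
     module.span (scale (dual_module exterior_square))
       (\<Union>w\<in>pair_weights (-1). weight_vectors (dual_module exterior_square) w)"
proof
  interpret S: vector_space "\<lambda>c (f :: 'f^'n^'n \<Rightarrow> 'f) v. c * f v" by (rule fun_scale_vector_space)
  let ?E = "exterior_square :: ('f, 'n, 'f^'n^'n) sl_module"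
  fix f :: "'f^'n^'n \<Rightarrow> 'f" assume f: "f \<in> carrier (dual_module exterior_square)"
  \<comment> \<open>The coordinate functionals are cut off outside the skew matrices because
    elements of \<open>dual_module\<close> vanish outside the carrier.\<close>
  define c where "c i j = (\<lambda>m. if m \<in> carrier ?E then m $ i $ j else 0)" for i j
  have sk: "m $ i $ j = - m $ j $ i" if "m \<in> carrier ?E" for m :: "'f^'n^'n" and i j
    using that unfolding exterior_square_iff by blast
  note cl = exterior_square_closed
  have lin: "vlinear ?E \<lparr>carrier = UNIV, scale = (*)\<rparr> (c i j)" for i j
  proof -
    have "scale ?E k m = (\<chi> a b. k * m $ a $ b)" for k m by (simp add: exterior_square_def)
    then show ?thesis unfolding vlinear_def by (simp add: c_def cl)
  qed
  have *: "c i j \<in> S.span (\<Union>w\<in>pair_weights (-1). weight_vectors (dual_module exterior_square) w)" for i j :: 'n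
  proof (cases "i = j")
    case False
    have "act (dual_module exterior_square) h (c i j) = (\<lambda>m. wt (sgl (-1) i + sgl (-1) j) h * c i j m)"
      if h: "h \<in> cartan" for h :: "'f^'n^'n"
    proof
      fix m :: "'f^'n^'n"
      have cl': "h ** m + m ** transpose h \<in> carrier ?E" if "m \<in> carrier ?E"
        unfolding exterior_square_iff cartan_act_skew[OF h]
      proof (intro allI)
        fix a b
        show "(h $ a $ a + h $ b $ b) * m $ a $ b = - ((h $ b $ b + h $ a $ a) * m $ b $ a)"
          using sk[OF that, of a b] by (simp add: add.commute)
      qed
      show "act (dual_module exterior_square) h (c i j) m = wt (sgl (-1) i + sgl (-1) j) h * c i j m"
      proof (cases "m \<in> carrier ?E")
        case True
        have "act (dual_module ?E) h (c i j) m = - c i j (h ** m + m ** transpose h)"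
          using True by (simp add: dual_module_def) (simp add: exterior_square_def)
        also have "\<dots> = - ((h $ i $ i + h $ j $ j) * m $ i $ j)"
          using cl'[OF True] by (simp only: c_def if_True cartan_act_skew[OF h])
        finally show ?thesis using True h by (simp add: c_def wt_add wt_sgl algebra_simps)
      next
        case False
        then show ?thesis by (simp add: dual_module_def c_def)
      qed
    qed
    moreover have "c i j \<in> carrier (dual_module ?E)" using lin by (simp add: dual_module_def) (simp add: c_def)
    moreover have "scale (dual_module ?E) k (c i j) = (\<lambda>m. k * c i j m)" for k by (simp add: dual_module_def)
    ultimately have "c i j \<in> weight_vectors (dual_module exterior_square) (sgl (-1) i + sgl (-1) j)"
      by (simp add: weight_vectors_def)
    then show ?thesis using False by (intro S.span_base) blast
  next
    case True
    have "c i i = 0" using sk[of _ i i] by (auto simp: c_def fun_eq_iff)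
    then show ?thesis using True by (simp add: S.span_zero)
  qed
  have "f = (\<Sum>z\<in>UNIV. (\<lambda>m. f (skew_unit (fst z) (snd z)) / 2 * c (fst z) (snd z) m))"
  proof
    fix m
    show "f m = (\<Sum>z\<in>UNIV. (\<lambda>m. f (skew_unit (fst z) (snd z)) / 2 * c (fst z) (snd z) m)) m"
    proof (cases "m \<in> carrier ?E")
      case True then show ?thesis
        unfolding sum_fun_apply by (subst dual_skew_expansion[OF f True]) (simp add: c_def)
    next
      case False then show ?thesis using f by (simp add: dual_module_def c_def sum_fun_apply)
    qed
  qed
  also have "\<dots> \<in> S.span (\<Union>w\<in>pair_weights (-1). weight_vectors (dual_module exterior_square) w)"
    by (rule S.span_sum) (rule S.span_scale[OF *])
  finally show "f \<in> module.span (scale (dual_module exterior_square))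
       (\<Union>w\<in>pair_weights (-1). weight_vectors (dual_module exterior_square) w)"
    by (simp add: dual_module_def)
qed

context sl_lie5
begin

text \<open>The weights in each isotypic component are sums of one or two unit vectors with a common
  sign. For the components that are paired in the star conditions the signs agree, so norms add
  without cancellation to three or four.\<close>

lemma norm_graded_star:
  assumes NG: "norm_graded \<iota> L"
  shows "star_conditions \<iota> L"
proof -
  define V V' where "V = isotypic_component \<iota> L natural_module" and "V' = isotypic_component \<iota> L (dual_module natural_module)"
  define \<Lambda> \<Lambda>' where "\<Lambda> = isotypic_component \<iota> L exterior_square" and "\<Lambda>' = isotypic_component \<iota> L (dual_module exterior_square)"
  have V: "V \<subseteq> span (\<Union>w\<in>range (sgl 1). Sp w)" unfolding V_def
    by (rule isotypic_subset_span[OF _ _ natural_module_span])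
      (simp_all add: natural_module_def vec.vector_space_axioms vec.subspace_UNIV)
  have V': "V' \<subseteq> span (\<Union>w\<in>range (sgl (-1)). Sp w)" unfolding V'_def
    by (rule isotypic_subset_span[OF _ _ dual_natural_span])
      (rule dual_module_vector_space, rule dual_module_subspace)
  have \<Lambda>: "\<Lambda> \<subseteq> span (\<Union>w\<in>pair_weights 1. Sp w)" unfolding \<Lambda>_def
    by (rule isotypic_subset_span[OF _ _ exterior_square_span])
      (rule exterior_square_vector_space, rule exterior_square_subspace)
  have \<Lambda>': "\<Lambda>' \<subseteq> span (\<Union>w\<in>pair_weights (-1). Sp w)" unfolding \<Lambda>'_def
    by (rule isotypic_subset_span[OF _ _ dual_exterior_span])
      (rule dual_module_vector_space, rule dual_module_subspace)
  have z: "br x y = 0" if "x \<in> span (\<Union>w\<in>A. Sp w)" "y \<in> span (\<Union>w\<in>B. Sp w)"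
    and AB: "\<And>v w. v \<in> A \<Longrightarrow> w \<in> B \<Longrightarrow> nrm v \<le> 2 \<and> nrm w \<le> 2 \<and> 2 < nrm (v + w)" for x y A B
  proof -
    have "br x y = 0" if xy: "x \<in> (\<Union>w\<in>A. Sp w)" "y \<in> (\<Union>w\<in>B. Sp w)" for x y
    proof -
      obtain v w where vw: "v \<in> A" "x \<in> Sp v" "w \<in> B" "y \<in> Sp w" using xy by blast
      then have "bracket L x y = 0" using NG AB[OF vw(1,3)] unfolding norm_graded_def by blast
      then show ?thesis using vw by (simp add: br_eq Sp_carrier)
    qed
    then have "br x y \<in> {0}"
      by (intro span_br_subset[OF subspace_single_0 _ that(1,2)]) (simp only: singleton_iff)
    then show ?thesis by simp
  qed
  have same: "nrm (u + v) = nrm u + nrm v" if "\<And>i. 0 \<le> u i * v i" for u v :: "'n \<Rightarrow> int"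
  proof -
    have "\<bar>u i + v i\<bar> = \<bar>u i\<bar> + \<bar>v i\<bar>" for i using that[of i] by (auto simp: zero_le_mult_iff)
    then show ?thesis by (simp add: nrm_def sum.distrib)
  qed
  have nn: "0 \<le> sgl s i k * sgl s j k" for s and i j k :: 'n by (simp add: sgl_def)
  have nrm4: "nrm (sgl s i + sgl s j + (sgl s k + sgl s l)) = 4" "nrm (sgl s i + sgl s j + sgl s k) = 3"
    if "s = 1 \<or> s = -1" for s and i j k l :: 'n
    using that by (auto simp: same nn algebra_simps add_nonneg_nonneg)
  have LL: "br x y = 0" if "x \<in> span (\<Union>w\<in>pair_weights s. Sp w)" "y \<in> span (\<Union>w\<in>pair_weights s. Sp w)" "s = 1 \<or> s = -1" for x y s
    by (rule z[OF that(1,2)]) (use nrm4 that(3) in auto)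
  have LV: "br x y = 0" if "x \<in> span (\<Union>w\<in>pair_weights s. Sp w)" "y \<in> span (\<Union>w\<in>range (sgl s). Sp w)" "s = 1 \<or> s = -1" for x y s
    by (rule z[OF that(1,2)]) (use nrm4 that(3) in auto)
  have iso: "x \<in> carrier L" if "x \<in> span (\<Union>w\<in>A. Sp w)" for x A
    using span_minimal[OF _ carrier_sub, of "\<Union>w\<in>A. Sp w"] Sp_carrier that by blast
  have bs: "bracket_span L X Y = {0}" if "\<And>x y. x \<in> X \<Longrightarrow> y \<in> Y \<Longrightarrow> bracket L x y = 0" for X Y
  proof -
    have "span {bracket L x y |x y. x \<in> X \<and> y \<in> Y} \<subseteq> {0}" using that by (intro span_minimal) auto
    then show ?thesis using span_zero unfolding bracket_span_def vspan_def by blast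
  qed
  have add: "bracket L x (y + z) = br x y + br x z" if "x \<in> carrier L" "y \<in> carrier L" "z \<in> carrier L" for x y z
    using that by (simp add: br_eq[symmetric] subspace_add[OF carrier_sub] br_add_right)
  have LLb: "bracket L x y = 0" if "x \<in> span (\<Union>w\<in>pair_weights s. Sp w)" "y \<in> span (\<Union>w\<in>pair_weights s. Sp w)"
      "s = 1 \<or> s = -1" for x y s
    using LL[OF that] br_eq[OF iso[OF that(1)] iso[OF that(2)]] by simp
  have "bracket_span L \<Lambda> \<Lambda> = {0}"
    by (rule bs, rule LLb[where s = 1]) (use \<Lambda> in auto)
  moreover have "bracket_span L \<Lambda>' \<Lambda>' = {0}"
    by (rule bs, rule LLb[where s = "-1"]) (use \<Lambda>' in auto)
  moreover have "bracket_span L \<Lambda> {x + y |x y. x \<in> \<Lambda> \<and> y \<in> V} = {0}"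
  proof (rule bs, clarify)
    fix x y z assume "x \<in> \<Lambda>" "y \<in> \<Lambda>" "z \<in> V"
    then have *: "x \<in> span (\<Union>w\<in>pair_weights 1. Sp w)" "y \<in> span (\<Union>w\<in>pair_weights 1. Sp w)" "z \<in> span (\<Union>w\<in>range (sgl 1). Sp w)"
      using \<Lambda> V by auto
    show "bracket L x (y + z) = 0" using LL[OF *(1,2)] LV[OF *(1,3)] add[OF *[THEN iso]] by simp
  qed
  moreover have "bracket_span L \<Lambda>' {x + y |x y. x \<in> \<Lambda>' \<and> y \<in> V'} = {0}"
  proof (rule bs, clarify)
    fix x y z assume "x \<in> \<Lambda>'" "y \<in> \<Lambda>'" "z \<in> V'"
    then have *: "x \<in> span (\<Union>w\<in>pair_weights (-1). Sp w)" "y \<in> span (\<Union>w\<in>pair_weights (-1). Sp w)" "z \<in> span (\<Union>w\<in>range (sgl (-1)). Sp w)"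
      using \<Lambda>' V' by auto
    show "bracket L x (y + z) = 0" using LL[OF *(1,2)] LV[OF *(1,3)] add[OF *[THEN iso]] by simp
  qed
  ultimately show ?thesis unfolding star_conditions_def Let_def V_def V'_def \<Lambda>_def \<Lambda>'_def by simp
qed

end

lemma uminus_image: "(\<And>v. v \<in> A \<Longrightarrow> - v \<in> A) \<Longrightarrow> uminus ` A = A" for A :: "'v::group_add set"
  by (metis image_subsetI minus_minus rev_image_eqI subsetI subset_antisym)

section \<open>Entries and action of the skew matrix units\<close>

lemma pair_delta_sum:
  fixes f g :: "'n::finite \<Rightarrow> 'n \<Rightarrow> 'v::comm_monoid_add"
  shows "(\<Sum>z\<in>UNIV. (if snd z = l then f (fst z) (snd z) else 0) + (if fst z = k then g (fst z) (snd z) else 0)) =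
    (\<Sum>i\<in>UNIV. f i l) + (\<Sum>j\<in>UNIV. g k j)"
proof -
  have *: "(\<Sum>z\<in>UNIV. h (fst z) (snd z)) = (\<Sum>i\<in>UNIV. \<Sum>j\<in>UNIV. h i j)" for h :: "'n \<Rightarrow> 'n \<Rightarrow> 'v"
    by (simp add: sum.cartesian_product case_prod_beta flip: UNIV_Times_UNIV)
  have "(\<Sum>z\<in>UNIV. if fst z = k then g (fst z) (snd z) else 0) = (\<Sum>j\<in>UNIV. \<Sum>i\<in>UNIV. if i = k then g i j else 0)"
    using *[of "\<lambda>i j. if i = k then g i j else 0"] sum.swap[of "\<lambda>i j. if i = k then g i j else 0" UNIV UNIV] by simp
  moreover have "(\<Sum>z\<in>UNIV. if snd z = l then f (fst z) (snd z) else 0) = (\<Sum>i\<in>UNIV. \<Sum>j\<in>UNIV. if j = l then f i j else 0)"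
    using *[of "\<lambda>i j. if j = l then f i j else 0"] by simp
  ultimately show ?thesis by (simp add: sum.distrib)
qed

lemma skew_unit_entry:
  "skew_unit k l $ p $ q = (if p = k \<and> q = l then 1 else 0) - (if p = l \<and> q = k then 1 else 0 :: 'f::field)"
  by (simp only: skew_unit_def vector_minus_component unit_matrix_def vec_lambda_beta)

lemma skew_unit_sum:
  "(\<Sum>m\<in>UNIV. f m * skew_unit k l $ m $ q) = (if q = l then f k else 0) - (if q = k then f l else 0 :: 'f::field)"
proof -
  have "(\<Sum>m\<in>UNIV. f m * skew_unit k l $ m $ q) =
    (\<Sum>m\<in>UNIV. (if m = k then (if q = l then f k else 0) else 0) - (if m = l then (if q = k then f l else 0) else 0))"
    by (rule sum.cong) (simp_all only: skew_unit_entry right_diff_distrib, simp)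
  then show ?thesis by (simp add: sum_subtractf)
qed

text \<open>The entries are antisymmetrized Kronecker symbols, which are symmetric in the two index
  pairs.\<close>

lemma skew_unit_swap: "skew_unit i l $ p $ q = (skew_unit p q $ i $ l :: 'f::field)"
proof -
  have "(p = i \<and> q = l) = (i = p \<and> l = q)" "(p = l \<and> q = i) = (i = q \<and> l = p)" by auto
  then show ?thesis by (simp only: skew_unit_entry)
qed

lemma skew_unit_neg: "skew_unit l k $ p $ q = - (skew_unit k l $ p $ q :: 'f::field)"
  by (simp only: skew_unit_entry minus_diff_eq)

lemma exterior_square_act:
  fixes u :: "'f::field^'n::finite^'n"
  assumes u: "u \<in> carrier exterior_square"
  shows "a ** u + u ** transpose a \<in> carrier exterior_square"
  unfolding exterior_square_iff
proof (intro allI)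
  fix p q
  have sk: "u $ i $ j = - u $ j $ i" for i j using u unfolding exterior_square_iff by blast
  have "(\<Sum>k\<in>UNIV. a $ p $ k * u $ k $ q) = - (\<Sum>k\<in>UNIV. u $ q $ k * a $ p $ k)" for p q
    unfolding sum_negf[symmetric] by (rule sum.cong[OF refl]) (subst sk, simp add: mult.commute)
  then show "(a ** u + u ** transpose a) $ p $ q = - (a ** u + u ** transpose a) $ q $ p"
    by (simp add: matrix_matrix_mult_def transpose_def)
qed

text \<open>This is \<open>a(e\<^sub>k \<and> e\<^sub>l) = a e\<^sub>k \<and> e\<^sub>l + e\<^sub>k
  \<and> a e\<^sub>l\<close>, expanded over ordered pairs.\<close>

lemma skew_unit_act:
  fixes a :: "'f::field^'n::finite^'n"
  shows "a ** skew_unit k l + skew_unit k l ** transpose a = (\<Sum>z\<in>UNIV. (\<chi> p q.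
    ((if snd z = l then a $ fst z $ k else 0) + (if fst z = k then a $ snd z $ l else 0)) * skew_unit (fst z) (snd z) $ p $ q))"
proof (intro iffD2[OF vec_eq_iff] allI)
  fix p q
  have "(\<Sum>z\<in>UNIV. ((if snd z = l then a $ fst z $ k else 0) + (if fst z = k then a $ snd z $ l else 0)) * skew_unit (fst z) (snd z) $ p $ q)
    = (\<Sum>z\<in>UNIV. (if snd z = l then a $ fst z $ k * skew_unit (fst z) (snd z) $ p $ q else 0)
        + (if fst z = k then a $ snd z $ l * skew_unit (fst z) (snd z) $ p $ q else 0))"
    by (rule sum.cong) (simp_all add: distrib_right)
  also have "\<dots> = (\<Sum>i\<in>UNIV. a $ i $ k * skew_unit i l $ p $ q) + (\<Sum>j\<in>UNIV. a $ j $ l * skew_unit k j $ p $ q)"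
    by (rule pair_delta_sum)
  also have "(\<Sum>i\<in>UNIV. a $ i $ k * skew_unit i l $ p $ q) = (if l = q then a $ p $ k else 0) - (if l = p then a $ q $ k else 0)"
    unfolding skew_unit_swap[of _ l] by (rule skew_unit_sum)
  also have "(\<Sum>j\<in>UNIV. a $ j $ l * skew_unit k j $ p $ q) = - ((if k = q then a $ p $ l else 0) - (if k = p then a $ q $ l else 0))"
  proof -
    have "skew_unit k j $ p $ q = - (skew_unit p q $ j $ k :: 'f)" for j using skew_unit_neg[of k j] skew_unit_swap[of j k] by metis
    then show ?thesis using skew_unit_sum[of "\<lambda>j. a $ j $ l" p q k] by (simp add: sum_negf)
  qed
  finally have R: "(\<Sum>z\<in>UNIV. ((if snd z = l then a $ fst z $ k else 0) + (if fst z = k then a $ snd z $ l else 0)) * skew_unit (fst z) (snd z) $ p $ q)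
    = (if l = q then a $ p $ k else 0) - (if l = p then a $ q $ k else 0) + - ((if k = q then a $ p $ l else 0) - (if k = p then a $ q $ l else 0))" .
  have 1: "(a ** skew_unit k l) $ p $ q = (if q = l then a $ p $ k else 0) - (if q = k then a $ p $ l else 0)"
    unfolding matrix_matrix_mult_def vec_lambda_beta by (rule skew_unit_sum)
  have "(skew_unit k l ** transpose a) $ p $ q = (\<Sum>m\<in>UNIV. a $ q $ m * skew_unit l k $ m $ p)"
  proof -
    have "skew_unit k l $ p $ m = (skew_unit l k $ m $ p :: 'f)" for m
      by (simp only: skew_unit_entry conj_commute)
    then show ?thesis by (simp add: matrix_matrix_mult_def transpose_def mult.commute)
  qed
  also have "\<dots> = (if p = k then a $ q $ l else 0) - (if p = l then a $ q $ k else 0)" by (rule skew_unit_sum)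
  finally show "(a ** skew_unit k l + skew_unit k l ** transpose a) $ p $ q = (\<Sum>z\<in>UNIV. (\<chi> p q.
    ((if snd z = l then a $ fst z $ k else 0) + (if fst z = k then a $ snd z $ l else 0)) * skew_unit (fst z) (snd z) $ p $ q)) $ p $ q"
    using R 1 by (simp add: eq_commute)
qed

lemma sgl_app: "sgl s i j = (if j = i then s else 0)" by (simp add: sgl_def)

context sl_lie5
begin

lemma fresh: "length xs \<le> 4 \<Longrightarrow> \<exists>m :: 'n. m \<notin> set xs"
proof (rule ccontr)
  assume xs: "length xs \<le> 4" and "\<nexists>m. m \<notin> set xs"
  then have "set xs = UNIV" by blast
  then have "CARD('n) \<le> length xs" using card_length[of xs] by simp
  then show False using card5 xs by simp
qed

lemma eq_neg_zero:
  fixes x :: 'l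
  assumes "x = - x"
  shows "x = 0"
proof -
  have "scale L 2 x = x + x" using scale_left_distrib[of 1 1 x] by simp
  also have "\<dots> = 0" using assms by (metis add.right_inverse)
  finally show ?thesis by simp
qed

text \<open>Several summands may share a weight, as those of \<open>(i, j)\<close> and
  \<open>(j, i)\<close> will do; independence then concerns the sums over the fibers of
  \<open>g\<close>.\<close>

lemma Sp_indep_fiber:
  assumes "finite Z" "\<And>z. z \<in> Z \<Longrightarrow> g z \<in> W2 \<and> x z \<in> Sp (g z)" "(\<Sum>z\<in>Z. x z) = 0" "w \<in> W2"
  shows "(\<Sum>z\<in>{z \<in> Z. g z = w}. x z) = 0"
proof (rule Sp_indep[OF _ _ assms(4)])
  show "(\<Sum>z\<in>{z \<in> Z. g z = v}. x z) \<in> Sp v" for v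
    by (rule subspace_sum[OF Sp_sub]) (use assms(2) in auto)
  have "(\<Sum>w\<in>W2. \<Sum>z\<in>{z \<in> Z. g z = w}. x z) = (\<Sum>z\<in>Z. x z)"
    by (rule sum.group) (use assms finite_nrm_le_2 in auto)
  then show "(\<Sum>w\<in>W2. \<Sum>z\<in>{z \<in> Z. g z = w}. x z) = 0" using assms(3) by simp
qed

text \<open>The coordinates \<open>c z\<close> on \<open>M\<close> and the vectors
  \<open>y z\<close> in \<open>L\<close> transform by the same matrices \<open>T a\<close>, so
  replacing coordinates by vectors commutes with the action of \<open>sl\<close>. By
  \<open>inj\<close> this embeds \<open>M\<close> into \<open>L\<close>.\<close>

lemma isotypic_coordinates:
  fixes M :: "('f, 'n, 'v::ab_group_add) sl_module" and c :: "'z::finite \<Rightarrow> 'v \<Rightarrow> 'f"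
  assumes M: "vector_space (scale M)" "module.subspace (scale M) (carrier M)"
    and add: "\<And>z u v. u \<in> carrier M \<Longrightarrow> v \<in> carrier M \<Longrightarrow> c z (u + v) = c z u + c z v"
    and sc: "\<And>z k u. u \<in> carrier M \<Longrightarrow> c z (scale M k u) = k * c z u"
    and act: "\<And>a u. a \<in> carrier sl \<Longrightarrow> u \<in> carrier M \<Longrightarrow> act M a u \<in> carrier M"
      "\<And>a u z. a \<in> carrier sl \<Longrightarrow> u \<in> carrier M \<Longrightarrow> c z (act M a u) = (\<Sum>z'\<in>UNIV. T a z z' * c z' u)"
    and y: "\<And>z. y z \<in> carrier L" "\<And>a z'. a \<in> carrier sl \<Longrightarrow> br (\<iota> a) (y z') = (\<Sum>z\<in>UNIV. scale L (T a z z') (y z))"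
    and inj: "\<And>u. u \<in> carrier M \<Longrightarrow> (\<Sum>z\<in>UNIV. scale L (c z u) (y z)) = 0 \<Longrightarrow> u = 0"
    and u: "u \<in> carrier M"
  shows "(\<Sum>z\<in>UNIV. scale L (c z u) (y z)) \<in> isotypic_component \<iota> L M"
proof -
  interpret M: vector_space "scale M" by (rule M(1))
  define f where "f u = (\<Sum>z\<in>UNIV. scale L (c z u) (y z))" for u
  have fa: "f (u + v) = f u + f v" if "u \<in> carrier M" "v \<in> carrier M" for u v
    using that by (simp add: f_def add scale_left_distrib sum.distrib)
  have fs: "f (scale M k u) = scale L k (f u)" if "u \<in> carrier M" for k u
    using that by (simp add: f_def sc scale_sum_right)
  have lin: "vlinear M L f"
    unfolding vlinear_def using fa fs
    by (auto simp: f_def intro!: subspace_sum[OF carrier_sub] subspace_scale[OF carrier_sub] y)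
  have "f u \<in> isotypic_component \<iota> L M"
  proof (rule isotypic_memI[OF lin _ _ _ _ _ u])
    show "inj_on f (carrier M)"
    proof (rule inj_onI)
      fix u v assume uv: "u \<in> carrier M" "v \<in> carrier M" "f u = f v"
      have mv: "scale M (-1) v \<in> carrier M" using uv by (intro M.subspace_scale[OF M(2)])
      have "f (u + scale M (-1) v) = 0" using uv fa[OF uv(1) mv] fs[OF uv(2), of "-1"] by simp
      then have "u + scale M (-1) v = 0" using inj[OF M.subspace_add[OF M(2) uv(1) mv]] by (simp add: f_def)
      then show "u = v" by simp
    qed
    fix a :: "'f^'n^'n" and u assume a: "a \<in> carrier sl" and u: "u \<in> carrier M"
    have "f (act M a u) = (\<Sum>z\<in>UNIV. \<Sum>z'\<in>UNIV. scale L (T a z z' * c z' u) (y z))"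
      using a u by (simp add: f_def act scale_sum_left)
    also have "\<dots> = (\<Sum>z'\<in>UNIV. \<Sum>z\<in>UNIV. scale L (T a z z' * c z' u) (y z))" by (rule sum.swap)
    also have "\<dots> = (\<Sum>z'\<in>UNIV. scale L (c z' u) (br (\<iota> a) (y z')))"
      using a by (simp add: y scale_sum_right mult.commute)
    also have "\<dots> = br (\<iota> a) (f u)" by (simp add: f_def br_sum_right br_scale_right)
    finally show "act M a u \<in> carrier M \<and> f (act M a u) = br (\<iota> a) (f u)" using act a u by simp
  qed (use M M.subspace_0 M.subspace_add M.subspace_scale in auto)
  then show ?thesis by (simp add: f_def)
qed

end

section \<open>Weight vectors inside isotypic components, and the effect of the star
  conditions\<close>

context Theta_lie
begin

lemma E_move1: "k \<noteq> i \<Longrightarrow> x \<in> Sp (sgl 1 i) \<Longrightarrow> br (E k i) x \<in> Sp (sgl 1 k)"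
proof -
  assume *: "k \<noteq> i" "x \<in> Sp (sgl 1 i)"
  have eq: "sgl 1 k + sgl (-1) i + sgl 1 i = sgl 1 k" by (simp add: fun_eq_iff sgl_app)
  show ?thesis using Sp_br[OF E_Sp[OF *(1)] *(2)] unfolding eq .
qed

lemma E_move2: "k \<noteq> i \<Longrightarrow> x \<in> Sp (sgl 1 i + sgl 1 j) \<Longrightarrow> br (E k i) x \<in> Sp (sgl 1 k + sgl 1 j)"
proof -
  assume *: "k \<noteq> i" "x \<in> Sp (sgl 1 i + sgl 1 j)"
  have eq: "sgl 1 k + sgl (-1) i + (sgl 1 i + sgl 1 j) = sgl 1 k + sgl 1 j" by (simp add: fun_eq_iff sgl_app)
  show ?thesis using Sp_br[OF E_Sp[OF *(1)] *(2)] unfolding eq .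
qed

lemma E_kill1: "a \<noteq> b \<Longrightarrow> i \<noteq> b \<Longrightarrow> x \<in> Sp (sgl 1 i) \<Longrightarrow> br (E a b) x = 0"
  by (rule root_br_zero[of a b x "sgl 1 i"]) (auto simp: nrm_add_sgl sgl_app)

lemma E_kill2:
  assumes "a \<noteq> b" "i \<noteq> b" "j \<noteq> b" "i \<noteq> j" "x \<in> Sp (sgl 1 i + sgl 1 j)"
  shows "br (E a b) x = 0"
proof (rule root_br_zero[OF assms(1,5)])
  show "nrm (sgl 1 i + sgl 1 j) \<le> 2" using assms by simp
  show "2 < nrm (sgl 1 a + sgl (-1) b + (sgl 1 i + sgl 1 j))"
    unfolding add.assoc[symmetric] using assms by (simp add: nrm_add_sgl sgl_app)
qed

lemma E_comp: "\<lbrakk>distinct [i, k, m]; br (E m k) x = 0\<rbrakk> \<Longrightarrow> br (E m k) (br (E k i) x) = br (E m i) x"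
  using E_br(1)[of m k k i] by (auto simp: br_jacobi[of "E m k" "E k i"])

text \<open>The commutator of \<open>E i k\<close> and \<open>E k i\<close> acts by
  \<open>w i - w k = 1\<close>, and one of its two products vanishes on \<open>x\<close>.\<close>

lemma E_inv:
  assumes "i \<noteq> k" "x \<in> Sp w" "w i = 1" "w k = 0" "br (E i k) x = 0"
  shows "br (E i k) (br (E k i) x) = x"
  using assms H_act[OF assms(1,2)] by (simp add: br_jacobi[of "E i k"])

text \<open>\<open>E a b\<close> kills weight \<open>\<epsilon>\<^sub>i\<close> for
  \<open>i \<noteq> b\<close>, since the sum of the weights has norm three. The operators
  \<open>E k i\<close> therefore transport one vector coherently to a family that transforms like
  the standard basis of the natural module.\<close>

lemma V_family:
  assumes x: "x \<in> Sp (sgl 1 k0)"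
  obtains y where "y k0 = x" "\<And>i. y i \<in> Sp (sgl 1 i)"
    "\<And>a i. a \<in> carrier sl \<Longrightarrow> br (\<iota> a) (y i) = (\<Sum>j\<in>UNIV. scale L (a $ j $ i) (y j))"
proof -
  obtain y where y: "y k0 = x" "\<And>i. i \<in> UNIV \<Longrightarrow> y i \<in> Sp (sgl 1 i)"
    "\<And>i k. \<lbrakk>i \<in> UNIV; k \<in> UNIV; i \<noteq> k\<rbrakk> \<Longrightarrow> br (E k i) (y i) = y k"
  proof (rule coherent_line[of UNIV "\<lambda>i. Sp (sgl 1 i)" "\<lambda>k i. br (E k i)" k0 x])
    show "br (E m k) (br (E k i) x) = br (E m i) x" if "i \<noteq> k" "k \<noteq> m" "i \<noteq> m" "x \<in> Sp (sgl 1 i)" for i k m x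
      using that by (intro E_comp E_kill1) auto
    show "br (E i k) (br (E k i) x) = x" if "i \<noteq> k" "x \<in> Sp (sgl 1 i)" for i k x
      using that by (intro E_inv[OF _ that(2)] E_kill1) auto
  qed (use x E_move1 in auto)
  have "\<forall>i. br (\<iota> a) (y i) = (\<Sum>j\<in>UNIV. scale L (a $ j $ i) (y j))" if "a \<in> carrier sl" for a
    using that
  proof (induction rule: sl_induct)
    case (add a b)
    then show ?case by (simp add: lie_homD[OF hom] br_add_left scale_left_distrib sum.distrib)
  next
    case (scale c a)
    have "\<iota> (scale sl c a) = scale L c (\<iota> a)" using scale by (simp add: lie_homD[OF hom])
    then show ?case using scale by (simp add: br_scale_left scale_sum_right) (simp add: sl_def)
  next
    case (unit k l)
    show ?case
    proof
      fix i
      have "(\<Sum>j\<in>UNIV. scale L (unit_matrix k l $ j $ i) (y j)) = (\<Sum>j\<in>UNIV. if j = k then (if i = l then y k else 0) else 0)"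
        by (rule sum.cong) (simp_all add: unit_matrix_def)
      also have "\<dots> = (if i = l then y k else 0)" by simp
      also have "\<dots> = br (E k l) (y i)"
        using unit y E_kill1[OF unit, of i "y i"] by auto
      finally show "br (\<iota> (unit_matrix k l)) (y i) = (\<Sum>j\<in>UNIV. scale L (unit_matrix k l $ j $ i) (y j))"
        by (simp add: E_def)
    qed
  next
    case (cartan h)
    show ?case
    proof
      fix i
      have "(\<Sum>j\<in>UNIV. scale L (h $ j $ i) (y j)) = (\<Sum>j\<in>UNIV. if j = i then scale L (h $ i $ i) (y i) else 0)"
        by (rule sum.cong) (use cartan in \<open>auto simp: cartan_def\<close>)
      also have "\<dots> = br (\<iota> h) (y i)" using y(2)[of i] cartan by (simp add: mem_Sp wt_sgl)
      finally show "br (\<iota> h) (y i) = (\<Sum>j\<in>UNIV. scale L (h $ j $ i) (y j))" ..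
    qed
  qed
  then show ?thesis using that[of y] y by auto
qed

text \<open>The family is indexed by ordered pairs: \<open>y i j\<close> and \<open>y j i\<close>
  have the same weight, but the moves treat their indices differently. Comparing them will separate
  a skew part from a symmetric one.\<close>

lemma pair_family:
  assumes x: "x \<in> Sp (sgl 1 i0 + sgl 1 j0)" "i0 \<noteq> j0"
  obtains y where "y i0 j0 = x" "\<And>i j. i \<noteq> j \<Longrightarrow> y i j \<in> Sp (sgl 1 i + sgl 1 j)"
    "\<And>i j k. distinct [i, j, k] \<Longrightarrow> br (E k i) (y i j) = y k j"
    "\<And>i j k. distinct [i, j, k] \<Longrightarrow> br (E k j) (y i j) = y i k"
proof (rule coherent_grid[where lft = "\<lambda>k i. br (E k i)" and X = "\<lambda>i j. Sp (sgl 1 i + sgl 1 j)"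
      and rgt = "\<lambda>k i. br (E k i)" and ?i0.0 = i0 and ?j0.0 = j0 and x = x])
  have S: "x \<in> Sp (sgl 1 j + sgl 1 i)" if "x \<in> Sp (sgl 1 i + sgl 1 j)" for x i j
    using that by (simp add: add.commute)
  show "br (E k i) x \<in> Sp (sgl 1 k + sgl 1 j)" if "distinct [i, j, k]" "x \<in> Sp (sgl 1 i + sgl 1 j)" for i j k x
    using that by (intro E_move2) auto
  show "br (E k j) x \<in> Sp (sgl 1 i + sgl 1 k)" if "distinct [i, j, k]" "x \<in> Sp (sgl 1 i + sgl 1 j)" for i j k x
  proof -
    have "br (E k j) x \<in> Sp (sgl 1 k + sgl 1 i)" using that(1) by (intro E_move2 S[OF that(2)]) auto
    then show ?thesis by (rule S)
  qed
  show comp: "br (E m k) (br (E k i) x) = br (E m i) x" if "distinct [i, j, k, m]" "x \<in> Sp (sgl 1 i + sgl 1 j)" for i j k m x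
    using that by (intro E_comp E_kill2[OF _ _ _ _ that(2)]) auto
  show "br (E m k) (br (E k j) x) = br (E m j) x" if "distinct [i, j, k, m]" "x \<in> Sp (sgl 1 i + sgl 1 j)" for i j k m x
    using that(1) by (intro comp[OF _ S[OF that(2)]]) auto
  show inv: "br (E i k) (br (E k i) x) = x" if "distinct [i, j, k]" "x \<in> Sp (sgl 1 i + sgl 1 j)" for i j k x
    using that by (intro E_inv[OF _ that(2)] E_kill2[OF _ _ _ _ that(2)]) (auto simp: sgl_app)
  show "br (E j k) (br (E k j) x) = x" if "distinct [i, j, k]" "x \<in> Sp (sgl 1 i + sgl 1 j)" for i j k x
    using that(1) by (intro inv[OF _ S[OF that(2)]]) auto
  show "br (E l j) (br (E k i) x) = br (E k i) (br (E l j) x)" if "distinct [i, j, k, l]" "x \<in> Sp (sgl 1 i + sgl 1 j)" for i j k l x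
    using that(1) E_br(2)[of l j k i] by (auto simp: br_jacobi[of "E l j" "E k i"])
qed (use x card5 that in auto)

text \<open>Transport settles all brackets except \<open>[E i j, y i j]\<close>, of weight
  \<open>2\<epsilon>\<^sub>i\<close>. By skewness its sign changes when the index \<open>j\<close>
  is exchanged for another one, and three exchanges lead back to \<open>j\<close>; so it equals its
  negative.\<close>

lemma skew_family_action:
  assumes y: "\<And>i j. i \<noteq> j \<Longrightarrow> y i j \<in> Sp (sgl 1 i + sgl 1 j)"
    "\<And>i j k. distinct [i, j, k] \<Longrightarrow> br (E k i) (y i j) = y k j"
    and skew: "\<And>i j. y j i = - y i j" and a: "a \<in> carrier sl"
  shows "br (\<iota> a) (y i j) = (\<Sum>k\<in>UNIV. scale L (a $ k $ i) (y k j)) + (\<Sum>k\<in>UNIV. scale L (a $ k $ j) (y i k))"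
proof -
  note half = eq_neg_zero
  have y0: "y i i = 0" for i using half[OF skew[of i i]] .
  have y': "br (E k j) (y i j) = y i k" if "distinct [i, j, k]" for i j k
    using y(2)[of j i k] that skew[of i j] skew[of i k] by auto
  have diag: "br (E i j) (y i j) = 0" if "i \<noteq> j" for i j
  proof -
    have c: "br (E i j) (y i j) = - br (E i k) (y i k)" if d: "distinct [i, j, k]" for i j k
    proof -
      have "br (E i j) (y i j) = br (E i j) (br (E i k) (y k j))" using y(2)[of k j i] d by auto
      also have "\<dots> = br (E i k) (br (E i j) (y k j))"
        using d E_br(2)[of i j i k] by (auto simp: br_jacobi[of "E i j" "E i k"])
      also have "br (E i j) (y k j) = y k i" using y'[of k j i] d by auto
      finally show ?thesis using skew[of i k] by simp
    qed
    obtain k where k: "k \<notin> {i, j}" using fresh[of "[i, j]"] by auto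
    obtain l where l: "l \<notin> {i, j, k}" using fresh[of "[i, j, k]"] by auto
    have "br (E i j) (y i j) = - br (E i k) (y i k)" using c[of i j k] that k by auto
    also have "\<dots> = br (E i l) (y i l)" using c[of i k l] that k l by auto
    also have "\<dots> = - br (E i j) (y i j)" using c[of i l j] that k l by auto
    finally show ?thesis by (rule half)
  qed
  have "\<forall>i j. br (\<iota> a) (y i j) = (\<Sum>k\<in>UNIV. scale L (a $ k $ i) (y k j)) + (\<Sum>k\<in>UNIV. scale L (a $ k $ j) (y i k))"
    using a
  proof (induction rule: sl_induct)
    case (add a b)
    then show ?case by (simp add: lie_homD[OF hom] br_add_left scale_left_distrib sum.distrib)
  next
    case (scale c a)
    have "\<iota> (scale sl c a) = scale L c (\<iota> a)" using scale by (simp add: lie_homD[OF hom])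
    then show ?case using scale by (simp add: br_scale_left scale_sum_right scale_right_distrib) (simp add: sl_def)
  next
    case (unit k l)
    show ?case
    proof (intro allI)
      fix i j
      have s1: "(\<Sum>m\<in>UNIV. scale L (unit_matrix k l $ m $ i) (g m)) = (if i = l then g k else 0)" for g i
      proof -
        have "(\<Sum>m\<in>UNIV. scale L (unit_matrix k l $ m $ i) (g m)) = (\<Sum>m\<in>UNIV. if m = k then (if i = l then g k else 0) else 0)"
          by (rule sum.cong) (simp_all add: unit_matrix_def)
        then show ?thesis by simp
      qed
      have "br (E k l) (y i j) = (if i = l then y k j else 0) + (if j = l then y i k else 0)"
      proof (cases "i = j")
        case True
        then show ?thesis using skew[of k l] by (simp add: y0)
      next
        case False
        consider "l = i" "k = j" | "l = i" "k \<noteq> j" | "l = j" "k = i" | "l = j" "k \<noteq> i" | "l \<noteq> i" "l \<noteq> j" by blast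
        then show ?thesis
        proof cases
          case 1
          then show ?thesis using False diag[of j i] skew[of i j] y0 by simp
        next
          case 2
          then show ?thesis using False unit y(2)[of i j k] by auto
        next
          case 3
          then show ?thesis using False diag[of i j] y0 by simp
        next
          case 4
          then show ?thesis using False unit y'[of i j k] by auto
        next
          case 5
          then show ?thesis using False unit E_kill2[OF unit _ _ False y(1)[OF False]] by simp
        qed
      qed
      then show "br (\<iota> (unit_matrix k l)) (y i j) = (\<Sum>m\<in>UNIV. scale L (unit_matrix k l $ m $ i) (y m j)) +
          (\<Sum>m\<in>UNIV. scale L (unit_matrix k l $ m $ j) (y i m))"
        unfolding s1 by (simp add: E_def)
    qed
  next
    case (cartan h)
    show ?case
    proof (intro allI)
      fix i j
      have s1: "(\<Sum>m\<in>UNIV. scale L (h $ m $ i) (g m)) = scale L (h $ i $ i) (g i)" for g i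
      proof -
        have "(\<Sum>m\<in>UNIV. scale L (h $ m $ i) (g m)) = (\<Sum>m\<in>UNIV. if m = i then scale L (h $ i $ i) (g i) else 0)"
          by (rule sum.cong) (use cartan in \<open>auto simp: cartan_def\<close>)
        then show ?thesis by simp
      qed
      show "br (\<iota> h) (y i j) = (\<Sum>m\<in>UNIV. scale L (h $ m $ i) (y m j)) + (\<Sum>m\<in>UNIV. scale L (h $ m $ j) (y i m))"
        unfolding s1 using y(1)[of i j] cartan y0
        by (cases "i = j") (simp_all add: mem_Sp wt_add wt_sgl scale_left_distrib)
    qed
  qed
  then show ?thesis by blast
qed

text \<open>The symmetric part of \<open>x\<close> is \<open>[E\<^sub>i\<^sub>j, t]\<close> with \<open>t\<close> of weight \<open>2\<epsilon>\<^sub>j\<close>, which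
  commutes with the relevant weight spaces.\<close>

lemma pair_decomposition:
  assumes x: "x \<in> Sp (sgl 1 i0 + sgl 1 j0)" "i0 \<noteq> j0"
  obtains y s where "x = y i0 j0 + s" "\<And>i j. y j i = - y i j" "\<And>i j. i \<noteq> j \<Longrightarrow> y i j \<in> Sp (sgl 1 i + sgl 1 j)"
    "\<And>a i j. a \<in> carrier sl \<Longrightarrow>
      br (\<iota> a) (y i j) = (\<Sum>k\<in>UNIV. scale L (a $ k $ i) (y k j)) + (\<Sum>k\<in>UNIV. scale L (a $ k $ j) (y i k))"
    "s \<in> Sp (sgl 1 i0 + sgl 1 j0)" "\<And>i j k. distinct [i, j, k] \<Longrightarrow> br (E k i) (y i j) = y k j"
    "\<And>v z. \<lbrakk>z \<in> Sp v; nrm v \<le> 2; 0 < nrm v; \<And>i. 0 \<le> v i; v i0 = 0; v j0 = 0\<rbrakk> \<Longrightarrow> br s z = 0"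
proof -
  obtain f where f: "f i0 j0 = x" "\<And>i j. i \<noteq> j \<Longrightarrow> f i j \<in> Sp (sgl 1 i + sgl 1 j)"
    "\<And>i j k. distinct [i, j, k] \<Longrightarrow> br (E k i) (f i j) = f k j"
    "\<And>i j k. distinct [i, j, k] \<Longrightarrow> br (E k j) (f i j) = f i k"
    using pair_family[OF x] by metis
  have fS: "f j i \<in> Sp (sgl 1 i + sgl 1 j)" if "i \<noteq> j" for i j using f(2)[of j i] that by (simp add: add.commute)
  define y where "y i j = scale L (1/2) (f i j - f j i)" for i j
  define s where "s = scale L (1/2) (f i0 j0 + f j0 i0)"
  have skew: "y j i = - y i j" for i j by (simp add: y_def flip: scale_minus_right)
  have yS: "y i j \<in> Sp (sgl 1 i + sgl 1 j)" if "i \<noteq> j" for i j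
    unfolding y_def using f(2)[OF that] fS[OF that] by (intro subspace_scale[OF Sp_sub] subspace_diff[OF Sp_sub])
  have yE: "br (E k i) (y i j) = y k j" if "distinct [i, j, k]" for i j k
    using f(3)[of i j k] f(4)[of j i k] that by (auto simp: y_def br_scale_right br_diff_right)
  have sS: "s \<in> Sp (sgl 1 i0 + sgl 1 j0)"
    unfolding s_def using f(2)[OF x(2)] fS[OF x(2)] by (intro subspace_scale[OF Sp_sub] subspace_add[OF Sp_sub])
  have sum: "x = y i0 j0 + s"
  proof -
    have "y i0 j0 + s = scale L (1/2) (f i0 j0 + f i0 j0)"
      by (simp add: y_def s_def flip: scale_right_distrib)
    also have "\<dots> = scale L (1/2) (scale L 2 (f i0 j0))" using scale_left_distrib[of 1 1 "f i0 j0"] by simp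
    finally show ?thesis by (simp add: f)
  qed
  obtain k where "k \<notin> {i0, j0}" using fresh[of "[i0, j0]"] by auto
  then have k: "distinct [i0, j0, k]" using x(2) by auto
  \<comment> \<open>The weight of \<open>t\<close> is twice a unit vector, which brings its brackets
    under the first alternative of \<open>br_zero\<close>. Applying \<open>E i0 j0\<close> returns
    \<open>2 s\<close> because the family of half sums is symmetric.\<close>
  define t where "t = br (E j0 i0) s"
  have tS: "t \<in> Sp (sgl 2 j0)"
    using E_move2[OF x(2)[symmetric] sS] by (simp add: t_def sgl_add)
  have ts: "br (E i0 j0) t = scale L 2 s"
  proof -
    define F where "F i j = scale L (1/2) (f i j + f j i)" for i j
    have F_sym: "F i j = F j i" for i j by (simp add: F_def add.commute)
    have FS: "F i j \<in> Sp (sgl 1 i + sgl 1 j)" if "i \<noteq> j" for i j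
      unfolding F_def using f(2)[OF that] fS[OF that] by (intro subspace_scale[OF Sp_sub] subspace_add[OF Sp_sub])
    have FE: "br (E k i) (F i j) = F k j" if "distinct [i, j, k]" for i j k
      using f(3)[of i j k] f(4)[of j i k] that by (auto simp: F_def br_scale_right br_add_right)
    have FE': "br (E k j) (F i j) = F i k" if "distinct [i, j, k]" for i j k
      using FE[of j i k] that F_sym by auto
    have "t = br (E j0 i0) (br (E i0 k) (F k j0))"
      using FE[of k j0 i0] k by (auto simp: t_def s_def F_def)
    also have "\<dots> = br (E j0 k) (F k j0)"
      using E_br(1)[of j0 i0 i0 k] E_kill2[of j0 i0 k j0 "F k j0"] FS[of k j0] k
      by (auto simp: br_jacobi[of "E j0 i0" "E i0 k"])
    finally have "br (E i0 j0) t = br (E i0 k) (F k j0) + br (E j0 k) (br (E i0 j0) (F k j0))"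
      using E_br(1)[of i0 j0 j0 k] k by (auto simp: br_jacobi[of "E i0 j0" "E j0 k"])
    also have "br (E i0 k) (F k j0) = F i0 j0" using FE[of k j0 i0] k by auto
    also have "br (E i0 j0) (F k j0) = F k i0" using FE'[of k j0 i0] k by auto
    also have "br (E j0 k) (F k i0) = F i0 j0" using FE[of k i0 j0] k F_sym by auto
    finally show ?thesis using scale_left_distrib[of 1 1 s] by (simp add: F_def s_def)
  qed
  \<comment> \<open>\<open>z\<close> commutes with \<open>t\<close> and with \<open>E i0 j0\<close>,
    hence with their bracket \<open>2 s\<close>.\<close>
  have "br s z = 0" if z: "z \<in> Sp v" and v: "nrm v \<le> 2" "0 < nrm v" "\<And>i. 0 \<le> v i" "v i0 = 0" "v j0 = 0" for v z
  proof -
    obtain a where a: "v a \<noteq> 0" using v(2) nrm_eq_0[of v] by (metis less_irrefl nrm_zero ext zero_fun_apply)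
    have ne: "a \<noteq> i0" "a \<noteq> j0" and pos: "0 < v a" using a v(3)[of a] v(4,5) by auto
    have "br t z = 0"
    proof (rule br_zero[OF tS z _ v(1)])
      have "(\<Sum>i\<in>{j0, a}. \<bar>(sgl 2 j0 + v) i\<bar>) \<le> nrm (sgl 2 j0 + v)" by (rule nrm_ge)
      then show "2 < nrm (sgl 2 j0 + v)" using ne pos v(5) by (simp add: sgl_app)
    qed (auto simp: sgl_app v intro!: exI[of _ j0])
    moreover have "br (E i0 j0) z = 0"
    proof (rule root_br_zero[OF x(2) z v(1)])
      have "(\<Sum>i\<in>{i0, j0, a}. \<bar>(sgl 1 i0 + sgl (-1) j0 + v) i\<bar>) \<le> nrm (sgl 1 i0 + sgl (-1) j0 + v)" by (rule nrm_ge)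
      then show "2 < nrm (sgl 1 i0 + sgl (-1) j0 + v)" using ne pos v(4,5) x(2) by (simp add: sgl_app)
    qed
    ultimately have "br (br (E i0 j0) t) z = 0" by (simp add: br_jacobi_left)
    then show ?thesis unfolding ts br_scale_left by simp
  qed
  then show ?thesis using that[OF sum skew yS _ sS yE] skew_family_action[OF yS yE skew] by blast
qed

text \<open>The automorphism \<open>x \<mapsto> - x\<^sup>t\<close> of \<open>sl\<close> negates all
  weights. Precomposition with it reduces statements about the dual modules to those about the
  modules themselves.\<close>

lemma twist: "Theta_lie L br (\<lambda>x. \<iota> (- transpose x))"
  and twist_Sp: "wsp (\<lambda>x. \<iota> (- transpose x)) L w = Sp (- w)"
proof -
  define \<tau> :: "'f^'n^'n \<Rightarrow> 'f^'n^'n" where "\<tau> x = - transpose x" for x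
  have tr: "trace (transpose x) = trace x" for x :: "'f^'n^'n" by (simp add: trace_def transpose_def)
  have \<tau>_sl: "\<tau> x \<in> carrier sl" if "x \<in> carrier sl" for x
    using that tr[of x] by (simp add: \<tau>_def sl_def trace_def sum_negf)
  have \<tau>_br: "\<tau> (bracket sl x y) = bracket sl (\<tau> x) (\<tau> y)" for x y
    by (simp add: \<tau>_def sl_def vec_eq_iff matrix_matrix_mult_def transpose_def mult.commute)
  have \<tau>_cartan: "\<tau> h = scale sl (-1) h" if "h \<in> cartan" for h
    using that by (auto simp: \<tau>_def sl_def vec_eq_iff cartan_def transpose_def) metis
  have \<tau>_lin: "\<tau> (x + y) = \<tau> x + \<tau> y" "\<tau> (scale sl c x) = scale sl c (\<tau> x)" for x y c
    by (simp_all add: \<tau>_def sl_def vec_eq_iff transpose_def)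
  have hom': "lie_hom sl L (\<lambda>x. \<iota> (\<tau> x))"
    unfolding lie_hom_def vlinear_def by (simp add: lie_homD[OF hom] \<tau>_sl \<tau>_br \<tau>_lin)
  have "sl_lie L br (\<lambda>x. \<iota> (\<tau> x))" using lieL total br_eq br_closed hom' by (simp add: sl_lie_def)
  then interpret T: sl_lie5 L br "\<lambda>x. \<iota> (\<tau> x)" using card5 by (simp add: sl_lie5_def sl_lie5_axioms_def)
  have Sp: "T.Sp w = Sp (- w)" for w
  proof -
    have "br (\<iota> (\<tau> h)) x = scale L (wt w h) x \<longleftrightarrow> br (\<iota> h) x = scale L (wt (- w) h) x" if "h \<in> cartan" for h x
    proof -
      have "\<iota> (\<tau> h) = - \<iota> h" using that cartan_subset_sl by (auto simp: \<tau>_cartan lie_homD[OF hom])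
      then show ?thesis by (simp add: wt_minus minus_equation_iff[of "br (\<iota> h) x"]) (metis minus_minus)
    qed
    then show ?thesis by (auto simp: mem_Sp T.mem_Sp)
  qed
  have Gen: "T.Gen w = Gen (- w)" for w
  proof (cases "w = 0")
    case True
    have "(\<Union>v\<in>W2 - {0}. {br x y |x y. x \<in> Sp (- v) \<and> y \<in> Sp v}) = (\<Union>v\<in>W2 - {0}. {br x y |x y. x \<in> Sp v \<and> y \<in> Sp (- v)})"
      (is "?A = ?B")
    proof -
      have "?A = (\<Union>v\<in>uminus ` (W2 - {0}). {br x y |x y. x \<in> Sp v \<and> y \<in> Sp (- v)})" by simp
      moreover have "uminus ` (W2 - {0}) = W2 - {0}" by (rule uminus_image) auto
      ultimately show ?thesis by simp
    qed
    then show ?thesis using True by (simp add: T.Gen_def Gen_def Sp)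
  qed (simp add: T.Gen_def Gen_def Sp)
  have "(\<Union>w\<in>W2. T.Gen w) = (\<Union>w\<in>uminus ` W2. Gen w)" by (simp add: Gen)
  moreover have "uminus ` W2 = W2" by (rule uminus_image) auto
  ultimately have "T.generated" using gen by (simp add: T.generated_def generated_def)
  then show "Theta_lie L br (\<lambda>x. \<iota> (- transpose x))"
    using T.sl_lie5_axioms by (simp add: Theta_lie_def Theta_lie_axioms_def \<tau>_def)
  show "wsp (\<lambda>x. \<iota> (- transpose x)) L w = Sp (- w)" using Sp by (simp add: \<tau>_def)
qed

lemma zero_isotypic: "0 \<in> isotypic_component \<iota> L M"
  unfolding isotypic_component_def vspan_def by (rule span_zero)

lemma sgl_pair_eq: "\<lbrakk>i \<noteq> j; k \<noteq> l; s \<noteq> 0\<rbrakk> \<Longrightarrow> sgl s k + sgl s l = sgl s i + sgl s j \<longleftrightarrow> (k = i \<and> l = j) \<or> (k = j \<and> l = i)"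
  by (auto simp: fun_eq_iff sgl_app split: if_splits)

lemma V_independent:
  assumes s: "s = 1 \<or> s = -1" and yS: "\<And>i. y i \<in> Sp (sgl s i)" and nz: "\<And>i. y i \<noteq> 0"
    and sum: "(\<Sum>i\<in>UNIV. scale L (c i) (y i)) = 0"
  shows "c i = 0"
proof -
  have "(\<Sum>j\<in>{j \<in> UNIV. sgl s j = sgl s i}. scale L (c j) (y j)) = 0"
    by (rule Sp_indep_fiber[OF _ _ sum]) (use s yS in \<open>auto intro: subspace_scale[OF Sp_sub]\<close>)
  moreover have "{j \<in> UNIV. sgl s j = sgl s i} = {i}" using s by (auto simp: fun_eq_iff sgl_app split: if_splits)
  ultimately show ?thesis using nz[of i] by simp
qed

text \<open>The pairs \<open>(i, j)\<close> and \<open>(j, i)\<close> share a weight. Since both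
  \<open>c\<close> and \<open>y\<close> are skew, their two terms are equal and add up instead of
  cancelling.\<close>

lemma pair_independent:
  assumes s: "s = 1 \<or> s = -1" and yS: "\<And>i j. i \<noteq> j \<Longrightarrow> y i j \<in> Sp (sgl s i + sgl s j)"
    and skew: "\<And>i j. y j i = - y i j" and y0: "\<And>i. y i i = 0" and nz: "\<And>i j. i \<noteq> j \<Longrightarrow> y i j \<noteq> 0"
    and c: "\<And>i j. c j i = - c i j"
    and sum: "(\<Sum>z\<in>UNIV. scale L (c (fst z) (snd z)) (y (fst z) (snd z))) = 0" and ij: "i \<noteq> j"
  shows "c i j = 0"
proof -
  define Z where "Z = {z :: 'n \<times> 'n. fst z \<noteq> snd z}"
  have "(\<Sum>z\<in>Z. scale L (c (fst z) (snd z)) (y (fst z) (snd z))) = (\<Sum>z\<in>UNIV. scale L (c (fst z) (snd z)) (y (fst z) (snd z)))"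
    by (rule sum.mono_neutral_left) (auto simp: Z_def y0)
  then have "(\<Sum>z\<in>{z \<in> Z. sgl s (fst z) + sgl s (snd z) = sgl s i + sgl s j}. scale L (c (fst z) (snd z)) (y (fst z) (snd z))) = 0"
    using sum s ij yS
    by (intro Sp_indep_fiber) (auto simp: Z_def intro: subspace_scale[OF Sp_sub])
  moreover have "{z \<in> Z. sgl s (fst z) + sgl s (snd z) = sgl s i + sgl s j} = {(i, j), (j, i)}"
    using s ij by (auto simp: Z_def sgl_pair_eq)
  ultimately have "scale L (c i j) (y i j) + scale L (c j i) (y j i) = 0" using ij by simp
  moreover have "scale L (c j i) (y j i) = scale L (c i j) (y i j)" by (simp add: c[of i j] skew[of i j])
  moreover have "scale L (2 * c i j) (y i j) = scale L (c i j) (y i j) + scale L (c i j) (y i j)"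
    by (simp only: mult_2 scale_left_distrib)
  ultimately have "scale L (2 * c i j) (y i j) = 0" by simp
  then show ?thesis using nz[OF ij] by simp
qed

lemma V_nonzero:
  assumes "\<And>a i. a \<in> carrier sl \<Longrightarrow> br (\<iota> a) (y i) = (\<Sum>j\<in>UNIV. scale L (a $ j $ i) (y j))" "y k \<noteq> 0"
  shows "y i \<noteq> 0"
proof (cases "i = k")
  case False
  have "(\<Sum>j\<in>UNIV. scale L (unit_matrix k i $ j $ i) (y j)) = (\<Sum>j\<in>UNIV. if j = k then y k else 0)"
    by (rule sum.cong) (simp_all add: unit_matrix_def)
  then have "br (\<iota> (unit_matrix k i)) (y i) = y k" using assms(1)[OF unit_matrix_in_sl, of k i i] False by simp
  then show ?thesis using assms(2) by auto
qed (use assms in simp)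

text \<open>The moves of the first index, combined with skewness, would spread a zero entry to all
  positions.\<close>

lemma pair_nonzero:
  assumes skew: "\<And>i j. y j i = - y i j" and yE: "\<And>i j k. distinct [i, j, k] \<Longrightarrow> br (E k i) (y i j) = y k j"
    and nz: "y i0 j0 \<noteq> 0" "i0 \<noteq> j0" and ij: "i \<noteq> j"
  shows "y i j \<noteq> 0"
proof
  assume 0: "y i j = 0"
  have step: "y k j = 0" if "y i j = 0" "i \<noteq> j" "k \<noteq> j" for i j k
    using yE[of i j k] that by (cases "k = i") auto
  have kj: "y k j = 0" if "k \<noteq> j" for k using step[OF 0 ij that] .
  have "y l k = 0" if "k \<noteq> j" "l \<noteq> k" for l k
    using step[of j k l] kj[OF that(1)] skew[of k j] that by auto
  then show False using nz kj by (cases "j0 = j") auto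
qed

text \<open>If \<open>x\<close> is nonzero, the family through it spans a copy of the natural module
  in which \<open>x\<close> is the image of a basis vector.\<close>

lemma Sp_subset_natural:
  assumes x: "x \<in> Sp (sgl 1 k)"
  shows "x \<in> isotypic_component \<iota> L natural_module"
proof (cases "x = 0")
  case False
  obtain y where y: "y k = x" "\<And>i. y i \<in> Sp (sgl 1 i)"
    "\<And>a i. a \<in> carrier sl \<Longrightarrow> br (\<iota> a) (y i) = (\<Sum>j\<in>UNIV. scale L (a $ j $ i) (y j))"
    by (rule V_family[OF x]) (rule that)
  have nz: "y i \<noteq> 0" for i by (rule V_nonzero[OF y(3), of k]) (use y(1) False in auto)
  let ?M = "natural_module :: ('f, 'n, 'f^'n) sl_module"
  have "(\<Sum>i\<in>UNIV. scale L (axis k 1 $ i) (y i)) \<in> isotypic_component \<iota> L ?M"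
  proof (rule isotypic_coordinates[where T = "\<lambda>a i j. a $ i $ j" and c = "\<lambda>i v. v $ i"])
    show "vector_space (scale ?M)" by (simp add: natural_module_def vec.vector_space_axioms)
    show "module.subspace (scale ?M) (carrier ?M)" by (simp add: natural_module_def)
    show "br (\<iota> a) (y i) = (\<Sum>z\<in>UNIV. scale L (a $ z $ i) (y z))" if "a \<in> carrier sl" for a i by (rule y(3)[OF that])
    show "y i \<in> carrier L" for i by (rule Sp_carrier[OF y(2)])
    show "u = 0" if "(\<Sum>z\<in>UNIV. scale L (u $ z) (y z)) = 0" for u
      using V_independent[OF _ y(2) nz that] by (simp add: vec_eq_iff)
  qed (simp_all add: natural_module_def matrix_vector_mult_def)
  also have "(\<Sum>i\<in>UNIV. scale L (axis k 1 $ i) (y i)) = (\<Sum>i\<in>UNIV. if i = k then x else 0)"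
    by (rule sum.cong) (auto simp: axis_def y)
  finally show ?thesis by simp
qed (simp add: zero_isotypic)

text \<open>The family is taken with respect to the twisted embedding; replacing \<open>a\<close> by
  \<open>- a\<^sup>t\<close> turns its action into the contragredient one. Values on the standard
  basis are the coordinates on the dual.\<close>

lemma Sp_subset_dual:
  assumes x: "x \<in> Sp (sgl (-1) k)"
  shows "x \<in> isotypic_component \<iota> L (dual_module natural_module)"
proof (cases "x = 0")
  case False
  interpret T: Theta_lie L br "\<lambda>x. \<iota> (- transpose x)" by (rule twist)
  have xT: "x \<in> T.Sp (sgl 1 k)" using x by (simp add: twist_Sp sgl_minus)
  obtain y where y: "y k = x" "\<And>i. y i \<in> T.Sp (sgl 1 i)"
    "\<And>a i. a \<in> carrier sl \<Longrightarrow> br (\<iota> (- transpose a)) (y i) = (\<Sum>j\<in>UNIV. scale L (a $ j $ i) (y j))"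
    by (rule T.V_family[OF xT]) (rule that)
  have nz: "y i \<noteq> 0" for i by (rule T.V_nonzero[OF y(3), of k]) (use y(1) False in auto)
  have yS: "y i \<in> Sp (sgl (-1) i)" for i using y(2)[of i] by (simp add: twist_Sp sgl_minus)
  have ya: "br (\<iota> a) (y i) = (\<Sum>j\<in>UNIV. scale L (- a $ i $ j) (y j))" if a: "a \<in> carrier sl" for a i
  proof -
    have "- transpose a \<in> carrier sl" using a by (simp add: sl_def trace_def transpose_def sum_negf)
    moreover have "- transpose (- transpose a) = a" by (simp add: transpose_def vec_eq_iff)
    moreover have "(- transpose a) $ j $ i = - a $ i $ j" for j by (simp add: transpose_def)
    ultimately show ?thesis using y(3)[of "- transpose a" i] by simp
  qed
  let ?M = "dual_module natural_module :: ('f, 'n, 'f^'n \<Rightarrow> 'f) sl_module"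
  define \<phi> :: "'f^'n \<Rightarrow> 'f" where "\<phi> = (\<lambda>v. v $ k)"
  have "(\<Sum>i\<in>UNIV. scale L (\<phi> (axis i 1)) (y i)) \<in> isotypic_component \<iota> L ?M"
  proof (rule isotypic_coordinates[where T = "\<lambda>a i j. - a $ j $ i" and c = "\<lambda>i \<phi>. \<phi> (axis i 1)"])
    show "vector_space (scale ?M)" by (rule dual_module_vector_space)
    show "module.subspace (scale ?M) (carrier ?M)" by (rule dual_module_subspace)
    show "\<phi> \<in> carrier ?M" by (simp add: \<phi>_def dual_module_def vlinear_def natural_module_def)
    show "act ?M a \<psi> \<in> carrier ?M" if "\<psi> \<in> carrier ?M" for a \<psi>
      using that by (simp add: dual_module_def vlinear_def natural_module_def matrix_vector_right_distrib vector_scalar_commute)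
    show "act ?M a \<psi> (axis i 1) = (\<Sum>j\<in>UNIV. - a $ j $ i * \<psi> (axis j 1))" if "\<psi> \<in> carrier ?M" for a \<psi> i
    proof -
      have "act ?M a \<psi> (axis i 1) = - \<psi> (a *v axis i 1)" by (simp add: dual_module_def natural_module_def)
      also have "\<dots> = - (\<Sum>j\<in>UNIV. \<psi> (axis j 1) * a $ j $ i)"
        using dual_natural_expansion[OF that, of "a *v axis i 1"] by (simp add: matrix_vector_axis)
      finally show ?thesis by (simp add: sum_negf mult.commute)
    qed
    show "\<psi> = 0" if \<psi>: "\<psi> \<in> carrier ?M" and s: "(\<Sum>i\<in>UNIV. scale L (\<psi> (axis i 1)) (y i)) = 0" for \<psi>
    proof
      have "\<psi> (axis i 1) = 0" for i using V_independent[OF _ yS nz s] by simp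
      then show "\<psi> v = 0 v" for v using dual_natural_expansion[OF \<psi>, of v] by simp
    qed
    show "y i \<in> carrier L" for i by (rule Sp_carrier[OF yS])
    show "br (\<iota> a) (y i) = (\<Sum>j\<in>UNIV. scale L (- a $ i $ j) (y j))" if "a \<in> carrier sl" for a i by (rule ya[OF that])
  qed (simp_all add: dual_module_def)
  also have "(\<Sum>i\<in>UNIV. scale L (\<phi> (axis i 1)) (y i)) = (\<Sum>i\<in>UNIV. if i = k then x else 0)"
    by (rule sum.cong) (auto simp: axis_def y \<phi>_def)
  finally show ?thesis by simp
qed (simp add: zero_isotypic)

lemma skew_unit_coordinates:
  fixes y :: "'n \<Rightarrow> 'n \<Rightarrow> 'l"
  assumes skew: "\<And>i j. y j i = - y i j" and ij: "i0 \<noteq> j0"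
  shows "(\<Sum>z\<in>UNIV. scale L (skew_unit i0 j0 $ fst z $ snd z / 2) (y (fst z) (snd z))) = y i0 j0"
proof -
  have "(\<Sum>z\<in>UNIV. scale L (skew_unit i0 j0 $ fst z $ snd z / 2) (y (fst z) (snd z))) =
      (\<Sum>z\<in>UNIV. (if z = (i0, j0) then scale L (1 / 2) (y i0 j0) else 0) + (if z = (j0, i0) then scale L (1 / 2) (y i0 j0) else 0))"
  proof (rule sum.cong[OF refl])
    fix z :: "'n \<times> 'n"
    obtain p q where z: "z = (p, q)" by (cases z)
    show "scale L (skew_unit i0 j0 $ fst z $ snd z / 2) (y (fst z) (snd z)) =
      (if z = (i0, j0) then scale L (1 / 2) (y i0 j0) else 0) + (if z = (j0, i0) then scale L (1 / 2) (y i0 j0) else 0)"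
    proof (cases "p = i0 \<and> q = j0")
      case True
      then show ?thesis using ij by (simp add: z skew_unit_entry)
    next
      case F: False
      show ?thesis
      proof (cases "p = j0 \<and> q = i0")
        case True
        then show ?thesis using ij skew[of i0 j0] by (simp add: z skew_unit_entry)
      next
        case False
        have "skew_unit i0 j0 $ p $ q = (0 :: 'f)" unfolding skew_unit_entry if_not_P[OF F] if_not_P[OF False] by simp
        then have "scale L (skew_unit i0 j0 $ fst z $ snd z / 2) (y (fst z) (snd z)) = 0"
          by (simp only: z fst_conv snd_conv div_0 scale_zero_left)
        moreover have "z \<noteq> (i0, j0)" "z \<noteq> (j0, i0)" using F False z by auto
        ultimately show ?thesis by (simp only: if_False add_0_right)
      qed
    qed
  qed
  also have "\<dots> = y i0 j0" by (simp add: sum.distrib flip: scale_left_distrib)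
  finally show ?thesis .
qed

text \<open>Matrix entries, halved because ordered pairs count twice, are the coordinates on the
  exterior square; with these, \<open>skew_unit i0 j0\<close> is sent to
  \<open>y i0 j0\<close>.\<close>

lemma pair_subset_exterior:
  assumes skew: "\<And>i j. y j i = - y i j" and yS: "\<And>i j. i \<noteq> j \<Longrightarrow> y i j \<in> Sp (sgl 1 i + sgl 1 j)"
    and ya: "\<And>a i j. a \<in> carrier sl \<Longrightarrow>
      br (\<iota> a) (y i j) = (\<Sum>k\<in>UNIV. scale L (a $ k $ i) (y k j)) + (\<Sum>k\<in>UNIV. scale L (a $ k $ j) (y i k))"
    and yE: "\<And>i j k. distinct [i, j, k] \<Longrightarrow> br (E k i) (y i j) = y k j" and ij: "i0 \<noteq> j0"
  shows "y i0 j0 \<in> isotypic_component \<iota> L exterior_square"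
proof (cases "y i0 j0 = 0")
  case False
  let ?M = "exterior_square :: ('f, 'n, 'f^'n^'n) sl_module"
  have nz: "y i j \<noteq> 0" if "i \<noteq> j" for i j by (rule pair_nonzero[OF skew yE False ij that])
  have y0: "y i i = 0" for i using skew[of i i] by (rule eq_neg_zero)
  have yC: "y i j \<in> carrier L" for i j using yS[of i j] y0[of i] Sp_carrier subspace_0[OF carrier_sub] by (cases "i = j") auto
  define T where "T a z z' = (if snd z = snd z' then a $ fst z $ fst z' else 0) + (if fst z = fst z' then a $ snd z $ snd z' else 0)"
    for a :: "'f^'n^'n" and z z' :: "'n \<times> 'n"
  have "(\<Sum>z\<in>UNIV. scale L (skew_unit i0 j0 $ fst z $ snd z / 2) (y (fst z) (snd z))) \<in> isotypic_component \<iota> L ?M"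
  proof (rule isotypic_coordinates[where T = T and c = "\<lambda>z m. m $ fst z $ snd z / 2" and y = "\<lambda>z. y (fst z) (snd z)"])
    show "vector_space (scale ?M)" by (rule exterior_square_vector_space)
    show "module.subspace (scale ?M) (carrier ?M)" by (rule exterior_square_subspace)
    show "act ?M a u \<in> carrier ?M" if u: "u \<in> carrier ?M" for a u
      using exterior_square_act[OF u, of a] by (simp add: exterior_square_def)
    show "br (\<iota> a) (y (fst z') (snd z')) = (\<Sum>z\<in>UNIV. scale L (T a z z') (y (fst z) (snd z)))" if a: "a \<in> carrier sl" for a z'
    proof -
      have "(\<Sum>z\<in>UNIV. scale L (T a z z') (y (fst z) (snd z))) =
        (\<Sum>z\<in>UNIV. (if snd z = snd z' then scale L (a $ fst z $ fst z') (y (fst z) (snd z)) else 0) +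
          (if fst z = fst z' then scale L (a $ snd z $ snd z') (y (fst z) (snd z)) else 0))"
        by (rule sum.cong) (simp_all add: T_def scale_left_distrib)
      also have "\<dots> = (\<Sum>i\<in>UNIV. scale L (a $ i $ fst z') (y i (snd z'))) + (\<Sum>j\<in>UNIV. scale L (a $ j $ snd z') (y (fst z') j))"
        by (rule pair_delta_sum)
      finally show ?thesis using ya[OF a, of "fst z'" "snd z'"] by simp
    qed
    show "act ?M a u $ fst z $ snd z / 2 = (\<Sum>z'\<in>UNIV. T a z z' * (u $ fst z' $ snd z' / 2))" for a u z
    proof -
      have "(\<Sum>z'\<in>UNIV. T a z z' * (u $ fst z' $ snd z' / 2)) =
        (\<Sum>z'\<in>UNIV. (if snd z' = snd z then a $ fst z $ fst z' * (u $ fst z' $ snd z' / 2) else 0) +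
          (if fst z' = fst z then a $ snd z $ snd z' * (u $ fst z' $ snd z' / 2) else 0))"
        by (rule sum.cong) (simp_all add: T_def distrib_right eq_commute)
      also have "\<dots> = (\<Sum>i\<in>UNIV. a $ fst z $ i * (u $ i $ snd z / 2)) + (\<Sum>j\<in>UNIV. a $ snd z $ j * (u $ fst z $ j / 2))"
        by (rule pair_delta_sum)
      also have "\<dots> = act ?M a u $ fst z $ snd z / 2"
        by (simp add: exterior_square_def matrix_matrix_mult_def transpose_def add_divide_distrib sum_divide_distrib mult.commute)
      finally show ?thesis ..
    qed
    show "u = 0" if u: "u \<in> carrier ?M" and s: "(\<Sum>z\<in>UNIV. scale L (u $ fst z $ snd z / 2) (y (fst z) (snd z))) = 0" for u
    proof -
      have sk: "u $ j $ i = - u $ i $ j" for i j using u unfolding exterior_square_iff by blast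
      have cs: "u $ j $ i / 2 = - (u $ i $ j / 2)" for i j using sk[of j i] by simp
      have "u $ i $ j / 2 = 0" if "i \<noteq> j" for i j
        by (rule pair_independent[where c = "\<lambda>i j. u $ i $ j / 2" and s = 1, OF _ yS skew y0 nz cs s that]) simp
      moreover have "u $ i $ i = 0" for i using sk[of i i] by simp
      ultimately have "u $ i $ j = 0" for i j by (cases "i = j") auto
      then show ?thesis by (simp add: vec_eq_iff)
    qed
    show "skew_unit i0 j0 \<in> carrier ?M" by (simp add: exterior_square_def skew_unit_skew)
  qed (simp_all add: exterior_square_def yC add_divide_distrib)
  also have "(\<Sum>z\<in>UNIV. scale L (skew_unit i0 j0 $ fst z $ snd z / 2) (y (fst z) (snd z))) = y i0 j0"
    by (rule skew_unit_coordinates[OF skew ij])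
  finally show ?thesis .
qed (simp add: zero_isotypic)

text \<open>Coordinates on the dual are the values on the matrices \<open>skew_unit i j\<close>.
  With these, half of the entry functional at \<open>(i0, j0)\<close> is sent to
  \<open>y i0 j0\<close>.\<close>

lemma dual_pair_subset:
  assumes skew: "\<And>i j. y j i = - y i j" and yS: "\<And>i j. i \<noteq> j \<Longrightarrow> y i j \<in> Sp (sgl (-1) i + sgl (-1) j)"
    and ya: "\<And>a i j. a \<in> carrier sl \<Longrightarrow>
      br (\<iota> a) (y i j) = (\<Sum>k\<in>UNIV. scale L (- a $ i $ k) (y k j)) + (\<Sum>k\<in>UNIV. scale L (- a $ j $ k) (y i k))"
    and nz: "\<And>i j. y i0 j0 \<noteq> 0 \<Longrightarrow> i \<noteq> j \<Longrightarrow> y i j \<noteq> 0" and ij: "i0 \<noteq> j0"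
  shows "y i0 j0 \<in> isotypic_component \<iota> L (dual_module exterior_square)"
proof (cases "y i0 j0 = 0")
  case False
  let ?E = "exterior_square :: ('f, 'n, 'f^'n^'n) sl_module"
  let ?M = "dual_module ?E"
  have y0: "y i i = 0" for i using skew[of i i] by (rule eq_neg_zero)
  have yC: "y i j \<in> carrier L" for i j using yS[of i j] y0[of i] Sp_carrier subspace_0[OF carrier_sub] by (cases "i = j") auto
  \<comment> \<open>The negative transpose of the action on the exterior square, as required for the
    dual.\<close>
  define T where "T a z z' = - ((if snd z' = snd z then a $ fst z' $ fst z else 0) + (if fst z' = fst z then a $ snd z' $ snd z else 0))"
    for a :: "'f^'n^'n" and z z' :: "'n \<times> 'n"
  have sk: "skew_unit i j \<in> carrier ?E" for i j by (simp add: exterior_square_def skew_unit_skew)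
  define c where "c z \<phi> = \<phi> (skew_unit (fst z) (snd z))" for z :: "'n \<times> 'n" and \<phi> :: "'f^'n^'n \<Rightarrow> 'f"
  have dual: "vlinear ?E \<lparr>carrier = UNIV, scale = (*)\<rparr> \<phi>" if "\<phi> \<in> carrier ?M" for \<phi> using that by (simp add: dual_module_def)
  have ds: "\<phi> (\<chi> p q. k * u $ p $ q) = k * \<phi> u" if "\<phi> \<in> carrier ?M" "u \<in> carrier ?E" for \<phi> k u
  proof -
    have "\<phi> (scale ?E k u) = k * \<phi> u" using dual[OF that(1)] that(2) unfolding vlinear_def by simp
    then show ?thesis by (simp add: exterior_square_def)
  qed
  have da: "\<phi> (u + v) = \<phi> u + \<phi> v" if "\<phi> \<in> carrier ?M" "u \<in> carrier ?E" "v \<in> carrier ?E" for \<phi> u v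
    using dual[OF that(1)] that(2,3) unfolding vlinear_def by simp
  have actE: "act ?E a u = a ** u + u ** transpose a" for a u by (simp add: exterior_square_def)
  have am: "act ?M a \<phi> u = (if u \<in> carrier ?E then - \<phi> (a ** u + u ** transpose a) else 0)" for a \<phi> u
    by (simp add: dual_module_def actE)
  define \<phi>0 where "\<phi>0 = (\<lambda>m. if m \<in> carrier ?E then m $ i0 $ j0 / 2 else 0)"
  have "(\<Sum>z\<in>UNIV. scale L (c z \<phi>0) (y (fst z) (snd z))) \<in> isotypic_component \<iota> L ?M"
  proof (rule isotypic_coordinates[where T = T and c = c and y = "\<lambda>z. y (fst z) (snd z)"])
    show "vector_space (scale ?M)" by (rule dual_module_vector_space)
    show "module.subspace (scale ?M) (carrier ?M)" by (rule dual_module_subspace)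
    have scE: "scale ?E k u = (\<chi> p q. k * u $ p $ q)" for k u by (simp add: exterior_square_def)
    show "\<phi>0 \<in> carrier ?M"
      by (simp add: dual_module_def vlinear_def \<phi>0_def scE exterior_square_closed add_divide_distrib)
    show "act ?M a \<phi> \<in> carrier ?M" if \<phi>: "\<phi> \<in> carrier ?M" for a \<phi>
    proof -
      have 1: "a ** (u + v) + (u + v) ** transpose a = (a ** u + u ** transpose a) + (a ** v + v ** transpose a)" for u v
        by (simp add: matrix_add_ldistrib matrix_matrix_mult_def vec_eq_iff algebra_simps sum.distrib)
      have 2: "a ** (\<chi> p q. k * u $ p $ q) + (\<chi> p q. k * u $ p $ q) ** transpose a = (\<chi> p q. k * (a ** u + u ** transpose a) $ p $ q)" for k u
        by (simp add: matrix_matrix_mult_def vec_eq_iff algebra_simps sum_distrib_left)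
      have 3: "\<phi> (a ** (\<chi> p q. k * u $ p $ q) + (\<chi> p q. k * u $ p $ q) ** transpose a) = k * \<phi> (a ** u + u ** transpose a)"
        if "u \<in> carrier ?E" for k u
        unfolding 2 by (rule ds[OF \<phi> exterior_square_act[OF that]])
      have "vlinear ?E \<lparr>carrier = UNIV, scale = (*)\<rparr> (act ?M a \<phi>)"
        unfolding vlinear_def am scE
        by (simp add: 1 3 exterior_square_closed exterior_square_act da[OF \<phi>])
      then show ?thesis by (simp add: dual_module_def)
    qed
    show "c z (act ?M a \<phi>) = (\<Sum>z'\<in>UNIV. T a z z' * c z' \<phi>)" if \<phi>: "\<phi> \<in> carrier ?M" for a \<phi> z
    proof -
      let ?S = "\<lambda>z'. (if snd z' = snd z then a $ fst z' $ fst z else 0) + (if fst z' = fst z then a $ snd z' $ snd z else 0)"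
      have "\<phi> (a ** skew_unit (fst z) (snd z) + skew_unit (fst z) (snd z) ** transpose a) =
          (\<Sum>z'\<in>UNIV. \<phi> (\<chi> p q. ?S z' * skew_unit (fst z') (snd z') $ p $ q))"
        unfolding skew_unit_act
      proof (rule vlinear_sum[OF dual[OF \<phi>], THEN conjunct1])
        show "(\<chi> p q. ?S z' * skew_unit (fst z') (snd z') $ p $ q) \<in> carrier ?E" for z'
          by (rule exterior_square_closed(2)[OF sk])
        show "0 \<in> carrier ?E" by (rule exterior_square_closed(3)[OF sk])
      qed (simp_all add: exterior_square_closed)
      also have "\<dots> = (\<Sum>z'\<in>UNIV. ?S z' * c z' \<phi>)" unfolding ds[OF \<phi> sk] by (simp only: c_def)
      finally have "c z (act ?M a \<phi>) = - (\<Sum>z'\<in>UNIV. ?S z' * c z' \<phi>)" by (simp only: c_def am sk if_True)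
      then show ?thesis unfolding T_def mult_minus_left sum_negf .
    qed
    show "br (\<iota> a) (y (fst z') (snd z')) = (\<Sum>z\<in>UNIV. scale L (T a z z') (y (fst z) (snd z)))" if a: "a \<in> carrier sl" for a z'
    proof -
      have "(\<Sum>z\<in>UNIV. scale L (T a z z') (y (fst z) (snd z))) =
        (\<Sum>z\<in>UNIV. (if snd z = snd z' then scale L (- a $ fst z' $ fst z) (y (fst z) (snd z)) else 0) +
          (if fst z = fst z' then scale L (- a $ snd z' $ snd z) (y (fst z) (snd z)) else 0))"
        by (rule sum.cong) (simp_all add: T_def scale_left_distrib scale_left_diff_distrib eq_commute)
      also have "\<dots> = (\<Sum>i\<in>UNIV. scale L (- a $ fst z' $ i) (y i (snd z'))) + (\<Sum>j\<in>UNIV. scale L (- a $ snd z' $ j) (y (fst z') j))"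
        by (rule pair_delta_sum)
      finally show ?thesis using ya[OF a, of "fst z'" "snd z'"] by simp
    qed
    show "\<phi> = 0" if \<phi>: "\<phi> \<in> carrier ?M" and s: "(\<Sum>z\<in>UNIV. scale L (c z \<phi>) (y (fst z) (snd z))) = 0" for \<phi>
    proof
      have neg: "c (j, i) \<phi> = - c (i, j) \<phi>" for i j
      proof -
        have "(skew_unit j i :: 'f^'n^'n) = (\<chi> p q. (-1) * skew_unit i j $ p $ q)" by (simp add: vec_eq_iff skew_unit_neg[of j i])
        then show ?thesis using ds[OF \<phi> sk, of "-1"] by (simp add: c_def)
      qed
      have off: "c (i, j) \<phi> = 0" if "i \<noteq> j" for i j
        by (rule pair_independent[where c = "\<lambda>i j. c (i, j) \<phi>" and s = "-1", OF _ yS skew y0 nz[OF False] neg _ that]) (use s in auto)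
      have "c (i, i) \<phi> = 0" for i using neg[of i i] by simp
      then have 0: "\<phi> (skew_unit i j) = 0" for i j using off[of i j] by (cases "i = j") (auto simp: c_def)
      show "\<phi> m = 0 m" for m
      proof (cases "m \<in> carrier ?E")
        case True
        then show ?thesis using dual_skew_expansion[OF \<phi> True] 0 by simp
      next
        case False
        then show ?thesis using \<phi> by (simp add: dual_module_def)
      qed
    qed
  qed (simp_all add: yC c_def dual_module_def)
  also have "(\<Sum>z\<in>UNIV. scale L (c z \<phi>0) (y (fst z) (snd z))) = (\<Sum>z\<in>UNIV. scale L (skew_unit i0 j0 $ fst z $ snd z / 2) (y (fst z) (snd z)))"
  proof (rule sum.cong[OF refl])
    fix z
    have "c z \<phi>0 = skew_unit i0 j0 $ fst z $ snd z / 2"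
      using skew_unit_swap[of "fst z" "snd z" i0 j0] sk by (simp add: c_def \<phi>0_def)
    then show "scale L (c z \<phi>0) (y (fst z) (snd z)) = scale L (skew_unit i0 j0 $ fst z $ snd z / 2) (y (fst z) (snd z))" by simp
  qed
  also have "\<dots> = y i0 j0" by (rule skew_unit_coordinates[OF skew ij])
  finally show ?thesis .
qed (simp add: zero_isotypic)

text \<open>The whole skew family around \<open>x\<close> is packed into one predicate so that it
  can be reused for the twisted embedding.\<close>

definition pair_element :: "'l \<Rightarrow> bool" where
  "pair_element x \<longleftrightarrow> (\<exists>y i j. i \<noteq> j \<and> x = y i j \<and> (\<forall>i j. y j i = - y i j) \<and>
     (\<forall>i j. i \<noteq> j \<longrightarrow> y i j \<in> Sp (sgl 1 i + sgl 1 j)) \<and>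
     (\<forall>a\<in>carrier sl. \<forall>i j. br (\<iota> a) (y i j) =
        (\<Sum>k\<in>UNIV. scale L (a $ k $ i) (y k j)) + (\<Sum>k\<in>UNIV. scale L (a $ k $ j) (y i k))) \<and>
     (\<forall>i j k. distinct [i, j, k] \<longrightarrow> br (E k i) (y i j) = y k j))"

lemma pair_element_exterior: "pair_element x \<Longrightarrow> x \<in> isotypic_component \<iota> L exterior_square"
  unfolding pair_element_def using pair_subset_exterior by blast

text \<open>This is all that has to be known of the symmetric part: it commutes with nonzero
  nonnegative weights of norm at most two that avoid \<open>i\<close> and \<open>j\<close>.\<close>

definition commutes_off :: "'l \<Rightarrow> 'n \<Rightarrow> 'n \<Rightarrow> bool" where
  "commutes_off s i j \<longleftrightarrow> (\<forall>v z. z \<in> Sp v \<and> nrm v \<le> 2 \<and> 0 < nrm v \<and> (\<forall>i. 0 \<le> v i) \<and> v i = 0 \<and> v j = 0 \<longrightarrow> br s z = 0)"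

lemma pair_element_split:
  assumes "x \<in> Sp (sgl 1 i + sgl 1 j)" "i \<noteq> j"
  shows "\<exists>a s. x = a + s \<and> pair_element a \<and> a \<in> Sp (sgl 1 i + sgl 1 j) \<and> commutes_off s i j"
proof (rule pair_decomposition[OF assms])
  fix y s
  assume *: "x = y i j + s" "\<And>i j. y j i = - y i j" "\<And>i j. i \<noteq> j \<Longrightarrow> y i j \<in> Sp (sgl 1 i + sgl 1 j)"
    "\<And>a i j. a \<in> carrier sl \<Longrightarrow>
      br (\<iota> a) (y i j) = (\<Sum>k\<in>UNIV. scale L (a $ k $ i) (y k j)) + (\<Sum>k\<in>UNIV. scale L (a $ k $ j) (y i k))"
    "s \<in> Sp (sgl 1 i + sgl 1 j)" "\<And>i j k. distinct [i, j, k] \<Longrightarrow> br (E k i) (y i j) = y k j"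
    "\<And>v z. \<lbrakk>z \<in> Sp v; nrm v \<le> 2; 0 < nrm v; \<And>i. 0 \<le> v i; v i = 0; v j = 0\<rbrakk> \<Longrightarrow> br s z = 0"
  have "pair_element (y i j)"
    unfolding pair_element_def by (rule exI[of _ y], rule exI[of _ i], rule exI[of _ j]) (use * assms(2) in blast)
  moreover have "commutes_off s i j" unfolding commutes_off_def using *(7) by blast
  ultimately show ?thesis using *(1) *(3)[OF assms(2)] by blast
qed

text \<open>With \<open>x = a + s\<close> and \<open>y = b + t\<close>, the symmetric parts satisfy
  \<open>[s, y] = 0\<close> and \<open>[a, t] = 0\<close>. What remains is \<open>[a, b]\<close>, a
  bracket of two members of skew families.\<close>

lemma br_pair_pair:
  assumes x: "x \<in> Sp (sgl 1 i + sgl 1 j)" and y: "y \<in> Sp (sgl 1 k + sgl 1 l)" and d: "distinct [i, j, k, l]"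
    and H: "\<And>a b. pair_element a \<Longrightarrow> pair_element b \<Longrightarrow> br a b = 0"
  shows "br x y = 0"
proof -
  have ij: "i \<noteq> j" and kl: "k \<noteq> l" using d by auto
  have w: "nrm (sgl 1 p + sgl 1 q) \<le> 2" "0 < nrm (sgl 1 p + sgl 1 q)" "0 \<le> (sgl 1 p + sgl 1 q) m" if "p \<noteq> q" for p q m :: 'n
    using that by (auto simp: sgl_app)
  have z: "(sgl 1 k + sgl 1 l) i = 0" "(sgl 1 k + sgl 1 l) j = 0" "(sgl 1 i + sgl 1 j) k = 0" "(sgl 1 i + sgl 1 j) l = 0"
    using d by (auto simp: sgl_app)
  obtain a s where a: "x = a + s" "pair_element a" "a \<in> Sp (sgl 1 i + sgl 1 j)" "commutes_off s i j"
    using pair_element_split[OF x ij] by blast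
  obtain b t where b: "y = b + t" "pair_element b" "b \<in> Sp (sgl 1 k + sgl 1 l)" "commutes_off t k l"
    using pair_element_split[OF y kl] by blast
  have "br s y = 0" using a(4) y w[OF kl] z(1,2) unfolding commutes_off_def by blast
  moreover have "br t a = 0" using b(4) a(3) w[OF ij] z(3,4) unfolding commutes_off_def by blast
  ultimately show ?thesis
    using H[OF a(2) b(2)] br_skew[of a t] by (simp add: a(1) b(1) br_add_left br_add_right)
qed

lemma br_pair_single:
  assumes x: "x \<in> Sp (sgl 1 i + sgl 1 j)" and y: "y \<in> Sp (sgl 1 k)" and d: "distinct [i, j, k]"
    and H: "\<And>a. pair_element a \<Longrightarrow> br a y = 0"
  shows "br x y = 0"
proof -
  have ij: "i \<noteq> j" using d by auto
  obtain a s where a: "x = a + s" "pair_element a" "a \<in> Sp (sgl 1 i + sgl 1 j)" "commutes_off s i j"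
    using pair_element_split[OF x ij] by blast
  have "nrm (sgl 1 k) \<le> 2" "0 < nrm (sgl 1 k)" "\<forall>m. 0 \<le> sgl 1 k m" "sgl 1 k i = 0" "sgl 1 k j = 0"
    using d by (auto simp: sgl_app)
  then have "br s y = 0" using a(4) y unfolding commutes_off_def by blast
  then show ?thesis using H[OF a(2)] by (simp add: a(1) br_add_left)
qed

lemma twisted_pair_element:
  assumes "Theta_lie.pair_element L br (\<lambda>x. \<iota> (- transpose x)) x"
  shows "x \<in> isotypic_component \<iota> L (dual_module exterior_square)"
proof -
  interpret T: Theta_lie L br "\<lambda>x. \<iota> (- transpose x)" by (rule twist)
  obtain y i0 j0 where y: "i0 \<noteq> j0" "x = y i0 j0" and skew: "\<And>i j. y j i = - y i j"
    and yS: "\<And>i j. i \<noteq> j \<Longrightarrow> y i j \<in> T.Sp (sgl 1 i + sgl 1 j)"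
    and ya: "\<And>a i j. a \<in> carrier sl \<Longrightarrow> br (\<iota> (- transpose a)) (y i j) =
        (\<Sum>k\<in>UNIV. scale L (a $ k $ i) (y k j)) + (\<Sum>k\<in>UNIV. scale L (a $ k $ j) (y i k))"
    and yE: "\<And>i j k. distinct [i, j, k] \<Longrightarrow> br (T.E k i) (y i j) = y k j"
    using assms unfolding T.pair_element_def by blast
  show ?thesis unfolding y(2)
  proof (rule dual_pair_subset[where y = y])
    show "y i j \<in> Sp (sgl (-1) i + sgl (-1) j)" if "i \<noteq> j" for i j
    proof -
      have "- (sgl 1 i + sgl 1 j) = sgl (-1) i + sgl (-1) j" by (simp add: sgl_minus[symmetric])
      then show ?thesis using yS[OF that] unfolding twist_Sp by simp
    qed
    show "br (\<iota> a) (y i j) = (\<Sum>k\<in>UNIV. scale L (- a $ i $ k) (y k j)) + (\<Sum>k\<in>UNIV. scale L (- a $ j $ k) (y i k))"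
      if a: "a \<in> carrier sl" for a i j
    proof -
      have "- transpose a \<in> carrier sl" using a by (simp add: sl_def trace_def transpose_def sum_negf)
      moreover have "- transpose (- transpose a) = a" by (simp add: transpose_def vec_eq_iff)
      moreover have "(- transpose a) $ k $ i = - a $ i $ k" for k i by (simp add: transpose_def)
      ultimately show ?thesis using ya[of "- transpose a" i j] by simp
    qed
    show "y i j \<noteq> 0" if "y i0 j0 \<noteq> 0" "i \<noteq> j" for i j
      by (rule T.pair_nonzero[OF skew yE that(1) y(1) that(2)])
  qed (rule skew, rule y(1))
qed

text \<open>A bracket whose weight is not in \<open>Theta\<close> vanishes by
  \<open>Sp_trivial\<close>. The exceptional coincidences pair vectors of a common sign with
  disjoint supports; there the symmetric parts drop out and the remaining factors lie in isotypic
  components to which the star conditions apply. Negative signs are treated through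
  \<open>twist\<close>.\<close>

lemma star_norm_graded:
  assumes star: "star_conditions \<iota> L"
  shows "norm_graded \<iota> L"
  unfolding norm_graded_def
proof (intro allI impI, elim conjE)
  fix u v :: "'n \<Rightarrow> int" and x y
  assume n: "nrm u \<le> 2" "nrm v \<le> 2" "2 < nrm (u + v)" and x: "x \<in> Sp u" and y: "y \<in> Sp v"
  interpret T: Theta_lie L br "\<lambda>x. \<iota> (- transpose x)" by (rule twist)
  define V V' where "V = isotypic_component \<iota> L natural_module" and "V' = isotypic_component \<iota> L (dual_module natural_module)"
  define \<Lambda> \<Lambda>' where "\<Lambda> = isotypic_component \<iota> L exterior_square" and "\<Lambda>' = isotypic_component \<iota> L (dual_module exterior_square)"
  have s6: "bracket_span L \<Lambda> \<Lambda> = {0}" "bracket_span L \<Lambda>' \<Lambda>' = {0}" if "CARD('n) = 6"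
    using star that unfolding star_conditions_def Let_def \<Lambda>_def \<Lambda>'_def by auto
  have s5: "bracket_span L \<Lambda> {x + y |x y. x \<in> \<Lambda> \<and> y \<in> V} = {0}" "bracket_span L \<Lambda>' {x + y |x y. x \<in> \<Lambda>' \<and> y \<in> V'} = {0}" if "CARD('n) = 5"
    using star that unfolding star_conditions_def Let_def \<Lambda>_def \<Lambda>'_def V_def V'_def by auto
  have bs: "bracket L a b = 0" if "bracket_span L X Y = {0}" "a \<in> X" "b \<in> Y" for X Y a b
  proof -
    have "bracket L a b \<in> bracket_span L X Y" unfolding bracket_span_def vspan_def using that by (intro span_base) blast
    then show ?thesis using that(1) by simp
  qed
  \<comment> \<open>Zero lies in every component, so each component is contained in the set of sums
    that occurs in the condition for n = 5.\<close>
  have z: "0 \<in> V" "0 \<in> V'" "0 \<in> \<Lambda>" "0 \<in> \<Lambda>'" unfolding V_def V'_def \<Lambda>_def \<Lambda>'_def by (rule zero_isotypic)+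
  have in1: "a \<in> {x + y |x y. x \<in> \<Lambda> \<and> y \<in> V}" if "a \<in> \<Lambda> \<or> a \<in> V" for a
    using that z by (metis (mono_tags, lifting) add.left_neutral add.right_neutral mem_Collect_eq)
  have in2: "a \<in> {x + y |x y. x \<in> \<Lambda>' \<and> y \<in> V'}" if "a \<in> \<Lambda>' \<or> a \<in> V'" for a
    using that z by (metis (mono_tags, lifting) add.left_neutral add.right_neutral mem_Collect_eq)
  have pC: "a \<in> carrier L" if "pair_element a" for a using that Sp_carrier unfolding pair_element_def by blast
  have tC: "a \<in> carrier L" if "T.pair_element a" for a using that T.Sp_carrier unfolding T.pair_element_def by blast
  have pL: "a \<in> \<Lambda>" if "pair_element a" for a unfolding \<Lambda>_def by (rule pair_element_exterior[OF that])
  have tL: "a \<in> \<Lambda>'" if "T.pair_element a" for a unfolding \<Lambda>'_def by (rule twisted_pair_element[OF that])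
  have H1: "br a b = 0" if "pair_element a" "pair_element b" "CARD('n) = 5 \<or> CARD('n) = 6" for a b
    using bs[OF s6(1) pL pL] bs[OF s5(1) pL in1] pL that by (auto simp: br_eq pC)
  have H2: "br a b = 0" if "T.pair_element a" "T.pair_element b" "CARD('n) = 5 \<or> CARD('n) = 6" for a b
    using bs[OF s6(2) tL tL] bs[OF s5(2) tL in2] tL that by (auto simp: br_eq tC)
  have H3: "br a b = 0" if "pair_element a" "b \<in> Sp (sgl 1 k)" "CARD('n) = 5" for a b k
    using bs[OF s5(1) pL in1, of a b] that Sp_subset_natural[OF that(2)] by (simp add: br_eq pC Sp_carrier V_def)
  have H4: "br a b = 0" if "T.pair_element a" "b \<in> Sp (sgl (-1) k)" "CARD('n) = 5" for a b k
    using bs[OF s5(2) tL in2, of a b] that Sp_subset_dual[OF that(2)] by (simp add: br_eq tC Sp_carrier V'_def)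
  have tw: "sgl (-1) i = - sgl 1 i" "sgl (-1) i + sgl (-1) j = - (sgl 1 i + sgl 1 j)" for i j :: 'n
    by (simp_all add: sgl_minus[symmetric])
  have single: "br x y = 0" if x: "x \<in> Sp (sgl s i + sgl s j)" and y: "y \<in> Sp (sgl s k)" and s: "s = 1 \<or> s = -1"
    and d: "distinct [i, j, k]" and n5: "CARD('n) = 5" for x y s i j k
  proof (cases "s = 1")
    case True
    then show ?thesis using br_pair_single[of x i j y k] x y d H3[OF _ _ n5] by blast
  next
    case False
    then have sm: "s = -1" using s by simp
    have "x \<in> T.Sp (sgl 1 i + sgl 1 j)" "y \<in> T.Sp (sgl 1 k)" using x y unfolding sm tw twist_Sp by auto
    then show ?thesis using T.br_pair_single[of x i j y k] d H4[OF _ y[unfolded sm] n5] by blast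
  qed
  have "br x y = 0"
  proof (cases "\<exists>t c. nrm t \<le> 2 \<and> u + v = t + (\<lambda>_. c)")
    case False
    then show ?thesis using Sp_trivial[OF Sp_br[OF x y]] by blast
  next
    case True
    then obtain t c where t: "nrm t \<le> 2" "u + v = t + (\<lambda>_. c)" by blast
    show ?thesis
    proof (rule weight_sum_cases[OF card5 n t])
      fix s i j k l assume *: "CARD('n) = 5 \<or> CARD('n) = 6" "s = 1 \<or> s = -1" "distinct [i, j, k, l]"
        "u = sgl s i + sgl s j" "v = sgl s k + sgl s l"
      show ?thesis
      proof (cases "s = 1")
        case True
        then show ?thesis using br_pair_pair[of x i j y k l] x y * H1[OF _ _ *(1)] by blast
      next
        case False
        then have sm: "s = -1" using * by simp
        have "x \<in> T.Sp (sgl 1 i + sgl 1 j)" "y \<in> T.Sp (sgl 1 k + sgl 1 l)" using x y unfolding *(4,5) sm tw twist_Sp by auto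
        then show ?thesis using T.br_pair_pair[of x i j y k l] *(3) H2[OF _ _ *(1)] by blast
      qed
    next
      fix s i j k assume *: "CARD('n) = 5" "s = 1 \<or> s = -1" "distinct [i, j, k]" "u = sgl s i + sgl s j" "v = sgl s k"
      show ?thesis by (rule single[OF x[unfolded *(4)] y[unfolded *(5)] *(2,3,1)])
    next
      fix s i j k assume *: "CARD('n) = 5" "s = 1 \<or> s = -1" "distinct [i, j, k]" "v = sgl s i + sgl s j" "u = sgl s k"
      have "br y x = 0" by (rule single[OF y[unfolded *(4)] x[unfolded *(5)] *(2,3,1)])
      then show ?thesis using br_skew[of x y] by simp
    qed
  qed
  then show "bracket L x y = 0" using x y by (simp add: br_eq Sp_carrier)
qed

end

theorem star_conditions_iff_norm_graded:
  fixes L :: "('f::field_char_0, 'l::ab_group_add) lie" and \<iota> :: "'f^'n::finite^'n \<Rightarrow> 'l"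
  assumes TG: "Theta_graded \<iota> L" and n: "5 \<le> CARD('n)"
  shows "star_conditions \<iota> L \<longleftrightarrow> norm_graded \<iota> L"
proof -
  have L: "lie_algebra L" "lie_hom sl L \<iota>" "inj_on \<iota> (carrier sl)" using TG by (auto simp: Theta_graded_def)
  obtain br where "sl_lie L br \<iota>" using sl_lie_exists[OF L(1,2)] .
  then interpret S: sl_lie5 L br \<iota> using n by (simp add: sl_lie5_def sl_lie5_axioms_def)
  interpret T: Theta_lie L br \<iota> using S.Theta_graded_iff[OF L(3)] TG by unfold_locales simp
  show ?thesis using T.star_norm_graded S.norm_graded_star by blast
qed

section \<open>Unitary Lie algebras\<close>

text \<open>The parameter \<open>N\<close> carries the index type \<open>'n\<close>, which the
  coordinate data do not mention.\<close>

locale unitary =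
  fixes A :: "('f::field_char_0, 'a::ab_group_add) inv_algebra" and e1 e2 :: 'a
    and B :: "('f, 'a, 'b::ab_group_add) herm_module" and N :: "'n::finite itself"
  assumes data: "coordinate_data A e1 e2 B" and card5: "5 \<le> CARD('n)"
begin

abbreviation "CA \<equiv> carrier A"
abbreviation "CB \<equiv> carrier B"
abbreviation mul (infixl "\<cdot>" 70) where "a \<cdot> b \<equiv> mult A a b"
abbreviation "\<eta> \<equiv> invol A"
abbreviation ra (infixl "\<star>" 70) where "x \<star> a \<equiv> ract B x a"
abbreviation "ch \<equiv> herm B"
abbreviation "one \<equiv> unit A"

lemma inv_alg: "involutive_algebra A" using data by (simp add: coordinate_data_def)
lemma rmod: "unital_right_module A B" using data by (simp add: coordinate_data_def)
lemma hform: "hermitian_form A B" using data by (simp add: coordinate_data_def)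

lemma vsA: "vector_space (scale A)" and subA: "module.subspace (scale A) CA"
  using inv_alg by (auto simp: involutive_algebra_def vspace_def)
lemma vsB: "vector_space (scale B)" and subB: "module.subspace (scale B) CB"
  using rmod by (auto simp: unital_right_module_def vspace_def)

sublocale VA: vector_space "scale A" by (rule vsA)
sublocale VB: vector_space "scale B" by (rule vsB)

lemma A_closed [simp]:
  "0 \<in> CA" "a \<in> CA \<Longrightarrow> b \<in> CA \<Longrightarrow> a + b \<in> CA" "a \<in> CA \<Longrightarrow> - a \<in> CA" "a \<in> CA \<Longrightarrow> b \<in> CA \<Longrightarrow> a - b \<in> CA"
  "a \<in> CA \<Longrightarrow> scale A c a \<in> CA" "a \<in> CA \<Longrightarrow> b \<in> CA \<Longrightarrow> a \<cdot> b \<in> CA" "a \<in> CA \<Longrightarrow> \<eta> a \<in> CA" "one \<in> CA"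
  using subA inv_alg VA.subspace_0 VA.subspace_add VA.subspace_neg VA.subspace_diff VA.subspace_scale
  by (auto simp: involutive_algebra_def vbilinear_def vlinear_def)

lemma A_sum_closed [simp]: "(\<And>i. i \<in> I \<Longrightarrow> f i \<in> CA) \<Longrightarrow> sum f I \<in> CA"
  by (rule VA.subspace_sum[OF subA])

lemma B_closed [simp]:
  "0 \<in> CB" "x \<in> CB \<Longrightarrow> y \<in> CB \<Longrightarrow> x + y \<in> CB" "x \<in> CB \<Longrightarrow> - x \<in> CB" "x \<in> CB \<Longrightarrow> y \<in> CB \<Longrightarrow> x - y \<in> CB"
  "x \<in> CB \<Longrightarrow> scale B c x \<in> CB" "x \<in> CB \<Longrightarrow> a \<in> CA \<Longrightarrow> x \<star> a \<in> CB"
  using subB rmod VB.subspace_0 VB.subspace_add VB.subspace_neg VB.subspace_diff VB.subspace_scale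
  by (auto simp: unital_right_module_def vbilinear_def vlinear_def)

lemma ch_closed [simp]: "x \<in> CB \<Longrightarrow> y \<in> CB \<Longrightarrow> ch x y \<in> CA"
  using hform unfolding hermitian_form_def vbilinear_def vlinear_def by blast

lemma mul_add: "\<lbrakk>a \<in> CA; b \<in> CA; c \<in> CA\<rbrakk> \<Longrightarrow> a \<cdot> (b + c) = a \<cdot> b + a \<cdot> c"
    "\<lbrakk>a \<in> CA; b \<in> CA; c \<in> CA\<rbrakk> \<Longrightarrow> (a + b) \<cdot> c = a \<cdot> c + b \<cdot> c"
  and mul_scale: "\<lbrakk>a \<in> CA; b \<in> CA\<rbrakk> \<Longrightarrow> a \<cdot> scale A k b = scale A k (a \<cdot> b)"
    "\<lbrakk>a \<in> CA; b \<in> CA\<rbrakk> \<Longrightarrow> scale A k a \<cdot> b = scale A k (a \<cdot> b)"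
  and mul_assoc: "\<lbrakk>a \<in> CA; b \<in> CA; c \<in> CA\<rbrakk> \<Longrightarrow> a \<cdot> b \<cdot> c = a \<cdot> (b \<cdot> c)"
  and mul_one: "a \<in> CA \<Longrightarrow> one \<cdot> a = a" "a \<in> CA \<Longrightarrow> a \<cdot> one = a"
  and eta_add: "\<lbrakk>a \<in> CA; b \<in> CA\<rbrakk> \<Longrightarrow> \<eta> (a + b) = \<eta> a + \<eta> b"
  and eta_scale: "a \<in> CA \<Longrightarrow> \<eta> (scale A k a) = scale A k (\<eta> a)"
  and eta_mul: "\<lbrakk>a \<in> CA; b \<in> CA\<rbrakk> \<Longrightarrow> \<eta> (a \<cdot> b) = \<eta> b \<cdot> \<eta> a"
  and eta_eta: "a \<in> CA \<Longrightarrow> \<eta> (\<eta> a) = a"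
  using inv_alg by (auto simp: involutive_algebra_def vbilinear_def vlinear_def)

lemma ra_add: "\<lbrakk>x \<in> CB; b \<in> CA; c \<in> CA\<rbrakk> \<Longrightarrow> x \<star> (b + c) = x \<star> b + x \<star> c"
    "\<lbrakk>x \<in> CB; y \<in> CB; c \<in> CA\<rbrakk> \<Longrightarrow> (x + y) \<star> c = x \<star> c + y \<star> c"
  and ra_scale: "\<lbrakk>x \<in> CB; b \<in> CA\<rbrakk> \<Longrightarrow> x \<star> scale A k b = scale B k (x \<star> b)"
    "\<lbrakk>x \<in> CB; b \<in> CA\<rbrakk> \<Longrightarrow> scale B k x \<star> b = scale B k (x \<star> b)"
  and ra_assoc: "\<lbrakk>x \<in> CB; b \<in> CA; c \<in> CA\<rbrakk> \<Longrightarrow> x \<star> (b \<cdot> c) = x \<star> b \<star> c"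
  and ra_one: "x \<in> CB \<Longrightarrow> x \<star> one = x"
  using rmod by (auto simp: unital_right_module_def vbilinear_def vlinear_def)

lemma ch_add: "\<lbrakk>x \<in> CB; y \<in> CB; z \<in> CB\<rbrakk> \<Longrightarrow> ch x (y + z) = ch x y + ch x z"
    "\<lbrakk>x \<in> CB; y \<in> CB; z \<in> CB\<rbrakk> \<Longrightarrow> ch (x + y) z = ch x z + ch y z"
  and ch_scale: "\<lbrakk>x \<in> CB; y \<in> CB\<rbrakk> \<Longrightarrow> ch x (scale B k y) = scale A k (ch x y)"
    "\<lbrakk>x \<in> CB; y \<in> CB\<rbrakk> \<Longrightarrow> ch (scale B k x) y = scale A k (ch x y)"
  and ch_ra: "\<lbrakk>x \<in> CB; y \<in> CB; a \<in> CA\<rbrakk> \<Longrightarrow> ch x (y \<star> a) = ch x y \<cdot> a"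
    "\<lbrakk>x \<in> CB; y \<in> CB; a \<in> CA\<rbrakk> \<Longrightarrow> ch (x \<star> a) y = \<eta> a \<cdot> ch x y"
  and ch_eta: "\<lbrakk>x \<in> CB; y \<in> CB\<rbrakk> \<Longrightarrow> \<eta> (ch x y) = ch y x"
proof -
  have h: "vbilinear B B A ch" "\<And>x y a. \<lbrakk>x \<in> CB; y \<in> CB; a \<in> CA\<rbrakk> \<Longrightarrow> ch (x \<star> a) y = \<eta> a \<cdot> ch x y \<and> ch x (y \<star> a) = ch x y \<cdot> a"
    "\<And>x y. \<lbrakk>x \<in> CB; y \<in> CB\<rbrakk> \<Longrightarrow> ch y x = \<eta> (ch x y)"
    using hform unfolding hermitian_form_def by blast+
  show "\<lbrakk>x \<in> CB; y \<in> CB; z \<in> CB\<rbrakk> \<Longrightarrow> ch x (y + z) = ch x y + ch x z"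
    "\<lbrakk>x \<in> CB; y \<in> CB; z \<in> CB\<rbrakk> \<Longrightarrow> ch (x + y) z = ch x z + ch y z"
    "\<lbrakk>x \<in> CB; y \<in> CB\<rbrakk> \<Longrightarrow> ch x (scale B k y) = scale A k (ch x y)"
    "\<lbrakk>x \<in> CB; y \<in> CB\<rbrakk> \<Longrightarrow> ch (scale B k x) y = scale A k (ch x y)"
    using h(1) by (auto simp: vbilinear_def vlinear_def)
  show "\<lbrakk>x \<in> CB; y \<in> CB; a \<in> CA\<rbrakk> \<Longrightarrow> ch x (y \<star> a) = ch x y \<cdot> a"
    "\<lbrakk>x \<in> CB; y \<in> CB; a \<in> CA\<rbrakk> \<Longrightarrow> ch (x \<star> a) y = \<eta> a \<cdot> ch x y" using h(2) by blast+
  show "\<lbrakk>x \<in> CB; y \<in> CB\<rbrakk> \<Longrightarrow> \<eta> (ch x y) = ch y x" using h(3)[of x y] by simp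
qed

lemma mul_zero [simp]: "a \<in> CA \<Longrightarrow> a \<cdot> 0 = 0" "a \<in> CA \<Longrightarrow> 0 \<cdot> a = 0"
  using mul_add(1)[of a 0 0] mul_add(2)[of 0 0 a] by auto
lemma ra_zero [simp]: "x \<in> CB \<Longrightarrow> x \<star> 0 = 0" "a \<in> CA \<Longrightarrow> 0 \<star> a = 0"
  using ra_add(1)[of x 0 0] ra_add(2)[of 0 0 a] by auto
lemma ch_zero [simp]: "x \<in> CB \<Longrightarrow> ch x 0 = 0" "x \<in> CB \<Longrightarrow> ch 0 x = 0"
  using ch_add(1)[of x 0 0] ch_add(2)[of 0 0 x] by auto
lemma eta_zero [simp]: "\<eta> 0 = 0" using eta_add[of 0 0] by simp

lemma mul_minus: "\<lbrakk>a \<in> CA; b \<in> CA\<rbrakk> \<Longrightarrow> a \<cdot> (- b) = - (a \<cdot> b)" "\<lbrakk>a \<in> CA; b \<in> CA\<rbrakk> \<Longrightarrow> (- a) \<cdot> b = - (a \<cdot> b)"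
  using mul_scale(1)[of a b "-1"] mul_scale(2)[of a b "-1"] by auto
lemma eta_minus: "a \<in> CA \<Longrightarrow> \<eta> (- a) = - \<eta> a" using eta_scale[of a "-1"] by auto
lemma ra_minus: "\<lbrakk>x \<in> CB; b \<in> CA\<rbrakk> \<Longrightarrow> x \<star> (- b) = - (x \<star> b)" "\<lbrakk>x \<in> CB; b \<in> CA\<rbrakk> \<Longrightarrow> (- x) \<star> b = - (x \<star> b)"
  using ra_scale(1)[of x b "-1"] ra_scale(2)[of x b "-1"] by auto
lemma ch_minus: "\<lbrakk>x \<in> CB; y \<in> CB\<rbrakk> \<Longrightarrow> ch x (- y) = - ch x y" "\<lbrakk>x \<in> CB; y \<in> CB\<rbrakk> \<Longrightarrow> ch (- x) y = - ch x y"
  using ch_scale(1)[of x y "-1"] ch_scale(2)[of x y "-1"] by auto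
lemma mul_diff: "\<lbrakk>a \<in> CA; b \<in> CA; c \<in> CA\<rbrakk> \<Longrightarrow> a \<cdot> (b - c) = a \<cdot> b - a \<cdot> c"
    "\<lbrakk>a \<in> CA; b \<in> CA; c \<in> CA\<rbrakk> \<Longrightarrow> (a - b) \<cdot> c = a \<cdot> c - b \<cdot> c"
  using mul_add(1)[of a b "- c"] mul_add(2)[of a "- b" c] by (simp_all add: mul_minus)
lemma ra_diff: "\<lbrakk>x \<in> CB; b \<in> CA; c \<in> CA\<rbrakk> \<Longrightarrow> x \<star> (b - c) = x \<star> b - x \<star> c"
    "\<lbrakk>x \<in> CB; y \<in> CB; c \<in> CA\<rbrakk> \<Longrightarrow> (x - y) \<star> c = x \<star> c - y \<star> c"
  using ra_add(1)[of x b "- c"] ra_add(2)[of x "- y" c] by (simp_all add: ra_minus)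
lemma ch_diff: "\<lbrakk>x \<in> CB; y \<in> CB; z \<in> CB\<rbrakk> \<Longrightarrow> ch x (y - z) = ch x y - ch x z"
    "\<lbrakk>x \<in> CB; y \<in> CB; z \<in> CB\<rbrakk> \<Longrightarrow> ch (x - y) z = ch x z - ch y z"
  using ch_add(1)[of x y "- z"] ch_add(2)[of x "- y" z] by (simp_all add: ch_minus)
lemma eta_diff: "\<lbrakk>a \<in> CA; b \<in> CA\<rbrakk> \<Longrightarrow> \<eta> (a - b) = \<eta> a - \<eta> b"
  using eta_add[of a "- b"] by (simp add: eta_minus)
lemma mul_sum: "a \<in> CA \<Longrightarrow> (\<And>i. i \<in> I \<Longrightarrow> f i \<in> CA) \<Longrightarrow> a \<cdot> sum f I = (\<Sum>i\<in>I. a \<cdot> f i)"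
  by (induction I rule: infinite_finite_induct) (auto simp: mul_add)
lemma sum_mul: "a \<in> CA \<Longrightarrow> (\<And>i. i \<in> I \<Longrightarrow> f i \<in> CA) \<Longrightarrow> sum f I \<cdot> a = (\<Sum>i\<in>I. f i \<cdot> a)"
  by (induction I rule: infinite_finite_induct) (auto simp: mul_add)
lemma eta_one [simp]: "\<eta> one = one"
  by (metis A_closed(7,8) eta_eta eta_mul mul_one)

section \<open>Skew endomorphisms of the hermitian module\<close>

abbreviation W :: "('f, 'a, ('a^'n) \<times> 'b) herm_module" where "W \<equiv> sum_module A B"
abbreviation U :: "('f, ('a^'n) \<times> 'b \<Rightarrow> ('a^'n) \<times> 'b) lie" where "U \<equiv> skew_endomorphisms A W"
abbreviation "CW \<equiv> carrier W"

lemma W_carrier: "u \<in> CW \<longleftrightarrow> (\<forall>i. fst u $ i \<in> CA) \<and> snd u \<in> CB"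
  by (cases u) (simp add: sum_module_def)
lemma W_scale: "scale W c u = (\<chi> i. scale A c (fst u $ i), scale B c (snd u))"
  by (cases u) (simp add: sum_module_def)
lemma W_ract: "ract W u a = (\<chi> i. fst u $ i \<cdot> a, snd u \<star> a)"
  by (cases u) (simp add: sum_module_def)
lemma W_herm: "herm W u w = (\<Sum>i\<in>UNIV. \<eta> (fst u $ i) \<cdot> (fst w $ i)) - ch (snd u) (snd w)"
  by (cases u; cases w) (simp add: sum_module_def)

lemma W_closed [simp]: "0 \<in> CW" "u \<in> CW \<Longrightarrow> w \<in> CW \<Longrightarrow> u + w \<in> CW" "u \<in> CW \<Longrightarrow> - u \<in> CW"
  "u \<in> CW \<Longrightarrow> w \<in> CW \<Longrightarrow> u - w \<in> CW" "u \<in> CW \<Longrightarrow> scale W c u \<in> CW" "u \<in> CW \<Longrightarrow> a \<in> CA \<Longrightarrow> ract W u a \<in> CW"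
  by (simp_all add: W_carrier W_scale W_ract)

lemma vsW: "vector_space (scale W)"
  by unfold_locales (auto simp: W_scale prod_eq_iff vec_eq_iff VA.scale_right_distrib VB.scale_right_distrib
      VA.scale_left_distrib VB.scale_left_distrib)

sublocale VW: vector_space "scale W" by (rule vsW)

lemma W_ract_add: "u \<in> CW \<Longrightarrow> w \<in> CW \<Longrightarrow> a \<in> CA \<Longrightarrow> ract W (u + w) a = ract W u a + ract W w a"
  and W_ract_scale: "u \<in> CW \<Longrightarrow> a \<in> CA \<Longrightarrow> ract W (scale W c u) a = scale W c (ract W u a)"
  by (simp_all add: W_ract W_scale W_carrier prod_eq_iff vec_eq_iff mul_add ra_add mul_scale ra_scale)

lemma W_ract_minus: "u \<in> CW \<Longrightarrow> a \<in> CA \<Longrightarrow> ract W (- u) a = - ract W u a"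
  using W_ract_scale[of u a "-1"] by simp
lemma W_ract_diff: "u \<in> CW \<Longrightarrow> w \<in> CW \<Longrightarrow> a \<in> CA \<Longrightarrow> ract W (u - w) a = ract W u a - ract W w a"
  using W_ract_add[of u "- w" a] by (simp add: W_ract_minus)

lemma herm_add: "u \<in> CW \<Longrightarrow> v \<in> CW \<Longrightarrow> w \<in> CW \<Longrightarrow> herm W (u + v) w = herm W u w + herm W v w"
    "u \<in> CW \<Longrightarrow> v \<in> CW \<Longrightarrow> w \<in> CW \<Longrightarrow> herm W w (u + v) = herm W w u + herm W w v"
  and herm_scale: "u \<in> CW \<Longrightarrow> w \<in> CW \<Longrightarrow> herm W (scale W c u) w = scale A c (herm W u w)"
    "u \<in> CW \<Longrightarrow> w \<in> CW \<Longrightarrow> herm W w (scale W c u) = scale A c (herm W w u)"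
  by (simp_all add: W_herm W_scale W_carrier mul_add eta_add ch_add sum.distrib eta_scale mul_scale ch_scale
      VA.scale_right_diff_distrib VA.scale_sum_right)

lemma herm_minus: "u \<in> CW \<Longrightarrow> w \<in> CW \<Longrightarrow> herm W (- u) w = - herm W u w"
    "u \<in> CW \<Longrightarrow> w \<in> CW \<Longrightarrow> herm W w (- u) = - herm W w u"
  using herm_scale[of u w "-1"] by simp_all
lemma herm_diff: "u \<in> CW \<Longrightarrow> v \<in> CW \<Longrightarrow> w \<in> CW \<Longrightarrow> herm W (u - v) w = herm W u w - herm W v w"
    "u \<in> CW \<Longrightarrow> v \<in> CW \<Longrightarrow> w \<in> CW \<Longrightarrow> herm W w (u - v) = herm W w u - herm W w v"
  using herm_add[of u "- v" w] by (simp_all add: herm_minus)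

lemma mem_U: "T \<in> carrier U \<longleftrightarrow> (\<forall>u\<in>CW. T u \<in> CW) \<and> (\<forall>u\<in>CW. \<forall>w\<in>CW. T (u + w) = T u + T w) \<and>
    (\<forall>c. \<forall>u\<in>CW. T (scale W c u) = scale W c (T u)) \<and> (\<forall>u. u \<notin> CW \<longrightarrow> T u = 0) \<and>
    (\<forall>u\<in>CW. \<forall>a\<in>CA. T (ract W u a) = ract W (T u) a) \<and>
    (\<forall>u\<in>CW. \<forall>w\<in>CW. herm W (T u) w + herm W u (T w) = 0)"
  by (simp add: skew_endomorphisms_def vlinear_def)

lemma U_D:
  assumes "T \<in> carrier U"
  shows "\<And>u. u \<in> CW \<Longrightarrow> T u \<in> CW" "\<And>u w. u \<in> CW \<Longrightarrow> w \<in> CW \<Longrightarrow> T (u + w) = T u + T w"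
    "\<And>c u. u \<in> CW \<Longrightarrow> T (scale W c u) = scale W c (T u)" "\<And>u. u \<notin> CW \<Longrightarrow> T u = 0"
    "\<And>u a. u \<in> CW \<Longrightarrow> a \<in> CA \<Longrightarrow> T (ract W u a) = ract W (T u) a"
    "\<And>u w. u \<in> CW \<Longrightarrow> w \<in> CW \<Longrightarrow> herm W (T u) w + herm W u (T w) = 0"
  using assms unfolding mem_U by blast+

lemma U_in: "T \<in> carrier U \<Longrightarrow> T u \<in> CW" by (cases "u \<in> CW") (auto simp: U_D)
lemma U_zero: "T \<in> carrier U \<Longrightarrow> T 0 = 0" using U_D(2)[of T 0 0] by simp
lemma U_minus: "T \<in> carrier U \<Longrightarrow> u \<in> CW \<Longrightarrow> T (- u) = - T u" using U_D(3)[of T u "-1"] by simp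
lemma U_diff: "T \<in> carrier U \<Longrightarrow> u \<in> CW \<Longrightarrow> w \<in> CW \<Longrightarrow> T (u - w) = T u - T w"
  using U_D(2)[of T u "- w"] by (simp add: U_minus)
lemma U_sum: "T \<in> carrier U \<Longrightarrow> (\<And>i. i \<in> I \<Longrightarrow> f i \<in> CW) \<Longrightarrow> sum f I \<in> CW \<and> T (sum f I) = (\<Sum>i\<in>I. T (f i))"
  by (induction I rule: infinite_finite_induct) (auto simp: U_D U_zero)

lemma U_ops: "scale U c T = (\<lambda>u. scale W c (T u))" "bracket U S T = (\<lambda>u. S (T u) - T (S u))"
  by (simp_all add: skew_endomorphisms_def)

lemma U_bracket_closed:
  assumes S: "S \<in> carrier U" and T: "T \<in> carrier U"
  shows "bracket U S T \<in> carrier U"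
proof -
  note D = U_D[OF S] U_D[OF T] U_zero[OF S] U_zero[OF T] U_diff[OF S] U_diff[OF T]
  have skew: "herm W (S u) w = - herm W u (S w)" "herm W (T u) w = - herm W u (T w)" if "u \<in> CW" "w \<in> CW" for u w
    using D(6)[OF that] D(12)[OF that] by (simp_all add: eq_neg_iff_add_eq_0)
  show ?thesis unfolding mem_U U_ops
    by (simp add: D(1-5,7-11,13-14) W_ract_diff herm_diff skew VW.scale_right_diff_distrib)
qed

lemma lie_algebra_U: "lie_algebra U"
proof -
  have vsU: "vector_space (scale U)"
    unfolding U_ops by unfold_locales (auto simp: fun_eq_iff VW.scale_right_distrib VW.scale_left_distrib)
  interpret VU: vector_space "scale U" by (rule vsU)
  have subU: "VU.subspace (carrier U)"
    unfolding VU.subspace_def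
  proof (intro conjI ballI allI)
    show "0 \<in> carrier U" by (simp add: mem_U W_ract W_herm W_carrier prod_eq_iff vec_eq_iff)
  next
    fix S T assume S: "S \<in> carrier U" and T: "T \<in> carrier U"
    have "herm W (S u) w + herm W (T u) w + (herm W u (S w) + herm W u (T w)) = 0" if "u \<in> CW" "w \<in> CW" for u w
    proof -
      have "herm W (S u) w + herm W (T u) w + (herm W u (S w) + herm W u (T w)) =
          (herm W (S u) w + herm W u (S w)) + (herm W (T u) w + herm W u (T w))" by (simp only: ac_simps)
      then show ?thesis by (simp only: U_D(6)[OF S that] U_D(6)[OF T that] add_0_left)
    qed
    then show "S + T \<in> carrier U" unfolding mem_U
      by (simp add: U_D[OF S] U_D[OF T] W_ract_add herm_add VW.scale_right_distrib)
  next
    fix c T assume T: "T \<in> carrier U"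
    have "scale A c (herm W (T u) w) + scale A c (herm W u (T w)) = 0" if "u \<in> CW" "w \<in> CW" for u w
      by (simp only: U_D(6)[OF T that] VA.scale_zero_right flip: VA.scale_right_distrib)
    then show "scale U c T \<in> carrier U" unfolding mem_U U_ops
      by (simp add: U_D[OF T] W_ract_scale herm_scale VW.scale_right_distrib VW.scale_left_commute)
  qed
  have "vbilinear U U U (bracket U)"
    unfolding vbilinear_def vlinear_def
    by (intro conjI ballI allI U_bracket_closed)
      (simp_all add: U_ops fun_eq_iff U_D U_in VW.scale_right_diff_distrib split_paired_all del: split_paired_All)
  moreover have "bracket U S (bracket U T R) + bracket U T (bracket U R S) + bracket U R (bracket U S T) = 0"
    if "S \<in> carrier U" "T \<in> carrier U" "R \<in> carrier U" for S T R
  proof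
    fix u
    show "(bracket U S (bracket U T R) + bracket U T (bracket U R S) + bracket U R (bracket U S T)) u = 0 u"
    proof (cases "u \<in> CW")
      case True
      then show ?thesis using that by (simp add: U_ops U_diff U_D)
    next
      case False
      then show ?thesis using that by (simp add: U_ops U_D U_zero)
    qed
  qed
  ultimately show ?thesis
    unfolding lie_algebra_def vspace_def using vsU subU by (auto simp: U_ops fun_eq_iff)
qed

text \<open>The skew analogue of a matrix unit: a coefficient \<open>a\<close> at
  \<open>(i, j)\<close> forces \<open>- \<eta> a\<close> at \<open>(j, i)\<close>.\<close>

definition X :: "'n \<Rightarrow> 'n \<Rightarrow> 'a \<Rightarrow> ('a^'n) \<times> 'b \<Rightarrow> ('a^'n) \<times> 'b" where
  "X i j a u = (if u \<in> CW then (\<chi> k. if k = i then a \<cdot> fst u $ j else if k = j then - (\<eta> a \<cdot> fst u $ i) else 0, 0) else 0)"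

text \<open>The basis vector at \<open>i\<close> is sent to \<open>y\<close>. Skewness then forces
  the values \<open>ch y\<close> on the module part; the sign is positive because the form contains
  \<open>- ch\<close>.\<close>

definition Y :: "'n \<Rightarrow> 'b \<Rightarrow> ('a^'n) \<times> 'b \<Rightarrow> ('a^'n) \<times> 'b" where
  "Y i y u = (if u \<in> CW then (\<chi> k. if k = i then ch y (snd u) else 0, y \<star> fst u $ i) else 0)"

lemma sum_pair:
  assumes "i \<noteq> j" "\<And>k. k \<noteq> i \<Longrightarrow> k \<noteq> j \<Longrightarrow> F k = 0"
  shows "sum F (UNIV::'n set) = F i + F j"
proof -
  have "sum F UNIV = sum F {i, j}" by (rule sum.mono_neutral_right) (use assms in auto)
  then show ?thesis using assms(1) by simp
qed

lemma X_fst: "u \<in> CW \<Longrightarrow> fst (X i j a u) $ k = (if k = i then a \<cdot> fst u $ j else if k = j then - (\<eta> a \<cdot> fst u $ i) else 0)"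
  and X_snd [simp]: "snd (X i j a u) = 0"
  and X_out: "u \<notin> CW \<Longrightarrow> X i j a u = 0"
  and Y_fst: "u \<in> CW \<Longrightarrow> fst (Y i y u) $ k = (if k = i then ch y (snd u) else 0)"
  and Y_snd: "u \<in> CW \<Longrightarrow> snd (Y i y u) = y \<star> fst u $ i"
  and Y_out: "u \<notin> CW \<Longrightarrow> Y i y u = 0"
  by (simp_all add: X_def Y_def)

lemma CW_D: "u \<in> CW \<Longrightarrow> fst u $ k \<in> CA" "u \<in> CW \<Longrightarrow> snd u \<in> CB"
  by (simp_all add: W_carrier)

lemma W_eqI: "(\<And>k. fst u $ k = fst w $ k) \<Longrightarrow> snd u = snd w \<Longrightarrow> u = (w :: ('a^'n) \<times> 'b)"
  by (simp add: prod_eq_iff vec_eq_iff)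

lemma X_CW: "a \<in> CA \<Longrightarrow> X i j a u \<in> CW"
  by (cases "u \<in> CW") (simp_all add: X_out W_carrier[of "X i j a u"] X_fst CW_D)
lemma Y_CW: "y \<in> CB \<Longrightarrow> Y i y u \<in> CW"
  by (cases "u \<in> CW") (simp_all add: Y_out W_carrier[of "Y i y u"] Y_fst Y_snd CW_D)

lemma W_comp: "fst (u + w) $ k = fst u $ k + fst w $ k" "fst (u - w) $ k = fst u $ k - fst w $ k"
  "fst (- u) $ k = - (fst u $ k)" "fst (scale W c u) $ k = scale A c (fst u $ k)" "snd (scale W c u) = scale B c (snd u)"
  "fst (ract W u a) $ k = fst u $ k \<cdot> a" "snd (ract W u a) = snd u \<star> a" "fst (0 :: ('a^'n) \<times> 'b) $ k = 0"
  by (simp_all add: W_scale W_ract)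

lemma X_in: assumes "i \<noteq> j" "a \<in> CA" shows "X i j a \<in> carrier U"
  unfolding mem_U
proof (intro conjI ballI allI impI)
  fix u w assume uw: "u \<in> CW" "w \<in> CW"
  have "(\<Sum>k\<in>UNIV. \<eta> (fst (X i j a u) $ k) \<cdot> fst w $ k) = \<eta> (fst (X i j a u) $ i) \<cdot> fst w $ i + \<eta> (fst (X i j a u) $ j) \<cdot> fst w $ j"
    by (rule sum_pair) (use uw assms in \<open>simp_all add: X_fst CW_D\<close>)
  moreover have "(\<Sum>k\<in>UNIV. \<eta> (fst u $ k) \<cdot> fst (X i j a w) $ k) = \<eta> (fst u $ i) \<cdot> fst (X i j a w) $ i + \<eta> (fst u $ j) \<cdot> fst (X i j a w) $ j"
    by (rule sum_pair) (use uw assms in \<open>simp_all add: X_fst CW_D\<close>)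
  ultimately show "herm W (X i j a u) w + herm W u (X i j a w) = 0"
    using uw assms assms(1)[symmetric] by (simp add: W_herm X_fst CW_D mul_minus eta_minus eta_mul eta_eta mul_assoc)
next
  fix u w assume "u \<in> CW" "w \<in> CW" then show "X i j a (u + w) = X i j a u + X i j a w"
    using assms by (intro W_eqI) (simp_all add: W_comp X_fst mul_add mul_scale mul_minus CW_D mul_assoc)
next
  fix c u assume "u \<in> CW" then show "X i j a (scale W c u) = scale W c (X i j a u)"
    using assms by (intro W_eqI) (simp_all add: W_comp X_fst mul_add mul_scale mul_minus CW_D mul_assoc)
next
  fix u c assume "u \<in> CW" "c \<in> CA" then show "X i j a (ract W u c) = ract W (X i j a u) c"
    using assms by (intro W_eqI) (simp_all add: W_comp X_fst mul_add mul_scale mul_minus CW_D mul_assoc)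
qed (use assms in \<open>auto simp: X_CW X_out W_comp X_fst mul_add mul_scale mul_minus CW_D mul_assoc\<close>)

lemma Y_in: assumes "y \<in> CB" shows "Y i y \<in> carrier U"
  unfolding mem_U
proof (intro conjI ballI allI impI)
  fix u w assume uw: "u \<in> CW" "w \<in> CW"
  have "(\<Sum>k\<in>UNIV. \<eta> (fst (Y i y u) $ k) \<cdot> fst w $ k) = (\<Sum>k\<in>UNIV. if k = i then ch (snd u) y \<cdot> fst w $ i else 0)"
    by (rule sum.cong) (use uw assms in \<open>simp_all add: Y_fst CW_D ch_eta\<close>)
  moreover have "(\<Sum>k\<in>UNIV. \<eta> (fst u $ k) \<cdot> fst (Y i y w) $ k) = (\<Sum>k\<in>UNIV. if k = i then \<eta> (fst u $ i) \<cdot> ch y (snd w) else 0)"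
    by (rule sum.cong) (use uw assms in \<open>simp_all add: Y_fst CW_D ch_eta\<close>)
  ultimately show "herm W (Y i y u) w + herm W u (Y i y w) = 0"
    using uw assms by (simp add: W_herm Y_snd CW_D ch_ra)
next
  fix u w assume "u \<in> CW" "w \<in> CW" then show "Y i y (u + w) = Y i y u + Y i y w"
    using assms by (intro W_eqI) (simp_all add: W_comp Y_fst Y_snd ch_add ch_scale ch_ra ra_add ra_scale ra_assoc CW_D)
next
  fix c u assume "u \<in> CW" then show "Y i y (scale W c u) = scale W c (Y i y u)"
    using assms by (intro W_eqI) (simp_all add: W_comp Y_fst Y_snd ch_add ch_scale ch_ra ra_add ra_scale ra_assoc CW_D)
next
  fix u c assume "u \<in> CW" "c \<in> CA" then show "Y i y (ract W u c) = ract W (Y i y u) c"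
    using assms by (intro W_eqI) (simp_all add: W_comp Y_fst Y_snd ch_add ch_scale ch_ra ra_add ra_scale ra_assoc CW_D)
qed (use assms in \<open>auto simp: Y_CW Y_out W_comp Y_fst Y_snd ch_add ch_scale ch_ra ra_add ra_scale ra_assoc CW_D\<close>)

lemma X_add: "a \<in> CA \<Longrightarrow> b \<in> CA \<Longrightarrow> X i j (a + b) = X i j a + X i j b"
  and X_scale: "a \<in> CA \<Longrightarrow> X i j (scale A c a) = scale U c (X i j a)"
  and Y_add: "y \<in> CB \<Longrightarrow> z \<in> CB \<Longrightarrow> Y i (y + z) = Y i y + Y i z"
  and Y_scale: "y \<in> CB \<Longrightarrow> Y i (scale B c y) = scale U c (Y i y)"
  by (auto simp: fun_eq_iff X_def Y_def U_ops W_scale prod_eq_iff vec_eq_iff W_carrier mul_add mul_scale eta_add eta_scale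
      ch_add ra_add ch_scale ra_scale)

lemma U_ext: assumes "\<And>u. u \<in> CW \<Longrightarrow> S u = T u" "\<And>u. u \<notin> CW \<Longrightarrow> S u = 0" "\<And>u. u \<notin> CW \<Longrightarrow> T u = 0"
  shows "S = (T :: ('a^'n) \<times> 'b \<Rightarrow> ('a^'n) \<times> 'b)"
  using assms by (metis ext)

lemma XY_zero_arg: "a \<in> CA \<Longrightarrow> X i j a 0 = 0" "y \<in> CB \<Longrightarrow> Y i y 0 = 0"
  by (rule W_eqI; simp add: X_fst Y_fst Y_snd)+

lemma X_skew: "i \<noteq> j \<Longrightarrow> a \<in> CA \<Longrightarrow> X j i a = - X i j (\<eta> a)"
  by (rule U_ext, rule W_eqI) (simp_all add: X_fst X_out W_comp eta_eta)

text \<open>These brackets recover product, module action and hermitian form from the generators.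
  They are the relations that \<open>coordinatized\<close> assumes later.\<close>

lemma
  assumes ij: "i \<noteq> j" and a: "a \<in> CA"
  shows X_X: "j \<noteq> k \<Longrightarrow> i \<noteq> k \<Longrightarrow> b \<in> CA \<Longrightarrow> bracket U (X i j a) (X j k b) = X i k (a \<cdot> b)"
    and X_X0: "k \<noteq> l \<Longrightarrow> {i,j} \<inter> {k,l} = {} \<Longrightarrow> b \<in> CA \<Longrightarrow> bracket U (X i j a) (X k l b) = 0"
    and Y_X: "y \<in> CB \<Longrightarrow> bracket U (Y i y) (X i j a) = Y j (y \<star> a)"
    and Y_X0: "y \<in> CB \<Longrightarrow> k \<noteq> i \<Longrightarrow> k \<noteq> j \<Longrightarrow> bracket U (Y k y) (X i j a) = 0"
    and Y_Y: "y \<in> CB \<Longrightarrow> z \<in> CB \<Longrightarrow> bracket U (Y i y) (Y j z) = X i j (ch y z)"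
  subgoal
    by (rule U_ext, rule W_eqI) (simp_all add: U_ops X_fst X_out X_CW XY_zero_arg W_comp mul_minus eta_mul mul_assoc CW_D ij a ij[symmetric])
  subgoal
    by (rule U_ext, rule W_eqI; fastforce simp: U_ops X_fst X_out X_CW XY_zero_arg W_comp CW_D ij a ij[symmetric])
  subgoal
    by (rule U_ext, rule W_eqI) (simp_all add: U_ops X_fst X_out X_CW Y_fst Y_snd Y_out Y_CW ch_ra ra_assoc ra_minus XY_zero_arg W_comp mul_minus eta_mul mul_assoc CW_D ij a ij[symmetric])
  subgoal
    by (rule U_ext, rule W_eqI) (simp_all add: U_ops X_fst X_out X_CW Y_fst Y_snd Y_out Y_CW ch_ra ra_assoc XY_zero_arg W_comp mul_minus eta_mul mul_assoc CW_D ij a ij[symmetric])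
  subgoal
    by (rule U_ext, rule W_eqI) (simp_all add: U_ops X_fst X_out X_CW Y_fst Y_snd Y_out Y_CW ch_ra ch_eta ra_assoc XY_zero_arg W_comp mul_minus eta_mul mul_assoc CW_D ij a ij[symmetric])
  done

section \<open>Matrix coefficients and diagonal endomorphisms\<close>

definition ax :: "'n \<Rightarrow> ('a^'n) \<times> 'b" where "ax j = (axis j one, 0)"

definition entry :: "(('a^'n) \<times> 'b \<Rightarrow> ('a^'n) \<times> 'b) \<Rightarrow> 'n \<Rightarrow> 'n \<Rightarrow> 'a" where
  "entry T i j = fst (T (ax j)) $ i"

definition yent :: "(('a^'n) \<times> 'b \<Rightarrow> ('a^'n) \<times> 'b) \<Rightarrow> 'n \<Rightarrow> 'b" where
  "yent T i = snd (T (ax i))"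

lemma ax_fst: "fst (ax j) $ k = (if k = j then one else 0)" and ax_snd [simp]: "snd (ax j) = 0"
  by (simp_all add: ax_def axis_def)

lemma ax_CW [simp]: "ax j \<in> CW" by (simp add: W_carrier ax_fst)

lemma entry_closed: "T \<in> carrier U \<Longrightarrow> entry T i j \<in> CA" and yent_closed: "T \<in> carrier U \<Longrightarrow> yent T i \<in> CB"
  by (simp_all add: entry_def yent_def U_D CW_D)

lemma entry_add: "entry (S + T) i j = entry S i j + entry T i j" "entry (scale U c T) i j = scale A c (entry T i j)"
  "yent (S + T) i = yent S i + yent T i" "yent (scale U c T) i = scale B c (yent T i)"
  by (simp_all add: entry_def yent_def U_ops W_comp)

lemma entry_X: "i \<noteq> j \<Longrightarrow> k \<noteq> l \<Longrightarrow> a \<in> CA \<Longrightarrow>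
    entry (X k l a) i j = (if i = k \<and> j = l then a else if i = l \<and> j = k then - \<eta> a else 0)"
  and yent_X: "yent (X k l a) i = 0"
  and entry_Y: "y \<in> CB \<Longrightarrow> entry (Y k y) i j = 0"
  and yent_Y: "y \<in> CB \<Longrightarrow> yent (Y k y) i = (if i = k then y else 0)"
  by (auto simp: entry_def yent_def X_fst ax_fst Y_fst Y_snd mul_one ra_one mul_minus)

lemma entry_XX: "i \<noteq> j \<Longrightarrow> k \<noteq> l \<Longrightarrow> a \<in> CA \<Longrightarrow> b \<in> CA \<Longrightarrow> entry (bracket U (X k l a) (X k l b)) i j = 0"
  and yent_XX: "yent (bracket U (X k l a) (X k l b)) i = 0"
  and entry_YY: "i \<noteq> j \<Longrightarrow> y \<in> CB \<Longrightarrow> z \<in> CB \<Longrightarrow> entry (bracket U (Y k y) (Y k z)) i j = 0"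
  and yent_YY: "y \<in> CB \<Longrightarrow> z \<in> CB \<Longrightarrow> yent (bracket U (Y k y) (Y k z)) i = 0"
  by (auto simp: entry_def yent_def U_ops X_fst ax_fst Y_fst Y_snd X_CW Y_CW)

lemma X_injective: "i \<noteq> j \<Longrightarrow> a \<in> CA \<Longrightarrow> X i j a = 0 \<Longrightarrow> a = 0"
  using entry_X[of i j i j a] by (simp add: entry_def)

lemma Y_injective: "y \<in> CB \<Longrightarrow> Y i y = 0 \<Longrightarrow> y = 0"
  using yent_Y[of y i i] by (simp add: yent_def)

text \<open>The skewness of \<open>T\<close> is tested on the two basis vectors \<open>ax j\<close>
  and \<open>ax i\<close>.\<close>

lemma entry_skew:
  assumes "T \<in> carrier U" shows "\<eta> (entry T i j) = - entry T j i"
proof -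
  have "herm W (T (ax j)) (ax i) + herm W (ax j) (T (ax i)) = 0" using U_D(6)[OF assms] by simp
  moreover have "(\<Sum>k\<in>UNIV. \<eta> (fst (T (ax j)) $ k) \<cdot> fst (ax i) $ k) = (\<Sum>k\<in>UNIV. if k = i then \<eta> (entry T i j) else 0)"
    using U_D(1)[OF assms, of "ax j"] by (intro sum.cong) (simp_all add: ax_fst entry_def CW_D mul_one)
  moreover have "(\<Sum>k\<in>UNIV. \<eta> (fst (ax j) $ k) \<cdot> fst (T (ax i)) $ k) = (\<Sum>k\<in>UNIV. if k = j then entry T j i else 0)"
    using U_D(1)[OF assms, of "ax i"] by (intro sum.cong) (simp_all add: ax_fst entry_def CW_D mul_one)
  ultimately show ?thesis using U_D(1)[OF assms, of "ax j"] U_D(1)[OF assms, of "ax i"]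
    by (simp add: W_herm CW_D eq_neg_iff_add_eq_0)
qed

text \<open>What is left of a skew endomorphism after all its \<open>X\<close> and \<open>Y\<close>
  components have been removed.\<close>

definition diagonal :: "(('a^'n) \<times> 'b \<Rightarrow> ('a^'n) \<times> 'b) \<Rightarrow> bool" where
  "diagonal T \<longleftrightarrow> T \<in> carrier U \<and> (\<forall>i j. i \<noteq> j \<longrightarrow> entry T i j = 0) \<and> (\<forall>i. yent T i = 0)"

lemma W_decompose:
  assumes "u \<in> CW"
  shows "u = (\<Sum>i\<in>UNIV. ract W (ax i) (fst u $ i)) + (0, snd u)"
proof (rule W_eqI)
  fix k
  have "fst (\<Sum>i\<in>UNIV. ract W (ax i) (fst u $ i)) $ k = (\<Sum>i\<in>UNIV. fst (ract W (ax i) (fst u $ i)) $ k)"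
    by (simp add: fst_sum)
  also have "\<dots> = (\<Sum>i\<in>UNIV. if i = k then fst u $ i else 0)"
    by (rule sum.cong) (use assms in \<open>simp_all add: W_comp ax_fst CW_D mul_one\<close>)
  finally show "fst u $ k = fst ((\<Sum>i\<in>UNIV. ract W (ax i) (fst u $ i)) + (0, snd u)) $ k" by (simp add: W_comp)
next
  have "snd (ract W (ax i) (fst u $ i)) = 0" for i using assms by (simp add: W_comp CW_D)
  then show "snd u = snd ((\<Sum>i\<in>UNIV. ract W (ax i) (fst u $ i)) + (0, snd u))"
    by (simp add: snd_sum)
qed

text \<open>Module linearity reduces \<open>T\<close> to the basis vectors and to the module part.
  Pairing with \<open>ax k\<close> shows that the module part is preserved, because the adjoint
  coefficients \<open>yent\<close> vanish.\<close>

lemma diagonal_apply: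
  assumes T: "diagonal T" and u: "u \<in> CW"
  shows "fst (T u) $ k = entry T k k \<cdot> fst u $ k" "snd (T u) = snd (T (0, snd u))"
    "\<eta> (entry T k k) = - entry T k k"
proof -
  have TU: "T \<in> carrier U" and off: "\<And>i j. i \<noteq> j \<Longrightarrow> entry T i j = 0" and ye: "\<And>i. yent T i = 0"
    using T by (auto simp: diagonal_def)
  note D = U_D[OF TU]
  have su: "(0, snd u) \<in> CW" using u by (simp add: W_carrier)
  have r: "ract W (ax i) (fst u $ i) \<in> CW" for i using u by (simp add: CW_D)
  have S: "(\<Sum>i\<in>UNIV. ract W (ax i) (fst u $ i)) \<in> CW \<and>
      T (\<Sum>i\<in>UNIV. ract W (ax i) (fst u $ i)) = (\<Sum>i\<in>UNIV. T (ract W (ax i) (fst u $ i)))"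
    by (rule U_sum[OF TU]) (rule r)
  have "T u = T ((\<Sum>i\<in>UNIV. ract W (ax i) (fst u $ i)) + (0, snd u))" using W_decompose[OF u] by simp
  also have "\<dots> = (\<Sum>i\<in>UNIV. T (ract W (ax i) (fst u $ i))) + T (0, snd u)"
    using D(2) S su by simp
  also have "(\<Sum>i\<in>UNIV. T (ract W (ax i) (fst u $ i))) = (\<Sum>i\<in>UNIV. ract W (T (ax i)) (fst u $ i))"
    by (rule sum.cong) (use u D(5) in \<open>simp_all add: CW_D\<close>)
  finally have Tu: "T u = (\<Sum>i\<in>UNIV. ract W (T (ax i)) (fst u $ i)) + T (0, snd u)" .
  have z: "fst (T (0, snd u)) $ k = 0" for k
  proof -
    have "herm W (T (ax k)) (0, snd u) + herm W (ax k) (T (0, snd u)) = 0" by (rule D(6)) (simp_all add: su)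
    moreover have "herm W (T (ax k)) (0, snd u) = 0"
    proof -
      have "snd (T (ax k)) = 0" using ye by (simp add: yent_def)
      then show ?thesis using u D(1)[of "ax k"] by (simp add: W_herm CW_D)
    qed
    moreover have "herm W (ax k) (T (0, snd u)) = (\<Sum>i\<in>UNIV. if i = k then fst (T (0, snd u)) $ i else 0)"
    proof -
      have "(\<Sum>i\<in>UNIV. \<eta> (fst (ax k) $ i) \<cdot> fst (T (0, snd u)) $ i) = (\<Sum>i\<in>UNIV. if i = k then fst (T (0, snd u)) $ i else 0)"
        by (rule sum.cong) (use D(1)[OF su] in \<open>simp_all add: ax_fst CW_D mul_one\<close>)
      then show ?thesis using D(1)[OF su] by (simp add: W_herm CW_D)
    qed
    ultimately show ?thesis by simp
  qed
  have "fst (\<Sum>i\<in>UNIV. ract W (T (ax i)) (fst u $ i)) $ k = (\<Sum>i\<in>UNIV. entry T k i \<cdot> fst u $ i)"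
    by (simp add: fst_sum W_comp entry_def)
  also have "\<dots> = (\<Sum>i\<in>UNIV. if i = k then entry T k i \<cdot> fst u $ i else 0)"
    by (rule sum.cong) (use off u in \<open>auto simp: CW_D\<close>)
  finally show "fst (T u) $ k = entry T k k \<cdot> fst u $ k" using z by (simp add: Tu)
  have "snd (ract W (T (ax i)) (fst u $ i)) = 0" for i using ye u by (simp add: W_comp CW_D yent_def)
  then show "snd (T u) = snd (T (0, snd u))" by (simp add: Tu snd_sum)
  have "herm W (T (ax k)) (ax k) + herm W (ax k) (T (ax k)) = 0" by (rule D(6)) simp_all
  moreover have "(\<Sum>i\<in>UNIV. \<eta> (fst (T (ax k)) $ i) \<cdot> fst (ax k) $ i) = (\<Sum>i\<in>UNIV. if i = k then \<eta> (entry T k k) else 0)"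
    using D(1)[of "ax k"] by (intro sum.cong) (simp_all add: ax_fst entry_def CW_D mul_one)
  moreover have "(\<Sum>i\<in>UNIV. \<eta> (fst (ax k) $ i) \<cdot> fst (T (ax k)) $ i) = (\<Sum>i\<in>UNIV. if i = k then entry T k k else 0)"
    using D(1)[of "ax k"] by (intro sum.cong) (simp_all add: ax_fst entry_def CW_D mul_one)
  ultimately show "\<eta> (entry T k k) = - entry T k k" using D(1)[of "ax k"]
    by (simp add: W_herm CW_D eq_neg_iff_add_eq_0)
qed

lemma diagonal_X:
  assumes T: "diagonal T" and ij: "i \<noteq> j" and a: "a \<in> CA"
  shows "bracket U T (X i j a) = X i j (entry T i i \<cdot> a - a \<cdot> entry T j j)"
proof -
  have TU: "T \<in> carrier U" using T by (simp add: diagonal_def)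
  have [simp]: "(0, 0) = (0 :: ('a^'n) \<times> 'b)" by (simp add: zero_prod_def)
  show ?thesis
    by (rule U_ext, rule W_eqI)
      (simp_all add: U_ops X_fst X_out X_CW W_comp diagonal_apply[OF T] U_in[OF TU] U_D[OF TU] U_zero[OF TU] XY_zero_arg
      entry_closed[OF TU] eta_diff eta_mul mul_minus mul_diff mul_assoc CW_D a ij ij[symmetric])
qed

text \<open>On the module part \<open>T\<close> commutes with the action of the coordinate algebra
  and is skew for \<open>ch\<close>, so it can be moved across the form.\<close>

lemma diagonal_Y:
  assumes T: "diagonal T" and y: "y \<in> CB"
  shows "bracket U T (Y i y) = Y i (snd (T (0, y)) - y \<star> entry T i i)"
proof -
  have TU: "T \<in> carrier U" using T by (simp add: diagonal_def)
  have in': "(0, x) \<in> CW" if "x \<in> CB" for x using that by (simp add: W_carrier)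
  have fz: "fst (T (0, x)) $ k = 0" if "x \<in> CB" for x k
    using diagonal_apply(1)[OF T in'[OF that]] entry_closed[OF TU] by simp
  have sT: "snd (T (0, x)) \<in> CB" if "x \<in> CB" for x using CW_D(2)[OF U_D(1)[OF TU in'[OF that]]] .
  have skew: "ch (snd (T (0, y))) x = - ch y (snd (T (0, x)))" if "x \<in> CB" for x
    using U_D(6)[OF TU in'[OF y] in'[OF that]] U_D(1)[OF TU in'[OF y]] U_D(1)[OF TU in'[OF that]]
    by (simp add: W_herm fz y that CW_D neg_eq_iff_add_eq_0 eq_neg_iff_add_eq_0)
  have lin: "snd (T (0, y \<star> a)) = snd (T (0, y)) \<star> a" if "a \<in> CA" for a
  proof -
    have "ract W (0, y) a = (0, y \<star> a)" using that by (simp add: W_ract prod_eq_iff vec_eq_iff)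
    then show ?thesis using U_D(5)[OF TU in'[OF y] that] by (simp add: W_ract)
  qed
  show ?thesis
    by (rule U_ext, rule W_eqI)
      (simp_all add: U_ops Y_fst Y_snd Y_out Y_CW W_comp diagonal_apply[OF T] U_in[OF TU] U_D[OF TU] U_zero[OF TU] XY_zero_arg
      entry_closed[OF TU] sT skew lin ch_diff ch_ra ra_diff ra_assoc mul_minus CW_D y)
qed

end

section \<open>Lie algebras coordinatized by a hermitian form\<close>

text \<open>The maps \<open>px i j\<close> and \<open>py i\<close> are projections onto the images of \<open>xe i j\<close> and \<open>ye i\<close>; that they
  vanish on the other generators and on brackets of generators with equal indices expresses that
  the sum of these images is direct.\<close>

locale coordinatized = unitary A e1 e2 B N + total_lie_algebra sc br
  for A :: "('f::field_char_0, 'a::ab_group_add) inv_algebra" and e1 e2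
    and B :: "('f, 'a, 'b::ab_group_add) herm_module" and N :: "'n::finite itself"
    and sc :: "'f \<Rightarrow> 'm::ab_group_add \<Rightarrow> 'm" and br +
  fixes xe :: "'n \<Rightarrow> 'n \<Rightarrow> 'a \<Rightarrow> 'm" and ye :: "'n \<Rightarrow> 'b \<Rightarrow> 'm"
    and px :: "'n \<Rightarrow> 'n \<Rightarrow> 'm \<Rightarrow> 'm" and py :: "'n \<Rightarrow> 'm \<Rightarrow> 'm"
  assumes xe_add: "\<lbrakk>i \<noteq> j; a \<in> CA; b \<in> CA\<rbrakk> \<Longrightarrow> xe i j (a + b) = xe i j a + xe i j b"
    and xe_scale: "\<lbrakk>i \<noteq> j; a \<in> CA\<rbrakk> \<Longrightarrow> xe i j (scale A c a) = sc c (xe i j a)"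
    and ye_add: "\<lbrakk>y \<in> CB; z \<in> CB\<rbrakk> \<Longrightarrow> ye i (y + z) = ye i y + ye i z"
    and ye_scale: "y \<in> CB \<Longrightarrow> ye i (scale B c y) = sc c (ye i y)"
    and xe_skew: "\<lbrakk>i \<noteq> j; a \<in> CA\<rbrakk> \<Longrightarrow> xe j i a = - xe i j (\<eta> a)"
    and xe_xe: "\<lbrakk>i \<noteq> j; j \<noteq> k; i \<noteq> k; a \<in> CA; b \<in> CA\<rbrakk> \<Longrightarrow> br (xe i j a) (xe j k b) = xe i k (a \<cdot> b)"
    and xe_xe0: "\<lbrakk>i \<noteq> j; k \<noteq> l; {i, j} \<inter> {k, l} = {}; a \<in> CA; b \<in> CA\<rbrakk> \<Longrightarrow> br (xe i j a) (xe k l b) = 0"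
    and ye_xe: "\<lbrakk>i \<noteq> j; a \<in> CA; y \<in> CB\<rbrakk> \<Longrightarrow> br (ye i y) (xe i j a) = ye j (y \<star> a)"
    and ye_xe0: "\<lbrakk>i \<noteq> j; k \<noteq> i; k \<noteq> j; a \<in> CA; y \<in> CB\<rbrakk> \<Longrightarrow> br (ye k y) (xe i j a) = 0"
    and ye_ye: "\<lbrakk>i \<noteq> j; y \<in> CB; z \<in> CB\<rbrakk> \<Longrightarrow> br (ye i y) (ye j z) = xe i j (ch y z)"
    and px_add: "px i j (u + v) = px i j u + px i j v" and px_scale: "px i j (sc c u) = sc c (px i j u)"
    and py_add: "py i (u + v) = py i u + py i v" and py_scale: "py i (sc c u) = sc c (py i u)"
    and px_xe: "\<lbrakk>i \<noteq> j; a \<in> CA\<rbrakk> \<Longrightarrow> px i j (xe i j a) = xe i j a"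
    and px_xe0: "\<lbrakk>i \<noteq> j; k \<noteq> l; {i, j} \<noteq> {k, l}; a \<in> CA\<rbrakk> \<Longrightarrow> px i j (xe k l a) = 0"
    and px_ye: "\<lbrakk>i \<noteq> j; y \<in> CB\<rbrakk> \<Longrightarrow> px i j (ye k y) = 0"
    and px_xx: "\<lbrakk>i \<noteq> j; k \<noteq> l; a \<in> CA; b \<in> CA\<rbrakk> \<Longrightarrow> px i j (br (xe k l a) (xe k l b)) = 0"
    and px_yy: "\<lbrakk>i \<noteq> j; y \<in> CB; z \<in> CB\<rbrakk> \<Longrightarrow> px i j (br (ye k y) (ye k z)) = 0"
    and py_ye: "y \<in> CB \<Longrightarrow> py i (ye i y) = ye i y"
    and py_ye0: "\<lbrakk>i \<noteq> k; y \<in> CB\<rbrakk> \<Longrightarrow> py i (ye k y) = 0"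
    and py_xe: "\<lbrakk>k \<noteq> l; a \<in> CA\<rbrakk> \<Longrightarrow> py i (xe k l a) = 0"
    and py_xx: "\<lbrakk>k \<noteq> l; a \<in> CA; b \<in> CA\<rbrakk> \<Longrightarrow> py i (br (xe k l a) (xe k l b)) = 0"
    and py_yy: "\<lbrakk>y \<in> CB; z \<in> CB\<rbrakk> \<Longrightarrow> py i (br (ye k y) (ye k z)) = 0"
    and xe_inj: "\<lbrakk>i \<noteq> j; a \<in> CA; xe i j a = 0\<rbrakk> \<Longrightarrow> a = 0"
    and ye_inj: "\<lbrakk>y \<in> CB; ye i y = 0\<rbrakk> \<Longrightarrow> y = 0"
begin

definition "XI i j = xe i j ` CA"
definition "YI i = ye i ` CB"

text \<open>Brackets of generators with equal indices: in the examples below they make up the part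
  of weight zero modulo two.\<close>

definition "DS = {br x y | x y i j. i \<noteq> j \<and> x \<in> XI i j \<and> y \<in> XI i j} \<union> {br x y | x y i. x \<in> YI i \<and> y \<in> YI i}"
definition "GS = {x. \<exists>i j. i \<noteq> j \<and> x \<in> XI i j} \<union> {y. \<exists>i. y \<in> YI i} \<union> DS"
definition "S = span GS"
definition "LS = \<lparr>carrier = S, scale = sc, bracket = br\<rparr>"

lemma xe_zero: "i \<noteq> j \<Longrightarrow> xe i j 0 = 0" using xe_add[of i j 0 0] by simp
lemma ye_zero: "ye i 0 = 0" using ye_add[of 0 0 i] by simp

lemma XI_sub: "i \<noteq> j \<Longrightarrow> subspace (XI i j)"
  unfolding subspace_def XI_def
  by (auto simp: xe_add[symmetric] xe_scale[symmetric] intro!: image_eqI[of _ _ 0] simp: xe_zero)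

lemma YI_sub: "subspace (YI i)"
  unfolding subspace_def YI_def
  by (auto simp: ye_add[symmetric] ye_scale[symmetric] intro!: image_eqI[of _ _ 0] simp: ye_zero)

lemma XI_swap: assumes "i \<noteq> j" shows "XI i j = XI j i"
proof -
  have *: "XI k l \<subseteq> XI l k" if kl: "k \<noteq> l" for k l
  proof
    fix x assume "x \<in> XI k l"
    then obtain a where "a \<in> CA" "x = xe k l a" by (auto simp: XI_def)
    then have "x = - xe l k (\<eta> a)" "xe l k (\<eta> a) \<in> XI l k" using xe_skew[of l k a] kl by (auto simp: XI_def)
    then show "x \<in> XI l k" using subspace_neg[OF XI_sub[of l k]] kl by auto
  qed
  show ?thesis using *[of i j] *[of j i] assms by auto
qed

lemma XX: "\<lbrakk>x \<in> XI i j; y \<in> XI j k; i \<noteq> j; j \<noteq> k; i \<noteq> k\<rbrakk> \<Longrightarrow> br x y \<in> XI i k"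
  and XX0: "\<lbrakk>x \<in> XI i j; y \<in> XI k l; i \<noteq> j; k \<noteq> l; {i, j} \<inter> {k, l} = {}\<rbrakk> \<Longrightarrow> br x y = 0"
  and YX: "\<lbrakk>y \<in> YI i; x \<in> XI i j; i \<noteq> j\<rbrakk> \<Longrightarrow> br y x \<in> YI j"
  and YX0: "\<lbrakk>y \<in> YI k; x \<in> XI i j; i \<noteq> j; k \<noteq> i; k \<noteq> j\<rbrakk> \<Longrightarrow> br y x = 0"
  and YY: "\<lbrakk>y \<in> YI i; z \<in> YI j; i \<noteq> j\<rbrakk> \<Longrightarrow> br y z \<in> XI i j"
  using xe_xe xe_xe0 ye_xe ye_xe0 ye_ye by (auto simp: XI_def YI_def)

lemma XY: "\<lbrakk>y \<in> YI i; x \<in> XI i j; i \<noteq> j\<rbrakk> \<Longrightarrow> br x y \<in> YI j"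
  and XY0: "\<lbrakk>y \<in> YI k; x \<in> XI i j; i \<noteq> j; k \<noteq> i; k \<noteq> j\<rbrakk> \<Longrightarrow> br x y = 0"
  using YX[of y i x j] YX0[of y k x i j] subspace_neg[OF YI_sub] br_skew[of x y] by auto

lemma XI_split:
  assumes "x \<in> XI i j" "i \<noteq> j" "m \<noteq> i" "m \<noteq> j"
  obtains u v where "u \<in> XI i m" "v \<in> XI m j" "x = br u v"
proof -
  obtain a where a: "a \<in> CA" "x = xe i j a" using assms by (auto simp: XI_def)
  have "x = br (xe i m one) (xe m j a)" using xe_xe[of i m j one a] a assms by (simp add: mul_one)
  then show ?thesis using that[of "xe i m one" "xe m j a"] a by (simp add: XI_def)
qed

lemma YI_split:
  assumes "y \<in> YI j" "i \<noteq> j"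
  obtains u v where "u \<in> YI i" "v \<in> XI i j" "y = br u v"
proof -
  obtain z where z: "z \<in> CB" "y = ye j z" using assms by (auto simp: YI_def)
  have "y = br (ye i z) (xe i j one)" using ye_xe[of i j one z] z assms by (simp add: ra_one)
  then show ?thesis using that[of "ye i z" "xe i j one"] z by (simp add: XI_def YI_def)
qed

lemma fresh3: obtains m :: 'n where "m \<noteq> i" "m \<noteq> j" "m \<noteq> k"
proof -
  have "card {i, j, k} \<le> 3" using card_length[of "[i, j, k]"] by simp
  then have "{i, j, k} \<noteq> UNIV" using card5 by auto
  then show ?thesis using that by auto
qed

text \<open>Disjoint index pairs give zero, and for pairs with one common index the Jacobi identity
  reduces the claim to the product rules. If the pairs coincide, \<open>z\<close> is factored
  through a third index, and the operator acts as a derivation on two factors that are already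
  covered.\<close>

lemma XX_act_X:
  assumes x: "x1 \<in> XI k l" "x2 \<in> XI k l" "k \<noteq> l" and z: "z \<in> XI i j" "i \<noteq> j"
  shows "br (br x1 x2) z \<in> XI i j"
proof -
  have one: "br (br u v) w \<in> XI p q" if "u \<in> XI p r" "v \<in> XI p r" "w \<in> XI p q" "distinct [p, q, r]" for u v w p q r
  proof -
    have "br u' (br v' w) \<in> XI p q" if "u' \<in> XI p r" "v' \<in> XI p r" for u' v'
    proof -
      have "br v' w \<in> XI r q" using XX[of v' r p w q] XI_swap[of p r] that \<open>w \<in> XI p q\<close> \<open>distinct [p, q, r]\<close> by auto
      then show ?thesis using XX[of u' p r "br v' w" q] that \<open>distinct [p, q, r]\<close> by auto
    qed
    then show ?thesis unfolding br_jacobi_left using that by (intro subspace_diff[OF XI_sub]) auto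
  qed
  have gen: "br (br x1 x2) w \<in> XI p q" if w: "w \<in> XI p q" "p \<noteq> q" and m: "{p, q} \<noteq> {k, l}" for w p q
  proof -
    note sw = XI_swap[OF x(3)] XI_swap[OF w(2)]
    consider (none) "p \<notin> {k, l}" "q \<notin> {k, l}" | (p) "p \<in> {k, l}" "q \<notin> {k, l}" | (q) "p \<notin> {k, l}" "q \<in> {k, l}" using m w(2) by auto
    then show ?thesis
    proof cases
      case none
      then have "br x1 w = 0" "br x2 w = 0" using XX0[of x1 k l w p q] XX0[of x2 k l w p q] x w by auto
      then show ?thesis using subspace_0[OF XI_sub[OF w(2)]] by (simp add: br_jacobi_left)
    next
      case p
      then obtain r where "{k, l} = {p, r}" by auto
      then have "x1 \<in> XI p r" "x2 \<in> XI p r" "distinct [p, q, r]" using x sw p w by (auto simp: doubleton_eq_iff)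
      then show ?thesis using one w by blast
    next
      case q
      then obtain r where "{k, l} = {q, r}" by auto
      then have "x1 \<in> XI q r" "x2 \<in> XI q r" "distinct [q, p, r]" using x sw q w by (auto simp: doubleton_eq_iff)
      then show ?thesis using one w sw by blast
    qed
  qed
  show ?thesis
  proof (cases "{i, j} = {k, l}")
    case True
    obtain m where m: "m \<noteq> i" "m \<noteq> j" by (rule fresh3[of i j j])
    then have "m \<notin> {k, l}" using True by auto
    obtain u v where uv: "u \<in> XI i m" "v \<in> XI m j" "z = br u v" using XI_split[OF z m] by blast
    have "br (br x1 x2) u \<in> XI i m" "br (br x1 x2) v \<in> XI m j" using gen uv m \<open>m \<notin> {k, l}\<close> by auto
    then show ?thesis unfolding uv(3) br_jacobi[of "br x1 x2"] using uv m z
      by (intro subspace_add[OF XI_sub] XX[of _ i m _ j]) auto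
  qed (use gen z in auto)
qed

lemma XX_act_Y:
  assumes x: "x1 \<in> XI k l" "x2 \<in> XI k l" "k \<noteq> l" and z: "z \<in> YI i"
  shows "br (br x1 x2) z \<in> YI i"
proof -
  have one: "br (br u v) z \<in> YI i" if "u \<in> XI i r" "v \<in> XI i r" "i \<noteq> r" for u v r
  proof -
    have "br u' (br v' z) \<in> YI i" if "u' \<in> XI i r" "v' \<in> XI i r" for u' v'
      using XY[of z i v' r] XY[of "br v' z" r u' i] XI_swap[OF \<open>i \<noteq> r\<close>] that z \<open>i \<noteq> r\<close> by auto
    then show ?thesis unfolding br_jacobi_left using that by (intro subspace_diff[OF YI_sub]) auto
  qed
  consider "i \<notin> {k, l}" | "i = k" | "i = l" by auto
  then show ?thesis
  proof cases
    case 1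
    then have "br x1 z = 0" "br x2 z = 0" using XY0 x z by auto
    then show ?thesis using subspace_0[OF YI_sub] by (simp add: br_jacobi_left)
  qed (use one[of x1 _ x2] x XI_swap in auto)
qed

lemma YY_act_X:
  assumes y: "y1 \<in> YI k" "y2 \<in> YI k" and z: "z \<in> XI i j" "i \<noteq> j"
  shows "br (br y1 y2) z \<in> XI i j"
proof -
  have one: "br (br y1 y2) w \<in> XI k q" if w: "w \<in> XI k q" "k \<noteq> q" for w q
  proof -
    have "br u (br v w) \<in> XI k q" if "u \<in> YI k" "v \<in> YI k" for u v
      using YX[of v k w q] YY[of u k "br v w" q] that w by auto
    then show ?thesis unfolding br_jacobi_left using y w by (intro subspace_diff[OF XI_sub]) auto
  qed
  consider "k \<notin> {i, j}" | "k = i" | "k = j" by auto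
  then show ?thesis
  proof cases
    case 1
    then have "br y1 z = 0" "br y2 z = 0" using YX0 y z by auto
    then show ?thesis using subspace_0[OF XI_sub[OF z(2)]] by (simp add: br_jacobi_left)
  qed (use one[of z] z XI_swap[OF z(2)] in auto)
qed

text \<open>For \<open>i = k\<close> the element is factored through another index; its factors are
  covered by \<open>YY_act_X\<close> and by the case of different indices.\<close>

lemma YY_act_Y:
  assumes y: "y1 \<in> YI k" "y2 \<in> YI k" and z: "z \<in> YI i"
  shows "br (br y1 y2) z \<in> YI i"
proof -
  have one: "br (br y1 y2) w \<in> YI q" if w: "w \<in> YI q" "k \<noteq> q" for w q
  proof -
    have "br u (br v w) \<in> YI q" if "u \<in> YI k" "v \<in> YI k" for u v
      using YY[of v k w q] YX[of u k "br v w" q] that w by auto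
    then show ?thesis unfolding br_jacobi_left using y w by (intro subspace_diff[OF YI_sub]) auto
  qed
  show ?thesis
  proof (cases "i = k")
    case True
    obtain m where m: "m \<noteq> i" by (rule fresh3[of i i i])
    obtain u v where uv: "u \<in> YI m" "v \<in> XI m i" "z = br u v" using YI_split[OF z m] by blast
    have "br (br y1 y2) u \<in> YI m" "br (br y1 y2) v \<in> XI m i" using one uv m YY_act_X y True by auto
    then show ?thesis unfolding uv(3) br_jacobi[of "br y1 y2"] using uv m
      by (intro subspace_add[OF YI_sub] YX[of _ m _ i]) auto
  qed (use one z in auto)
qed

lemma DS_act: assumes "d \<in> DS" shows "z \<in> XI i j \<Longrightarrow> i \<noteq> j \<Longrightarrow> br d z \<in> XI i j" "z \<in> YI i \<Longrightarrow> br d z \<in> YI i"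
  using assms XX_act_X XX_act_Y YY_act_X YY_act_Y by (auto simp: DS_def)

lemma span_DS_act:
  assumes "d \<in> span DS" shows "z \<in> XI i j \<Longrightarrow> i \<noteq> j \<Longrightarrow> br d z \<in> XI i j" "z \<in> YI i \<Longrightarrow> br d z \<in> YI i"
  using span_br_subset[OF XI_sub, of i j DS "{z}" d z] span_br_subset[OF YI_sub, of DS "{z}" i d z] DS_act assms
  by (auto intro: span_base)

lemma S_sub: "subspace S" by (simp add: S_def)

lemma S_in: "x \<in> XI i j \<Longrightarrow> i \<noteq> j \<Longrightarrow> x \<in> S" "y \<in> YI i \<Longrightarrow> y \<in> S"
  "x \<in> XI i j \<Longrightarrow> x' \<in> XI i j \<Longrightarrow> i \<noteq> j \<Longrightarrow> br x x' \<in> S" "y \<in> YI i \<Longrightarrow> y' \<in> YI i \<Longrightarrow> br y y' \<in> S"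
  unfolding S_def by (rule span_base; auto simp: GS_def DS_def)+

lemma XX_in_S:
  assumes x: "x \<in> XI i j" "i \<noteq> j" and y: "y \<in> XI k l" "k \<noteq> l"
  shows "br x y \<in> S"
proof -
  note sw = XI_swap[OF x(2)] XI_swap[OF y(2)]
  have one: "br x y \<in> S" if "x \<in> XI p r" "y \<in> XI r q" "p \<noteq> r" "r \<noteq> q" for p q r
  proof (cases "p = q")
    case True
    then show ?thesis using that XI_swap[of p r] S_in(3)[of x p r y] by auto
  qed (use S_in(1)[OF XX[OF that(1,2)]] that in auto)
  consider "{i, j} \<inter> {k, l} = {}" | "i = k" | "i = l" | "j = k" | "j = l" by auto
  then show ?thesis
  proof cases
    case 1
    then show ?thesis using XX0 x y subspace_0[OF S_sub] by simp
  next
    case 2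
    show ?thesis by (rule one[of j i l]) (use 2 x y sw in simp_all)
  next
    case 3
    show ?thesis by (rule one[of j i k]) (use 3 x y sw in simp_all)
  next
    case 4
    show ?thesis by (rule one[of i j l]) (use 4 x y sw in simp_all)
  next
    case 5
    show ?thesis by (rule one[of i j k]) (use 5 x y sw in simp_all)
  qed
qed

lemma YX_in_S:
  assumes y: "y \<in> YI k" and x: "x \<in> XI i j" "i \<noteq> j"
  shows "br y x \<in> S" "br x y \<in> S"
proof -
  show *: "br y x \<in> S"
  proof -
    consider "k = i" | "k = j" | "k \<noteq> i" "k \<noteq> j" by auto
    then show ?thesis
    proof cases
      case 1
      then show ?thesis using YX[of y i x j] x y S_in(2) by simp
    next
      case 2
      then show ?thesis using YX[of y j x i] x y S_in(2) XI_swap[OF x(2)] by simp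
    next
      case 3
      then show ?thesis using YX0[OF y x 3] subspace_0[OF S_sub] by simp
    qed
  qed
  show "br x y \<in> S" unfolding br_skew[of x y] by (rule subspace_neg[OF S_sub *])
qed

lemma YY_in_S: "y \<in> YI i \<Longrightarrow> z \<in> YI j \<Longrightarrow> br y z \<in> S"
  using YY[of y i z j] S_in(1)[of "br y z" i j] S_in(4)[of y i z] by (cases "i = j") auto

lemma DS_act_S:
  assumes d: "d \<in> DS" and x: "x \<in> GS"
  shows "br d x \<in> S"
proof -
  consider i j where "x \<in> XI i j" "i \<noteq> j" | i where "x \<in> YI i"
    | u v i j where "x = br u v" "u \<in> XI i j" "v \<in> XI i j" "i \<noteq> j" | u v i where "x = br u v" "u \<in> YI i" "v \<in> YI i"
    using x by (auto simp: GS_def DS_def)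
  then show ?thesis
  proof cases
    case 3
    then show ?thesis unfolding 3(1) br_jacobi[of d] using DS_act[OF d] by (intro subspace_add[OF S_sub] S_in) auto
  next
    case 4
    then show ?thesis unfolding 4(1) br_jacobi[of d] using DS_act[OF d] by (intro subspace_add[OF S_sub] S_in) auto
  next
    case 1
    then show ?thesis using DS_act(1)[OF d] S_in(1) by blast
  next
    case 2
    then show ?thesis using DS_act(2)[OF d] S_in(2) by blast
  qed
qed

text \<open>Brackets of generators are generators, diagonal brackets or zero, and diagonal brackets
  act as derivations that preserve every component.\<close>

lemma S_br: assumes "x \<in> S" "y \<in> S" shows "br x y \<in> S"
proof -
  have g: "br x y \<in> S" if "x \<in> GS" "y \<in> GS" for x y
  proof (cases "x \<in> DS \<or> y \<in> DS")
    case True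
    then show ?thesis
      using DS_act_S[of x y] DS_act_S[of y x] br_skew[of x y] subspace_neg[OF S_sub] that by auto
  next
    case False
    then show ?thesis using that XX_in_S YX_in_S YY_in_S by (auto simp: GS_def)
  qed
  show ?thesis by (rule span_br_subset[OF S_sub g]) (use assms in \<open>auto simp: S_def\<close>)
qed

lemma LS_simps [simp]: "carrier LS = S" "scale LS = sc" "bracket LS = br" by (simp_all add: LS_def)

lemma lie_algebra_LS: "lie_algebra LS"
proof -
  have "br x (br y z) + br y (br z x) + br z (br x y) = 0" for x y z
    using br_jacobi[of x y z] br_skew[of z x] br_skew[of z "br x y"] by simp
  then show ?thesis
    unfolding lie_algebra_def vspace_def vbilinear_def vlinear_def
    using S_br S_sub vector_space_axioms by (simp add: br_add_left br_add_right br_scale_left br_scale_right)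
qed

text \<open>The unit, inserted at a fresh index, writes every generator as a bracket of two
  generators.\<close>

lemma perfect_LS: "perfect LS"
proof -
  let ?T = "span {br x y | x y. x \<in> S \<and> y \<in> S}"
  have br_in: "br x y \<in> ?T" if "x \<in> S" "y \<in> S" for x y using that by (intro span_base) auto
  have "x \<in> ?T" if x: "x \<in> XI i j" "i \<noteq> j" for x i j
  proof -
    obtain m where m: "m \<noteq> i" "m \<noteq> j" by (rule fresh3[of i j j])
    obtain u v where uv: "u \<in> XI i m" "v \<in> XI m j" "x = br u v" using XI_split[OF x m] by blast
    then show ?thesis using br_in[of u v] S_in(1)[of u i m] S_in(1)[of v m j] m by simp
  qed
  moreover have "y \<in> ?T" if y: "y \<in> YI i" for y i
  proof -
    obtain m where m: "m \<noteq> i" by (rule fresh3[of i i i])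
    obtain u v where uv: "u \<in> YI m" "v \<in> XI m i" "y = br u v" using YI_split[OF y m] by blast
    then show ?thesis using br_in[of u v] S_in(2)[of u m] S_in(1)[of v m i] m by simp
  qed
  moreover have "d \<in> ?T" if d: "d \<in> DS" for d
  proof -
    obtain u v where "d = br u v" "u \<in> S" "v \<in> S" using d S_in(1,2) unfolding DS_def by blast
    then show ?thesis using br_in by simp
  qed
  ultimately have "GS \<subseteq> ?T" by (auto simp: GS_def)
  then have "span GS \<subseteq> ?T" by (rule span_minimal) simp
  then have "S \<subseteq> ?T" by (simp only: S_def[symmetric])
  moreover have "?T \<subseteq> S" by (rule span_minimal) (use S_br S_sub in auto)
  ultimately show ?thesis by (auto simp: perfect_def bracket_span_def vspan_def)
qed

text \<open>The factor 1/2 compensates for the sum over ordered pairs, in which each component of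
  type \<open>XI\<close> is counted twice.\<close>

definition "prj z = sc (1/2) (\<Sum>p\<in>{p :: 'n \<times> 'n. fst p \<noteq> snd p}. px (fst p) (snd p) z) + (\<Sum>i\<in>UNIV. py i z)"

lemma prj_add: "prj (u + v) = prj u + prj v" and prj_scale: "prj (sc c u) = sc c (prj u)"
  by (simp_all add: prj_def px_add py_add sum.distrib scale_right_distrib px_scale py_scale scale_sum_right mult.commute)

lemma px_XI: "i \<noteq> j \<Longrightarrow> x \<in> XI i j \<Longrightarrow> px i j x = x"
  and px_XI0: "i \<noteq> j \<Longrightarrow> k \<noteq> l \<Longrightarrow> {i, j} \<noteq> {k, l} \<Longrightarrow> x \<in> XI k l \<Longrightarrow> px i j x = 0"
  and px_YI: "i \<noteq> j \<Longrightarrow> y \<in> YI k \<Longrightarrow> px i j y = 0"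
  and px_DS: "i \<noteq> j \<Longrightarrow> d \<in> DS \<Longrightarrow> px i j d = 0"
  and py_YI: "y \<in> YI k \<Longrightarrow> py i y = (if i = k then y else 0)"
  and py_XI: "k \<noteq> l \<Longrightarrow> x \<in> XI k l \<Longrightarrow> py i x = 0"
  and py_DS: "d \<in> DS \<Longrightarrow> py i d = 0"
proof -
  show "px i j x = 0" if "i \<noteq> j" "k \<noteq> l" "{i, j} \<noteq> {k, l}" "x \<in> XI k l"
    using that px_xe0[OF that(1-3)] unfolding XI_def by blast
qed (use px_xe px_ye px_xx px_yy py_ye py_ye0 py_xe py_xx py_yy in \<open>auto simp: XI_def YI_def DS_def\<close>)

lemma prj_X: assumes x: "x \<in> XI k l" "k \<noteq> l" shows "prj x = x"
proof -
  have "(\<Sum>p\<in>{p :: 'n \<times> 'n. fst p \<noteq> snd p}. px (fst p) (snd p) x) = (\<Sum>p\<in>{(k, l), (l, k)}. px (fst p) (snd p) x)"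
  proof (rule sum.mono_neutral_right)
    show "\<forall>p\<in>{p :: 'n \<times> 'n. fst p \<noteq> snd p} - {(k, l), (l, k)}. px (fst p) (snd p) x = 0"
    proof
      fix p assume "p \<in> {p :: 'n \<times> 'n. fst p \<noteq> snd p} - {(k, l), (l, k)}"
      then have "fst p \<noteq> snd p" "{fst p, snd p} \<noteq> {k, l}" by (auto simp: prod_eq_iff doubleton_eq_iff)
      then show "px (fst p) (snd p) x = 0" using px_XI0 x by blast
    qed
  qed (use x in auto)
  also have "\<dots> = x + x" using x px_XI[of k l x] px_XI[of l k x] XI_swap[of k l] by simp
  finally show ?thesis using x py_XI by (simp add: prj_def scale_right_distrib flip: scale_left_distrib)
qed

lemma prj_Y: "y \<in> YI k \<Longrightarrow> prj y = y"
  by (simp add: prj_def px_YI py_YI)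

lemma prj_D: "d \<in> DS \<Longrightarrow> prj d = 0"
  by (simp add: prj_def px_DS py_DS)

text \<open>Each claim describes a subspace, and on the generators it is one of the assumptions on
  \<open>px\<close> and \<open>py\<close>.\<close>

lemma S_components:
  assumes "z \<in> S"
  shows "z - prj z \<in> span DS" "i \<noteq> j \<Longrightarrow> px i j z \<in> XI i j" "py i z \<in> YI i"
proof -
  have z: "z \<in> span GS" using assms by (simp add: S_def)
  have comp0: "prj 0 = 0" using prj_add[of 0 0] by simp
  have "span GS \<subseteq> {z. z - prj z \<in> span DS}"
  proof (rule span_minimal)
    show "GS \<subseteq> {z. z - prj z \<in> span DS}" using prj_X prj_Y prj_D span_base by (auto simp: GS_def span_zero)
    show "subspace {z. z - prj z \<in> span DS}"
      unfolding subspace_def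
      by (auto simp: comp0 prj_add prj_scale add_diff_add span_zero span_add span_scale simp flip: scale_right_diff_distrib)
  qed
  then show "z - prj z \<in> span DS" using z by blast
  show "px i j z \<in> XI i j" if ij: "i \<noteq> j"
  proof -
    have 0: "px i j 0 = 0" using px_add[of i j 0 0] by simp
    note sub = XI_sub[OF ij]
    have "px i j x \<in> XI i j" if "x \<in> XI k l" "k \<noteq> l" for x k l
    proof (cases "{i, j} = {k, l}")
      case True
      then have "XI k l = XI i j" using XI_swap[OF ij] by (auto simp: doubleton_eq_iff)
      then show ?thesis using px_XI[OF ij] that by simp
    qed (use px_XI0[OF ij] that subspace_0[OF sub] in simp)
    then have "GS \<subseteq> {z. px i j z \<in> XI i j}"
      using px_YI[OF ij] px_DS[OF ij] subspace_0[OF sub] by (auto simp: GS_def)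
    moreover have "subspace {z. px i j z \<in> XI i j}"
      unfolding subspace_def using sub by (auto simp: 0 px_add px_scale subspace_def)
    ultimately show ?thesis using span_minimal z by blast
  qed
  show "py i z \<in> YI i"
  proof -
    have 0: "py i 0 = 0" using py_add[of i 0 0] by simp
    note sub = YI_sub[of i]
    have "GS \<subseteq> {z. py i z \<in> YI i}"
      using py_YI py_XI py_DS subspace_0[OF sub] by (auto simp: GS_def)
    moreover have "subspace {z. py i z \<in> YI i}"
      unfolding subspace_def using sub by (auto simp: 0 py_add py_scale subspace_def)
    ultimately show ?thesis using span_minimal z by blast
  qed
qed

lemma S_kernel:
  assumes "z \<in> S" "\<And>i j. i \<noteq> j \<Longrightarrow> px i j z = 0" "\<And>i. py i z = 0"
  shows "z \<in> span DS"
  using S_components(1)[OF assms(1)] assms(2,3) by (simp add: prj_def)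

text \<open>The elements that commute with \<open>z\<close> form a subspace closed under brackets,
  so the generators decide.\<close>

lemma S_central:
  assumes X: "\<And>i j x. i \<noteq> j \<Longrightarrow> x \<in> XI i j \<Longrightarrow> br z x = 0" and Y: "\<And>i y. y \<in> YI i \<Longrightarrow> br z y = 0"
    and s: "s \<in> S"
  shows "br z s = 0"
proof -
  have "br z (br u v) = 0" if "br z u = 0" "br z v = 0" for u v
    using that br_jacobi[of z u v] by simp
  then have "GS \<subseteq> {s. br z s = 0}" using X Y by (auto simp: GS_def DS_def)
  moreover have "subspace {s. br z s = 0}" by (auto simp: subspace_def br_add_right br_scale_right)
  ultimately show ?thesis using span_minimal s by (auto simp: S_def)
qed

text \<open>Here \<open>u\<close> need not lie in \<open>S\<close>. The lemma is meant for an
  arbitrary skew endomorphism, whose generator part is to be split off.\<close>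

lemma prj_components:
  assumes x: "\<And>i j. i \<noteq> j \<Longrightarrow> px i j u \<in> XI i j" "\<And>i j. i \<noteq> j \<Longrightarrow> px j i u = px i j u" and y: "\<And>i. py i u \<in> YI i"
  shows "i \<noteq> j \<Longrightarrow> px i j (prj u) = px i j u" "py i (prj u) = py i u"
proof -
  have sum_px: "px i j (sum f I) = (\<Sum>p\<in>I. px i j (f p))" for i j f and I :: "'z set"
    by (induction I rule: infinite_finite_induct) (use px_add[of i j 0 0] in \<open>simp_all add: px_add\<close>)
  have sum_py: "py i (sum f I) = (\<Sum>p\<in>I. py i (f p))" for i f and I :: "'z set"
    by (induction I rule: infinite_finite_induct) (use py_add[of i 0 0] in \<open>simp_all add: py_add\<close>)
  show "px i j (prj u) = px i j u" if ij: "i \<noteq> j"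
  proof -
    have "(\<Sum>p\<in>{p :: 'n \<times> 'n. fst p \<noteq> snd p}. px i j (px (fst p) (snd p) u)) = (\<Sum>p\<in>{(i, j), (j, i)}. px i j (px (fst p) (snd p) u))"
    proof (rule sum.mono_neutral_right)
      show "\<forall>p\<in>{p. fst p \<noteq> snd p} - {(i, j), (j, i)}. px i j (px (fst p) (snd p) u) = 0"
      proof
        fix p assume "p \<in> {p. fst p \<noteq> snd p} - {(i, j), (j, i)}"
        then have "fst p \<noteq> snd p" "{i, j} \<noteq> {fst p, snd p}" by (auto simp: prod_eq_iff doubleton_eq_iff)
        then show "px i j (px (fst p) (snd p) u) = 0" using px_XI0 x(1) ij by blast
      qed
    qed (use ij in auto)
    also have "\<dots> = px i j u + px i j u" using ij x px_XI[OF ij x(1)[OF ij]] by simp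
    finally show ?thesis using px_YI[OF ij y]
      by (simp add: prj_def px_add px_scale sum_px scale_right_distrib flip: scale_left_distrib)
  qed
  have "py i (px (fst p) (snd p) u) = 0" if "fst p \<noteq> snd p" for p
    using py_XI x(1) that by blast
  then show "py i (prj u) = py i u"
    by (simp add: prj_def py_add py_scale sum_py py_YI[OF y])
qed

end

text \<open>The generators of two such Lie algebras over the same coordinates are paired up in the
  product, where they generate a central extension of both.\<close>

locale coordinatized_pair =
  C1: coordinatized A e1 e2 B N sc1 br1 xe1 ye1 px1 py1 + C2: coordinatized A e1 e2 B N sc2 br2 xe2 ye2 px2 py2
  for A :: "('f::field_char_0, 'a::ab_group_add) inv_algebra" and e1 e2
    and B :: "('f, 'a, 'b::ab_group_add) herm_module" and N :: "'n::finite itself"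
    and sc1 :: "'f \<Rightarrow> 'm1::ab_group_add \<Rightarrow> 'm1" and br1 xe1 ye1 px1 py1
    and sc2 :: "'f \<Rightarrow> 'm2::ab_group_add \<Rightarrow> 'm2" and br2 xe2 ye2 px2 py2
begin

sublocale P: coordinatized A e1 e2 B N "\<lambda>c (u, v). (sc1 c u, sc2 c v)" "\<lambda>(u, v) (u', v'). (br1 u u', br2 v v')"
  "\<lambda>i j a. (xe1 i j a, xe2 i j a)" "\<lambda>i y. (ye1 i y, ye2 i y)" "\<lambda>i j (u, v). (px1 i j u, px2 i j v)" "\<lambda>i (u, v). (py1 i u, py2 i v)"
proof (unfold_locales, goal_cases)
  case (10 x y z)
  show ?case
    by (simp add: split_beta prod_eq_iff) (intro conjI C1.br_jacobi C2.br_jacobi)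
next
  case (15 i j a)
  then show ?case using C1.xe_skew[of i j a] C2.xe_skew[of i j a] by simp
next
  case (35 i j a)
  then show ?case using C1.xe_inj[of i j a] by (simp add: prod_eq_iff)
next
  case (36 y i)
  then show ?case using C1.ye_inj[of y i] by (simp add: prod_eq_iff)
qed (simp_all add: split_beta prod_eq_iff C1.scale_right_distrib C2.scale_right_distrib C1.scale_left_distrib C2.scale_left_distrib
    C1.br_add_left C2.br_add_left C1.br_add_right C2.br_add_right C1.br_scale_left C2.br_scale_left C1.br_scale_right C2.br_scale_right
    C1.xe_add C2.xe_add C1.xe_scale C2.xe_scale C1.ye_add C2.ye_add C1.ye_scale C2.ye_scale
    C1.xe_xe C2.xe_xe C1.xe_xe0 C2.xe_xe0 C1.ye_xe C2.ye_xe C1.ye_xe0 C2.ye_xe0 C1.ye_ye C2.ye_ye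
    C1.px_add C2.px_add C1.px_scale C2.px_scale C1.py_add C2.py_add C1.py_scale C2.py_scale C1.px_xe C2.px_xe C1.px_xe0 C2.px_xe0
    C1.px_ye C2.px_ye C1.px_xx C2.px_xx C1.px_yy C2.px_yy C1.py_ye C2.py_ye C1.py_ye0 C2.py_ye0 C1.py_xe C2.py_xe C1.py_xx C2.py_xx
    C1.py_yy C2.py_yy)

lemma map_prod_linear:
  "Vector_Spaces.linear (\<lambda>c (u, v). (sc1 c u, sc2 c v)) sc1 fst" "Vector_Spaces.linear (\<lambda>c (u, v). (sc1 c u, sc2 c v)) sc2 snd"
  by unfold_locales auto

lemma image_S: "fst ` P.S = C1.S" "snd ` P.S = C2.S"
proof -
  have XI: "P.XI i j = (\<lambda>a. (xe1 i j a, xe2 i j a)) ` C1.CA" "P.YI i = (\<lambda>y. (ye1 i y, ye2 i y)) ` C1.CB" for i j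
    by (simp_all add: P.XI_def P.YI_def)
  \<comment> \<open>The same index sets parametrize generators and their brackets on both sides, so
    the projections can be compared term by term; for a generator the last coefficient is a
    dummy.\<close>
  define I where "I = {(i :: 'n, j, a, b). i \<noteq> j \<and> a \<in> C1.CA \<and> b \<in> C1.CA}"
  define J where "J = {(i :: 'n, y, z). y \<in> C1.CB \<and> z \<in> C1.CB}"
  define f1 where "f1 = (\<lambda>(i, j, a, b). br1 (xe1 i j a) (xe1 i j b))"
  define f2 where "f2 = (\<lambda>(i, j, a, b). br2 (xe2 i j a) (xe2 i j b))"
  define g1 where "g1 = (\<lambda>(i, y, z). br1 (ye1 i y) (ye1 i z))"
  define g2 where "g2 = (\<lambda>(i, y, z). br2 (ye2 i y) (ye2 i z))"
  define x1 x2 where "x1 = (\<lambda>(i, j, a, b :: 'a). xe1 i j a)" and "x2 = (\<lambda>(i, j, a, b :: 'a). xe2 i j a)"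
  define y1 y2 where "y1 = (\<lambda>(i, y, z :: 'b). ye1 i y)" and "y2 = (\<lambda>(i, y, z :: 'b). ye2 i y)"
  note defs = I_def J_def f1_def f2_def g1_def g2_def x1_def x2_def y1_def y2_def
  have D: "P.DS = (\<lambda>t. (f1 t, f2 t)) ` I \<union> (\<lambda>t. (g1 t, g2 t)) ` J"
    unfolding P.DS_def XI by (fastforce simp: image_iff defs)
  have D1: "C1.DS = f1 ` I \<union> g1 ` J" "C2.DS = f2 ` I \<union> g2 ` J"
    unfolding C1.DS_def C1.XI_def C1.YI_def C2.DS_def C2.XI_def C2.YI_def
    by (fastforce simp: image_iff defs)+
  have z: "0 \<in> C1.CA" "0 \<in> C1.CB" by simp_all
  have G: "P.GS = (\<lambda>t. (x1 t, x2 t)) ` I \<union> (\<lambda>t. (y1 t, y2 t)) ` J \<union> P.DS"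
    unfolding P.GS_def XI using z by (fastforce simp: image_iff defs)
  have G1: "C1.GS = x1 ` I \<union> y1 ` J \<union> C1.DS" "C2.GS = x2 ` I \<union> y2 ` J \<union> C2.DS"
    unfolding C1.GS_def C1.XI_def C1.YI_def C2.GS_def C2.XI_def C2.YI_def using z
    by (fastforce simp: image_iff defs)+
  have f: "fst ` P.GS = C1.GS" "snd ` P.GS = C2.GS" unfolding G G1 D D1 image_Un image_image fst_conv snd_conv by (rule refl)+
  interpret f: Vector_Spaces.linear "\<lambda>c (u, v). (sc1 c u, sc2 c v)" sc1 fst by (rule map_prod_linear)
  interpret s: Vector_Spaces.linear "\<lambda>c (u, v). (sc1 c u, sc2 c v)" sc2 snd by (rule map_prod_linear)
  show "fst ` P.S = C1.S" "snd ` P.S = C2.S"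
    unfolding P.S_def C1.S_def C2.S_def f[symmetric] by (simp_all only: f.span_image s.span_image)
qed

text \<open>The components of \<open>z\<close> are paired generators with one zero entry. Their
  coordinates vanish because \<open>xe\<close> and \<open>ye\<close> are injective on both sides, so
  \<open>z\<close> lies in the span of the diagonal brackets. Its bracket with a paired generator is
  again a paired generator with one zero entry, hence zero.\<close>

lemma kernel_central:
  assumes z: "z \<in> P.S" "fst z = 0 \<or> snd z = 0" and s: "s \<in> P.S"
  shows "(\<lambda>(u, v) (u', v'). (br1 u u', br2 v v')) z s = 0"
proof -
  obtain u v where uv: "z = (u, v)" "u = 0 \<or> v = 0" using z(2) by (cases z) auto
  have px0: "px1 i j 0 = 0" "px2 i j 0 = 0" "py1 i 0 = 0" "py2 i 0 = 0" for i j
    using C1.px_add[of i j 0 0] C2.px_add[of i j 0 0] C1.py_add[of i 0 0] C2.py_add[of i 0 0] by auto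
  have X0: "w = 0" if w: "w \<in> P.XI i j" "i \<noteq> j" "fst w = 0 \<or> snd w = 0" for w i j
  proof -
    obtain a where a: "a \<in> C1.CA" "w = (xe1 i j a, xe2 i j a)" using w(1) by (auto simp: P.XI_def)
    then have "a = 0" using w C1.xe_inj[of i j a] C2.xe_inj[of i j a] by auto
    then show ?thesis using a w C1.xe_zero C2.xe_zero by (simp add: zero_prod_def)
  qed
  have Y0: "w = 0" if w: "w \<in> P.YI i" "fst w = 0 \<or> snd w = 0" for w i
  proof -
    obtain a where a: "a \<in> C1.CB" "w = (ye1 i a, ye2 i a)" using w(1) by (auto simp: P.YI_def)
    then have "a = 0" using w C1.ye_inj[of a i] C2.ye_inj[of a i] by auto
    then show ?thesis using a w C1.ye_zero C2.ye_zero by (simp add: zero_prod_def)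
  qed
  have zD: "z \<in> P.span P.DS"
  proof (rule P.S_kernel[OF z(1)])
    show "(case z of (u, v) \<Rightarrow> (px1 i j u, px2 i j v)) = 0" if "i \<noteq> j" for i j
      using X0[OF P.S_components(2)[OF z(1) that] that] uv px0 by auto
    show "(case z of (u, v) \<Rightarrow> (py1 i u, py2 i v)) = 0" for i
      using Y0[OF P.S_components(3)[OF z(1)]] uv px0 by auto
  qed
  show ?thesis
  proof (rule P.S_central[OF _ _ s])
    fix i j x assume x: "i \<noteq> j" "x \<in> P.XI i j"
    show "(\<lambda>(u, v) (u', v'). (br1 u u', br2 v v')) z x = 0"
      by (rule X0[OF P.span_DS_act(1)[OF zD x(2,1)] x(1)]) (use uv in \<open>auto split: prod.split\<close>)
  next
    fix i y assume y: "y \<in> P.YI i"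
    show "(\<lambda>(u, v) (u', v'). (br1 u u', br2 v v')) z y = 0"
      by (rule Y0[OF P.span_DS_act(2)[OF zD y]]) (use uv in \<open>auto split: prod.split\<close>)
  qed
qed

lemma isogenous:
  assumes L: "lie_algebra L" "carrier L = C1.S" "scale L = sc1" "\<And>x y. x \<in> C1.S \<Longrightarrow> y \<in> C1.S \<Longrightarrow> bracket L x y = br1 x y"
    and M: "lie_algebra M" "carrier M = C2.S" "scale M = sc2" "\<And>x y. x \<in> C2.S \<Longrightarrow> y \<in> C2.S \<Longrightarrow> bracket M x y = br2 x y"
  shows "centrally_isogenous L M"
proof (rule centrally_isogenous_via[OF P.perfect_LS])
  have in1: "fst z \<in> C1.S" "snd z \<in> C2.S" if "z \<in> P.S" for z using image_S that by blast+
  have ker: "(br1 (fst z) (fst s), br2 (snd z) (snd s)) = 0" if "z \<in> P.S" "fst z = 0 \<or> snd z = 0" "s \<in> P.S" for z s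
    using kernel_central[OF that] by (simp add: split_beta)
  have ker': "(0 :: 'm1, br2 (snd z) (snd s)) = 0" if "z \<in> P.S" "fst z = 0" "s \<in> P.S" for z s
    using ker[OF that(1) _ that(3)] that(2) by simp
  have ker'': "(br1 (fst z) (fst s), 0 :: 'm2) = 0" if "z \<in> P.S" "snd z = 0" "s \<in> P.S" for z s
    using ker[OF that(1) _ that(3)] that(2) by simp
  show "central_extension P.LS L fst"
    unfolding central_extension_def lie_hom_def vlinear_def P.LS_simps
    using P.lie_algebra_LS L image_S in1 ker' by (simp add: split_beta)
  show "central_extension P.LS M snd"
    unfolding central_extension_def lie_hom_def vlinear_def P.LS_simps
    using P.lie_algebra_LS M image_S in1 ker'' by (simp add: split_beta)
qed

end

section \<open>The copy of \<open>sl\<close> in the skew endomorphisms\<close>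

context unitary
begin

lemma e_rules: "e1 \<in> CA" "e2 \<in> CA" "e1 \<cdot> e1 = e1" "e2 \<cdot> e2 = e2" "e1 \<cdot> e2 = 0" "e2 \<cdot> e1 = 0"
  "\<eta> e1 = e2" "\<eta> e2 = e1" "one = e1 + e2"
  using data eta_eta[of e1] by (auto simp: coordinate_data_def)

lemma e1_nonzero: "e1 \<noteq> 0"
proof
  assume "e1 = 0"
  then have "e2 = 0" using eta_zero e_rules(7) by simp
  then show False using \<open>e1 = 0\<close> e_rules(9) data by (simp add: coordinate_data_def)
qed

abbreviation "sact \<equiv> sl_action A e1 e2 B :: 'f^'n^'n \<Rightarrow> ('a^'n) \<times> 'b \<Rightarrow> ('a^'n) \<times> 'b"

text \<open>The matrix of the action rewritten by idempotents: \<open>e1\<close> carries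
  \<open>x\<close> and \<open>e2\<close> carries its negative transpose. By orthogonality the two
  parts multiply separately.\<close>

definition cf :: "'f^'n^'n \<Rightarrow> 'n \<Rightarrow> 'n \<Rightarrow> 'a" where
  "cf x i j = scale A (x $ i $ j) e1 - scale A (x $ j $ i) e2"

lemma cf_in [simp]: "cf x i j \<in> CA" by (simp add: cf_def e_rules)

lemma sl_matrix_cf: "sl_matrix A e1 e2 x $ i $ j = cf x i j"
proof -
  have *: "scale A c (e1 - e2) + scale A d (e1 + e2) = scale A (c + d) e1 - scale A (c - d) e2" for c d
    by (simp add: VA.scale_left_distrib VA.scale_left_diff_distrib VA.scale_right_distrib VA.scale_right_diff_distrib)
  show ?thesis unfolding sl_matrix_def cf_def vec_lambda_beta e_rules(9) * by (simp add: field_simps flip: add_divide_distrib diff_divide_distrib)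
qed

lemma sact_fst: "u \<in> CW \<Longrightarrow> fst (sact x u) $ i = (\<Sum>j\<in>UNIV. cf x i j \<cdot> fst u $ j)"
  and sact_snd [simp]: "snd (sact x u) = 0"
  and sact_out: "u \<notin> CW \<Longrightarrow> sact x u = 0"
  by (simp_all add: sl_action_def sl_matrix_cf)

lemma sact_CW: "sact x u \<in> CW"
  by (cases "u \<in> CW") (simp_all add: sact_out W_carrier[of "sact x u"] sact_fst CW_D)

lemma sact_add: "sact (x + y) = sact x + sact y"
proof (rule U_ext)
  show "sact (x + y) u = (sact x + sact y) u" if "u \<in> CW" for u
    by (rule W_eqI)
      (use that in \<open>simp_all add: sact_fst W_comp cf_def VA.scale_left_distrib mul_add mul_diff CW_D e_rules algebra_simps
        flip: sum.distrib\<close>)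
qed (simp_all add: sact_out)

lemma sact_scale: "sact (scale sl c x) = scale U c (sact x)"
proof (rule U_ext)
  show "sact (scale sl c x) u = scale U c (sact x) u" if u: "u \<in> CW" for u
  proof -
    have "cf (scale sl c x) i j = scale A c (cf x i j)" for i j
      by (simp add: cf_def sl_def VA.scale_right_diff_distrib)
    then show ?thesis
      by (intro W_eqI) (use u in \<open>simp_all add: U_ops sact_fst W_comp mul_scale CW_D VA.scale_sum_right\<close>)
  qed
qed (simp_all add: U_ops sact_out)

lemma cf_mult: "cf x i j \<cdot> cf y j k = scale A (x $ i $ j * y $ j $ k) e1 + scale A (y $ k $ j * x $ j $ i) e2"
  by (simp add: cf_def mul_diff mul_scale e_rules mult.commute)

lemma cf_bracket: "cf (bracket sl x y) i k = (\<Sum>j\<in>UNIV. cf x i j \<cdot> cf y j k) - (\<Sum>j\<in>UNIV. cf y i j \<cdot> cf x j k)"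
  unfolding cf_mult
  by (simp add: cf_def sl_def matrix_matrix_mult_def sum.distrib VA.scale_left_diff_distrib flip: VA.scale_sum_left)

lemma sact_act: assumes u: "u \<in> CW" shows "fst (sact x (sact y u)) $ i = (\<Sum>k\<in>UNIV. (\<Sum>j\<in>UNIV. cf x i j \<cdot> cf y j k) \<cdot> fst u $ k)"
proof -
  have "fst (sact x (sact y u)) $ i = (\<Sum>j\<in>UNIV. \<Sum>k\<in>UNIV. cf x i j \<cdot> cf y j k \<cdot> fst u $ k)"
    using u by (simp add: sact_fst sact_CW mul_sum mul_assoc CW_D)
  also have "\<dots> = (\<Sum>k\<in>UNIV. \<Sum>j\<in>UNIV. cf x i j \<cdot> cf y j k \<cdot> fst u $ k)" by (rule sum.swap)
  finally show ?thesis using u by (simp add: sum_mul CW_D)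
qed

lemma sact_zero: "sact x 0 = 0" by (rule W_eqI) (simp_all add: sact_fst)

lemma sact_bracket: "sact (bracket sl x y) = bracket U (sact x) (sact y)"
proof (rule U_ext)
  show "sact (bracket sl x y) u = bracket U (sact x) (sact y) u" if u: "u \<in> CW" for u
  proof (rule W_eqI)
    fix i
    show "fst (sact (bracket sl x y) u) $ i = fst (bracket U (sact x) (sact y) u) $ i"
      using u by (simp add: U_ops W_comp sact_act sact_fst[OF u] cf_bracket mul_diff CW_D sum_subtractf)
  qed (simp add: U_ops)
qed (simp_all add: U_ops sact_out sact_zero)

text \<open>The coefficient at \<open>(j, i)\<close> is \<open>- e2\<close>, which is
  \<open>- \<eta> e1\<close>.\<close>

lemma sact_unit: assumes ij: "i \<noteq> j" shows "sact (unit_matrix i j) = X i j e1"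
proof (rule U_ext)
  show "sact (unit_matrix i j) u = X i j e1 u" if u: "u \<in> CW" for u
  proof (rule W_eqI)
    fix k
    have "fst (sact (unit_matrix i j) u) $ k =
        (\<Sum>l\<in>UNIV. (if l = j then if k = i then e1 \<cdot> fst u $ j else 0 else 0) - (if l = i then if k = j then e2 \<cdot> fst u $ i else 0 else 0))"
      unfolding sact_fst[OF u]
      by (rule sum.cong) (use u ij in \<open>auto simp: cf_def unit_matrix_def mul_minus CW_D e_rules\<close>)
    also have "\<dots> = fst (X i j e1 u) $ k" using u ij by (simp add: X_fst sum_subtractf e_rules)
    finally show "fst (sact (unit_matrix i j) u) $ k = fst (X i j e1 u) $ k" .
  qed simp
qed (simp_all add: sact_out X_out)

lemma sact_induct:
  assumes x: "x \<in> carrier sl"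
    and addK: "\<And>S T. S \<in> K \<Longrightarrow> T \<in> K \<Longrightarrow> S + T \<in> K" and scale: "\<And>c T. T \<in> K \<Longrightarrow> scale U c T \<in> K"
    and X: "\<And>i j. i \<noteq> j \<Longrightarrow> X i j e1 \<in> K" and XX: "\<And>i j. i \<noteq> j \<Longrightarrow> bracket U (X i j e1) (X j i e1) \<in> K"
  shows "sact x \<in> K"
proof -
  have "2 \<le> CARD('n)" using card5 by simp
  with x show ?thesis
  proof (induction rule: sl_induct_basis)
    case (cartan i j)
    have "sact (cartan_elt i j) = bracket U (X i j e1) (X j i e1)"
      using cartan sact_bracket[of "unit_matrix i j" "unit_matrix j i"] by (simp add: sact_unit unit_matrix_bracket_cartan)
    then show ?case using XX cartan by simp
  next
    case (add x y)
    then show ?case unfolding sact_add by (intro addK)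
  qed (simp_all add: sact_scale sact_unit scale X)
qed

lemma sact_cartan:
  assumes "h \<in> cartan"
  shows "u \<in> CW \<Longrightarrow> fst (sact h u) $ i = scale A (h $ i $ i) ((e1 - e2) \<cdot> fst u $ i)"
    "diagonal (sact h) \<longleftrightarrow> sact h \<in> carrier U" "entry (sact h) i i = scale A (h $ i $ i) (e1 - e2)"
proof -
  have off: "cf h i j = (if j = i then scale A (h $ i $ i) (e1 - e2) else 0)" for i j
    using assms by (auto simp: cf_def cartan_def VA.scale_right_diff_distrib)
  have f: "fst (sact h u) $ i = scale A (h $ i $ i) ((e1 - e2) \<cdot> fst u $ i)" if "u \<in> CW" for u i
  proof -
    have "fst (sact h u) $ i = (\<Sum>j\<in>UNIV. if j = i then scale A (h $ i $ i) ((e1 - e2) \<cdot> fst u $ i) else 0)"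
      unfolding sact_fst[OF that] by (rule sum.cong) (use that in \<open>simp_all add: off mul_scale CW_D e_rules\<close>)
    then show ?thesis by simp
  qed
  show "u \<in> CW \<Longrightarrow> fst (sact h u) $ i = scale A (h $ i $ i) ((e1 - e2) \<cdot> fst u $ i)" by (rule f)
  show "diagonal (sact h) \<longleftrightarrow> sact h \<in> carrier U"
    by (auto simp: diagonal_def entry_def yent_def f ax_fst e_rules)
  show "entry (sact h) i i = scale A (h $ i $ i) (e1 - e2)"
    by (simp add: entry_def f ax_fst mul_one e_rules del: e_rules(9))
qed

text \<open>Multiplying a matrix entry by \<open>e1\<close> isolates \<open>x $ i $ j\<close>, and
  \<open>e1\<close> is nonzero.\<close>

lemma sact_injective:
  assumes "sact x = 0" shows "x = 0"
proof -
  have "x $ i $ j = 0" for i j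
  proof -
    have "fst (sact x (ax j)) $ i = (\<Sum>k\<in>UNIV. if k = j then cf x i j else 0)"
      unfolding sact_fst[OF ax_CW] by (rule sum.cong) (simp_all add: ax_fst mul_one)
    then have "cf x i j = 0" using assms by simp
    then have "e1 \<cdot> cf x i j = 0" by (simp add: e_rules)
    then have "scale A (x $ i $ j) e1 = 0" by (simp add: cf_def mul_diff mul_scale e_rules)
    then show ?thesis using e1_nonzero by simp
  qed
  then show ?thesis by (simp add: vec_eq_iff)
qed

end

text \<open>The component maps of \<open>coordinatized\<close> must be linear on the whole function
  type. The projection \<open>pr\<close> sees to it that the matrix coefficients they read off
  always lie in the coordinate algebra and module.\<close>

locale unitary_total = unitary A e1 e2 B N
  for A :: "('f::field_char_0, 'a::ab_group_add) inv_algebra" and e1 e2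
    and B :: "('f, 'a, 'b::ab_group_add) herm_module" and N :: "'n::finite itself" +
  fixes br and pr :: "(('a^'n) \<times> 'b \<Rightarrow> ('a^'n) \<times> 'b) \<Rightarrow> ('a^'n) \<times> 'b \<Rightarrow> ('a^'n) \<times> 'b"
  assumes tot: "total_lie_algebra (scale U) br"
    and br_U: "\<And>S T. S \<in> carrier U \<Longrightarrow> T \<in> carrier U \<Longrightarrow> br S T = bracket U S T"
    and pr_lin: "Vector_Spaces.linear (scale U) (scale U) pr"
    and pr_in: "\<And>T. pr T \<in> carrier U" and pr_id: "\<And>T. T \<in> carrier U \<Longrightarrow> pr T = T"
begin

sublocale total_lie_algebra "scale U" br by (rule tot)
interpretation pl: Vector_Spaces.linear "scale U" "scale U" pr by (rule pr_lin)

sublocale coordinatized A e1 e2 B N "scale U" br X Y "\<lambda>i j T. X i j (entry (pr T) i j)" "\<lambda>i T. Y i (yent (pr T) i)"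
proof (unfold_locales, goal_cases)
  case (5 i j a)
  then show ?case by (rule X_skew)
next
  case (16 i j k l a)
  then have "entry (pr (X k l a)) i j = 0" by (auto simp: pr_id X_in entry_X)
  then show ?case using X_scale[of 0 i j 0] by simp
next
  case (25 i j a)
  then show ?case by (rule X_injective)
next
  case (26 y i)
  then show ?case by (rule Y_injective)
qed (use X_scale[of 0 _ _ 0] Y_scale[of 0 _ 0] in \<open>simp_all add: X_add X_scale Y_add Y_scale br_U X_in Y_in X_X X_X0 Y_X Y_X0 Y_Y[OF _ A_closed(1)]
    pl.add pl.scale pr_id pr_in entry_add entry_closed yent_closed entry_X yent_X entry_Y yent_Y entry_XX yent_XX entry_YY yent_YY
    U_bracket_closed\<close>)

lemma U_sub: "subspace (carrier U)" by (rule lie_algebraD(2)[OF lie_algebra_U])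

lemma XI_U: "i \<noteq> j \<Longrightarrow> T \<in> XI i j \<Longrightarrow> T \<in> carrier U" and YI_U: "T \<in> YI i \<Longrightarrow> T \<in> carrier U"
  using X_in Y_in by (auto simp: XI_def YI_def)

lemma S_U: "S \<subseteq> carrier U"
  unfolding S_def by (rule span_minimal[OF _ U_sub]) (auto simp: GS_def DS_def XI_U YI_U br_U U_bracket_closed)

lemma br_S: "T \<in> S \<Longrightarrow> R \<in> S \<Longrightarrow> br T R = bracket U T R" using S_U br_U by blast

text \<open>Subtracting the generator part \<open>prj T\<close>, which lies in the subalgebra
  \<open>S\<close>, leaves a diagonal endomorphism. By \<open>diagonal_X\<close> and
  \<open>diagonal_Y\<close> that one preserves every space of generators.\<close>

lemma ideal_S:
  assumes T: "T \<in> carrier U" and R: "R \<in> S"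
  shows "br T R \<in> S"
proof -
  define T0 where "T0 = T - prj T"
  have XS: "X i j a \<in> S" if "i \<noteq> j" "a \<in> CA" for i j a using that S_in(1) by (auto simp: XI_def)
  have YS: "Y i y \<in> S" if "y \<in> CB" for i y using that S_in(2) by (auto simp: YI_def)
  have prjS: "prj T \<in> S"
    unfolding prj_def
    by (intro subspace_add[OF S_sub] subspace_scale[OF S_sub] subspace_sum[OF S_sub] XS YS)
      (use T in \<open>auto simp: pr_id entry_closed yent_closed\<close>)
  have T0U: "T0 \<in> carrier U" unfolding T0_def using T S_U prjS by (intro subspace_diff[OF U_sub]) auto
  have D0: "diagonal T0"
  proof -
    \<comment> \<open>The coefficients at \<open>(i, j)\<close> and \<open>(j, i)\<close> determine
      each other by \<open>entry_skew\<close>, so both orders of an index pair yield the same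
      component.\<close>
    have sym: "X j i (entry (pr T) j i) = X i j (entry (pr T) i j)" if "i \<noteq> j" for i j
      using X_skew[OF that entry_closed[OF T], of j i] entry_skew[OF T, of j i] X_scale[OF entry_closed[OF T], of i j "-1" i j] T
      by (simp add: pr_id)
    have inn: "X i j (entry (pr T) i j) \<in> XI i j" "Y i (yent (pr T) i) \<in> YI i" for i j
      using T by (auto simp: XI_def YI_def pr_id entry_closed yent_closed)
    have c: "X i j (entry (pr (prj T)) i j) = X i j (entry (pr T) i j)" "Y i (yent (pr (prj T)) i) = Y i (yent (pr T) i)"
      if "i \<noteq> j" for i j
      using prj_components[of T, OF inn(1) sym inn(2)] that by blast+
    have U1: "prj T \<in> carrier U" using prjS S_U by blast
    have "entry T0 i j = 0" if ij: "i \<noteq> j" for i j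
    proof (rule X_injective[OF ij entry_closed[OF T0U]])
      have "X i j (entry T0 i j + entry (prj T) i j) = X i j (entry T i j)"
        by (simp add: T0_def flip: entry_add)
      then show "X i j (entry T0 i j) = 0"
        using c(1)[OF ij] T U1 by (simp add: pr_id X_add entry_closed T0U)
    qed
    moreover have "yent T0 i = 0" for i
    proof (rule Y_injective[OF yent_closed[OF T0U]])
      obtain j where "i \<noteq> j" by (metis fresh3)
      have "Y i (yent T0 i + yent (prj T) i) = Y i (yent T i)"
        by (simp add: T0_def flip: entry_add)
      then show "Y i (yent T0 i) = 0"
        using c(2)[OF \<open>i \<noteq> j\<close>] T U1 by (simp add: pr_id Y_add yent_closed T0U)
    qed
    ultimately show ?thesis using T0U by (simp add: diagonal_def)
  qed
  have DX: "br T0 R \<in> XI i j" if "R \<in> XI i j" "i \<noteq> j" for R i j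
    using that T0U by (auto simp: XI_def br_U X_in diagonal_X[OF D0] entry_closed)
  have DY: "br T0 R \<in> YI i" if R: "R \<in> YI i" for R i
  proof -
    obtain y where y: "R = Y i y" "y \<in> CB" using R by (auto simp: YI_def)
    then have "(0, y) \<in> CW" by (simp add: W_carrier)
    then have "snd (T0 (0, y)) \<in> CB" using U_D(1)[OF T0U] CW_D(2) by blast
    then show ?thesis using y T0U by (auto simp: YI_def br_U Y_in diagonal_Y[OF D0] entry_closed)
  qed
  have "br T0 R \<in> S" if R: "R \<in> GS" for R
  proof -
    consider i j where "R \<in> XI i j" "i \<noteq> j" | i where "R \<in> YI i"
      | u v i j where "R = br u v" "u \<in> XI i j" "v \<in> XI i j" "i \<noteq> j" | u v i where "R = br u v" "u \<in> YI i" "v \<in> YI i"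
      using R by (auto simp: GS_def DS_def)
    then show ?thesis
    proof cases
      case 1
      then show ?thesis using DX S_in(1) by blast
    next
      case 2
      then show ?thesis using DY S_in(2) by blast
    next
      case 3
      then show ?thesis unfolding 3(1) br_jacobi[of T0] using DX by (intro subspace_add[OF S_sub] S_in) auto
    next
      case 4
      then show ?thesis unfolding 4(1) br_jacobi[of T0] using DY by (intro subspace_add[OF S_sub] S_in) auto
    qed
  qed
  then have "GS \<subseteq> {R. br T0 R \<in> S}" by blast
  then have "br T0 R \<in> S" using span_minimal[OF _ subspace_br_right[OF S_sub], of GS T0] R by (auto simp: S_def)
  moreover have "br (prj T) R \<in> S" by (rule S_br[OF prjS R])
  moreover have "br T R = br T0 R + br (prj T) R" by (simp add: T0_def flip: br_add_left)
  ultimately show ?thesis using subspace_add[OF S_sub] by simp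
qed

abbreviation "UL \<equiv> unitary_lie A e1 e2 B :: ('f, ('a^'n) \<times> 'b \<Rightarrow> ('a^'n) \<times> 'b) lie"

lemma XI_in: "a \<in> CA \<Longrightarrow> X i j a \<in> XI i j" and YI_in: "y \<in> CB \<Longrightarrow> Y i y \<in> YI i"
  by (auto simp: XI_def YI_def)

lemma sact_S: "x \<in> carrier sl \<Longrightarrow> sact x \<in> S"
proof (rule sact_induct)
  fix i j :: 'n assume ij: "i \<noteq> j"
  have "X i j e1 \<in> XI i j" "X j i e1 \<in> XI i j" using XI_in e_rules XI_swap[OF ij] by auto
  then show "X i j e1 \<in> S" "bracket U (X i j e1) (X j i e1) \<in> S"
    using S_in(1) S_in(3) ij XI_U br_U by metis+
qed (auto intro: subspace_add[OF S_sub] subspace_scale[OF S_sub])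

text \<open>An ideal that contains every \<open>X i j e1\<close> contains every
  \<open>X i j e2\<close> by skewness, hence every \<open>X i j one\<close>; brackets of these with
  arbitrary \<open>X\<close> and \<open>Y\<close> give all generators. In the other direction,
  \<open>S\<close> is an ideal containing the copy of \<open>sl\<close>.\<close>

lemma unitary_lie_carrier: "UL = U\<lparr>carrier := S\<rparr>"
proof -
  have "lie_ideal U hull (sact ` carrier sl) = S"
  proof
    have "lie_ideal U S" unfolding lie_ideal_def using S_U S_sub ideal_S br_U by (metis (no_types) subsetD)
    then show "lie_ideal U hull (sact ` carrier sl) \<subseteq> S" using sact_S by (intro hull_minimal) auto
    show "S \<subseteq> lie_ideal U hull (sact ` carrier sl)"
      unfolding hull_def
    proof (rule Inter_greatest)
      fix I assume "I \<in> {t. lie_ideal U t \<and> sact ` carrier sl \<subseteq> t}"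
      then have I: "I \<subseteq> carrier U" "subspace I" "\<And>T R. T \<in> carrier U \<Longrightarrow> R \<in> I \<Longrightarrow> br T R \<in> I" and sI: "sact ` carrier sl \<subseteq> I"
        unfolding lie_ideal_def using br_U by auto
      have 1: "X i j e1 \<in> I" if "i \<noteq> j" for i j
        using sI sact_unit[OF that] unit_matrix_in_sl[OF that] by (metis image_subset_iff)
      have 2: "X i j one \<in> I" if ij: "i \<noteq> j" for i j
      proof -
        have "X i j e2 = - X j i e1" using X_skew[of j i e2] ij by (simp add: e_rules)
        then have "X i j e2 \<in> I" using 1[of j i] ij subspace_neg[OF I(2)] by simp
        then show ?thesis using 1[OF ij] subspace_add[OF I(2)] by (simp add: X_add e_rules)
      qed
      have 3: "X i j a \<in> I" if ij: "i \<noteq> j" and a: "a \<in> CA" for i j a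
      proof -
        obtain m where m: "m \<noteq> i" "m \<noteq> j" by (rule fresh3[of i j j])
        have "X i j a = br (X i m a) (X m j one)" using xe_xe[of i m j a one] ij a m by (simp add: mul_one)
        then show ?thesis using I(3)[OF X_in[of i m a] 2[of m j]] a m by simp
      qed
      have 4: "Y i y \<in> I" if y: "y \<in> CB" for i y
      proof -
        obtain m where m: "m \<noteq> i" by (rule fresh3[of i i i])
        have "Y i y = br (Y m y) (X m i one)" using ye_xe[of m i one y] y m by (simp add: ra_one)
        then show ?thesis using I(3)[OF Y_in[of y m] 2[of m i]] y m by simp
      qed
      have XI: "T \<in> I" if "T \<in> XI i j" "i \<noteq> j" for T i j using that 3 by (auto simp: XI_def)
      have YI: "T \<in> I" if "T \<in> YI i" for T i using that 4 by (auto simp: YI_def)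
      have "GS \<subseteq> I" unfolding GS_def DS_def using XI YI I(1,3) by (auto simp: subset_iff)
      then show "S \<subseteq> I" unfolding S_def by (rule span_minimal[OF _ I(2)])
    qed
  qed
  then show ?thesis by (simp add: unitary_lie_def Let_def)
qed

lemma UL_simps: "carrier UL = S" "scale UL = scale U" "bracket UL = bracket U"
  by (simp_all add: unitary_lie_carrier)

lemma lie_algebra_UL: "lie_algebra UL"
  unfolding unitary_lie_carrier
  using S_U S_sub S_br br_S by (intro lie_algebra_subalgebra[OF lie_algebra_U]) auto

lemma lie_hom_sact: "lie_hom sl UL sact"
  unfolding lie_hom_def vlinear_def UL_simps by (simp add: sact_S sact_add sact_scale sact_bracket)

lemma inj_sact: "inj_on sact (carrier sl)"
proof (rule inj_onI)
  fix x y :: "'f^'n^'n" assume eq: "sact x = sact y"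
  have "sact ((x - y) + y) = sact (x - y) + sact y" by (rule sact_add)
  then have "sact (x - y) = 0" using eq by simp
  then show "x = y" using sact_injective by force
qed

section \<open>Weights of the unitary Lie algebra\<close>

definition pm :: "int \<Rightarrow> bool" where "pm s \<longleftrightarrow> s = 1 \<or> s = -1"

lemma pm_1 [simp]: "pm 1" "pm (-1)"
  by (auto simp: pm_def)

text \<open>For a sign \<open>s\<close> this is the idempotent on which \<open>e1 - e2\<close>, the
  coefficient of diagonal matrices, acts as \<open>s\<close>.\<close>

definition "ee s = (if s = (1::int) then e1 else e2)"

lemma ee_rules: "ee s \<in> CA" "pm s \<Longrightarrow> (e1 - e2) \<cdot> ee s = scale A (of_int s) (ee s)"
  "pm s \<Longrightarrow> ee s \<cdot> (e1 - e2) = scale A (of_int s) (ee s)" "ee s \<cdot> ee s = ee s"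
  "pm s \<Longrightarrow> \<eta> (ee s) = ee (- s)" "pm s \<Longrightarrow> ee s \<cdot> ee (- s) = 0"
  by (auto simp: ee_def pm_def e_rules mul_diff simp del: e_rules(9))

text \<open>Diagonal matrices act through \<open>e1 - e2\<close>, which multiplies the Peirce part
  \<open>ee s \<cdot> a \<cdot> ee t\<close> by \<open>s\<close> from the left and by
  \<open>t\<close> from the right.\<close>

lemma X_weight:
  assumes ij: "i \<noteq> j" and st: "pm s" "pm t" and a: "a \<in> CA" "ee s \<cdot> a = a" "a \<cdot> ee t = a"
  shows "X i j a \<in> wsp sact UL (sgl s i + sgl (- t) j)"
  unfolding wsp_def weight_space_def UL_simps
proof (intro CollectI conjI ballI)
  show "X i j a \<in> S" using XI_in S_in(1) ij a by blast
  fix h :: "'f^'n^'n" assume h: "h \<in> cartan"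
  then have hU: "sact h \<in> carrier U" using sact_S cartan_subset_sl S_U by blast
  have "(e1 - e2) \<cdot> (ee s \<cdot> a) = scale A (of_int s) (ee s \<cdot> a)"
    using ee_rules(2)[OF st(1)] a(1) ee_rules(1) by (simp add: e_rules mul_scale flip: mul_assoc del: e_rules(9))
  moreover have "(a \<cdot> ee t) \<cdot> (e1 - e2) = scale A (of_int t) (a \<cdot> ee t)"
    using ee_rules(3)[OF st(2)] a(1) ee_rules(1) by (simp add: e_rules mul_scale mul_assoc del: e_rules(9))
  ultimately have c: "(e1 - e2) \<cdot> a = scale A (of_int s) a" "a \<cdot> (e1 - e2) = scale A (of_int t) a"
    by (simp_all only: a)
  have "bracket U (sact h) (X i j a) = X i j (scale A (h $ i $ i * of_int s - h $ j $ j * of_int t) a)"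
    using diagonal_X[of "sact h" i j a] hU ij a c sact_cartan(2,3)[OF h]
    by (simp add: mul_scale e_rules VA.scale_left_diff_distrib del: e_rules(9))
  then show "bracket U (sact h) (X i j a) = scale U (wt (sgl s i + sgl (- t) j) h) (X i j a)"
    using h a by (simp add: X_scale wt_add wt_sgl mult.commute)
qed

lemma Y_weight:
  assumes t: "pm t" and y: "y \<in> CB" "y \<star> ee t = y"
  shows "Y i y \<in> wsp sact UL (sgl (- t) i)"
  unfolding wsp_def weight_space_def UL_simps
proof (intro CollectI conjI ballI)
  show "Y i y \<in> S" using YI_in S_in(2) y by blast
  fix h :: "'f^'n^'n" assume h: "h \<in> cartan"
  then have hU: "sact h \<in> carrier U" using sact_S cartan_subset_sl S_U by blast
  have "(y \<star> ee t) \<star> (e1 - e2) = scale B (of_int t) (y \<star> ee t)"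
    using ee_rules(3)[OF t] y(1) ee_rules(1) by (simp add: e_rules ra_scale flip: ra_assoc del: e_rules(9))
  then have c: "y \<star> (e1 - e2) = scale B (of_int t) y" by (simp only: y)
  have "bracket U (sact h) (Y i y) = Y i (scale B (- (h $ i $ i * of_int t)) y)"
    using diagonal_Y[of "sact h" y i] hU y c sact_cartan(2,3)[OF h]
    by (simp add: ra_scale e_rules del: e_rules(9))
  then show "bracket U (sact h) (Y i y) = scale U (wt (sgl (- t) i) h) (Y i y)"
    using h y by (simp add: Y_scale wt_sgl mult.commute del: VB.scale_minus_left)
qed

text \<open>Such a bracket would have weight of norm four. It vanishes because \<open>a\<close> ends
  in \<open>ee t\<close> while \<open>\<eta> b\<close> begins with the orthogonal idempotent
  \<open>ee (- t)\<close>, and similarly with \<open>ee s\<close> for products in the other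
  order.\<close>

lemma X_X_vanish:
  assumes ij: "i \<noteq> j" and t: "pm t" and s: "pm s"
    and a: "a \<in> CA" "ee s \<cdot> a = a" "a \<cdot> ee t = a" and b: "b \<in> CA" "ee s \<cdot> b = b" "b \<cdot> ee t = b"
  shows "br (X i j a) (X i j b) = 0"
proof -
  have z: "c \<cdot> \<eta> d = 0" "\<eta> c \<cdot> d = 0" if c: "c \<in> CA" "ee s \<cdot> c = c" "c \<cdot> ee t = c" and d: "d \<in> CA" "ee s \<cdot> d = d" "d \<cdot> ee t = d" for c d
  proof -
    have "\<eta> d = ee (- t) \<cdot> \<eta> d" using eta_mul[of d "ee t"] d ee_rules(1) ee_rules(5)[OF t] by simp
    moreover have "(c \<cdot> ee t) \<cdot> (ee (- t) \<cdot> \<eta> d) = c \<cdot> ((ee t \<cdot> ee (- t)) \<cdot> \<eta> d)"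
      using c(1) d(1) ee_rules(1) by (simp add: mul_assoc)
    ultimately have "(c \<cdot> ee t) \<cdot> \<eta> d = c \<cdot> ((ee t \<cdot> ee (- t)) \<cdot> \<eta> d)" by simp
    then show "c \<cdot> \<eta> d = 0" using ee_rules(6)[OF t] c d by simp
    have "\<eta> c = \<eta> c \<cdot> ee (- s)" using eta_mul[of "ee s" c] c ee_rules(1) ee_rules(5)[OF s] by simp
    moreover have "(\<eta> c \<cdot> ee (- s)) \<cdot> (ee s \<cdot> d) = \<eta> c \<cdot> ((ee (- s) \<cdot> ee s) \<cdot> d)"
      using c(1) d(1) ee_rules(1) by (simp add: mul_assoc)
    ultimately have "\<eta> c \<cdot> (ee s \<cdot> d) = \<eta> c \<cdot> ((ee (- s) \<cdot> ee s) \<cdot> d)" by simp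
    moreover have "ee (- s) \<cdot> ee s = 0" using s by (auto simp: ee_def pm_def e_rules)
    ultimately show "\<eta> c \<cdot> d = 0" using c d by simp
  qed
  have "bracket U (X i j a) (X i j b) = 0"
  proof (rule U_ext)
    show "bracket U (X i j a) (X i j b) u = 0 u" if u: "u \<in> CW" for u
      by (rule W_eqI) (use u ij a b z[OF a b] z[OF b a] in \<open>simp_all add: U_ops X_fst X_CW W_comp mul_minus CW_D flip: mul_assoc\<close>)
  qed (use a b in \<open>simp_all add: U_ops X_out XY_zero_arg\<close>)
  then show ?thesis using br_U X_in ij a b by simp
qed

text \<open>\<open>NX\<close>, \<open>NY\<close> and \<open>ND\<close> are homogeneous pieces of the
  generators. Weights in \<open>NX\<close> and \<open>NY\<close> have odd entries, so the evenness
  demanded in \<open>ND\<close> keeps the diagonal brackets apart from them.\<close>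

definition "NX w = {X i j a | i j a s t. i \<noteq> j \<and> a \<in> CA \<and> ee s \<cdot> a = a \<and> a \<cdot> ee t = a \<and>
    pm s \<and> pm t \<and> w = sgl s i + sgl (- t) j}"
definition "NY w = {Y i y | i y t. y \<in> CB \<and> y \<star> ee t = y \<and> pm t \<and> w = sgl (- t) i}"
definition "ND w = {br S T | S T u v. S \<in> wsp sact UL u \<and> T \<in> wsp sact UL v \<and> u \<noteq> 0 \<and> v \<noteq> 0 \<and> nrm u \<le> 2 \<and> nrm v \<le> 2 \<and>
    w = u + v \<and> (\<forall>i. even (w i))}"
lemma NDI: "\<lbrakk>R \<in> wsp sact UL u; T \<in> wsp sact UL v; u \<noteq> 0; v \<noteq> 0; nrm u \<le> 2; nrm v \<le> 2; \<forall>i. even ((u + v) i)\<rbrakk> \<Longrightarrow> br R T \<in> ND (u + v)"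
  unfolding ND_def by blast

definition "NN w = NX w \<union> NY w \<union> ND w"

lemma NX_wsp: "NX w \<subseteq> wsp sact UL w" and NY_wsp: "NY w \<subseteq> wsp sact UL w"
  unfolding NX_def NY_def using X_weight Y_weight by blast+

abbreviation "SN \<equiv> span (\<Union>w\<in>{w :: 'n \<Rightarrow> int. nrm w \<le> 2}. NN w)"

definition "HX i j = {X i j a | a s t. a \<in> CA \<and> ee s \<cdot> a = a \<and> a \<cdot> ee t = a \<and> pm s \<and> pm t}"
definition "HY i = {Y i y | y t. y \<in> CB \<and> y \<star> ee t = y \<and> pm t}"

lemma XI_homogeneous: assumes "T \<in> XI i j" shows "T \<in> span (HX i j)"
proof -
  obtain a where a: "a \<in> CA" "T = X i j a" using assms by (auto simp: XI_def)
  have h: "X i j (ee s \<cdot> a \<cdot> ee t) \<in> span (HX i j)" if "pm s" "pm t" for s t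
  proof -
    have "ee s \<cdot> (ee s \<cdot> a \<cdot> ee t) = ee s \<cdot> a \<cdot> ee t" "ee s \<cdot> a \<cdot> ee t \<cdot> ee t = ee s \<cdot> a \<cdot> ee t"
      using a ee_rules(1) ee_rules(4) mul_assoc[of "ee s" "ee s" "a \<cdot> ee t"] by (simp_all add: mul_assoc)
    moreover have "ee s \<cdot> a \<cdot> ee t \<in> CA" using a ee_rules(1) by simp
    ultimately show ?thesis unfolding HX_def using that by (intro span_base) blast
  qed
  have c: "e1 \<cdot> a \<cdot> e1 + e1 \<cdot> a \<cdot> e2 + (e2 \<cdot> a \<cdot> e1 + e2 \<cdot> a \<cdot> e2) = one \<cdot> a \<cdot> one"
    using a by (simp add: e_rules mul_add algebra_simps)
  have "T = X i j (e1 \<cdot> a \<cdot> e1) + X i j (e1 \<cdot> a \<cdot> e2) + (X i j (e2 \<cdot> a \<cdot> e1) + X i j (e2 \<cdot> a \<cdot> e2))"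
    using a by (simp add: c mul_one e_rules(1,2) flip: X_add)
  then show ?thesis using h[of 1 1] h[of 1 "-1"] h[of "-1" 1] h[of "-1" "-1"] by (simp add: ee_def span_add)
qed

lemma YI_homogeneous: assumes "T \<in> YI i" shows "T \<in> span (HY i)"
proof -
  obtain y where y: "y \<in> CB" "T = Y i y" using assms by (auto simp: YI_def)
  have h: "Y i (y \<star> ee t) \<in> span (HY i)" if "pm t" for t
  proof -
    have "y \<star> ee t \<star> ee t = y \<star> ee t" "y \<star> ee t \<in> CB" using y ee_rules(1,4) by (simp_all flip: ra_assoc)
    then show ?thesis unfolding HY_def using that by (intro span_base) blast
  qed
  have "y \<star> e1 + y \<star> e2 = y" using y by (simp add: e_rules(1,2) ra_one flip: ra_add e_rules(9))
  then have "T = Y i (y \<star> e1) + Y i (y \<star> e2)" using y by (simp add: e_rules(1,2) flip: Y_add)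
  then show ?thesis using h[of 1] h[of "-1"] by (simp add: ee_def span_add)
qed

lemma HX_NX: assumes "T \<in> HX i j" "i \<noteq> j"
  obtains s t a where "pm s" "pm t" "T \<in> NX (sgl s i + sgl (- t) j)" "T = X i j a" "a \<in> CA" "ee s \<cdot> a = a" "a \<cdot> ee t = a"
  using assms that unfolding HX_def NX_def by blast

lemma HY_NY: assumes "T \<in> HY i"
  obtains t where "pm t" "T \<in> NY (sgl (- t) i)"
  using assms that unfolding HY_def NY_def by blast

text \<open>The Peirce decomposition splits each generator into weight vectors. For brackets at an
  index pair, equal signs give zero and different signs give a weight of norm at most two; brackets
  at a single index always have such a weight.\<close>

lemma S_SN: "S \<subseteq> SN"
proof -
  have base: "T \<in> SN" if "nrm w \<le> 2" "T \<in> NN w" for T w using that by (intro span_base) blast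
  have n1: "nrm (sgl (- t) i) \<le> 2" if "pm t" for i :: 'n and t using that by (auto simp: pm_def)
  have n2: "nrm (sgl s i + sgl (- t) j) = 2" if "pm s" "pm t" "i \<noteq> j" for i j :: 'n and s t
    using that by (auto simp: pm_def)
  have "T \<in> SN" if T: "T \<in> HX i j" "i \<noteq> j" for T i j
  proof -
    obtain s t where "pm s" "pm t" "T \<in> NX (sgl s i + sgl (- t) j)" using HX_NX[OF T] by metis
    then show ?thesis using base[of "sgl s i + sgl (- t) j" T] n2[of s t i j] T by (simp add: NN_def)
  qed
  then have XI: "T \<in> SN" if "T \<in> XI i j" "i \<noteq> j" for T i j
    using span_minimal[of "HX i j" SN] XI_homogeneous[of T i j] that by blast
  have "T \<in> SN" if T: "T \<in> HY i" for T i
  proof -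
    obtain t where "pm t" "T \<in> NY (sgl (- t) i)" using HY_NY[OF T] by metis
    then show ?thesis using base[of "sgl (- t) i" T] n1 by (simp add: NN_def)
  qed
  then have YI: "T \<in> SN" if "T \<in> YI i" for T i
    using span_minimal[of "HY i" SN] YI_homogeneous[of T i] that by blast
  have XX: "br R T \<in> SN" if RT: "R \<in> XI i j" "T \<in> XI i j" "i \<noteq> j" for R T i j
  proof (rule span_br_subset[of SN "HX i j" "HX i j"])
    fix R T assume "R \<in> HX i j" "T \<in> HX i j"
    obtain s t a where R: "pm s" "pm t" "R \<in> NX (sgl s i + sgl (- t) j)" "R = X i j a" "a \<in> CA" "ee s \<cdot> a = a" "a \<cdot> ee t = a"
      using HX_NX[OF \<open>R \<in> HX i j\<close> RT(3)] by metis
    obtain s' t' b where T: "pm s'" "pm t'" "T \<in> NX (sgl s' i + sgl (- t') j)" "T = X i j b" "b \<in> CA" "ee s' \<cdot> b = b" "b \<cdot> ee t' = b"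
      using HX_NX[OF \<open>T \<in> HX i j\<close> RT(3)] by metis
    show "br R T \<in> SN"
    proof (cases "s = s' \<and> t = t'")
      case True
      then show ?thesis using X_X_vanish[of i j t s a b] R T RT(3) by (simp add: span_zero)
    next
      case False
      let ?u = "sgl s i + sgl (- t) j" and ?v = "sgl s' i + sgl (- t') j"
      have sum: "?u + ?v = sgl (s + s') i + sgl (- t - t') j" by (simp add: fun_eq_iff sgl_def)
      have nn: "nrm (?u + ?v) \<le> 2" unfolding sum using RT(3) R(1,2) T(1,2) False by (auto simp: pm_def)
      have "nrm ?u = 2" "nrm ?v = 2" by (rule n2; fact)+
      moreover from this have "?u \<noteq> 0" "?v \<noteq> 0" by (metis nrm_zero zero_neq_numeral)+
      moreover have "\<forall>k. even ((?u + ?v) k)" using R(1,2) T(1,2) unfolding sum by (auto simp: sgl_def pm_def)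
      ultimately have "br R T \<in> ND (?u + ?v)"
        by (intro NDI subsetD[OF NX_wsp R(3)] subsetD[OF NX_wsp T(3)]) simp_all
      then show ?thesis using base[OF nn] by (simp add: NN_def)
    qed
  qed (use RT XI_homogeneous in auto)
  have YY: "br R T \<in> SN" if RT: "R \<in> YI i" "T \<in> YI i" for R T i
  proof (rule span_br_subset[of SN "HY i" "HY i"])
    fix R T assume "R \<in> HY i" "T \<in> HY i"
    obtain t where R: "pm t" "R \<in> NY (sgl (- t) i)" using HY_NY[OF \<open>R \<in> HY i\<close>] by metis
    obtain t' where T: "pm t'" "T \<in> NY (sgl (- t') i)" using HY_NY[OF \<open>T \<in> HY i\<close>] by metis
    let ?u = "sgl (- t) i" and ?v = "sgl (- t') i"
    have sum: "?u + ?v = sgl (- t - t') i" by (simp add: sgl_add)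
    have nn: "nrm (?u + ?v) \<le> 2" unfolding sum using R(1) T(1) by (auto simp: pm_def)
    have "nrm ?u = 1" "nrm ?v = 1" using R(1) T(1) by (auto simp: pm_def)
    moreover from this have "?u \<noteq> 0" "?v \<noteq> 0" by (metis nrm_zero zero_neq_one)+
    moreover have "\<forall>k. even ((?u + ?v) k)" using R(1) T(1) unfolding sum by (auto simp: sgl_def pm_def)
    ultimately have "br R T \<in> ND (?u + ?v)"
      by (intro NDI subsetD[OF NY_wsp R(2)] subsetD[OF NY_wsp T(2)]) simp_all
    then show "br R T \<in> SN" using base[OF nn] by (simp add: NN_def)
  qed (use RT YI_homogeneous in auto)
  show ?thesis unfolding S_def using XI YI XX YY by (intro span_minimal) (auto simp: GS_def DS_def)
qed

text \<open>Oddness at \<open>i\<close> excludes the diagonal brackets and norm two excludes the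
  pieces of type \<open>Y\<close>, so only \<open>X\<close> at the indices \<open>i\<close>,
  \<open>j\<close> can have this weight.\<close>

lemma NN_XI:
  assumes ij: "i \<noteq> j" and s: "pm s"
  shows "NN (sgl s i + sgl s j) \<subseteq> XI i j"
proof
  fix T assume T: "T \<in> NN (sgl s i + sgl s j)"
  have "T \<notin> NY (sgl s i + sgl s j)"
  proof
    assume "T \<in> NY (sgl s i + sgl s j)"
    then obtain t k where "pm t" "sgl s i + sgl s j = sgl (- t) k" unfolding NY_def by blast
    then have "nrm (sgl s i + sgl s j) = 1" by (auto simp: pm_def)
    then show False using ij s by (auto simp: pm_def)
  qed
  moreover have "T \<notin> ND (sgl s i + sgl s j)"
  proof
    assume "T \<in> ND (sgl s i + sgl s j)"
    then have "even ((sgl s i + sgl s j) i)" unfolding ND_def by blast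
    then show False using ij s by (auto simp: pm_def)
  qed
  ultimately obtain k l a p t where kl: "k \<noteq> l" "a \<in> CA" "T = X k l a" "pm p" "pm t" "sgl s i + sgl s j = sgl p k + sgl (- t) l"
    using T unfolding NN_def NX_def by blast
  have "k \<in> {i, j}" "l \<in> {i, j}"
    using fun_cong[OF kl(6), of k] fun_cong[OF kl(6), of l] kl(1,4,5) by (auto simp: sgl_def pm_def split: if_splits)
  then have "XI k l = XI i j" using XI_swap[OF ij] kl(1) by auto
  then show "T \<in> XI i j" using XI_in kl(2,3) by blast
qed

lemma NN_YI:
  assumes s: "pm s"
  shows "NN (sgl s i) \<subseteq> YI i"
proof
  fix T assume T: "T \<in> NN (sgl s i)"
  have "T \<notin> NX (sgl s i)"
  proof
    assume "T \<in> NX (sgl s i)"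
    then obtain k l p t where "k \<noteq> l" "pm p" "pm t" "sgl s i = sgl p k + sgl (- t) l" unfolding NX_def by blast
    then have "nrm (sgl s i) = 2" by (auto simp: pm_def)
    then show False using s by (auto simp: pm_def)
  qed
  moreover have "T \<notin> ND (sgl s i)"
  proof
    assume "T \<in> ND (sgl s i)"
    then have "even ((sgl s i) i)" unfolding ND_def by blast
    then show False using s by (auto simp: pm_def)
  qed
  ultimately obtain k y t where k: "y \<in> CB" "T = Y k y" "pm t" "sgl s i = sgl (- t) k"
    using T unfolding NN_def NY_def by blast
  have "k = i" using fun_cong[OF k(4), of k] k(3) by (auto simp: sgl_def pm_def split: if_splits)
  then show "T \<in> YI i" using YI_in k(1,2) by blast
qed

text \<open>The homogeneous pieces of \<open>S_SN\<close> give the grading. A bracket whose weight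
  has norm above two vanishes unless an exceptional coincidence occurs; then the two vectors lie in
  generator spaces with disjoint indices, which commute.\<close>

lemma unitary_graded: "Theta_graded sact UL" "norm_graded sact UL"
proof -
  obtain br' where "sl_lie UL br' sact" by (rule sl_lie_exists[OF lie_algebra_UL lie_hom_sact])
  then interpret M: sl_lie5 UL br' sact using card5 by (simp add: sl_lie5_def sl_lie5_axioms_def)
  have br': "br' R T = br R T" if "R \<in> S" "T \<in> S" for R T
    using M.br_eq[of R T] that br_S by (simp add: UL_simps)
  have SpS: "T \<in> S" if "T \<in> M.Sp w" for T w using M.Sp_carrier[OF that] by (simp add: UL_simps)
  have ND_Sp: "ND w \<subseteq> M.Sp w" for w
  proof
    fix D assume "D \<in> ND w"
    then obtain R T u v where "D = br R T" "R \<in> M.Sp u" "T \<in> M.Sp v" "w = u + v" unfolding ND_def by blast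
    then show "D \<in> M.Sp w" using M.Sp_br[of R u T v] br' SpS by metis
  qed
  have NN_Sp: "NN w \<subseteq> M.Sp w" for w using NX_wsp NY_wsp ND_Sp by (simp add: NN_def)
  have "NN w \<subseteq> M.Gen w" for w
  proof (cases "w = 0")
    case True
    have "NX 0 = {}"
    proof -
      have "sgl p k + sgl (- t) l \<noteq> (0 :: 'n \<Rightarrow> int)" if "k \<noteq> l" "pm p" "pm t" for k l p t
        using nrm_sgl2[OF that(1), of p "- t"] that(2,3) by (auto simp: pm_def simp del: nrm_sgl2)
      then show ?thesis unfolding NX_def by fastforce
    qed
    moreover have "NY 0 = {}"
    proof -
      have "sgl (- t) k \<noteq> (0 :: 'n \<Rightarrow> int)" if "pm t" for k t
        using nrm_sgl[of "- t" k] that by (auto simp: pm_def simp del: nrm_sgl)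
      then show ?thesis unfolding NY_def by fastforce
    qed
    moreover have "ND 0 \<subseteq> M.Gen 0"
    proof
      fix D assume "D \<in> ND 0"
      then obtain R T u v where D: "D = br R T" "R \<in> M.Sp u" "T \<in> M.Sp v" "0 = u + v" "u \<noteq> 0" "nrm u \<le> 2" unfolding ND_def by blast
      moreover have "v = - u" using D(4) by (simp add: eq_neg_iff_add_eq_0 add.commute)
      moreover have "br R T = br' R T" using br' SpS D by metis
      ultimately show "D \<in> M.Gen 0" by (auto simp: M.Gen_def)
    qed
    ultimately show ?thesis using True by (simp add: NN_def)
  next
    case False
    then show ?thesis using NN_Sp by (simp add: M.Gen_def)
  qed
  then have "(\<Union>w\<in>M.W2. NN w) \<subseteq> (\<Union>w\<in>M.W2. M.Gen w)" by blast
  then have "M.span (\<Union>w\<in>M.W2. NN w) \<subseteq> M.span (\<Union>w\<in>M.W2. M.Gen w)" by (rule M.span_mono)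
  then have gen: M.generated using S_SN unfolding M.generated_def UL_simps by blast
  then show "Theta_graded sact UL" using M.Theta_graded_iff[OF inj_sact] by simp
  interpret Th: Theta_lie UL br' sact by unfold_locales (rule gen)
  have in_NN: "T \<in> M.span (NN w)" if "T \<in> M.Sp w" "nrm w \<le> 2" for T w
    by (rule M.Sp_span[where N = NN]) (use NN_Sp that SpS S_SN in \<open>auto simp: UL_simps\<close>)
  have inX: "T \<in> XI i j" if "T \<in> M.Sp (sgl s i + sgl s j)" "i \<noteq> j" "pm s" for T i j s
  proof -
    have "nrm (sgl s i + sgl s j) \<le> 2" using that by (auto simp: pm_def)
    then show ?thesis
      using in_NN[OF that(1)] span_minimal[OF NN_XI[OF that(2,3)] XI_sub[OF that(2)]] by (auto simp: UL_simps)
  qed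
  have inY: "T \<in> YI i" if "T \<in> M.Sp (sgl s i)" "pm s" for T i s
  proof -
    have "nrm (sgl s i) \<le> 2" using that by (auto simp: pm_def)
    then show ?thesis
      using in_NN[OF that(1)] span_minimal[OF NN_YI[OF that(2)] YI_sub] by (auto simp: UL_simps)
  qed
  have zero: "br' R T = 0" if n: "nrm v \<le> 2" "nrm w \<le> 2" "2 < nrm (v + w)" and RT: "R \<in> M.Sp v" "T \<in> M.Sp w" for R T v w
  proof (cases "\<exists>t c. nrm t \<le> 2 \<and> v + w = t + (\<lambda>_. c)")
    case False
    then show ?thesis using Th.Sp_trivial[OF M.Sp_br[OF RT]] by blast
  next
    case True
    then obtain t c where t: "nrm t \<le> 2" "v + w = t + (\<lambda>_. c)" by blast
    have "br R T = 0"
    proof (rule weight_sum_cases[OF card5 n t])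
      fix s i j k l assume s: "s = 1 \<or> s = -1" "distinct [i, j, k, l]" "v = sgl s i + sgl s j" "w = sgl s k + sgl s l"
      then have "R \<in> XI i j" "T \<in> XI k l" using inX RT by (auto simp: pm_def)
      then show ?thesis using XX0 s(2) by auto
    next
      fix s i j k assume s: "s = 1 \<or> s = -1" "distinct [i, j, k]" "v = sgl s i + sgl s j" "w = sgl s k"
      then have "R \<in> XI i j" "T \<in> YI k" using inX inY RT by (auto simp: pm_def)
      then show ?thesis using XY0 s(2) by auto
    next
      fix s i j k assume s: "s = 1 \<or> s = -1" "distinct [i, j, k]" "w = sgl s i + sgl s j" "v = sgl s k"
      then have "T \<in> XI i j" "R \<in> YI k" using inX inY RT by (auto simp: pm_def)
      then show ?thesis using YX0 s(2) by auto
    qed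
    then show ?thesis using br' SpS RT by metis
  qed
  show "norm_graded sact UL"
    unfolding norm_graded_def using zero M.br_eq M.Sp_carrier by metis
qed

end

lemma (in unitary) unitary_total_exists: "\<exists>br pr. unitary_total A e1 e2 B (br :: (('a^'n) \<times> 'b \<Rightarrow> ('a^'n) \<times> 'b) \<Rightarrow> _) pr"
proof -
  obtain br where "total_lie_algebra (scale U) br" "\<forall>S\<in>carrier U. \<forall>T\<in>carrier U. br S T = bracket U S T"
    using total_bracket_exists[OF lie_algebra_U] by blast
  moreover obtain pr where "Vector_Spaces.linear (scale U) (scale U) pr" "\<forall>x. pr x \<in> carrier U" "\<forall>x\<in>carrier U. pr x = x"
    using exists_projection[OF lie_algebraD(1,2)[OF lie_algebra_U]] by blast
  ultimately show ?thesis
    by (intro exI[of _ br] exI[of _ pr]) (simp add: unitary_total_def unitary_total_axioms_def unitary_axioms)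
qed

section \<open>Coordinates of a graded Lie algebra\<close>

locale norm_graded_lie = Theta_lie L br \<iota>
  for L :: "('f::field_char_0, 'l::ab_group_add) lie" and br and \<iota> :: "'f^'n::finite^'n \<Rightarrow> 'l" +
  assumes ng: "norm_graded \<iota> L" and inj: "inj_on \<iota> (carrier sl)"
begin

lemma br_Sp_zero: "x \<in> Sp v \<Longrightarrow> y \<in> Sp w \<Longrightarrow> nrm v \<le> 2 \<Longrightarrow> nrm w \<le> 2 \<Longrightarrow> 2 < nrm (v + w) \<Longrightarrow> br x y = 0"
  using ng br_eq Sp_carrier unfolding norm_graded_def by metis

section \<open>Components of a graded Lie algebra modulo two\<close>

text \<open>A class modulo two is encoded by the set of its odd indices; addition of weights becomes
  symmetric difference.\<close>

definition "odds (w :: 'n \<Rightarrow> int) = {i. odd (w i)}"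
definition "MM S = span (\<Union>w\<in>{w. nrm w \<le> 2 \<and> odds w = S}. Sp w)"
text \<open>The future unit at \<open>(i, j)\<close>: in a unitary Lie algebra
  \<open>X i j one\<close> is \<open>X i j e1 - X j i e1\<close>.\<close>

definition "uu i j = E i j - E j i"

lemma MM_sub: "subspace (MM S)" by (simp add: MM_def)

lemma Sp_MM: "x \<in> Sp w \<Longrightarrow> nrm w \<le> 2 \<Longrightarrow> odds w = S \<Longrightarrow> x \<in> MM S"
  unfolding MM_def by (rule span_base) blast

lemma odds_add: "odds (v + w) = sym_diff (odds v) (odds w)"
  by (auto simp: odds_def)

lemma MM_br: assumes "x \<in> MM S" "y \<in> MM T" shows "br x y \<in> MM (sym_diff S T)"
proof (rule span_br_subset[OF MM_sub _ assms[unfolded MM_def]])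
  fix x y assume "x \<in> (\<Union>w\<in>{w. nrm w \<le> 2 \<and> odds w = S}. Sp w)" "y \<in> (\<Union>w\<in>{w. nrm w \<le> 2 \<and> odds w = T}. Sp w)"
  then obtain v w where v: "x \<in> Sp v" "nrm v \<le> 2" "odds v = S" and w: "y \<in> Sp w" "nrm w \<le> 2" "odds w = T" by blast
  show "br x y \<in> MM (sym_diff S T)"
  proof (cases "nrm (v + w) \<le> 2")
    case True
    then show ?thesis using Sp_MM[OF Sp_br[OF v(1) w(1)]] v w by (simp add: odds_add)
  next
    case False
    then show ?thesis using br_Sp_zero[OF v(1) w(1)] v w subspace_0[OF MM_sub] by simp
  qed
qed

text \<open>Every odd entry contributes at least one to the norm.\<close>

lemma MM_large: assumes "2 < card S" shows "MM S = {0}"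
proof -
  have "odds w \<noteq> S" if "nrm w \<le> 2" for w
  proof
    assume S: "odds w = S"
    have "int (card S) = (\<Sum>i\<in>S. 1)" by simp
    also have "\<dots> \<le> (\<Sum>i\<in>S. \<bar>w i\<bar>)"
    proof (rule sum_mono)
      fix i assume "i \<in> S"
      then have "w i \<noteq> 0" using S by (auto simp: odds_def)
      then show "1 \<le> \<bar>w i\<bar>" by linarith
    qed
    also have "\<dots> \<le> nrm w" by (rule nrm_ge)
    finally show False using assms that by simp
  qed
  then have "{w. nrm w \<le> 2 \<and> odds w = S} = {}" by blast
  then show ?thesis unfolding MM_def by (simp only: UN_empty image_empty Union_empty span_empty)
qed

lemma MM_XX: assumes "distinct [i, j, k]" "x \<in> MM {i, j}" "y \<in> MM {j, k}" shows "br x y \<in> MM {i, k}"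
proof -
  have "sym_diff {i, j} {j, k} = {i, k}" using assms(1) by auto
  then show ?thesis using MM_br[OF assms(2,3)] by simp
qed
lemma MM_YX: assumes "i \<noteq> j" "y \<in> MM {i}" "x \<in> MM {i, j}" shows "br y x \<in> MM {j}"
proof -
  have "sym_diff {i} {i, j} = {j}" using assms(1) by auto
  then show ?thesis using MM_br[OF assms(2,3)] by simp
qed
lemma MM_YY: assumes "i \<noteq> j" "y \<in> MM {i}" "z \<in> MM {j}" shows "br y z \<in> MM {i, j}"
proof -
  have "sym_diff {i} {j} = {i, j}" using assms(1) by auto
  then show ?thesis using MM_br[OF assms(2,3)] by simp
qed
lemma MM_same: "x \<in> MM S \<Longrightarrow> y \<in> MM S \<Longrightarrow> br x y \<in> MM {}"
  using MM_br[of x S y S] by simp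
lemma MM_XX0: assumes "distinct [i, j, k, l]" "x \<in> MM {i, j}" "y \<in> MM {k, l}" shows "br x y = 0"
proof -
  have "sym_diff {i, j} {k, l} = {i, j, k, l}" using assms(1) by auto
  moreover have "MM {i, j, k, l} = {0}" by (rule MM_large) (use assms(1) in simp)
  ultimately show ?thesis using MM_br[OF assms(2,3)] by simp
qed
lemma MM_YX0: assumes "distinct [i, j, k]" "y \<in> MM {k}" "x \<in> MM {i, j}" shows "br y x = 0"
proof -
  have "sym_diff {k} {i, j} = {i, j, k}" using assms(1) by auto
  moreover have "MM {i, j, k} = {0}" by (rule MM_large) (use assms(1) in simp)
  ultimately show ?thesis using MM_br[OF assms(2,3)] by simp
qed
lemma MM_XY0: "distinct [i, j, k] \<Longrightarrow> y \<in> MM {k} \<Longrightarrow> x \<in> MM {i, j} \<Longrightarrow> br x y = 0"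
  using MM_YX0[of i j k y x] br_skew[of x y] by simp

lemma E_MM: assumes "i \<noteq> j" shows "E i j \<in> MM {i, j}"
proof (rule Sp_MM[OF E_Sp[OF assms]])
  show "nrm (sgl 1 i + sgl (- 1) j) \<le> 2" using assms by simp
  show "odds (sgl 1 i + sgl (- 1) j) = {i, j}" using assms by (auto simp: odds_def sgl_def split: if_splits)
qed

lemma uu_MM: "i \<noteq> j \<Longrightarrow> uu i j \<in> MM {i, j}"
  using E_MM[of i j] E_MM[of j i] by (simp add: uu_def subspace_diff[OF MM_sub] insert_commute)

lemma uu_skew: "uu j i = - uu i j" by (simp add: uu_def)

lemma
  assumes "distinct [i, j, k]"
  shows E_uu: "br (E i j) (uu j k) = E i k" and uu_E: "br (uu i j) (E j k) = E i k" and uu_uu: "br (uu i j) (uu j k) = uu i k"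
    and E_E0: "br (E i j) (E k j) = 0" "br (E j i) (E j k) = 0"
proof -
  have n: "i \<noteq> j" "j \<noteq> i" "i \<noteq> k" "k \<noteq> i" "j \<noteq> k" "k \<noteq> j" using assms by auto
  show z: "br (E i j) (E k j) = 0" "br (E j i) (E j k) = 0" using E_br(2) n by auto
  have e: "br (E i j) (E j k) = E i k" "br (E k j) (E j i) = E k i" using E_br(1) n by auto
  show "br (E i j) (uu j k) = E i k" "br (uu i j) (E j k) = E i k" by (simp_all add: uu_def br_diff_left br_diff_right z e)
  show "br (uu i j) (uu j k) = uu i k"
    using br_skew[of "E j i" "E k j"] by (simp add: uu_def br_diff_left br_diff_right z e)
qed

text \<open>An \<open>sl\<^sub>2\<close> computation. The weight \<open>w\<close> is extreme for the
  root on \<open>i\<close> and \<open>j\<close>: one root vector kills \<open>x\<close>, the other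
  kills it when applied twice, and the remaining mixed product gives back \<open>x\<close>. The sign
  comes from \<open>uu i j = E i j - E j i\<close>.\<close>

lemma uu_uu_act_Sp:
  assumes ij: "i \<noteq> j" and x: "x \<in> Sp w" and w: "nrm w \<le> 2" "w i = 0" "\<bar>w j\<bar> = 1"
  shows "br (uu i j) (br (uu i j) x) = - x"
proof -
  have ji: "j \<noteq> i" using ij by simp
  have n: "nrm (sgl s i + sgl t j + v) = nrm v - \<bar>v i\<bar> + \<bar>v i + s\<bar> - \<bar>v j\<bar> + \<bar>v j + t\<bar>" for s t v
  proof -
    have "nrm (v + sgl s i + sgl t j) = nrm v - \<bar>v i\<bar> + \<bar>v i + s\<bar> - \<bar>v j\<bar> + \<bar>v j + t\<bar>"
      using ij by (simp add: nrm_add_sgl)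
    then show ?thesis by (simp add: ac_simps)
  qed
  have n1: "1 \<le> nrm w" using nrm_ge[of w "{j}"] w by simp
  note Eij = E_Sp[OF ij] and Eji = E_Sp[OF ji]
  have r: "nrm (sgl 1 i + sgl (- 1) j) \<le> 2" "nrm (sgl 1 j + sgl (- 1) i) \<le> 2" using ij by simp_all
  have c: "sgl 1 j + sgl (- 1) i = sgl (- 1) i + sgl 1 j" by (rule add.commute)
  have H: "br (br (E i j) (E j i)) x = scale L (of_int (- w j)) x" "br (br (E j i) (E i j)) x = scale L (of_int (w j)) x"
    using H_act[OF ij x] H_act[OF ji x] w(2) by simp_all
  consider "w j = 1" | "w j = -1" using w(3) by linarith
  then show ?thesis
  proof cases
    case 1
    have "br (E j i) x = 0"
      by (rule br_Sp_zero[OF Eji x r(2) w(1)]) (use n[of "-1" 1 w] n1 w 1 in \<open>simp add: c\<close>)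
    moreover have "br (E i j) (br (E i j) x) = 0"
      by (rule br_Sp_zero[OF Eij Sp_br[OF Eij x] r(1)])
        (use n[of 1 "-1" w] n[of 1 "-1" "sgl 1 i + sgl (- 1) j + w"] n1 w 1 ij in simp_all)
    moreover have "br (E j i) (br (E i j) x) = x"
      using br_jacobi[of "E j i" "E i j" x] H(2) 1 calculation(1) by simp
    ultimately show ?thesis by (simp add: uu_def br_diff_left br_diff_right)
  next
    case 2
    have "br (E i j) x = 0"
      by (rule br_Sp_zero[OF Eij x r(1) w(1)]) (use n[of 1 "-1" w] n1 w 2 in simp)
    moreover have "br (E j i) (br (E j i) x) = 0"
      by (rule br_Sp_zero[OF Eji Sp_br[OF Eji x] r(2)])
        (use n[of "-1" 1 w] n[of "-1" 1 "sgl (- 1) i + sgl 1 j + w"] n1 w 2 ij in \<open>simp_all add: c\<close>)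
    moreover have "br (E i j) (br (E j i) x) = x"
      using br_jacobi[of "E i j" "E j i" x] H(1) 2 calculation(1) by simp
    ultimately show ?thesis by (simp add: uu_def br_diff_left br_diff_right)
  qed
qed

text \<open>Evenness at \<open>i\<close>, oddness at \<open>j\<close> and norm at most two leave
  only \<open>w i = 0\<close> and \<open>\<bar>w j\<bar> = 1\<close>.\<close>

lemma uu_uu_act:
  assumes ij: "i \<noteq> j" and S: "i \<notin> S" "j \<in> S" and x: "x \<in> MM S"
  shows "br (uu i j) (br (uu i j) x) = - x"
proof -
  have "(\<Union>w\<in>{w. nrm w \<le> 2 \<and> odds w = S}. Sp w) \<subseteq> {x. br (uu i j) (br (uu i j) x) = - x}"
  proof clarify
    fix w x assume w: "nrm w \<le> 2" "S = odds w" "x \<in> Sp w"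
    have e: "even (w i)" "odd (w j)" using S w(2) by (auto simp: odds_def)
    have "(\<Sum>a\<in>{i, j}. \<bar>w a\<bar>) \<le> nrm w" by (rule nrm_ge)
    then have "\<bar>w i\<bar> + \<bar>w j\<bar> \<le> 2" using w(1) ij by simp
    then have "w i = 0" "\<bar>w j\<bar> = 1" using e by (presburger, presburger)
    then show "br (uu i j) (br (uu i j) x) = - x" using uu_uu_act_Sp ij w by blast
  qed
  moreover have "subspace {x. br (uu i j) (br (uu i j) x) = - x}"
    by (auto simp: subspace_def br_add_right br_scale_right)
  ultimately show ?thesis using span_minimal x unfolding MM_def by blast
qed

lemma uu_inverse:
  assumes "i \<noteq> j" "i \<notin> S" "j \<in> S" "x \<in> MM S"
  shows "br (uu j i) (br (uu i j) x) = x" "br (br x (uu j i)) (uu i j) = x"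
proof -
  show "br (uu j i) (br (uu i j) x) = x" using uu_uu_act[OF assms] by (simp add: uu_skew[of j i])
  then show "br (br x (uu j i)) (uu i j) = x"
    using br_skew[of x "uu j i"] br_skew[of "br (uu j i) x" "uu i j"] uu_uu_act[OF assms] by (simp add: uu_skew[of j i])
qed

definition "BB = (\<Union>i. \<Union>j\<in>-{i}. MM {i, j}) \<union> (\<Union>i. MM {i}) \<union>
  {br x y | x y i j. i \<noteq> j \<and> x \<in> MM {i, j} \<and> y \<in> MM {i, j}} \<union> {br x y | x y i. x \<in> MM {i} \<and> y \<in> MM {i}}"

lemma weight_cases:
  assumes "nrm w \<le> 2"
  obtains i j where "i \<noteq> j" "odds w = {i, j}" | i where "odds w = {i}" | "w = 0" | s i where "s = 1 \<or> s = -1" "w = sgl (2 * s) i"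
  using assms
proof (cases rule: nrm_le_2_cases)
  case 1
  then show ?thesis using that by blast
next
  case (2 s i)
  then have "odds w = {i}" by (auto simp: odds_def sgl_def split: if_splits)
  then show ?thesis using that by blast
next
  case (3 s i t j)
  show ?thesis
  proof (cases "i = j")
    case True
    then have "w = sgl (s + t) i" using 3 by (simp add: sgl_add)
    then show ?thesis using 3 that(3) that(4)[of s i] by (cases "s = t") auto
  next
    case False
    then have "odds w = {i, j}" using 3 by (auto simp: odds_def sgl_def split: if_splits)
    then show ?thesis using that False by blast
  qed
qed

text \<open>Twice a unit vector is even, so such weights belong to no component with odd indices.
  The commutator of \<open>E a b\<close> and \<open>E b a\<close> has eigenvalue 2 on
  \<open>x\<close>, and one of its products vanishes there, which exhibits \<open>x\<close> as a
  bracket of two elements of one \<open>MM {i, j}\<close>.\<close>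

lemma double_weight:
  assumes s: "s = 1 \<or> s = -1" and x: "x \<in> Sp (sgl (2 * s) i)"
  obtains j p q where "i \<noteq> j" "p \<in> MM {i, j}" "q \<in> MM {i, j}" "x = br p q"
proof -
  obtain j where ij: "i \<noteq> j"
  proof -
    have "UNIV \<noteq> {i}"
    proof
      assume "UNIV = {i}"
      then have "CARD('n) = 1" by (metis card_1_singleton_iff One_nat_def)
      then show False using card5 by simp
    qed
    then obtain j where "j \<noteq> i" by blast
    then show ?thesis using that[of j] by auto
  qed
  then have ji: "j \<noteq> i" by simp
  have one: thesis if "a \<noteq> b" "{a, b} = {i, j}" and w: "sgl (2 * s) i a - sgl (2 * s) i b = 2" for a b
  proof -
    let ?w = "sgl (2 * s) i"
    have ba: "b \<noteq> a" using that by simp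
    have wa: "(a = i \<and> b = j \<and> s = 1) \<or> (a = j \<and> b = i \<and> s = -1)"
      using that ij s by (auto simp: doubleton_eq_iff sgl_def)
    have w2: "nrm ?w \<le> 2" using s by auto
    have "br (E a b) x = 0"
    proof (rule br_Sp_zero[OF E_Sp[OF that(1)] x _ w2])
      show "nrm (sgl 1 a + sgl (- 1) b) \<le> 2" using that by simp
      have "sgl 1 a + sgl (- 1) b + ?w = sgl (if a = i then 3 else 1) a + sgl (if a = i then -1 else -3) b"
        using wa ij by (auto simp: fun_eq_iff sgl_def)
      then show "2 < nrm (sgl 1 a + sgl (- 1) b + ?w)" using that(1) by simp
    qed
    then have "br (E a b) (br (E b a) x) = scale L 2 x"
      using br_jacobi[of "E a b" "E b a" x] H_act[OF that(1) x] w by simp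
    then have eq: "x = br (scale L (1/2) (E a b)) (br (E b a) x)" by (simp add: br_scale_left)
    have "scale L (1/2) (E a b) \<in> MM {i, j}" using subspace_scale[OF MM_sub E_MM[OF that(1)]] that(2) by simp
    moreover have "br (E b a) x \<in> MM {i, j}"
    proof -
      have "odds ?w = {}" using s by (auto simp: odds_def sgl_def)
      then have "x \<in> MM {}" using Sp_MM[OF x w2] by simp
      then have "br (E b a) x \<in> MM {b, a}" using MM_br[OF E_MM[OF ba], of x "{}"] by simp
      then show ?thesis using that(2) by (simp add: insert_commute)
    qed
    ultimately show thesis using that ij eq \<open>\<And>p j q. \<lbrakk>i \<noteq> j; p \<in> MM {i, j}; q \<in> MM {i, j}; x = br p q\<rbrakk> \<Longrightarrow> thesis\<close> by blast
  qed
  show thesis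
  proof (cases "s = 1")
    case True
    then show ?thesis using one[OF ij] ij by simp
  next
    case False
    then show ?thesis using one[OF ji] s ij by (auto simp: insert_commute)
  qed
qed

text \<open>Weights with odd entries lie in some \<open>MM\<close>, and doubled unit vectors are
  covered by \<open>double_weight\<close>. Weight zero consists of brackets of opposite weights; for
  doubled unit vectors the Jacobi identity rewrites these as brackets inside one
  \<open>MM {i, j}\<close>.\<close>

lemma carrier_BB: "carrier L \<subseteq> span BB"
proof -
  have sb: "subspace (span BB)" by simp
  have b2: "x \<in> span BB" if "x \<in> MM {i, j}" "i \<noteq> j" for x i j using that by (intro span_base) (auto simp: BB_def)
  have b1: "x \<in> span BB" if "x \<in> MM {i}" for x i using that by (intro span_base) (auto simp: BB_def)
  have bb2: "br x y \<in> span BB" if "x \<in> MM {i, j}" "y \<in> MM {i, j}" "i \<noteq> j" for x y i j using that by (intro span_base) (auto simp: BB_def)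
  have bb1: "br x y \<in> span BB" if "x \<in> MM {i}" "y \<in> MM {i}" for x y i using that by (intro span_base) (auto simp: BB_def)
  have "Gen w \<subseteq> span BB" if w: "nrm w \<le> 2" for w
  proof (cases "w = 0")
    case False
    show ?thesis
    proof
      fix x assume "x \<in> Gen w"
      then have x: "x \<in> Sp w" using False by (simp add: Gen_def)
      show "x \<in> span BB" using w
      proof (cases rule: weight_cases)
        case (1 i j)
        then show ?thesis using Sp_MM[OF x w] b2 by simp
      next
        case (2 i)
        then show ?thesis using Sp_MM[OF x w] b1 by simp
      next
        case (4 s i)
        then show ?thesis using double_weight[of s x i] x bb2 by metis
      qed (use False in simp)
    qed
  next
    case True
    have "br x y \<in> span BB" if v: "nrm v \<le> 2" "v \<noteq> 0" and xy: "x \<in> Sp v" "y \<in> Sp (- v)" for v x y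
    proof -
      have o: "odds (- v) = odds v" by (simp add: odds_def)
      have n: "nrm (- v) \<le> 2" using v by simp
      show ?thesis using v(1)
      proof (cases rule: weight_cases)
        case (1 i j)
        then show ?thesis using bb2[of x i j y] Sp_MM[OF xy(1) v(1)] Sp_MM[OF xy(2) n] o by simp
      next
        case (2 i)
        then show ?thesis using bb1[of x i y] Sp_MM[OF xy(1) v(1)] Sp_MM[OF xy(2) n] o by simp
      next
        case (4 s i)
        then obtain j p q where pq: "i \<noteq> j" "p \<in> MM {i, j}" "q \<in> MM {i, j}" "x = br p q" using double_weight[of s x i] xy by metis
        have "odds (- v) = {}" using 4 by (auto simp: odds_def sgl_def)
        then have y: "y \<in> MM {}" using Sp_MM[OF xy(2) n] by simp
        have "br q y \<in> MM {i, j}" "br p y \<in> MM {i, j}" using MM_br[OF pq(3) y] MM_br[OF pq(2) y] by simp_all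
        then show ?thesis unfolding pq(4) br_jacobi_left using bb2 pq by (intro subspace_diff[OF sb]) auto
      qed (use v in simp)
    qed
    then show ?thesis using True by (auto simp: Gen_def)
  qed
  then have "span (\<Union>w\<in>W2. Gen w) \<subseteq> span BB" by (intro span_minimal) auto
  then show ?thesis using gen unfolding generated_def by blast
qed

text \<open>Uniqueness of weight components makes them additive. A projection onto the carrier is
  applied first, so that the maps are linear on the whole type.\<close>

lemma weight_projection_exists:
  "\<exists>P. (\<forall>S x y. P S (x + y) = P S x + P S y) \<and> (\<forall>S c x. P S (scale L c x) = scale L c (P S x)) \<and>
    (\<forall>S x. x \<in> MM S \<longrightarrow> P S x = x) \<and> (\<forall>S T x. x \<in> MM T \<longrightarrow> S \<noteq> T \<longrightarrow> P S x = 0)"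
proof -
  obtain pr where pr: "Vector_Spaces.linear (scale L) (scale L) pr" "\<And>x. pr x \<in> carrier L" "\<And>x. x \<in> carrier L \<Longrightarrow> pr x = x"
    using exists_projection[OF lie_algebraD(1,2)[OF lieL]] by blast
  interpret pr: Vector_Spaces.linear "scale L" "scale L" pr by (rule pr(1))
  have ex: "\<exists>f. (\<forall>w\<in>W2. f w \<in> Sp w) \<and> x = (\<Sum>w\<in>W2. f w)" if x: "x \<in> carrier L" for x
  proof -
    obtain f where f: "\<forall>w\<in>W2. f w \<in> span (Gen w)" "x = (\<Sum>w\<in>W2. f w)"
      using span_weight_decomposition[of x Gen] gen x unfolding generated_def by blast
    then show ?thesis using span_minimal[OF Gen_Sp Sp_sub] by blast
  qed
  define F where "F x = (SOME f. (\<forall>w\<in>W2. f w \<in> Sp w) \<and> x = (\<Sum>w\<in>W2. f w))" for x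
  have F: "\<And>w. w \<in> W2 \<Longrightarrow> F x w \<in> Sp w" "x = (\<Sum>w\<in>W2. F x w)" if "x \<in> carrier L" for x
    using someI_ex[OF ex[OF that]] unfolding F_def by blast+
  have Feq: "F x w = f w" if x: "x \<in> carrier L" and f: "\<And>w. w \<in> W2 \<Longrightarrow> f w \<in> Sp w" "x = (\<Sum>w\<in>W2. f w)" and w: "w \<in> W2" for x f w
  proof -
    have "F x w - f w = 0"
      by (rule Sp_indep[of "\<lambda>w. F x w - f w"])
        (use F[OF x] f w in \<open>auto simp: sum_subtractf intro: subspace_diff[OF Sp_sub]\<close>)
    then show ?thesis by simp
  qed
  define P where "P S x = (\<Sum>w\<in>{w\<in>W2. odds w = S}. F (pr x) w)" for S x
  have Fadd: "F (x + y) w = F x w + F y w" if "x \<in> carrier L" "y \<in> carrier L" "w \<in> W2" for x y w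
    by (rule Feq) (use that F(1) F(2)[OF that(1)] F(2)[OF that(2)] in \<open>auto simp: sum.distrib subspace_add[OF carrier_sub] intro: subspace_add[OF Sp_sub]\<close>)
  have Fsc: "F (scale L c x) w = scale L c (F x w)" if "x \<in> carrier L" "w \<in> W2" for x c w
    by (rule Feq) (use that F(1) F(2)[OF that(1)] in \<open>auto simp: subspace_scale[OF carrier_sub] intro: subspace_scale[OF Sp_sub] simp flip: scale_sum_right\<close>)
  have add: "P S (x + y) = P S x + P S y" for S x y
    by (simp add: P_def pr.add Fadd pr(2) sum.distrib)
  have sc: "P S (scale L c x) = scale L c (P S x)" for S c x
    by (simp add: P_def pr.scale Fsc pr(2) scale_sum_right)
  have PSp: "P S x = (if odds v = S then x else 0)" if v: "x \<in> Sp v" "nrm v \<le> 2" for S x v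
  proof -
    have x: "x \<in> carrier L" by (rule Sp_carrier[OF v(1)])
    have "F x w = (if w = v then x else 0)" if "w \<in> W2" for w
      by (rule Feq) (use x v that subspace_0[OF Sp_sub] in \<open>auto simp: finite_nrm_le_2\<close>)
    then have "P S x = (\<Sum>w\<in>{w\<in>W2. odds w = S}. if w = v then x else 0)"
      unfolding P_def pr(3)[OF x] by (intro sum.cong) auto
    moreover have "finite {w \<in> W2. odds w = S}" using finite_nrm_le_2 by (rule finite_subset[rotated]) auto
    ultimately show ?thesis using v by (simp only: sum.delta) simp
  qed
  have "MM S \<subseteq> {x. P S x = x}" for S
    unfolding MM_def
  proof (rule span_minimal)
    show "subspace {x. P S x = x}" using add[of S 0 0] by (auto simp: subspace_def add sc)
  qed (use PSp in auto)
  moreover have "MM T \<subseteq> {x. P S x = 0}" if "S \<noteq> T" for S T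
    unfolding MM_def
  proof (rule span_minimal)
    show "subspace {x. P S x = 0}" using add[of S 0 0] by (auto simp: subspace_def add sc)
    show "(\<Union>w\<in>{w. nrm w \<le> 2 \<and> odds w = T}. Sp w) \<subseteq> {x. P S x = 0}"
    proof clarify
      fix w x assume "nrm w \<le> 2" "T = odds w" "x \<in> Sp w"
      then show "P S x = 0" using PSp[of x w S] that by simp
    qed
  qed
  ultimately show ?thesis using add sc by (intro exI[of _ P]) blast
qed

text \<open>An element of the coordinate algebra is a family of elements of the components \<open>MM {i, j}\<close> that
  correspond to each other under the operators \<open>uu i j\<close>, stored as a function on the codes of the
  pairs \<open>(i, j)\<close>; the coordinate module is treated in the same way at the codes of \<open>(i, i)\<close>.\<close>

definition cp :: "(nat \<Rightarrow> 'l) \<Rightarrow> 'n \<Rightarrow> 'n \<Rightarrow> 'l" where "cp f i j = f (to_nat (i, j))"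
definition fam :: "('n \<Rightarrow> 'n \<Rightarrow> 'l) \<Rightarrow> nat \<Rightarrow> 'l" where
  "fam g m = (if m \<in> range (to_nat :: 'n \<times> 'n \<Rightarrow> nat) then case from_nat m of (i, j) \<Rightarrow> g i j else 0)"
definition famA :: "('n \<Rightarrow> 'n \<Rightarrow> 'l) \<Rightarrow> nat \<Rightarrow> 'l" where "famA g = fam (\<lambda>i j. if i = j then 0 else g i j)"
definition famB :: "('n \<Rightarrow> 'l) \<Rightarrow> nat \<Rightarrow> 'l" where "famB g = fam (\<lambda>i j. if i = j then g i else 0)"

definition supported :: "(nat \<Rightarrow> 'l) \<Rightarrow> bool" where
  "supported f \<longleftrightarrow> (\<forall>m. m \<notin> range (to_nat :: 'n \<times> 'n \<Rightarrow> nat) \<longrightarrow> f m = 0)"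

text \<open>The compatibility conditions let one entry determine the family. Zero diagonal and
  support on codes of pairs remove the freedom at places that carry no component.\<close>

definition "CA0 = {f. supported f \<and> (\<forall>i. cp f i i = 0) \<and> (\<forall>i j. i \<noteq> j \<longrightarrow> cp f i j \<in> MM {i, j}) \<and>
  (\<forall>i j k. distinct [i, j, k] \<longrightarrow> br (uu i j) (cp f j k) = cp f i k \<and> br (cp f i j) (uu j k) = cp f i k)}"
definition "CB0 = {f. supported f \<and> (\<forall>i j. i \<noteq> j \<longrightarrow> cp f i j = 0) \<and> (\<forall>i. cp f i i \<in> MM {i}) \<and>
  (\<forall>i j. i \<noteq> j \<longrightarrow> br (cp f i i) (uu i j) = cp f j j)}"

text \<open>An arbitrary further index; \<open>mul_indep\<close> and \<open>ract_indep\<close> show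
  that its choice does not matter.\<close>

definition "oth i j = (SOME k :: 'n. k \<noteq> i \<and> k \<noteq> j)"
definition "fscale c f = (\<lambda>m :: nat. scale L c (f m))"
definition "mulA x y = famA (\<lambda>i k. br (cp x i (oth i k)) (cp y (oth i k) k))"
text \<open>The formula mirrors \<open>X j i a = - X i j (\<eta> a)\<close> in the unitary Lie
  algebra.\<close>

definition "etaA x = famA (\<lambda>i j. - cp x j i)"
definition "ractB y a = famB (\<lambda>j. br (cp y (oth j j) (oth j j)) (cp a (oth j j) j))"
definition "hermB y z = famA (\<lambda>i j. br (cp y i i) (cp z j j))"

definition coord_algebra :: "('f, nat \<Rightarrow> 'l) inv_algebra" where
  "coord_algebra = \<lparr>carrier = CA0, scale = fscale, mult = mulA, unit = famA uu, invol = etaA\<rparr>"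
definition coord_module :: "('f, nat \<Rightarrow> 'l, nat \<Rightarrow> 'l) herm_module" where
  "coord_module = \<lparr>carrier = CB0, scale = fscale, ract = ractB, herm = hermB\<rparr>"

section \<open>The operations on coordinate families\<close>

lemma cp_fam [simp]: "cp (fam g) i j = g i j" by (simp add: cp_def fam_def)
lemma cp_famA: "cp (famA g) i j = (if i = j then 0 else g i j)" by (simp add: famA_def)
lemma cp_famB: "cp (famB g) i j = (if i = j then g i else 0)" by (simp add: famB_def)
lemma supported_fam: "supported (fam g)" "supported (famA g)" "supported (famB h)"
  by (simp_all add: supported_def fam_def famA_def famB_def)

lemma cp_ops: "cp (f + g) i j = cp f i j + cp g i j" "cp (fscale c f) i j = scale L c (cp f i j)" "cp 0 i j = 0"
  by (simp_all add: cp_def fscale_def)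

lemma supported_ops: "supported f \<Longrightarrow> supported g \<Longrightarrow> supported (f + g)" "supported f \<Longrightarrow> supported (fscale c f)" "supported 0"
  by (simp_all add: supported_def fscale_def)

lemma fam_ext: assumes "supported f" "supported g" "\<And>i j. cp f i j = cp g i j" shows "f = g"
proof
  fix m
  show "f m = g m"
  proof (cases "m \<in> range (to_nat :: 'n \<times> 'n \<Rightarrow> nat)")
    case True
    then obtain i j :: 'n where "m = to_nat (i, j)" by auto
    then show ?thesis using assms(3)[of i j] by (simp add: cp_def)
  qed (use assms in \<open>auto simp: supported_def\<close>)
qed

lemma oth: "oth i j \<noteq> i" "oth i j \<noteq> j"
proof -
  obtain k where "k \<notin> set [i, j]" using fresh[of "[i, j]"] by auto
  then have "\<exists>k. k \<noteq> i \<and> k \<noteq> j" by auto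
  from someI_ex[OF this] show "oth i j \<noteq> i" "oth i j \<noteq> j" by (simp_all add: oth_def)
qed

lemma CA_D:
  assumes "x \<in> CA0"
  shows "i \<noteq> j \<Longrightarrow> cp x i j \<in> MM {i, j}" "distinct [i, j, k] \<Longrightarrow> br (uu i j) (cp x j k) = cp x i k"
    "distinct [i, j, k] \<Longrightarrow> br (cp x i j) (uu j k) = cp x i k" "supported x" "cp x i i = 0"
  using assms by (simp_all add: CA0_def)

lemma CB_D:
  assumes "y \<in> CB0"
  shows "cp y i i \<in> MM {i}" "i \<noteq> j \<Longrightarrow> br (cp y i i) (uu i j) = cp y j j" "supported y" "i \<noteq> j \<Longrightarrow> cp y i j = 0"
  using assms by (simp_all add: CB0_def)

lemma famA_in:
  assumes "\<And>i j. i \<noteq> j \<Longrightarrow> g i j \<in> MM {i, j}" "\<And>i j k. distinct [i, j, k] \<Longrightarrow> br (uu i j) (g j k) = g i k"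
    "\<And>i j k. distinct [i, j, k] \<Longrightarrow> br (g i j) (uu j k) = g i k"
  shows "famA g \<in> CA0"
  using assms by (simp add: CA0_def supported_fam cp_famA)

lemma famB_in:
  assumes "\<And>i. g i \<in> MM {i}" "\<And>i j. i \<noteq> j \<Longrightarrow> br (g i) (uu i j) = g j"
  shows "famB g \<in> CB0"
  using assms by (simp add: CB0_def supported_fam cp_famB)

lemma CA_eqI: assumes "x \<in> CA0" "y \<in> CA0" "\<And>i j. i \<noteq> j \<Longrightarrow> cp x i j = cp y i j" shows "x = y"
  by (rule fam_ext) (use assms CA_D(4,5) in metis)+

lemma CB_eqI: assumes "x \<in> CB0" "y \<in> CB0" "\<And>i. cp x i i = cp y i i" shows "x = y"
  by (rule fam_ext) (use assms CB_D(3,4) in metis)+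

text \<open>A zero entry spreads along its row and column, and through a fresh index to every other
  position.\<close>

lemma CA_zero: assumes x: "x \<in> CA0" and ij: "i \<noteq> j" "cp x i j = 0" shows "x = 0"
proof (rule fam_ext)
  have left: "cp x k j = 0" if "cp x i j = 0" "i \<noteq> j" "k \<noteq> j" for i j k
    using CA_D(2)[OF x, of k i j] that by (cases "k = i") auto
  have right: "cp x i k = 0" if "cp x i j = 0" "i \<noteq> j" "i \<noteq> k" for i j k
    using CA_D(3)[OF x, of i j k] that by (cases "k = j") auto
  show "cp x k l = cp 0 k l" for k l
  proof (cases "k = l")
    case False
    obtain m where m: "m \<notin> set [i, j, k, l]" using fresh[of "[i, j, k, l]"] by auto
    have "cp x i m = 0" using right[OF ij(2,1)] m by auto
    then have "cp x k m = 0" using left[of i m k] m by auto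
    then show ?thesis using right[of k m l] m False by (auto simp: cp_ops)
  qed (simp add: CA_D(5)[OF x] cp_ops)
qed (simp_all add: supported_ops CA_D(4)[OF x])

lemma CB_zero: assumes y: "y \<in> CB0" and i: "cp y i i = 0" shows "y = 0"
proof (rule fam_ext)
  show "cp y k l = cp 0 k l" for k l
    using CB_D(2)[OF y, of i k] i CB_D(4)[OF y, of k l] by (cases "k = l"; cases "k = i") (auto simp: cp_ops)
qed (simp_all add: supported_ops CB_D(3)[OF y])

text \<open>Left and right moves by units are invertible by \<open>uu_inverse\<close> and commute
  because units with disjoint indices do, so \<open>coherent_grid\<close> extends \<open>x\<close>
  to a family.\<close>

lemma CA_exists: assumes ij: "i \<noteq> j" and x: "x \<in> MM {i, j}" obtains a where "a \<in> CA0" "cp a i j = x"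
proof -
  have inv: "br (uu i k) (br (uu k i) x) = x" "br (br x (uu j k)) (uu k j) = x" if "distinct [i, j, k]" "x \<in> MM {i, j}" for i j k x
    using uu_inverse(1)[of k i "{i, j}" x] uu_inverse(2)[of k j "{i, j}" x] that by auto
  obtain g where g: "g i j = x" "\<And>i j. i \<noteq> j \<Longrightarrow> g i j \<in> MM {i, j}"
    "\<And>i j k. distinct [i, j, k] \<Longrightarrow> br (uu k i) (g i j) = g k j"
    "\<And>i j k. distinct [i, j, k] \<Longrightarrow> br (g i j) (uu j k) = g i k"
  proof (rule coherent_grid[where X = "\<lambda>i j. MM {i, j}" and lft = "\<lambda>k i x. br (uu k i) x" and rgt = "\<lambda>l j x. br x (uu j l)" and x = x])
    show "4 \<le> CARD('n)" using card5 by simp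
    fix i j k l :: 'n and x
    { assume d: "distinct [i, j, k]" and x: "x \<in> MM {i, j}"
      show "br (uu k i) x \<in> MM {k, j}" using MM_XX[of k i j "uu k i" x] uu_MM[of k i] d x by auto
      show "br x (uu j k) \<in> MM {i, k}" using MM_XX[of i j k x "uu j k"] uu_MM[of j k] d x by auto
      show "br (uu i k) (br (uu k i) x) = x" "br (br x (uu j k)) (uu k j) = x" using inv d x by auto }
    { assume d: "distinct [i, j, k, l]" and x: "x \<in> MM {i, j}"
      have "br (uu l k) x = 0" "br x (uu k l) = 0"
        using MM_XX0[of l k i j "uu l k" x] MM_XX0[of i j k l x "uu k l"] uu_MM d x by auto
      then show "br (uu l k) (br (uu k i) x) = br (uu l i) x" "br (br x (uu j k)) (uu k l) = br x (uu j l)"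
        using br_jacobi[of "uu l k" "uu k i" x] br_jacobi_left[of x "uu j k" "uu k l"] uu_uu[of l k i] uu_uu[of j k l] d
        by auto
      have "br (uu k i) (uu j l) = 0" using MM_XX0[of k i j l] uu_MM d by auto
      then show "br (br (uu k i) x) (uu j l) = br (uu k i) (br x (uu j l))" using br_jacobi[of "uu k i" x "uu j l"] by simp }
  qed (use ij x in auto)
  have "famA g \<in> CA0"
  proof (rule famA_in)
    fix i j k :: 'n assume "distinct [i, j, k]"
    then show "br (uu i j) (g j k) = g i k" "br (g i j) (uu j k) = g i k" using g(3)[of j k i] g(4)[of i j k] by auto
  qed (rule g)
  then show ?thesis using that[of "famA g"] g ij by (simp add: cp_famA)
qed

lemma CB_exists: assumes x: "x \<in> MM {i}" obtains y where "y \<in> CB0" "cp y i i = x"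
proof -
  obtain g where g: "g i = x" "\<And>i. i \<in> UNIV \<Longrightarrow> g i \<in> MM {i}" "\<And>i k. \<lbrakk>i \<in> UNIV; k \<in> UNIV; i \<noteq> k\<rbrakk> \<Longrightarrow> br (g i) (uu i k) = g k"
  proof (rule coherent_line[where I = UNIV and X = "\<lambda>i. MM {i}" and tr = "\<lambda>k i x. br x (uu i k)" and ?i0.0 = i and x = x])
    fix i k m :: 'n and x
    assume ik: "i \<noteq> k" and x: "x \<in> MM {i}"
    show "br x (uu i k) \<in> MM {k}" using MM_YX[OF ik x] uu_MM[OF ik] by simp
    show "br (br x (uu i k)) (uu k i) = x" using uu_inverse(2)[of k i "{i}" x] ik x by auto
    assume "k \<noteq> m" "i \<noteq> m"
    then have "br x (uu k m) = 0" using MM_YX0[of k m i x "uu k m"] uu_MM[of k m] ik x by auto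
    then show "br (br x (uu i k)) (uu k m) = br x (uu i m)"
      using br_jacobi_left[of x "uu i k" "uu k m"] uu_uu[of i k m] ik \<open>k \<noteq> m\<close> \<open>i \<noteq> m\<close> by simp
  qed (use x in auto)
  then have "famB g \<in> CB0" by (intro famB_in) auto
  then show ?thesis using that[of "famB g"] g by (simp add: cp_famB)
qed

lemma vs_fscale: "vector_space fscale"
  by unfold_locales (simp_all add: fscale_def fun_eq_iff scale_right_distrib scale_left_distrib)

lemma CA_sub: "module.subspace fscale CA0" and CB_sub: "module.subspace fscale CB0"
proof -
  interpret F: vector_space fscale by (rule vs_fscale)
  show "F.subspace CA0" unfolding F.subspace_def
    by (auto simp: CA0_def supported_ops cp_ops subspace_0[OF MM_sub] subspace_add[OF MM_sub] subspace_scale[OF MM_sub]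
        br_add_left br_add_right br_scale_left br_scale_right)
  show "F.subspace CB0" unfolding F.subspace_def
    by (auto simp: CB0_def supported_ops cp_ops subspace_0[OF MM_sub] subspace_add[OF MM_sub] subspace_scale[OF MM_sub]
        br_add_left br_add_right br_scale_left br_scale_right)
qed

lemma CA_left: assumes "x \<in> CA0" "distinct [i, j, k]" shows "br (uu i j) (cp x k j) = cp x k i"
  using CA_D(3)[OF assms(1), of k j i] assms(2) br_skew[of "uu i j" "cp x k j"] uu_skew[of i j] by auto

lemma CA_right: assumes "x \<in> CA0" "distinct [i, j, k]" shows "br (cp x j i) (uu j k) = cp x k i"
  using CA_D(2)[OF assms(1), of k j i] assms(2) br_skew[of "cp x j i" "uu j k"] uu_skew[of j k] by auto

lemma CB_left: assumes "y \<in> CB0" "i \<noteq> j" shows "br (uu i j) (cp y j j) = cp y i i"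
  using CB_D(2)[OF assms(1), of j i] assms(2) br_skew[of "uu i j" "cp y j j"] uu_skew[of i j] by auto

lemma CA_swap: "x \<in> CA0 \<Longrightarrow> i \<noteq> j \<Longrightarrow> cp x j i \<in> MM {i, j}"
  using CA_D(1)[of x j i] by (simp add: insert_commute)

lemma CA_CA0: assumes "x \<in> CA0" "y \<in> CA0" "distinct [i, j, k, l]" shows "br (cp x i j) (cp y k l) = 0"
  by (rule MM_XX0[OF assms(3)]) (use assms CA_D(1) in auto)
lemma uu_CA0: assumes "y \<in> CA0" "distinct [i, j, k, l]" shows "br (uu i j) (cp y k l) = 0" "br (cp y k l) (uu i j) = 0"
proof -
  have "uu i j \<in> MM {i, j}" "cp y k l \<in> MM {k, l}" using assms CA_D(1) uu_MM by auto
  then show "br (uu i j) (cp y k l) = 0" "br (cp y k l) (uu i j) = 0"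
    using MM_XX0[of i j k l] MM_XX0[of k l i j] assms(2) by auto
qed
lemma CB_CA0: assumes "y \<in> CB0" "x \<in> CA0" "distinct [i, j, k]" shows "br (cp y k k) (cp x i j) = 0" "br (cp x i j) (cp y k k) = 0"
  using MM_YX0[OF assms(3)] MM_XY0[OF assms(3)] CB_D(1)[OF assms(1)] CA_D(1)[OF assms(2)] assms(3) by auto
lemma CB_uu0: assumes "y \<in> CB0" "distinct [i, j, k]" shows "br (cp y k k) (uu i j) = 0" "br (uu i j) (cp y k k) = 0"
  using MM_YX0[OF assms(2)] MM_XY0[OF assms(2)] CB_D(1)[OF assms(1)] uu_MM assms(2) by auto

text \<open>A unit inserted between the two factors moves the middle index from \<open>j\<close> to
  \<open>l\<close>. The remainder in the Jacobi identity contains a bracket of entries with disjoint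
  indices.\<close>

lemma mul_indep:
  assumes x: "x \<in> CA0" and y: "y \<in> CA0" and d: "distinct [i, j, k]" "distinct [i, l, k]"
  shows "br (cp x i j) (cp y j k) = br (cp x i l) (cp y l k)"
proof (cases "j = l")
  case False
  have "br (cp x i l) (cp y l k) = br (br (cp x i j) (uu j l)) (cp y l k)" using CA_D(3)[OF x, of i j l] d False by auto
  also have "\<dots> = br (cp x i j) (br (uu j l) (cp y l k)) - br (uu j l) (br (cp x i j) (cp y l k))" by (rule br_jacobi_left)
  also have "\<dots> = br (cp x i j) (cp y j k)" using CA_D(2)[OF y, of j l k] CA_CA0[OF x y, of i j l k] d False by auto
  finally show ?thesis ..
qed simp

lemma cp_mul: assumes "x \<in> CA0" "y \<in> CA0" "distinct [i, j, k]" shows "cp (mulA x y) i k = br (cp x i j) (cp y j k)"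
  using mul_indep[OF assms(1,2), of i "oth i k" k j] oth[of i k] assms(3) by (auto simp: mulA_def cp_famA)

lemma mul_in: assumes x: "x \<in> CA0" and y: "y \<in> CA0" shows "mulA x y \<in> CA0"
  unfolding mulA_def
proof (rule famA_in)
  have m: "br (cp x i (oth i k)) (cp y (oth i k) k) = br (cp x i j) (cp y j k)" if "distinct [i, j, k]" for i j k
    using mul_indep[OF x y, of i "oth i k" k j] oth[of i k] that by auto
  fix i j k :: 'n
  show "br (cp x i (oth i j)) (cp y (oth i j) j) \<in> MM {i, j}" if "i \<noteq> j"
    using MM_XX[of i "oth i j" j] CA_D(1)[OF x, of i "oth i j"] CA_D(1)[OF y, of "oth i j" j] oth[of i j] that by auto
  assume d: "distinct [i, j, k]"
  obtain l where "l \<notin> set [i, j, k]" using fresh[of "[i, j, k]"] by auto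
  then have l: "distinct [i, j, k, l]" using d by auto
  have "br (uu i j) (br (cp x j l) (cp y l k)) = br (br (uu i j) (cp x j l)) (cp y l k) + br (cp x j l) (br (uu i j) (cp y l k))"
    by (rule br_jacobi)
  also have "\<dots> = br (cp x i l) (cp y l k)" using CA_D(2)[OF x, of i j l] uu_CA0(1)[OF y, of i j l k] l by auto
  finally show "br (uu i j) (br (cp x j (oth j k)) (cp y (oth j k) k)) = br (cp x i (oth i k)) (cp y (oth i k) k)"
    using m[of i l k] m[of j l k] l by auto
  have "br (br (cp x i l) (cp y l j)) (uu j k) = br (cp x i l) (br (cp y l j) (uu j k)) - br (cp y l j) (br (cp x i l) (uu j k))"
    by (rule br_jacobi_left)
  also have "\<dots> = br (cp x i l) (cp y l k)" using CA_D(3)[OF y, of l j k] uu_CA0(2)[OF x, of j k i l] l by auto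
  finally show "br (br (cp x i (oth i j)) (cp y (oth i j) j)) (uu j k) = br (cp x i (oth i k)) (cp y (oth i k) k)"
    using m[of i l k] m[of i l j] l by auto
qed

lemma cp_eta: "i \<noteq> j \<Longrightarrow> cp (etaA x) i j = - cp x j i" by (simp add: etaA_def cp_famA)

lemma eta_in: assumes x: "x \<in> CA0" shows "etaA x \<in> CA0"
  unfolding etaA_def
  by (rule famA_in) (use CA_swap[OF x] CA_left[OF x] CA_right[OF x] in \<open>auto simp: subspace_neg[OF MM_sub]\<close>)

lemma unit_in: "famA uu \<in> CA0" by (rule famA_in) (simp_all add: uu_MM uu_uu)

lemma E_in: "famA E \<in> CA0" by (rule famA_in) (simp_all add: E_MM E_uu uu_E)

lemma ract_indep:
  assumes y: "y \<in> CB0" and a: "a \<in> CA0" and d: "i \<noteq> j" "k \<noteq> j"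
  shows "br (cp y i i) (cp a i j) = br (cp y k k) (cp a k j)"
proof (cases "i = k")
  case False
  have "br (cp y k k) (cp a k j) = br (br (cp y i i) (uu i k)) (cp a k j)" using CB_D(2)[OF y False] by simp
  also have "\<dots> = br (cp y i i) (br (uu i k) (cp a k j)) - br (uu i k) (br (cp y i i) (cp a k j))" by (rule br_jacobi_left)
  also have "\<dots> = br (cp y i i) (cp a i j)" using CA_D(2)[OF a, of i k j] CB_CA0(1)[OF y a, of k j i] d False by auto
  finally show ?thesis ..
qed simp

lemma cp_ract: assumes "y \<in> CB0" "a \<in> CA0" "i \<noteq> j" shows "cp (ractB y a) j j = br (cp y i i) (cp a i j)"
  using ract_indep[OF assms(1,2), of "oth j j" j i] oth[of j j] assms(3) by (auto simp: ractB_def cp_famB)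

lemma ract_in: assumes y: "y \<in> CB0" and a: "a \<in> CA0" shows "ractB y a \<in> CB0"
  unfolding ractB_def
proof (rule famB_in)
  have m: "br (cp y (oth j j) (oth j j)) (cp a (oth j j) j) = br (cp y i i) (cp a i j)" if "i \<noteq> j" for i j
    using ract_indep[OF y a, of "oth j j" j i] oth[of j j] that by auto
  fix i j :: 'n
  show "br (cp y (oth i i) (oth i i)) (cp a (oth i i) i) \<in> MM {i}"
    using MM_YX[of "oth i i" i] CB_D(1)[OF y] CA_D(1)[OF a, of "oth i i" i] oth[of i i] by auto
  assume d: "i \<noteq> j"
  obtain l where "l \<notin> set [i, j]" using fresh[of "[i, j]"] by auto
  then have l: "distinct [i, j, l]" using d by auto
  have "br (br (cp y l l) (cp a l i)) (uu i j) = br (cp y l l) (br (cp a l i) (uu i j)) - br (cp a l i) (br (cp y l l) (uu i j))"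
    by (rule br_jacobi_left)
  also have "\<dots> = br (cp y l l) (cp a l j)" using CA_D(3)[OF a, of l i j] CB_uu0(1)[OF y, of i j l] l by auto
  finally show "br (br (cp y (oth i i) (oth i i)) (cp a (oth i i) i)) (uu i j) = br (cp y (oth j j) (oth j j)) (cp a (oth j j) j)"
    using m[of l i] m[of l j] l by auto
qed

lemma cp_herm: "i \<noteq> j \<Longrightarrow> cp (hermB y z) i j = br (cp y i i) (cp z j j)" by (simp add: hermB_def cp_famA)

lemma herm_in: assumes y: "y \<in> CB0" and z: "z \<in> CB0" shows "hermB y z \<in> CA0"
  unfolding hermB_def
proof (rule famA_in)
  fix i j k :: 'n
  show "br (cp y i i) (cp z j j) \<in> MM {i, j}" if "i \<noteq> j" using MM_YY[OF that] CB_D(1) y z by simp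
  assume d: "distinct [i, j, k]"
  have "br (uu i j) (br (cp y j j) (cp z k k)) = br (br (uu i j) (cp y j j)) (cp z k k) + br (cp y j j) (br (uu i j) (cp z k k))"
    by (rule br_jacobi)
  then show "br (uu i j) (br (cp y j j) (cp z k k)) = br (cp y i i) (cp z k k)"
    using CB_left[OF y, of i j] CB_uu0(2)[OF z d] d by auto
  have "br (br (cp y i i) (cp z j j)) (uu j k) = br (cp y i i) (br (cp z j j) (uu j k)) - br (cp z j j) (br (cp y i i) (uu j k))"
    by (rule br_jacobi_left)
  then show "br (br (cp y i i) (cp z j j)) (uu j k) = br (cp y i i) (cp z k k)"
    using CB_D(2)[OF z, of j k] CB_uu0(1)[OF y, of j k i] d by auto
qed

text \<open>The two bracketings differ by a term that contains the bracket of
  \<open>cp x i j\<close> and \<open>cp z k l\<close>, which is zero for four different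
  indices.\<close>

lemma mul_assocA:
  assumes x: "x \<in> CA0" and y: "y \<in> CA0" and z: "z \<in> CA0"
  shows "mulA (mulA x y) z = mulA x (mulA y z)"
proof (rule CA_eqI)
  fix i l :: 'n assume il: "i \<noteq> l"
  obtain j where j: "j \<notin> set [i, l]" using fresh[of "[i, l]"] by auto
  obtain k where k: "k \<notin> set [i, l, j]" using fresh[of "[i, l, j]"] by auto
  have d: "distinct [i, j, k, l]" using il j k by auto
  have "cp (mulA (mulA x y) z) i l = br (br (cp x i j) (cp y j k)) (cp z k l)"
    using cp_mul[OF mul_in[OF x y] z, of i k l] cp_mul[OF x y, of i j k] d by auto
  also have "\<dots> = br (cp x i j) (br (cp y j k) (cp z k l)) - br (cp y j k) (br (cp x i j) (cp z k l))" by (rule br_jacobi_left)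
  also have "\<dots> = cp (mulA x (mulA y z)) i l"
    using cp_mul[OF x mul_in[OF y z], of i j l] cp_mul[OF y z, of j k l] CA_CA0[OF x z, of i j k l] d by auto
  finally show "cp (mulA (mulA x y) z) i l = cp (mulA x (mulA y z)) i l" .
qed (intro mul_in x y z)+

lemma oth3: "i \<noteq> j \<Longrightarrow> distinct [i, oth i j, j]" using oth[of i j] by auto

lemma mul_unitA: assumes x: "x \<in> CA0" shows "mulA (famA uu) x = x" "mulA x (famA uu) = x"
proof -
  show "mulA (famA uu) x = x"
    by (rule CA_eqI) (use x unit_in mul_in cp_mul[OF unit_in x oth3] CA_D(2)[OF x oth3] oth oth[THEN not_sym] in \<open>auto simp: cp_famA\<close>)
  show "mulA x (famA uu) = x"
    by (rule CA_eqI) (use x unit_in mul_in cp_mul[OF x unit_in oth3] CA_D(3)[OF x oth3] oth oth[THEN not_sym] in \<open>auto simp: cp_famA\<close>)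
qed

lemma eta_mulA: assumes x: "x \<in> CA0" and y: "y \<in> CA0" shows "etaA (mulA x y) = mulA (etaA y) (etaA x)"
proof (rule CA_eqI)
  fix i k :: 'n assume ik: "i \<noteq> k"
  let ?j = "oth i k"
  have d: "distinct [k, ?j, i]" "distinct [i, ?j, k]" using oth[of i k] ik by auto
  show "cp (etaA (mulA x y)) i k = cp (mulA (etaA y) (etaA x)) i k"
    using cp_mul[OF x y d(1)] cp_mul[OF eta_in[OF y] eta_in[OF x] d(2)] d ik br_skew[of "cp y ?j i" "cp x k ?j"]
    by (simp add: cp_eta)
qed (intro eta_in mul_in x y)+

lemma eta_etaA: "x \<in> CA0 \<Longrightarrow> etaA (etaA x) = x"
  by (rule CA_eqI) (auto simp: eta_in cp_eta)

lemma coord_algebra_simps [simp]: "carrier coord_algebra = CA0" "scale coord_algebra = fscale" "mult coord_algebra = mulA" "unit coord_algebra = famA uu" "invol coord_algebra = etaA"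
  by (simp_all add: coord_algebra_def)
lemma coord_module_simps [simp]: "carrier coord_module = CB0" "scale coord_module = fscale" "ract coord_module = ractB" "herm coord_module = hermB"
  by (simp_all add: coord_module_def)

lemma CA_closed: "x \<in> CA0 \<Longrightarrow> y \<in> CA0 \<Longrightarrow> x + y \<in> CA0" "x \<in> CA0 \<Longrightarrow> fscale c x \<in> CA0"
proof -
  interpret F: vector_space fscale by (rule vs_fscale)
  show "x \<in> CA0 \<Longrightarrow> y \<in> CA0 \<Longrightarrow> x + y \<in> CA0" "x \<in> CA0 \<Longrightarrow> fscale c x \<in> CA0"
    using F.subspace_add F.subspace_scale CA_sub by blast+
qed

lemma involutive_coord_algebra: "involutive_algebra coord_algebra"
proof -
  have "vbilinear coord_algebra coord_algebra coord_algebra mulA"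
    unfolding vbilinear_def vlinear_def
    by (auto intro!: fam_ext simp: mul_in supported_fam supported_ops mulA_def cp_famA cp_ops br_add_left br_add_right br_scale_left br_scale_right)
      (use mul_in in \<open>simp_all add: mulA_def\<close>)
  moreover have "vlinear coord_algebra coord_algebra etaA"
    unfolding vlinear_def
    by (auto intro!: fam_ext simp: eta_in supported_fam supported_ops etaA_def cp_famA cp_ops)
      (use eta_in in \<open>simp_all add: etaA_def\<close>)
  ultimately show ?thesis
    unfolding involutive_algebra_def vspace_def
    using vs_fscale CA_sub by (simp add: mul_assocA unit_in mul_unitA eta_mulA eta_etaA)
qed

lemma ract_one: assumes y: "y \<in> CB0" shows "ractB y (famA uu) = y"
proof (rule CB_eqI)
  fix j
  show "cp (ractB y (famA uu)) j j = cp y j j"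
    using cp_ract[OF y unit_in oth(1), of j j] CB_D(2)[OF y oth(1), of j j] oth(1)[of j j] by (simp add: cp_famA)
qed (intro ract_in unit_in y)+

lemma ract_mul: assumes y: "y \<in> CB0" and a: "a \<in> CA0" and b: "b \<in> CA0" shows "ractB y (mulA a b) = ractB (ractB y a) b"
proof (rule CB_eqI)
  fix k :: 'n
  obtain i where i: "i \<notin> set [k]" using fresh[of "[k]"] by auto
  obtain j where "j \<notin> set [i, k]" using fresh[of "[i, k]"] by auto
  then have d: "distinct [i, j, k]" using i by auto
  have "cp (ractB y (mulA a b)) k k = br (cp y i i) (br (cp a i j) (cp b j k))"
    using cp_ract[OF y mul_in[OF a b], of i k] cp_mul[OF a b d] d by auto
  also have "\<dots> = br (br (cp y i i) (cp a i j)) (cp b j k) + br (cp a i j) (br (cp y i i) (cp b j k))" by (rule br_jacobi)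
  also have "\<dots> = cp (ractB (ractB y a) b) k k"
    using cp_ract[OF ract_in[OF y a] b, of j k] cp_ract[OF y a, of i j] CB_CA0(1)[OF y b, of j k i] d by auto
  finally show "cp (ractB y (mulA a b)) k k = cp (ractB (ractB y a) b) k k" .
qed (intro ract_in mul_in y a b)+

lemma module_coord_module: "unital_right_module coord_algebra coord_module"
proof -
  have "vbilinear coord_module coord_algebra coord_module ractB"
    unfolding vbilinear_def vlinear_def
    by (auto intro!: fam_ext simp: ract_in supported_fam supported_ops ractB_def cp_famB cp_ops br_add_left br_add_right br_scale_left br_scale_right)
      (use ract_in in \<open>simp_all add: ractB_def\<close>)
  then show ?thesis
    unfolding unital_right_module_def vspace_def
    using vs_fscale CB_sub by (simp add: ract_one ract_mul)
qed

lemma herm_ractB: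
  assumes y: "y \<in> CB0" and z: "z \<in> CB0" and a: "a \<in> CA0"
  shows "hermB (ractB y a) z = mulA (etaA a) (hermB y z)" "hermB y (ractB z a) = mulA (hermB y z) a"
proof -
  show "hermB (ractB y a) z = mulA (etaA a) (hermB y z)"
  proof (rule CA_eqI)
    fix i k :: 'n assume ik: "i \<noteq> k"
    let ?j = "oth i k"
    have d: "distinct [i, ?j, k]" "distinct [?j, i, k]" using oth[of i k] ik by auto
    have "cp (hermB (ractB y a) z) i k = br (br (cp y ?j ?j) (cp a ?j i)) (cp z k k)"
      using cp_ract[OF y a, of ?j i] oth[of i k] ik by (simp add: cp_herm)
    also have "\<dots> = br (cp y ?j ?j) (br (cp a ?j i) (cp z k k)) - br (cp a ?j i) (br (cp y ?j ?j) (cp z k k))" by (rule br_jacobi_left)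
    also have "\<dots> = cp (mulA (etaA a) (hermB y z)) i k"
      using cp_mul[OF eta_in[OF a] herm_in[OF y z] d(1)] CB_CA0(2)[OF z a d(2)] d by (simp add: cp_eta cp_herm)
    finally show "cp (hermB (ractB y a) z) i k = cp (mulA (etaA a) (hermB y z)) i k" .
  qed (intro herm_in ract_in mul_in eta_in y z a)+
  show "hermB y (ractB z a) = mulA (hermB y z) a"
  proof (rule CA_eqI)
    fix i k :: 'n assume ik: "i \<noteq> k"
    let ?j = "oth i k"
    have d: "distinct [i, ?j, k]" "distinct [?j, k, i]" using oth[of i k] ik by auto
    have "cp (hermB y (ractB z a)) i k = br (cp y i i) (br (cp z ?j ?j) (cp a ?j k))"
      using cp_ract[OF z a, of ?j k] oth[of i k] ik by (simp add: cp_herm)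
    also have "\<dots> = br (br (cp y i i) (cp z ?j ?j)) (cp a ?j k) + br (cp z ?j ?j) (br (cp y i i) (cp a ?j k))" by (rule br_jacobi)
    also have "\<dots> = cp (mulA (hermB y z) a) i k"
      using cp_mul[OF herm_in[OF y z] a d(1)] CB_CA0(1)[OF y a d(2)] d by (simp add: cp_herm)
    finally show "cp (hermB y (ractB z a)) i k = cp (mulA (hermB y z) a) i k" .
  qed (intro herm_in ract_in mul_in y z a)+
qed

lemma hermitian_coord_module: "hermitian_form coord_algebra coord_module"
proof -
  have "vbilinear coord_module coord_module coord_algebra hermB"
    unfolding vbilinear_def vlinear_def
    by (auto intro!: fam_ext simp: herm_in supported_fam supported_ops hermB_def cp_famA cp_ops br_add_left br_add_right br_scale_left br_scale_right)
      (use herm_in in \<open>simp_all add: hermB_def\<close>)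
  moreover have "hermB z y = etaA (hermB y z)" if "y \<in> CB0" "z \<in> CB0" for y z
  proof (rule CA_eqI)
    fix i j :: 'n assume "i \<noteq> j"
    then show "cp (hermB z y) i j = cp (etaA (hermB y z)) i j"
      using br_skew[of "cp z i i" "cp y j j"] by (simp add: cp_herm cp_eta)
  qed (intro herm_in eta_in that)+
  ultimately show ?thesis unfolding hermitian_form_def coord_module_simps coord_algebra_simps using herm_ractB by blast
qed

lemma uu_nonzero: assumes "i \<noteq> j" shows "uu i j \<noteq> 0"
proof
  assume "uu i j = 0"
  then have "\<iota> (unit_matrix i j) = \<iota> (unit_matrix j i)" by (simp add: uu_def E_def)
  then have "unit_matrix i j = (unit_matrix j i :: 'f^'n^'n)"
    using inj_onD[OF inj] unit_matrix_in_sl[of i j] unit_matrix_in_sl[of j i] assms by blast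
  then have "unit_matrix i j $ i $ j = (unit_matrix j i :: 'f^'n^'n) $ i $ j" by simp
  then show False using assms by (simp add: unit_matrix_def)
qed

text \<open>The root vectors form the family \<open>e1\<close>. It is idempotent since
  \<open>E i j\<close> and \<open>E j k\<close> bracket to \<open>E i k\<close>, and it is
  orthogonal to \<open>e2\<close> since root vectors with equal row or equal column commute. The
  unit is the sum because \<open>uu i j = E i j - E j i\<close>.\<close>

lemma coordinate_data_coord_algebra: "coordinate_data coord_algebra (famA E) (etaA (famA E)) coord_module"
proof -
  have e2: "cp (etaA (famA E)) i j = - E j i" if "i \<noteq> j" for i j using that by (simp add: cp_eta cp_famA)
  have e1: "cp (famA E) i j = E i j" if "i \<noteq> j" for i j using that by (simp add: cp_famA)
  note in12 = E_in eta_in[OF E_in]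
  have m: "cp (mulA x y) i k = br (cp x i (oth i k)) (cp y (oth i k) k)" if "x \<in> CA0" "y \<in> CA0" "i \<noteq> k" for x y i k
    using cp_mul[OF that(1,2) oth3[OF that(3)]] .
  have z: "0 \<in> CA0" by (simp add: CA0_def supported_ops cp_ops subspace_0[OF MM_sub])
  have 1: "mulA (famA E) (famA E) = famA E"
  proof (rule CA_eqI)
    fix i k :: 'n assume ik: "i \<noteq> k"
    show "cp (mulA (famA E) (famA E)) i k = cp (famA E) i k"
      using m[OF in12(1) in12(1) ik] E_br(1)[of i "oth i k" "oth i k" k] oth[of i k] oth3[OF ik] ik by (simp add: e1)
  qed (intro mul_in in12)+
  have 2: "mulA (etaA (famA E)) (etaA (famA E)) = etaA (famA E)"
    using eta_mulA[OF E_in E_in] 1 by simp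
  have 3: "mulA (famA E) (etaA (famA E)) = 0"
  proof (rule CA_eqI)
    fix i k :: 'n assume ik: "i \<noteq> k"
    show "cp (mulA (famA E) (etaA (famA E))) i k = cp 0 i k"
      using m[OF in12 ik] E_E0(1)[OF oth3[OF ik]] oth[of i k] oth3[OF ik] by (simp add: e1 e2 cp_ops)
  qed (intro mul_in in12 z)+
  have 4: "mulA (etaA (famA E)) (famA E) = 0"
  proof (rule CA_eqI)
    fix i k :: 'n assume ik: "i \<noteq> k"
    show "cp (mulA (etaA (famA E)) (famA E)) i k = cp 0 i k"
      using m[OF in12(2,1) ik] E_E0(2)[OF oth3[OF ik]] oth[of i k] oth3[OF ik] by (simp add: e1 e2 cp_ops)
  qed (intro mul_in in12 z)+
  have 5: "famA uu = famA E + etaA (famA E)"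
    by (rule CA_eqI) (auto simp: unit_in CA_closed in12 cp_ops e1 e2, simp add: cp_famA uu_def)
  have 6: "famA uu \<noteq> 0"
  proof
    assume "famA uu = 0"
    obtain i j :: 'n where "i \<noteq> j" using oth(1) by blast
    then show False using uu_nonzero[of i j] \<open>famA uu = 0\<close> cp_famA[of uu i j] by (simp add: cp_ops)
  qed
  show ?thesis unfolding coordinate_data_def
    using involutive_coord_algebra module_coord_module hermitian_coord_module in12 1 2 3 4 5 6 by simp
qed

text \<open>\<open>L\<close> and the unitary Lie algebra become two instances of
  \<open>coordinatized\<close> over the same coordinates. In \<open>L\<close> the generator spaces
  are the components \<open>MM\<close> by \<open>CA_exists\<close> and \<open>CB_exists\<close>, and
  these generate \<open>L\<close> by \<open>carrier_BB\<close>.\<close>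

lemma isogenous_unitary:
  "centrally_isogenous L (unitary_lie coord_algebra (famA E) (etaA (famA E)) coord_module ::
    ('f, ((nat \<Rightarrow> 'l)^'n) \<times> (nat \<Rightarrow> 'l) \<Rightarrow> ((nat \<Rightarrow> 'l)^'n) \<times> (nat \<Rightarrow> 'l)) lie)"
proof -
  interpret U: unitary coord_algebra "famA E" "etaA (famA E)" coord_module "TYPE('n)"
    by unfold_locales (rule coordinate_data_coord_algebra card5)+
  obtain br' pr where "unitary_total coord_algebra (famA E) (etaA (famA E)) coord_module (br' :: (((nat \<Rightarrow> 'l)^'n) \<times> (nat \<Rightarrow> 'l) \<Rightarrow> ((nat \<Rightarrow> 'l)^'n) \<times> (nat \<Rightarrow> 'l)) \<Rightarrow> _) pr"
    using U.unitary_total_exists by blast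
  then interpret T: unitary_total coord_algebra "famA E" "etaA (famA E)" coord_module "TYPE('n)" br' pr .
  obtain P where P: "\<And>S x y. P S (x + y) = P S x + P S y" "\<And>S c x. P S (scale L c x) = scale L c (P S x)"
    "\<And>S x. x \<in> MM S \<Longrightarrow> P S x = x" "\<And>S T x. x \<in> MM T \<Longrightarrow> S \<noteq> T \<Longrightarrow> P S x = 0"
    using weight_projection_exists by blast
  \<comment> \<open>Index sets with two, one and no elements are different, so the projections onto
    their components annihilate each other.\<close>
  have e: "{i, j} \<noteq> {}" "{i} \<noteq> {}" for i j :: 'n by auto
  have s: "{i, j} \<noteq> {k}" "{k} \<noteq> {i, j}" if "i \<noteq> j" for i j k :: 'n using that by (auto simp: doubleton_eq_iff)
  have z: "P {i, j} (cp y k k) = 0" if "i \<noteq> j" "y \<in> CB0" for i j k y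
    by (rule P(4)[OF CB_D(1)[OF that(2)] s(1)[OF that(1)]])
  have z': "P {i} (cp a k l) = 0" if "k \<noteq> l" "a \<in> CA0" for i k l a
    by (rule P(4)[OF CA_D(1)[OF that(2,1)] s(2)[OF that(1)]])
  interpret C: coordinatized coord_algebra "famA E" "etaA (famA E)" coord_module "TYPE('n)" "scale L" br
    "\<lambda>i j a. cp a i j" "\<lambda>i y. cp y i i" "\<lambda>i j. P {i, j}" "\<lambda>i. P {i}"
  proof (unfold_locales, unfold coord_algebra_simps coord_module_simps, goal_cases)
    case (5 i j a) then show ?case by (simp add: cp_eta)
  next
    case (6 i j k a b) then show ?case by (simp add: cp_mul)
  next
    case (7 i j k l a b) then show ?case by (intro CA_CA0) auto
  next
    case (8 i j a y) then show ?case by (simp add: cp_ract)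
  next
    case (9 i j k a y) then show ?case by (intro CB_CA0) auto
  next
    case (10 i j y z) then show ?case by (simp add: cp_herm)
  next
    case (16 i j k l a) show ?case by (rule P(4)[OF CA_D(1)[OF 16(4,2)] 16(3)])
  next
    case (25 i j a) show ?case by (rule CA_zero[OF 25(2,1,3)])
  next
    case (26 y i) show ?case by (rule CB_zero[OF 26(1,2)])
  qed (simp_all add: cp_ops P(1,2) P(3)[OF CA_D(1)] P(3)[OF CB_D(1)] P(4)[OF CB_D(1)] z z'
      P(4)[OF MM_same[OF CA_D(1) CA_D(1)]] P(4)[OF MM_same[OF CB_D(1) CB_D(1)]] s e)
  interpret Q: coordinatized_pair coord_algebra "famA E" "etaA (famA E)" coord_module "TYPE('n)" "scale L" br
    "\<lambda>i j a. cp a i j" "\<lambda>i y. cp y i i" "\<lambda>i j. P {i, j}" "\<lambda>i. P {i}"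
    "scale U.U" br' U.X U.Y "\<lambda>i j T. U.X i j (U.entry (pr T) i j)" "\<lambda>i T. U.Y i (U.yent (pr T) i)"
    ..
  have XI: "C.XI i j = MM {i, j}" if "i \<noteq> j" for i j
    using CA_exists[OF that] CA_D(1) that unfolding C.XI_def coord_algebra_simps by blast
  have YI: "C.YI i = MM {i}" for i
    using CB_exists CB_D(1) unfolding C.YI_def coord_module_simps by blast
  have GSeq: "C.GS = {x. \<exists>i j. i \<noteq> j \<and> x \<in> MM {i, j}} \<union> {y. \<exists>i. y \<in> MM {i}} \<union>
      ({br x y | x y i j. i \<noteq> j \<and> x \<in> MM {i, j} \<and> y \<in> MM {i, j}} \<union> {br x y | x y i. x \<in> MM {i} \<and> y \<in> MM {i}})"
    unfolding C.GS_def C.DS_def by (simp add: XI YI cong: conj_cong)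
  have GS: "BB \<subseteq> C.GS"
  proof -
    have "(\<Union>i. \<Union>j\<in>-{i}. MM {i, j}) = {x. \<exists>i j. i \<noteq> j \<and> x \<in> MM {i, j}}"
      by (simp add: set_eq_iff Bex_def) metis
    moreover have "(\<Union>i. MM {i}) = {y. \<exists>i. y \<in> MM {i}}" by (simp add: set_eq_iff)
    ultimately show ?thesis unfolding BB_def GSeq by (simp only: Un_assoc subset_refl)
  qed
  have MMc: "MM S \<subseteq> carrier L" for S
    unfolding MM_def by (rule span_minimal[OF _ carrier_sub]) (auto simp: Sp_carrier)
  have "C.GS \<subseteq> carrier L"
    unfolding GSeq using MMc br_closed by auto
  then have "C.S \<subseteq> carrier L" unfolding C.S_def by (rule span_minimal[OF _ carrier_sub])
  moreover have "carrier L \<subseteq> C.S" unfolding C.S_def using carrier_BB span_mono[OF GS] by blast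
  ultimately have SL: "carrier L = C.S" by blast
  show ?thesis
    by (rule Q.isogenous) (use lieL SL br_eq T.lie_algebra_UL T.UL_simps T.br_S in auto)
qed

end

text \<open>On the way up to the common extension and down to \<open>L\<close> the star conditions
  travel in the form of \<open>norm_graded\<close>.\<close>

lemma isogenous_unitary_graded:
  fixes L :: "('f::field_char_0, 'l::ab_group_add) lie" and A :: "('f, 'a::ab_group_add) inv_algebra"
    and B :: "('f, 'a, 'b::ab_group_add) herm_module"
  assumes n: "5 \<le> CARD('n::finite)" and data: "coordinate_data A e1 e2 B"
    and iso: "centrally_isogenous L (unitary_lie A e1 e2 B :: ('f, ('a^'n) \<times> 'b \<Rightarrow> ('a^'n) \<times> 'b) lie)"
  shows "\<exists>\<iota> :: 'f^'n^'n \<Rightarrow> 'l. Theta_graded \<iota> L \<and> star_conditions \<iota> L"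
proof -
  interpret U: unitary A e1 e2 B "TYPE('n)" by unfold_locales (rule data n)+
  obtain br pr where "unitary_total A e1 e2 B (br :: (('a^'n) \<times> 'b \<Rightarrow> ('a^'n) \<times> 'b) \<Rightarrow> _) pr"
    using U.unitary_total_exists by blast
  then interpret T: unitary_total A e1 e2 B "TYPE('n)" br pr .
  obtain E :: "('f, 'l \<times> 'l \<Rightarrow> 'f) lie" and p q
    where E: "perfect E" "central_extension E L p" "central_extension E T.UL q"
    using centrally_isogenous_common_extension[OF iso] .
  obtain \<iota> :: "'f^'n^'n \<Rightarrow> 'l \<times> 'l \<Rightarrow> 'f" where "Theta_graded \<iota> E" "norm_graded \<iota> E"
    using Theta_graded_lift[OF E(3,1) n T.unitary_graded] by blast
  then have "Theta_graded (\<lambda>x. p (\<iota> x)) L" "norm_graded (\<lambda>x. p (\<iota> x)) L"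
    using Theta_graded_image[OF E(2) n] by blast+
  then show ?thesis using star_conditions_iff_norm_graded[of _ L, OF _ n] by blast
qed

text \<open>Types cannot be quantified existentially. The coordinates found for a graded
  \<open>L\<close> live in \<open>nat \<Rightarrow> 'l\<close>, the type of families of elements of
  \<open>L\<close>; the second conjunct states the converse for coordinates in arbitrary
  types.\<close>

theorem theorem5p13:
  fixes L :: "('f::field_char_0, 'l::ab_group_add) lie"
  assumes "5 \<le> CARD('n::finite)"
    and "lie_algebra L"
    and "perfect L"
  shows "((\<exists>\<iota> :: 'f^'n^'n \<Rightarrow> 'l. Theta_graded \<iota> L \<and> star_conditions \<iota> L) \<longleftrightarrow>
          (\<exists>(A :: ('f, nat \<Rightarrow> 'l) inv_algebra) e1 e2 (B :: ('f, nat \<Rightarrow> 'l, nat \<Rightarrow> 'l) herm_module).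
             coordinate_data A e1 e2 B \<and>
             centrally_isogenous L
               (unitary_lie A e1 e2 B ::
                  ('f, ((nat \<Rightarrow> 'l)^'n) \<times> (nat \<Rightarrow> 'l) \<Rightarrow> ((nat \<Rightarrow> 'l)^'n) \<times> (nat \<Rightarrow> 'l)) lie)))
       \<and> (\<forall>(A :: ('f, 'a::ab_group_add) inv_algebra) e1 e2 (B :: ('f, 'a, 'b::ab_group_add) herm_module).
             coordinate_data A e1 e2 B \<and>
             centrally_isogenous L (unitary_lie A e1 e2 B :: ('f, ('a^'n) \<times> 'b \<Rightarrow> ('a^'n) \<times> 'b) lie) \<longrightarrow>
             (\<exists>\<iota> :: 'f^'n^'n \<Rightarrow> 'l. Theta_graded \<iota> L \<and> star_conditions \<iota> L))"
proof -
  have coords: "\<exists>(A :: ('f, nat \<Rightarrow> 'l) inv_algebra) e1 e2 (B :: ('f, nat \<Rightarrow> 'l, nat \<Rightarrow> 'l) herm_module).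
      coordinate_data A e1 e2 B \<and> centrally_isogenous L
        (unitary_lie A e1 e2 B :: ('f, ((nat \<Rightarrow> 'l)^'n) \<times> (nat \<Rightarrow> 'l) \<Rightarrow> ((nat \<Rightarrow> 'l)^'n) \<times> (nat \<Rightarrow> 'l)) lie)"
    if TG: "Theta_graded \<iota> L" and star: "star_conditions \<iota> L" for \<iota> :: "'f^'n^'n \<Rightarrow> 'l"
  proof -
    have h: "lie_hom sl L \<iota>" "inj_on \<iota> (carrier sl)" using TG by (auto simp: Theta_graded_def)
    obtain br where "sl_lie L br \<iota>" using sl_lie_exists[OF assms(2) h(1)] .
    then interpret S: sl_lie5 L br \<iota> using assms(1) by (simp add: sl_lie5_def sl_lie5_axioms_def)
    interpret norm_graded_lie L br \<iota>
      by unfold_locales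
        (use TG star S.Theta_graded_iff[OF h(2)] star_conditions_iff_norm_graded[OF TG assms(1)] h(2) in auto)
    show ?thesis using coordinate_data_coord_algebra isogenous_unitary by blast
  qed
  show ?thesis
  proof (intro conjI iffI allI impI)
    assume "\<exists>\<iota> :: 'f^'n^'n \<Rightarrow> 'l. Theta_graded \<iota> L \<and> star_conditions \<iota> L"
    then show "\<exists>(A :: ('f, nat \<Rightarrow> 'l) inv_algebra) e1 e2 (B :: ('f, nat \<Rightarrow> 'l, nat \<Rightarrow> 'l) herm_module).
      coordinate_data A e1 e2 B \<and> centrally_isogenous L
        (unitary_lie A e1 e2 B :: ('f, ((nat \<Rightarrow> 'l)^'n) \<times> (nat \<Rightarrow> 'l) \<Rightarrow> ((nat \<Rightarrow> 'l)^'n) \<times> (nat \<Rightarrow> 'l)) lie)"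
      using coords by blast
  qed (elim exE conjE, rule isogenous_unitary_graded[OF assms(1)], assumption+)+
qed

end
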